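(* Let $\Xi_1^3$ be the set of all elements $Z\in\Omega_1$ having a regular-fold at the origin. Then $\Xi_1^3$ is an embedded codimension one submanifold of $\Omega$ and an open subset of $\Omega_1$ (with the topology induced from $\Omega$).
   Context: Setting. Fix $r\ge 1$ and a bounded open neighborhood $\mathcal U$ of the origin $\mathbf 0$ in $\mathbb R^2$. Let $\Sigma=\{(x_1,x_2)\in\mathcal U: x_1x_2=0\}$, $\mathcal U^+=\{x_1x_2>0\}$, $\mathcal U^-=\{x_1x_2<0\}$. Write $\Sigma=\Sigma_1\cup\Sigma_2$ with $\Sigma_1=\{x_1=0\}$, $\Sigma_2=\{x_2=0\}$; $\Sigma_1^{\pm}=\{(0,x_2):\pm x_2>0\}$ and $\Sigma_2^{\pm}=\{(x_1,0):\pm x_1>0\}$. $\Omega$ is the set of piecewise smooth vector fields $Z=(X,Y)$, where $X=(X_1,X_2)$, $Y=(Y_1,Y_2)$ are $C^r$ vector fields on $\overline{\mathcal U}$, with $Z=X$ on $\mathcal U^+$ and $Z=Y$ on $\mathcal U^-$; $\Omega=\mathfrak X\times\mathfrak X$ has the product $C^r$ topology and is a Banach space. Regions of $\Sigma$. For $i=1,2$: crossing region $\Sigma_i^c=\{p\in\Sigma_i: X_iY_i(p)>0\}$; sliding region $\Sigma_i^s=\{p\in\Sigma_i^+:X_i(p)<0,Y_i(p)>0\}\cup\{p\in\Sigma_i^-:X_i(p)>0,Y_i(p)<0\}$; escaping region $\Sigma_i^e=\{p\in\Sigma_i^+:X_i(p)>0,Y_i(p)<0\}\cup\{p\in\Sigma_i^-:X_i(p)<0,Y_i(p)>0\}$.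 $\Sigma^{c},\Sigma^s,\Sigma^e$ are the unions over $i=1,2$. On $\Sigma_i^{s}\cup\Sigma_i^e$ the sliding vector field is the one-dimensional vector field $Z_i^s=\dfrac{Y_iX_j-X_iY_j}{Y_i-X_i}\Big|_{\Sigma_i}$, $j\neq i$. Trajectories of $Z$. For $p\neq\mathbf 0$: if $p\in\mathcal U^{+}$ (resp. $\mathcal U^-$) follow the trajectory of $X$ (resp. $Y$), where trajectories meeting $\Sigma^s\cup\Sigma^e$ transversally are regarded as relatively open (they do not reach $\Sigma^s\cup\Sigma^e$ in finite time); if $p\in\Sigma^c$ concatenate the trajectories of $X$ and $Y$ through $p$; if $p\in\Sigma_i^s\cup\Sigma_i^e$ follow the trajectory of $Z_i^s$; if $p\in\partial\Sigma_i^e\cup\partial\Sigma_i^s\cup\partial\Sigma_i^c$ and the one-sided limits $\lim_{q\to p^\pm}\varphi_Z(t;q)$ along $\Sigma_i$ coincide, the trajectory is this limit; for other such boundary points it is $\{p\}$. For $\mathbf 0$: if $\Sigma=\overline{\Sigma^c}$, it is the unique trajectory of $X$ or $Y$ that crosses the origin; if $\mathbf 0\in\overline{\Sigma_i^e\cup\Sigma_i^s}\cap\overline{\Sigma_j^c}$, $i\ne j$, it is the trajectory of $Z_i^s$; if $\mathbf 0\in\bigcap_{i=1,2}\overline{\Sigma_i^e\cup\Sigma_i^s}$, it is $\{\mathbf 0\}$. Stability. $Z,\tilde Z\in\Omega$ are locally $\Sigma$-equivalent if there are neighborhoods $\mathcal U_0,\tilde{\mathcal U}_0$ of the origin and an orientation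 preserving homeomorphism $h:\mathcal U_0\to\tilde{\mathcal U}_0$ mapping trajectories of $Z$ to trajectories of $\tilde Z$ and $\Sigma$ to $\Sigma$. $\Omega_0\subset\Omega$ is the set of locally $\Sigma$-structurally stable $Z$, i.e. those having a neighborhood in $\Omega$ all of whose elements are locally $\Sigma$-equivalent to $Z$; $\Omega_1=\Omega\setminus\Omega_0$. Regular-fold. A point $p\in\Sigma_i$ is a fold point of $X$ in $\Sigma_i$ if $X_i(p)=0$ and $X_j(p)\,\frac{\partial X_i}{\partial x_j}(p)\ne 0$, $j\neq i$. The origin is a regular-fold of $X$ in $\Sigma_i$ if it is a fold point of $X$ in $\Sigma_i$ and $Y_l(\mathbf 0)\neq0$ for $l=1,2$. Analogously with the roles of $X$ and $Y$ exchanged. $Z$ has a regular-fold at the origin if the origin is a regular-fold of $X$ or of $Y$ in $\Sigma_1$ or $\Sigma_2$. *)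

theory Defs
  imports "HOL-Complex_Analysis.Complex_Analysis" "HOL-Library.Function_Algebras"
begin

section \<open>The Banach space of piecewise smooth vector fields\<close>

instantiation "fun" :: (type, real_vector) real_vector
begin

definition scaleR_fun :: "real \<Rightarrow> ('a \<Rightarrow> 'b) \<Rightarrow> 'a \<Rightarrow> 'b"
  where "scaleR_fun c f = (\<lambda>x. c *\<^sub>R f x)"

instance
  by standard (auto simp: scaleR_fun_def plus_fun_def scaleR_add_right scaleR_add_left)

end

type_synonym plane = "real ^ 2"
type_synonym field = "plane \<Rightarrow> plane"

text \<open>The pair \<open>(X, Y)\<close>: \<open>X\<close> acts on \<open>x\<^sub>1 x\<^sub>2 > 0\<close> and \<open>Y\<close> on \<open>x\<^sub>1 x\<^sub>2 < 0\<close>.\<close>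
type_synonym pws_field = "field \<times> field"

definition partial :: "2 \<Rightarrow> field \<Rightarrow> field"
  where "partial j f x = frechet_derivative f (at x) (axis j 1)"

primrec iter_partial :: "2 list \<Rightarrow> field \<Rightarrow> field" where
  "iter_partial [] f = f"
| "iter_partial (j # js) f = partial j (iter_partial js f)"

text \<open>\<open>C\<^sup>r\<close> vector fields on \<open>closure U\<close>: all partial derivatives of order at most \<open>r\<close> exist on \<open>U\<close>
  and extend continuously to \<open>closure U\<close>. A function on \<open>closure U\<close> is represented by its extension
  by \<open>0\<close>, so that equality of functions is equality on \<open>closure U\<close>.\<close>
definition Cr_fields :: "nat \<Rightarrow> plane set \<Rightarrow> field set"
  where "Cr_fields r U = {f.
     (\<forall>js. length js < r \<longrightarrow> (\<forall>x\<in>U. iter_partial js f differentiable (at x))) \<and>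
     (\<forall>js. length js \<le> r \<longrightarrow>
        (\<exists>g. continuous_on (closure U) g \<and> (\<forall>x\<in>U. g x = iter_partial js f x))) \<and>
     continuous_on (closure U) f \<and>
     (\<forall>x. x \<notin> closure U \<longrightarrow> f x = 0)}"

definition Cr_norm :: "nat \<Rightarrow> plane set \<Rightarrow> field \<Rightarrow> real"
  where "Cr_norm r U f = (SUP (js, x) \<in> {js. length js \<le> r} \<times> U. norm (iter_partial js f x))"

definition Omega :: "nat \<Rightarrow> plane set \<Rightarrow> pws_field set"
  where "Omega r U = Cr_fields r U \<times> Cr_fields r U"

definition Omega_norm :: "nat \<Rightarrow> plane set \<Rightarrow> pws_field \<Rightarrow> real"
  where "Omega_norm r U Z = max (Cr_norm r U (fst Z)) (Cr_norm r U (snd Z))"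

text \<open>Here and below a normed space is given by a subspace \<open>E\<close> of a real vector space and a
  function \<open>N\<close> that is a norm on \<open>E\<close>. The locale \<open>Metric_space\<close> asks for nonnegativity and
  symmetry also outside of the carrier, where \<open>N\<close> is unspecified; hence the conditional.\<close>
definition norm_dist :: "'v::real_vector set \<Rightarrow> ('v \<Rightarrow> real) \<Rightarrow> 'v \<Rightarrow> 'v \<Rightarrow> real"
  where "norm_dist E N x y = (if x \<in> E \<and> y \<in> E then N (x - y) else 0)"

definition norm_topology :: "'v::real_vector set \<Rightarrow> ('v \<Rightarrow> real) \<Rightarrow> 'v topology"
  where "norm_topology E N = Metric_space.mtopology E (norm_dist E N)"

abbreviation Omega_topology :: "nat \<Rightarrow> plane set \<Rightarrow> pws_field topology"
  where "Omega_topology r U \<equiv> norm_topology (Omega r U) (Omega_norm r U)"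


section \<open>Submanifolds of codimension one\<close>

definition bounded_multilinear_on ::
    "'v::real_vector set \<Rightarrow> ('v \<Rightarrow> real) \<Rightarrow> nat \<Rightarrow> ('v list \<Rightarrow> 'v) \<Rightarrow> bool"
  where "bounded_multilinear_on E N k m \<longleftrightarrow>
    (\<forall>vs. length vs = k \<and> set vs \<subseteq> E \<longrightarrow> m vs \<in> E) \<and>
    (\<forall>vs i u v a b. length vs = k \<and> set vs \<subseteq> E \<and> i < k \<and> u \<in> E \<and> v \<in> E \<longrightarrow>
       m (vs[i := a *\<^sub>R u + b *\<^sub>R v]) = a *\<^sub>R m (vs[i := u]) + b *\<^sub>R m (vs[i := v])) \<and>
    (\<exists>B. \<forall>vs. length vs = k \<and> set vs \<subseteq> E \<longrightarrow> N (m vs) \<le> B * prod_list (map N vs))"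

text \<open>\<open>C\<^sup>\<infinity>\<close> in the sense of Frechet: \<open>D k x\<close> is the \<open>k\<close>-th derivative at \<open>x\<close>, a bounded
  \<open>k\<close>-linear map (a function of lists of length \<open>k\<close>), and \<open>x \<mapsto> D k x\<close> has Frechet derivative
  \<open>h \<mapsto> D (k + 1) x (h, \<dots>)\<close> with respect to the operator norm, which is spelt out as a
  uniform bound over tuples from the unit ball.\<close>
definition smooth_map_on ::
    "'v::real_vector set \<Rightarrow> ('v \<Rightarrow> real) \<Rightarrow> 'v set \<Rightarrow> ('v \<Rightarrow> 'v) \<Rightarrow> bool"
  where "smooth_map_on E N W f \<longleftrightarrow>
    (\<exists>D :: nat \<Rightarrow> 'v \<Rightarrow> 'v list \<Rightarrow> 'v.
      (\<forall>x\<in>W. D 0 x [] = f x) \<and>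
      (\<forall>k. \<forall>x\<in>W. bounded_multilinear_on E N k (D k x)) \<and>
      (\<forall>k. \<forall>x\<in>W. \<forall>e>0. \<exists>d>0. \<forall>h\<in>E. N h < d \<and> x + h \<in> W \<longrightarrow>
         (\<forall>vs. length vs = k \<and> set vs \<subseteq> {v\<in>E. N v \<le> 1} \<longrightarrow>
            N (D k (x + h) vs - D k x vs - D (Suc k) x (h # vs)) \<le> e * N h)))"

definition smooth_diffeo ::
    "'v::real_vector set \<Rightarrow> ('v \<Rightarrow> real) \<Rightarrow> 'v set \<Rightarrow> 'v set \<Rightarrow> ('v \<Rightarrow> 'v) \<Rightarrow> bool"
  where "smooth_diffeo E N W W' f \<longleftrightarrow>
    f ` W = W' \<and> smooth_map_on E N W f \<and>
    (\<exists>g. smooth_map_on E N W' g \<and> (\<forall>x\<in>W. g (f x) = x))"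

definition closed_hyperplane_in :: "'v::real_vector set \<Rightarrow> ('v \<Rightarrow> real) \<Rightarrow> 'v set \<Rightarrow> bool"
  where "closed_hyperplane_in E N F \<longleftrightarrow>
    F \<subseteq> E \<and> subspace F \<and> closedin (norm_topology E N) F \<and>
    (\<exists>e\<in>E. e \<notin> F \<and> (\<forall>x\<in>E. \<exists>c. x - c *\<^sub>R e \<in> F))"

text \<open>Slice charts modelled on \<open>E = F \<oplus> \<real> e\<close>.\<close>
definition embedded_submanifold_codim_1 ::
    "'v::real_vector set \<Rightarrow> ('v \<Rightarrow> real) \<Rightarrow> 'v set \<Rightarrow> bool"
  where "embedded_submanifold_codim_1 E N M \<longleftrightarrow>
    M \<subseteq> E \<and>
    (\<forall>p\<in>M. \<exists>W W' f F. p \<in> W \<and> openin (norm_topology E N) W \<and> openin (norm_topology E N) W' \<and>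
       smooth_diffeo E N W W' f \<and> closed_hyperplane_in E N F \<and> f ` (W \<inter> M) = W' \<inter> F)"


section \<open>Regions of the switching set\<close>

text \<open>All notions are relative to an open set \<open>V\<close>, i.e. they refer to the restriction of \<open>Z\<close> to
  \<open>V\<close>; local equivalence below compares restrictions to neighborhoods of the origin.\<close>

definition other :: "2 \<Rightarrow> 2"
  where "other i = (if i = 1 then 2 else 1)"

definition pos_part :: "plane set \<Rightarrow> plane set"
  where "pos_part V = {p\<in>V. p $ 1 * p $ 2 > 0}"

definition neg_part :: "plane set \<Rightarrow> plane set"
  where "neg_part V = {p\<in>V. p $ 1 * p $ 2 < 0}"

definition Sig :: "plane set \<Rightarrow> plane set"
  where "Sig V = {p\<in>V. p $ 1 * p $ 2 = 0}"

definition Sig_i :: "plane set \<Rightarrow> 2 \<Rightarrow> plane set"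
  where "Sig_i V i = {p\<in>V. p $ i = 0}"

definition Sig_i_plus :: "plane set \<Rightarrow> 2 \<Rightarrow> plane set"
  where "Sig_i_plus V i = {p\<in>V. p $ i = 0 \<and> p $ other i > 0}"

definition Sig_i_minus :: "plane set \<Rightarrow> 2 \<Rightarrow> plane set"
  where "Sig_i_minus V i = {p\<in>V. p $ i = 0 \<and> p $ other i < 0}"

definition crossing :: "plane set \<Rightarrow> pws_field \<Rightarrow> 2 \<Rightarrow> plane set"
  where "crossing V Z i = {p \<in> Sig_i V i. fst Z p $ i * snd Z p $ i > 0}"

definition sliding :: "plane set \<Rightarrow> pws_field \<Rightarrow> 2 \<Rightarrow> plane set"
  where "sliding V Z i =
    {p \<in> Sig_i_plus V i. fst Z p $ i < 0 \<and> snd Z p $ i > 0} \<union>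
    {p \<in> Sig_i_minus V i. fst Z p $ i > 0 \<and> snd Z p $ i < 0}"

definition escaping :: "plane set \<Rightarrow> pws_field \<Rightarrow> 2 \<Rightarrow> plane set"
  where "escaping V Z i =
    {p \<in> Sig_i_plus V i. fst Z p $ i > 0 \<and> snd Z p $ i < 0} \<union>
    {p \<in> Sig_i_minus V i. fst Z p $ i < 0 \<and> snd Z p $ i > 0}"

definition crossings :: "plane set \<Rightarrow> pws_field \<Rightarrow> plane set"
  where "crossings V Z = (\<Union>i. crossing V Z i)"

definition slidings :: "plane set \<Rightarrow> pws_field \<Rightarrow> 2 \<Rightarrow> plane set"
  where "slidings V Z i = sliding V Z i \<union> escaping V Z i"

definition sliding_field :: "pws_field \<Rightarrow> 2 \<Rightarrow> field"
  where "sliding_field Z i p = axis (other i)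
    ((snd Z p $ i * fst Z p $ other i - fst Z p $ i * snd Z p $ other i) /
     (snd Z p $ i - fst Z p $ i))"

text \<open>Points of \<open>\<Sigma>\<close> other than the origin at which \<open>X\<^sub>i Y\<^sub>i = 0\<close>. They include the relative
  boundary points of the regions; the remaining ones (interior to \<open>{X\<^sub>i Y\<^sub>i = 0}\<close>) are treated
  as boundary points without one-sided limits.\<close>
definition tangencies :: "plane set \<Rightarrow> pws_field \<Rightarrow> plane set"
  where "tangencies V Z = Sig V - {0} - crossings V Z - (\<Union>i. slidings V Z i)"


section \<open>Trajectories\<close>

text \<open>\<open>obeys V Z A J \<gamma> t\<close>: near time \<open>t\<close> the curve \<open>\<gamma>\<close>, defined on the interval \<open>J\<close>, follows
  \<open>Z\<close>. Near a crossing point the curve meets \<open>\<Sigma>\<close> at isolated times only, so that it is a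
  concatenation of trajectories of \<open>X\<close> and \<open>Y\<close>. A curve at a sliding or escaping point remains
  in \<open>\<Sigma>\<^sub>i\<close>, so trajectories of \<open>X\<close> and \<open>Y\<close> never include such a point. \<open>A\<close> is a set of
  curves \<open>c\<close>; they prescribe, as germs at time \<open>0\<close>, the trajectories of the points \<open>c 0\<close> at
  which no vector field does (tangencies and the origin).\<close>
definition obeys ::
    "plane set \<Rightarrow> pws_field \<Rightarrow> (real \<Rightarrow> plane) set \<Rightarrow> real set \<Rightarrow> (real \<Rightarrow> plane) \<Rightarrow> real \<Rightarrow> bool"
  where "obeys V Z A J \<gamma> t \<longleftrightarrow>
    \<gamma> t \<in> V \<and>
    (\<gamma> t \<in> pos_part V \<longrightarrow> (\<gamma> has_vector_derivative fst Z (\<gamma> t)) (at t within J)) \<and>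
    (\<gamma> t \<in> neg_part V \<longrightarrow> (\<gamma> has_vector_derivative snd Z (\<gamma> t)) (at t within J)) \<and>
    (\<gamma> t \<in> crossings V Z - {0} \<longrightarrow>
       continuous (at t within J) \<gamma> \<and> (\<forall>\<^sub>F s in at t within J. \<gamma> s \<notin> Sig V)) \<and>
    (\<forall>i. \<gamma> t \<in> slidings V Z i \<longrightarrow>
       (\<gamma> has_vector_derivative sliding_field Z i (\<gamma> t)) (at t within J) \<and>
       (\<forall>\<^sub>F s in at t within J. \<gamma> s \<in> Sig_i V i)) \<and>
    (\<gamma> t \<in> insert 0 (tangencies V Z) \<longrightarrow>
       (\<exists>c\<in>A. c 0 = \<gamma> t \<and> (\<forall>\<^sub>F s in at t within J. \<gamma> s = c (s - t))))"

definition arc_of ::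
    "plane set \<Rightarrow> pws_field \<Rightarrow> (real \<Rightarrow> plane) set \<Rightarrow> real set \<Rightarrow> (real \<Rightarrow> plane) \<Rightarrow> bool"
  where "arc_of V Z A J \<gamma> \<longleftrightarrow> is_interval J \<and> J \<noteq> {} \<and> (\<forall>t\<in>J. obeys V Z A J \<gamma> t)"

text \<open>The points of \<open>\<Sigma>\<^sub>i\<close> governed by a vector field, on the side of \<open>p\<close> given by the sign
  \<open>\<sigma>\<close>.\<close>
definition side_points :: "plane set \<Rightarrow> pws_field \<Rightarrow> 2 \<Rightarrow> real \<Rightarrow> plane \<Rightarrow> plane set"
  where "side_points V Z i \<sigma> p =
    {q \<in> (crossing V Z i \<union> slidings V Z i) - {0}. \<sigma> * (q $ other i - p $ other i) > 0}"

text \<open>For small \<open>t\<close>, \<open>c t\<close> is the limit of \<open>\<phi>\<^sub>Z(t; q)\<close> as \<open>q \<rightarrow> p\<close> along \<open>\<Sigma>\<^sub>i\<close>, from both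
  sides. A sliding trajectory starting at \<open>q\<close> may reach \<open>p\<close> within time \<open>t\<close>; it is then
  continued by \<open>c\<close> itself, hence the singleton \<open>{c}\<close>.\<close>
definition limit_trajectory :: "plane set \<Rightarrow> pws_field \<Rightarrow> plane \<Rightarrow> (real \<Rightarrow> plane) \<Rightarrow> bool"
  where "limit_trajectory V Z p c \<longleftrightarrow>
    c 0 = p \<and>
    (\<exists>i. p \<in> Sig_i V i \<and>
      (\<exists>\<epsilon>>0. \<forall>\<sigma>\<in>{-1, 1}. p islimpt side_points V Z i \<sigma> p \<and>
        (\<forall>t. \<bar>t\<bar> < \<epsilon> \<longrightarrow> (\<forall>e>0. \<forall>\<^sub>F q in at p within side_points V Z i \<sigma> p.
          \<exists>J \<gamma>. arc_of V Z {c} J \<gamma> \<and> 0 \<in> J \<and> t \<in> J \<and> \<gamma> 0 = q \<and> dist (\<gamma> t) (c t) < e))))"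

definition tangency_germ :: "plane set \<Rightarrow> pws_field \<Rightarrow> plane \<Rightarrow> (real \<Rightarrow> plane) \<Rightarrow> bool"
  where "tangency_germ V Z p c \<longleftrightarrow>
    (if \<exists>c'. limit_trajectory V Z p c' then limit_trajectory V Z p c else c = (\<lambda>_. p))"

text \<open>\<open>c\<close> is a trajectory of \<open>X\<close> through the origin that passes from one quadrant of the region
  of \<open>X\<close> to the opposite one; or likewise for \<open>Y\<close>.\<close>
definition crosses_origin :: "plane set \<Rightarrow> pws_field \<Rightarrow> (real \<Rightarrow> plane) \<Rightarrow> bool"
  where "crosses_origin V Z c \<longleftrightarrow> c 0 = 0 \<and>
    (\<exists>\<epsilon>>0.
      (\<forall>s. \<bar>s\<bar> < \<epsilon> \<longrightarrow> (c has_vector_derivative fst Z (c s)) (at s) \<and> (s \<noteq> 0 \<longrightarrow> c s \<in> pos_part V)) \<or>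
      (\<forall>s. \<bar>s\<bar> < \<epsilon> \<longrightarrow> (c has_vector_derivative snd Z (c s)) (at s) \<and> (s \<noteq> 0 \<longrightarrow> c s \<in> neg_part V)))"

text \<open>The integral curve through the origin of the formula for \<open>Z\<^sub>i\<^sup>s\<close> on \<open>\<Sigma>\<^sub>i\<close>. If one side of
  the origin is a crossing region, \<open>obeys\<close> only admits the part of it on the other side.\<close>
definition slides_through_origin :: "plane set \<Rightarrow> pws_field \<Rightarrow> 2 \<Rightarrow> (real \<Rightarrow> plane) \<Rightarrow> bool"
  where "slides_through_origin V Z i c \<longleftrightarrow> c 0 = 0 \<and>
    (\<exists>\<epsilon>>0. \<forall>s. \<bar>s\<bar> < \<epsilon> \<longrightarrow>
       c s \<in> Sig_i V i \<and> (c has_vector_derivative sliding_field Z i (c s)) (at s))"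

text \<open>The case of two sliding directions takes precedence over that of a single one: the two cases
  overlap if an axis is of sliding type on one side of the origin and of crossing type on the other.
  With this order the index \<open>i\<close> in the last case is unique.\<close>
definition origin_germ :: "plane set \<Rightarrow> pws_field \<Rightarrow> (real \<Rightarrow> plane) \<Rightarrow> bool"
  where "origin_germ V Z c \<longleftrightarrow>
    (if Sig V = closure (crossings V Z) \<inter> V then crosses_origin V Z c
     else if \<forall>i. 0 \<in> closure (slidings V Z i) then c = (\<lambda>_. 0)
     else if \<exists>i. 0 \<in> closure (slidings V Z i) \<inter> closure (crossing V Z (other i))
       then \<exists>i. 0 \<in> closure (slidings V Z i) \<inter> closure (crossing V Z (other i)) \<and>
              slides_through_origin V Z i c
     else c = (\<lambda>_. 0))"

definition germs :: "plane set \<Rightarrow> pws_field \<Rightarrow> (real \<Rightarrow> plane) set"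
  where "germs V Z = {c. origin_germ V Z c} \<union> {c. \<exists>p \<in> tangencies V Z. tangency_germ V Z p c}"

text \<open>Trajectories of \<open>Z\<close> in \<open>V\<close> are the curves following \<open>Z\<close> on a maximal interval.\<close>
definition trajectory :: "plane set \<Rightarrow> pws_field \<Rightarrow> real set \<Rightarrow> (real \<Rightarrow> plane) \<Rightarrow> bool"
  where "trajectory V Z J \<gamma> \<longleftrightarrow>
    arc_of V Z (germs V Z) J \<gamma> \<and>
    (\<forall>J' \<gamma>'. arc_of V Z (germs V Z) J' \<gamma>' \<and> J \<subseteq> J' \<and> (\<forall>t\<in>J. \<gamma>' t = \<gamma> t) \<longrightarrow> J' = J)"


section \<open>Local equivalence and structural stability\<close>

definition to_complex :: "plane \<Rightarrow> complex"
  where "to_complex p = Complex (p $ 1) (p $ 2)"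

definition of_complex :: "complex \<Rightarrow> plane"
  where "of_complex z = vector [Re z, Im z]"

text \<open>A homeomorphism \<open>h\<close> on the open set \<open>V\<close> preserves the orientation of the plane if it has
  local degree \<open>1\<close> at every point.\<close>
definition preserves_orientation :: "plane set \<Rightarrow> (plane \<Rightarrow> plane) \<Rightarrow> bool"
  where "preserves_orientation V h \<longleftrightarrow>
    (\<forall>p\<in>V. \<exists>\<rho>>0. cball p \<rho> \<subseteq> V \<and>
       (\<forall>s. 0 < s \<and> s \<le> \<rho> \<longrightarrow>
          winding_number (to_complex \<circ> h \<circ> of_complex \<circ> circlepath (to_complex p) s)
            (to_complex (h p)) = 1))"

text \<open>\<open>h\<close> maps every trajectory of \<open>Z\<close> in \<open>V\<close> onto a trajectory of \<open>Z'\<close> in \<open>V'\<close>, respecting the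
  direction of time but not the parametrization.\<close>
definition maps_trajectories ::
    "plane set \<Rightarrow> pws_field \<Rightarrow> plane set \<Rightarrow> pws_field \<Rightarrow> (plane \<Rightarrow> plane) \<Rightarrow> bool"
  where "maps_trajectories V Z V' Z' h \<longleftrightarrow>
    (\<forall>J \<gamma>. trajectory V Z J \<gamma> \<longrightarrow>
       (\<exists>J' \<gamma>' \<tau>. trajectory V' Z' J' \<gamma>' \<and> strict_mono_on J \<tau> \<and> \<tau> ` J = J' \<and>
          (\<forall>t\<in>J. h (\<gamma> t) = \<gamma>' (\<tau> t))))"

definition locally_equivalent :: "plane set \<Rightarrow> pws_field \<Rightarrow> pws_field \<Rightarrow> bool"
  where "locally_equivalent U Z Z' \<longleftrightarrow>
    (\<exists>V V' h g. open V \<and> 0 \<in> V \<and> V \<subseteq> U \<and> open V' \<and> 0 \<in> V' \<and> V' \<subseteq> U \<and>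
       homeomorphism V V' h g \<and> preserves_orientation V h \<and>
       h ` Sig V = Sig V' \<and>
       maps_trajectories V Z V' Z' h \<and> maps_trajectories V' Z' V Z g)"

definition Omega_0 :: "nat \<Rightarrow> plane set \<Rightarrow> pws_field set"
  where "Omega_0 r U = {Z \<in> Omega r U.
    \<exists>W. openin (Omega_topology r U) W \<and> Z \<in> W \<and> (\<forall>Z'\<in>W. locally_equivalent U Z Z')}"

definition Omega_1 :: "nat \<Rightarrow> plane set \<Rightarrow> pws_field set"
  where "Omega_1 r U = Omega r U - Omega_0 r U"


section \<open>Regular-folds\<close>

definition fold_point :: "field \<Rightarrow> 2 \<Rightarrow> plane \<Rightarrow> bool"
  where "fold_point X i p \<longleftrightarrow>
    p $ i = 0 \<and> X p $ i = 0 \<and> X p $ other i * partial (other i) X p $ i \<noteq> 0"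

text \<open>\<open>X\<close> has the fold, \<open>Y\<close> is regular.\<close>
definition regular_fold_of :: "field \<Rightarrow> field \<Rightarrow> 2 \<Rightarrow> bool"
  where "regular_fold_of X Y i \<longleftrightarrow> fold_point X i 0 \<and> (\<forall>l. Y 0 $ l \<noteq> 0)"

definition has_regular_fold :: "pws_field \<Rightarrow> bool"
  where "has_regular_fold Z \<longleftrightarrow>
    (\<exists>i. regular_fold_of (fst Z) (snd Z) i \<or> regular_fold_of (snd Z) (fst Z) i)"

definition Xi_1_3 :: "nat \<Rightarrow> plane set \<Rightarrow> pws_field set"
  where "Xi_1_3 r U = {Z \<in> Omega_1 r U. has_regular_fold Z}"

end

theory Submission
  imports Defs
begin

text \<open>The origin is a regular-fold of \<open>X\<close> in \<open>\<Sigma>\<^sub>i\<close>, say, if \<open>X\<^sub>i\<close> vanishes there, the derivative of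
  \<open>X\<^sub>i\<close> along \<open>\<Sigma>\<^sub>i\<close> does not, and the other three components of \<open>X\<close> and \<open>Y\<close> do not vanish either.
  The proof rests on two facts.

  A regular-fold is never structurally stable. Since \<open>X\<^sub>i\<close> changes its sign along \<open>\<Sigma>\<^sub>i\<close> at the
  origin, one half of \<open>\<Sigma>\<^sub>i\<close> is crossed and the other half slides or escapes. Adding a small constant to
  \<open>X\<^sub>i\<close> makes all of \<open>\<Sigma>\<^sub>i\<close> near the origin of one type, and the sign of the constant can be
  chosen such that this is the type of the other axis. For an equivalence of the two fields the
  origin is fixed (\<open>origin_fixed\<close>), being the only corner of \<open>\<Sigma>\<close>, and sliding or escaping points do not
  correspond to crossing points (\<open>sliding_not_mapped_to_crossing\<close>), because some trajectory stays in
  \<open>\<Sigma>\<close> at the former and none does at the latter. Hence the two fields are not equivalent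
  (\<open>fold_not_locally_equivalent\<close>).

  Fields none of whose components vanishes at the origin are structurally stable if moreover
  \<open>\<bar>Y\<^sub>1 X\<^sub>2\<bar> \<noteq> \<bar>X\<^sub>1 Y\<^sub>2\<bar>\<close> at the origin: the signs of the components and of
  \<open>\<bar>Y\<^sub>1 X\<^sub>2\<bar> - \<bar>X\<^sub>1 Y\<^sub>2\<bar>\<close> determine the local phase portrait (\<open>nondegenerate_locally_equivalent\<close>), and
  these signs are locally constant in \<open>\<Omega>\<close>.

  Near a given regular-fold, the component \<open>X\<^sub>i\<close> is the only one that can vanish at the
  origin, and \<open>\<bar>Y\<^sub>1 X\<^sub>2\<bar> \<noteq> \<bar>X\<^sub>1 Y\<^sub>2\<bar>\<close>, because exactly one of the two products vanishes at the
  fold. So a neighborhood \<open>W\<close> of the fold satisfies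
  \<open>\<Xi>\<^sub>1\<^sup>3 \<inter> W = \<Omega>\<^sub>1 \<inter> W = {Z \<in> W. X\<^sub>i(0) = 0}\<close> (\<open>fold_neighbourhood\<close>). The condition is the vanishing
  of a continuous linear functional, and hence the identity is a slice chart.

  The bulk of the text constructs the equivalence of two nondegenerate fields with the same signs. In
  a small square the integral curves of \<open>X\<close> and of \<open>Y\<close> are pieces of the graphs \<open>s \<mapsto> x s\<close> of the
  solutions of a scalar equation \<open>x' = f x s\<close>, here called leaves. The equivalence has the triangular
  form \<open>(x, s) \<mapsto> (\<eta> x s, \<rho> s)\<close>. It is determined by its values on the two axes, which have to be
  compatible with the leaves that join them. If leaves join the axes in all four quadrants, going around
  the origin along leaves is a contraction of the line that reverses the orientation (or the
  inverse of one), since the leaves of \<open>X\<close> and \<open>Y\<close> have different slopes; and any two such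
  contractions are conjugate. That the resulting homeomorphism preserves trajectories follows from a
  description of the trajectories by order and topology alone (\<open>follows\<close> and \<open>directed\<close>): the
  parametrization by time is recovered by integrating the speed (\<open>realization\<close>).\<close>

section \<open>Changes of time and Gronwall's inequality\<close>

lemma eventually_in_at_within: "\<forall>\<^sub>F s in at x within A. s \<in> A"
  by (simp add: eventually_at_filter)

lemma interval_Icc_subset:
  fixes J :: "real set"
  assumes "is_interval J" "a \<in> J" "b \<in> J" shows "{a..b} \<subseteq> J"
proof
  fix x assume "x \<in> {a..b}"
  then show "x \<in> J" using assms unfolding is_interval_1 by (meson atLeastAtMost_iff)
qed

text \<open>A monotone function can only be discontinuous by omitting values; the domain may be any set.\<close>

lemma strict_mono_on_interval_image_continuous:
  fixes f :: "real \<Rightarrow> real"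
  assumes mono: "strict_mono_on A f" and img: "is_interval (f ` A)"
  shows "continuous_on A f"
  unfolding continuous_on_def
proof (intro ballI order_tendstoI)
  fix x b assume x: "x \<in> A" and b: "f x < b"
  show "\<forall>\<^sub>F s in at x within A. f s < b"
  proof (cases "\<exists>y\<in>A. x < y")
    case True
    then obtain y where y: "y \<in> A" "x < y" by blast
    have fy: "f x < f y" using mono x y by (auto simp: strict_mono_on_def)
    define z where "z = (f x + min b (f y)) / 2"
    have z: "f x < z" "z < b" "z < f y" using fy b unfolding z_def by auto
    have "z \<in> f ` A"
      using img x y z unfolding is_interval_1 by (meson imageI less_imp_le)
    then obtain a where a: "a \<in> A" "z = f a" by blast
    have "x < a" using mono x a z(1) by (metis linorder_neqE_linordered_idom not_less_iff_gr_or_eq strict_mono_onD)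
    then have "\<forall>\<^sub>F s in at x within A. s < a" by (simp add: eventually_at_topological) (metis lessThan_iff open_lessThan)
    then show ?thesis
      using eventually_in_at_within[of A x]
      apply eventually_elim
      using mono a z(2) by (metis dual_order.strict_trans strict_mono_onD)
  next
    case False
    have "\<forall>\<^sub>F s in at x within A. s \<in> A" by (rule eventually_in_at_within)
    then show ?thesis
      apply eventually_elim
      using False b mono x by (metis linorder_neqE_linordered_idom order.strict_trans strict_mono_onD)
  qed
next
  fix x b assume x: "x \<in> A" and b: "b < f x"
  show "\<forall>\<^sub>F s in at x within A. b < f s"
  proof (cases "\<exists>y\<in>A. y < x")
    case True
    then obtain y where y: "y \<in> A" "y < x" by blast
    have fy: "f y < f x" using mono x y by (auto simp: strict_mono_on_def)
    define z where "z = (f x + max b (f y)) / 2"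
    have z: "z < f x" "b < z" "f y < z" using fy b unfolding z_def by auto
    have "z \<in> f ` A"
      using img x y z unfolding is_interval_1 by (meson imageI less_imp_le)
    then obtain a where a: "a \<in> A" "z = f a" by blast
    have "a < x" using mono x a z(1) by (metis linorder_neqE_linordered_idom not_less_iff_gr_or_eq strict_mono_onD)
    then have "\<forall>\<^sub>F s in at x within A. a < s" by (simp add: eventually_at_topological) (metis greaterThan_iff open_greaterThan)
    moreover have "\<forall>\<^sub>F s in at x within A. s \<in> A" by (rule eventually_in_at_within)
    ultimately show ?thesis
      apply eventually_elim
      using mono a z(2) by (metis dual_order.strict_trans strict_mono_onD)
  next
    case False
    have "\<forall>\<^sub>F s in at x within A. s \<in> A" by (rule eventually_in_at_within)
    then show ?thesis
      apply eventually_elim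
      using False b mono x by (metis linorder_neqE_linordered_idom order.strict_trans strict_mono_onD)
  qed
qed

lemma continuous_on_inv_into_strict_mono:
  fixes f :: "real \<Rightarrow> real"
  assumes mono: "strict_mono_on A f" and A: "is_interval A"
  shows "continuous_on (f ` A) (inv_into A f)"
proof (rule strict_mono_on_interval_image_continuous)
  have inj: "inj_on f A" using mono by (rule strict_mono_on_imp_inj_on)
  show "strict_mono_on (f ` A) (inv_into A f)"
    by (rule strict_mono_onI)
      (metis (no_types, lifting) f_inv_into_f inv_into_into linorder_neqE_linordered_idom mono
        not_less_iff_gr_or_eq strict_mono_onD)
  show "is_interval (inv_into A f ` f ` A)"
    using A inj by (simp add: inv_into_image_cancel)
qed

text \<open>Chain rule read backwards: a change of parameter between two curves is differentiable, with
  the quotient of the speeds as derivative.\<close>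

lemma DERIV_reparametrization:
  fixes \<phi> :: "real \<Rightarrow> real"
  assumes x: "x \<in> A" and inj: "inj_on \<phi> A" and cont: "continuous (at x within A) \<phi>"
    and sub: "\<phi> ` A \<subseteq> B" and eq: "\<And>y. y \<in> A \<Longrightarrow> m2 (\<phi> y) = m1 y"
    and d1: "(m1 has_real_derivative v1) (at x within A)"
    and d2: "(m2 has_real_derivative v2) (at (\<phi> x) within B)" and v2: "v2 \<noteq> 0"
  shows "(\<phi> has_real_derivative v1 / v2) (at x within A)"
proof -
  have fl: "filterlim \<phi> (at (\<phi> x) within B) (at x within A)"
    unfolding filterlim_at
  proof
    show "\<forall>\<^sub>F y in at x within A. \<phi> y \<in> B \<and> \<phi> y \<noteq> \<phi> x"
      unfolding eventually_at_filter by (rule always_eventually) (use sub inj x in \<open>auto simp: inj_on_def\<close>)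
    show "(\<phi> \<longlongrightarrow> \<phi> x) (at x within A)" using cont by (simp add: continuous_within)
  qed
  have l2: "((\<lambda>y. (m2 (\<phi> y) - m2 (\<phi> x)) / (\<phi> y - \<phi> x)) \<longlongrightarrow> v2) (at x within A)"
    using d2[unfolded has_field_derivative_iff] fl by (rule filterlim_compose)
  have l1: "((\<lambda>y. (m1 y - m1 x) / (y - x)) \<longlongrightarrow> v1) (at x within A)"
    using d1[unfolded has_field_derivative_iff] .
  have l3: "((\<lambda>y. ((m1 y - m1 x) / (y - x)) / ((m2 (\<phi> y) - m2 (\<phi> x)) / (\<phi> y - \<phi> x))) \<longlongrightarrow> v1 / v2) (at x within A)"
    by (rule tendsto_divide[OF l1 l2 v2])
  have ne: "\<forall>\<^sub>F y in at x within A. (m2 (\<phi> y) - m2 (\<phi> x)) / (\<phi> y - \<phi> x) \<noteq> 0"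
    using l2 v2 by (rule tendsto_imp_eventually_ne)
  show ?thesis unfolding has_field_derivative_iff
  proof (rule Lim_transform_eventually[OF l3])
    show "\<forall>\<^sub>F y in at x within A. ((m1 y - m1 x) / (y - x)) / ((m2 (\<phi> y) - m2 (\<phi> x)) / (\<phi> y - \<phi> x)) = (\<phi> y - \<phi> x) / (y - x)"
      using ne eventually_in_at_within[of A x]
    proof eventually_elim
      case (elim y)
      have quot: "(a / b) / (a / c) = c / b" if "a \<noteq> 0" for a b c :: real
        using that by (cases "b = 0"; cases "c = 0") (auto simp: field_simps)
      show ?case using elim eq[of y] eq[OF x] by (auto intro!: quot)
    qed
  qed
qed

lemma sparse_finite_in_compact_interval:
  fixes a b :: real
  assumes sp: "\<And>t. t \<in> {a..b} \<Longrightarrow> \<forall>\<^sub>F s in at t within {a..b}. s \<notin> K"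
  shows "finite (K \<inter> {a..b})"
proof (cases "a \<le> b")
  case True
  have "a \<le> a \<and> b \<le> b \<longrightarrow> finite (K \<inter> {a..b})"
    using True
  proof (induct rule: Bolzano[where P = "\<lambda>u v. a \<le> u \<and> v \<le> b \<longrightarrow> finite (K \<inter> {u..v})"])
    case (trans u v w)
    have "K \<inter> {u..w} \<subseteq> (K \<inter> {u..v}) \<union> (K \<inter> {v..w})" by auto
    then show ?case using trans by (meson finite_UnI finite_subset order_trans)
  next
    case (local x)
    then obtain d where d: "d > 0" "\<And>s. s \<in> {a..b} \<Longrightarrow> s \<noteq> x \<Longrightarrow> dist s x < d \<Longrightarrow> s \<notin> K"
      using sp[of x] unfolding eventually_at by auto
    show ?case
    proof (intro exI[of _ d] conjI allI impI)
      fix u v assume *: "u \<le> x \<and> x \<le> v \<and> v - u < d" "a \<le> u \<and> v \<le> b"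
      have "s = x" if "s \<in> K" "s \<in> {u..v}" for s
        proof (rule ccontr)
        assume "s \<noteq> x"
        moreover have "s \<in> {a..b}" "\<bar>s - x\<bar> < d" using * that by (auto simp: abs_less_iff)
        ultimately show False using d(2)[of s] that by (simp add: dist_real_def)
      qed
      then have "K \<inter> {u..v} \<subseteq> {x}" by blast
      then show "finite (K \<inter> {u..v})" using finite_subset by blast
    qed (use d in auto)
  qed
  then show ?thesis by simp
qed simp

lemma at_within_mono_eventually:
  assumes "\<forall>\<^sub>F s in at t within J. P s" "A \<subseteq> J"
  shows "\<forall>\<^sub>F s in at t within A. P s"
  using assms by (meson at_le filter_leD)

lemma strict_mono_on_if_positive_derivative:
  fixes m :: "real \<Rightarrow> real"
  assumes J: "is_interval J" and cont: "continuous_on J m"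
    and sp: "\<And>t. t \<in> J \<Longrightarrow> \<forall>\<^sub>F s in at t within J. s \<notin> K"
    and der: "\<And>t. t \<in> J - K \<Longrightarrow> \<exists>D>0. (m has_real_derivative D) (at t within J)"
  shows "strict_mono_on J m"
proof (rule strict_mono_onI)
  fix a b assume ab: "a \<in> J" "b \<in> J" "a < b"
  have sub: "{a..b} \<subseteq> J" using J ab(1,2) by (rule interval_Icc_subset)
  have inc: "m u < m v" if uv: "a \<le> u" "v \<le> b" "u < v" and nK: "\<And>x. u < x \<Longrightarrow> x < v \<Longrightarrow> x \<notin> K" for u v
  proof (rule DERIV_pos_imp_increasing_open[OF uv(3)])
    fix x assume x: "u < x" "x < v"
    then have "x \<in> J - K" using nK[OF x] uv sub by auto
    then obtain D where D: "D > 0" "(m has_real_derivative D) (at x within J)" using der by blast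
    have "{u..v} \<subseteq> J" using uv sub by auto
    then have "(m has_real_derivative D) (at x within {u..v})" by (rule DERIV_subset[OF D(2)])
    then show "\<exists>y. (m has_real_derivative y) (at x) \<and> 0 < y" using D(1) x by (auto simp: at_within_Icc_at)
  next
    show "continuous_on {u..v} m" using uv sub by (intro continuous_on_subset[OF cont]) auto
  qed
  have "a \<le> b" using ab by simp
  then have "a \<le> a \<and> b \<le> b \<and> a < b \<longrightarrow> m a < m b"
  proof (induct rule: Bolzano[where P = "\<lambda>u v. a \<le> u \<and> v \<le> b \<and> u < v \<longrightarrow> m u < m v"])
    case (trans u v w)
    then show ?case by (smt (verit))
  next
    case (local x)
    then have xJ: "x \<in> J" using sub by auto
    from sp[OF xJ] obtain d where d: "d > 0" "\<And>s. s \<in> J \<Longrightarrow> s \<noteq> x \<Longrightarrow> dist s x < d \<Longrightarrow> s \<notin> K"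
      unfolding eventually_at by blast
    show ?case
    proof (intro exI[of _ d] conjI allI impI)
      fix u v assume *: "u \<le> x \<and> x \<le> v \<and> v - u < d" "a \<le> u \<and> v \<le> b \<and> u < v"
      have nK: "y \<notin> K" if "u \<le> y" "y \<le> v" "y \<noteq> x" for y
      proof (rule d(2)[OF _ that(3)])
        show "y \<in> J" using sub that * by auto
        show "dist y x < d" using that * by (auto simp: dist_real_def abs_less_iff)
      qed
      have "m u < m x" if "u < x" by (rule inc) (use nK that * in auto)
      moreover have "m x < m v" if "x < v" by (rule inc) (use nK that * in auto)
      ultimately show "m u < m v" using * by (smt (verit))
    qed (use d in auto)
  qed
  then show "m a < m b" using ab by simp
qed

text \<open>Two parametrizations of the same curve by time, both moving with the speed that the vector
  field prescribes, differ by a time shift. The speed is not prescribed at the exceptional times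
  \<open>K\<close>, e.g. when the curve crosses the switching set.\<close>

lemma equal_speed_imp_time_shift:
  fixes \<omega> :: "real \<Rightarrow> real"
  assumes J: "is_interval J" and sp: "\<And>t. t \<in> J \<Longrightarrow> \<forall>\<^sub>F s in at t within J. s \<notin> K"
    and cont: "continuous_on J \<omega>" and inj: "inj_on \<omega> J" and sub: "\<omega> ` J \<subseteq> B"
    and eq: "\<And>t. t \<in> J \<Longrightarrow> m2 (\<omega> t) = m1 t"
    and d1: "\<And>t. t \<in> J - K \<Longrightarrow> (m1 has_real_derivative v t) (at t within J)"
    and d2: "\<And>t. t \<in> J - K \<Longrightarrow> (m2 has_real_derivative v t) (at (\<omega> t) within B)"
    and v: "\<And>t. t \<in> J - K \<Longrightarrow> v t \<noteq> 0"
  shows "\<exists>c. \<forall>t\<in>J. \<omega> t = t + c"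
proof (cases "J = {}")
  case False
  then obtain t0 where t0: "t0 \<in> J" by blast
  have der: "((\<lambda>t. \<omega> t - t) has_real_derivative 0) (at t within J)" if "t \<in> J - K" for t
  proof -
    have "(\<omega> has_real_derivative v t / v t) (at t within J)"
      using that cont by (intro DERIV_reparametrization[OF _ inj _ sub eq d1 d2 v])
        (auto simp: continuous_on_eq_continuous_within)
    then show ?thesis using v[OF that] by (auto intro!: derivative_eq_intros)
  qed
  have *: "\<omega> b - b = \<omega> a - a" if ab: "a \<in> J" "b \<in> J" "a \<le> b" for a b
  proof -
    have sub: "{a..b} \<subseteq> J" using J ab(1,2) by (rule interval_Icc_subset)
    show ?thesis
    proof (rule has_derivative_zero_unique_strong_interval[of "K \<inter> {a..b}" a b "\<lambda>t. \<omega> t - t" _ b])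
      show "finite (K \<inter> {a..b})"
        by (rule sparse_finite_in_compact_interval) (use sp sub at_within_mono_eventually in blast)
      show "continuous_on {a..b} (\<lambda>t. \<omega> t - t)"
        by (intro continuous_intros continuous_on_subset[OF cont sub])
      fix x assume "x \<in> {a..b} - K \<inter> {a..b}"
      then have "((\<lambda>t. \<omega> t - t) has_real_derivative 0) (at x within {a..b})"
        using der[of x] sub DERIV_subset by blast
      then show "((\<lambda>t. \<omega> t - t) has_derivative (\<lambda>h. 0)) (at x within {a..b})"
        by (simp add: has_field_derivative_def lambda_zero)
    qed (use ab in auto)
  qed
  show ?thesis
    by (rule exI[of _ "\<omega> t0 - t0"]) (metis "*" t0 add.commute diff_add_cancel linear)
qed simp

text \<open>The exceptional set \<open>K\<close> is discrete, so it does not affect the integral of \<open>g\<close>.\<close>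

lemma antiderivative_of_piecewise_continuous:
  fixes g :: "real \<Rightarrow> real"
  assumes I: "is_interval I" and sp: "\<And>u. u \<in> I \<Longrightarrow> \<forall>\<^sub>F w in at u within I. w \<notin> K"
    and cont: "\<And>u. u \<in> I - K \<Longrightarrow> continuous (at u within I) g"
    and bd: "\<And>u. u \<in> I - K \<Longrightarrow> lo \<le> g u \<and> g u \<le> hi" and lo: "0 < lo"
  shows "\<exists>T. continuous_on I T \<and> strict_mono_on I T \<and>
           (\<forall>u\<in>I - K. (T has_real_derivative g u) (at u within I))"
proof -
  define hi' where "hi' = max lo hi"
  \<comment> \<open>Any positive value will do off \<open>I - K\<close>; it keeps the integral strictly increasing.\<close>
  define q where "q u = (if u \<in> I - K then g u else lo)" for u
  have qb: "lo \<le> q u" "q u \<le> hi'" for u using bd[of u] by (auto simp: q_def hi'_def)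
  have opn: "\<exists>S. open S \<and> u \<in> S \<and> I \<inter> S \<subseteq> I - K" if "u \<in> I - K" for u
    using sp[of u] that unfolding eventually_at_topological by (metis DiffE DiffI IntE subsetI)
  have "openin (top_of_set I) (I - K)"
    unfolding openin_subopen[of _ "I - K"] openin_open
    using opn by (metis IntI DiffD1)
  then obtain O' where O': "open O'" "I - K = I \<inter> O'" by (auto simp: openin_open)
  have meas: "I - K \<in> sets borel" unfolding O'(2) using O'(1) I by (intro sets.Int borel_open real_interval_borel_measurable)
  have contIK: "continuous_on (I - K) g"
    unfolding continuous_on_eq_continuous_within using cont continuous_within_subset by blast
  have qm: "q \<in> borel_measurable borel"
    unfolding q_def using meas contIK by (rule borel_measurable_continuous_on_if) simp
  have qabs: "norm (q u) \<le> hi'" for u using qb[of u] lo by auto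
  have qint: "q integrable_on {a..b}" for a b
  proof -
    have "q \<in> borel_measurable (lebesgue_on {a..b})"
      using qm by (simp add: borel_measurable_if_D measurable_completion measurable_restrict_space1)
    then show ?thesis
      by (rule measurable_bounded_by_integrable_imp_integrable_real[where g = "\<lambda>_. hi'"])
        (use qabs in auto)
  qed
  define T where "T u = (if 0 \<le> u then integral {0..u} q else - integral {u..0} q)" for u
  have TD: "T v - T u = integral {u..v} q" if "u \<le> v" for u v
    using that qint Henstock_Kurzweil_Integration.integral_combine[of 0 u v q]
      Henstock_Kurzweil_Integration.integral_combine[of u 0 v q]
      Henstock_Kurzweil_Integration.integral_combine[of u v 0 q]
    by (auto simp: T_def)
  have Tlo: "lo * (v - u) \<le> T v - T u" if "u \<le> v" for u v
    using integral_le[of "\<lambda>_. lo" "{u..v}" q] qint qb that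
    by (simp add: TD mult.commute integrable_const_ivl)
  have Thi: "T v - T u \<le> hi' * (v - u)" if "u \<le> v" for u v
    using integral_le[of q "{u..v}" "\<lambda>_. hi'"] qint qb that
    by (simp add: TD mult.commute integrable_const_ivl)
  have mono: "strict_mono_on I T"
  proof (rule strict_mono_onI)
    fix r s :: real assume "r < s"
    then show "T r < T s" using Tlo[of r s] lo mult_pos_pos[of lo "s - r"] by linarith
  qed
  have "hi'-lipschitz_on I T"
  proof (rule lipschitz_onI)
    show "0 \<le> hi'" using lo by (simp add: hi'_def)
    have *: "dist (T x) (T y) \<le> hi' * dist x y" if "x \<le> y" for x y
    proof -
      have "0 \<le> lo * (y - x)" using lo that by (intro mult_nonneg_nonneg) auto
      then have "T x \<le> T y" using Tlo[OF that] by linarith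
      then show ?thesis using Thi[OF that] that by (simp add: dist_real_def)
    qed
    show "dist (T x) (T y) \<le> hi' * dist x y" for x y
      using *[of x y] *[of y x] by (cases "x \<le> y") (auto simp: dist_commute)
  qed
  then have contT: "continuous_on I T" by (rule lipschitz_on_continuous_on)
  have "(T has_real_derivative g u) (at u within I)" if u: "u \<in> I - K" for u
    unfolding has_field_derivative_def has_derivative_within_alt
  proof (intro conjI allI impI)
    show "bounded_linear ((*) (g u))" by (rule bounded_linear_mult_right)
    fix e :: real assume e: "0 < e"
    from cont[OF u] e obtain d1 where d1: "d1 > 0" "\<And>w. w \<in> I \<Longrightarrow> dist w u < d1 \<Longrightarrow> dist (g w) (g u) < e"
      unfolding continuous_within_eps_delta by blast
    from sp[of u] u obtain d2 where d2: "d2 > 0" "\<And>w. w \<in> I \<Longrightarrow> w \<noteq> u \<Longrightarrow> dist w u < d2 \<Longrightarrow> w \<notin> K"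
      unfolding eventually_at by blast
    have key: "\<bar>T v - T w - g u * (v - w)\<bar> \<le> e * (v - w)"
      if vw: "w \<le> v" "w = u \<or> v = u" "v \<in> I" "w \<in> I" "dist v w < min d1 d2" for v w
    proof -
      have b: "g u - e \<le> q x \<and> q x \<le> g u + e" if x: "x \<in> {w..v}" for x
      proof -
        have xI: "x \<in> I" using interval_Icc_subset[OF I vw(4,3)] x by (rule subsetD)
        have "dist x u < d1" "dist x u < d2" using x vw by (auto simp: dist_real_def)
        then show ?thesis using d1(2)[OF xI] d2(2)[OF xI] u xI by (auto simp: q_def dist_real_def)
      qed
      have "(g u - e) * (v - w) \<le> T v - T w"
        using integral_le[of "\<lambda>_. g u - e" "{w..v}" q] qint b vw
        by (simp add: TD mult.commute integrable_const_ivl)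
      moreover have "T v - T w \<le> (g u + e) * (v - w)"
        using integral_le[of q "{w..v}" "\<lambda>_. g u + e"] qint b vw
        by (simp add: TD mult.commute integrable_const_ivl)
      ultimately show ?thesis by (simp add: abs_le_iff algebra_simps)
    qed
    show "\<exists>d>0. \<forall>y\<in>I. norm (y - u) < d \<longrightarrow> norm (T y - T u - g u * (y - u)) \<le> e * norm (y - u)"
    proof (intro exI[of _ "min d1 d2"] conjI ballI impI)
      fix y assume y: "y \<in> I" "norm (y - u) < min d1 d2"
      show "norm (T y - T u - g u * (y - u)) \<le> e * norm (y - u)"
      proof (cases "u \<le> y")
        case True
        then show ?thesis using key[of u y] y u by (simp add: dist_real_def)
      next
        case False
        then have "\<bar>T u - T y - g u * (u - y)\<bar> \<le> e * (u - y)"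
          using key[of y u] y u by (simp add: dist_real_def abs_minus_commute)
        then show ?thesis using False by (simp add: abs_le_iff algebra_simps)
      qed
    qed (use d1 d2 in auto)
  qed
  then show ?thesis using mono contT by blast
qed

text \<open>Realization of an oriented curve \<open>\<beta>\<close> as an integral curve: if \<open>\<beta>\<close>, parametrized by an
  increasing quantity \<open>m\<close>, has the direction of \<open>E\<close>, and \<open>v\<close> is the speed of \<open>m\<close> along \<open>E\<close>, then
  the time needed is the integral of \<open>1 / v\<close>.\<close>

lemma time_change:
  fixes \<beta> :: "real \<Rightarrow> 'a::real_normed_vector" and m v :: "real \<Rightarrow> real"
  assumes J: "is_interval J" and contm: "continuous_on J m" and mono: "strict_mono_on J m"
    and sp: "\<And>t. t \<in> J \<Longrightarrow> \<forall>\<^sub>F s in at t within J. s \<notin> K"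
    and lo: "0 < lo" and bd: "\<And>t. t \<in> J - K \<Longrightarrow> lo \<le> v t \<and> v t \<le> hi"
    and contv: "\<And>t. t \<in> J - K \<Longrightarrow> continuous (at t within J) v"
    and curve: "\<And>t. t \<in> J - K \<Longrightarrow> \<exists>D. \<beta> t = D (m t) \<and> (\<forall>\<^sub>F s in at t within J. \<beta> s = D (m s)) \<and>
        (D has_vector_derivative (1 / v t) *\<^sub>R E t) (at (m t))"
  shows "\<exists>\<tau>. \<tau> t0 = a \<and> continuous_on J \<tau> \<and> strict_mono_on J \<tau> \<and> is_interval (\<tau> ` J) \<and>
     (\<forall>\<gamma>. (\<forall>t\<in>J. \<gamma> (\<tau> t) = \<beta> t) \<longrightarrow>
        (\<forall>t\<in>J - K. (\<gamma> has_vector_derivative E t) (at (\<tau> t) within \<tau> ` J)))"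
proof -
  define I where "I = m ` J"
  define mi where "mi = inv_into J m"
  have injm: "inj_on m J" using mono by (rule strict_mono_on_imp_inj_on)
  have mi: "mi (m t) = t" if "t \<in> J" for t using injm that by (simp add: mi_def)
  have I: "is_interval I" unfolding I_def
    using contm J connected_continuous_image is_interval_connected_1 by blast
  have contmi: "continuous_on I mi" unfolding I_def mi_def
    using mono J by (rule continuous_on_inv_into_strict_mono)
  have flmi: "filterlim mi (at (mi u) within J) (at u within I)" if "u \<in> I" for u
    unfolding filterlim_at
  proof
    show "\<forall>\<^sub>F y in at u within I. mi y \<in> J \<and> mi y \<noteq> mi u"
      unfolding eventually_at_filter by (rule always_eventually) (use that mi in \<open>auto simp: I_def\<close>)
    show "(mi \<longlongrightarrow> mi u) (at u within I)" using contmi that by (simp add: continuous_on_def)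
  qed
  define K' where "K' = {u\<in>I. mi u \<in> K}"
  have spI: "\<forall>\<^sub>F w in at u within I. w \<notin> K'" if "u \<in> I" for u
  proof -
    have "mi u \<in> J" using that mi by (auto simp: I_def)
    from sp[OF this] have "\<forall>\<^sub>F w in at u within I. mi w \<notin> K" using flmi[OF that] by (rule eventually_compose_filterlim)
    then show ?thesis by eventually_elim (simp add: K'_def)
  qed
  define hi' where "hi' = max lo hi"
  have IK: "mi u \<in> J - K" "m (mi u) = u" if "u \<in> I - K'" for u using that mi by (auto simp: I_def K'_def)
  have "\<exists>T. continuous_on I T \<and> strict_mono_on I T \<and>
           (\<forall>u\<in>I - K'. (T has_real_derivative 1 / v (mi u)) (at u within I))"
  proof (rule antiderivative_of_piecewise_continuous[OF I spI])
    show "continuous (at u within I) (\<lambda>u. 1 / v (mi u))" if "u \<in> I - K'" for u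
    proof -
      have "((\<lambda>u. v (mi u)) \<longlongrightarrow> v (mi u)) (at u within I)"
        using contv[OF IK(1)[OF that]] flmi[of u] that
        unfolding continuous_within by (auto intro: filterlim_compose)
      moreover have "v (mi u) \<noteq> 0" using bd[OF IK(1)[OF that]] lo by auto
      ultimately show ?thesis unfolding continuous_within by (intro tendsto_intros)
    qed
    show "1 / hi' \<le> 1 / v (mi u) \<and> 1 / v (mi u) \<le> 1 / lo" if "u \<in> I - K'" for u
      using bd[OF IK(1)[OF that]] lo by (auto simp: hi'_def field_simps)
    show "0 < 1 / hi'" using lo by (simp add: hi'_def)
  qed
  then obtain T0 where T0: "continuous_on I T0" "strict_mono_on I T0"
    and TD0: "\<And>u. u \<in> I - K' \<Longrightarrow> (T0 has_real_derivative 1 / v (mi u)) (at u within I)" by blast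
  define T where "T u = T0 u + (a - T0 (m t0))" for u
  have T: "continuous_on I T" "strict_mono_on I T"
    using T0 by (auto simp: T_def[abs_def] strict_mono_on_def intro!: continuous_intros)
  have TD: "(T has_real_derivative 1 / v (mi u)) (at u within I)" if "u \<in> I - K'" for u
    unfolding T_def using DERIV_add[OF TD0[OF that] DERIV_const] by simp
  define \<tau> where "\<tau> = T \<circ> m"
  have \<tau>c: "continuous_on J \<tau>" unfolding \<tau>_def using contm T(1) unfolding I_def by (rule continuous_on_compose)
  have \<tau>m: "strict_mono_on J \<tau>" unfolding \<tau>_def
    using mono T(2) by (auto simp: strict_mono_on_def I_def)
  have \<tau>i: "is_interval (\<tau> ` J)"
    using \<tau>c J connected_continuous_image is_interval_connected_1 by blast
  have \<tau>inj: "inj_on \<tau> J" using \<tau>m by (rule strict_mono_on_imp_inj_on)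
  define ti where "ti = inv_into J \<tau>"
  have ti: "ti (\<tau> t) = t" if "t \<in> J" for t using \<tau>inj that by (simp add: ti_def)
  have contti: "continuous_on (\<tau> ` J) ti" unfolding ti_def
    using \<tau>m J by (rule continuous_on_inv_into_strict_mono)
  have "(\<gamma> has_vector_derivative E t) (at (\<tau> t) within \<tau> ` J)"
    if \<gamma>: "\<forall>t\<in>J. \<gamma> (\<tau> t) = \<beta> t" and t: "t \<in> J - K" for \<gamma> t
  proof -
    have vt: "v t \<noteq> 0" using bd[OF t] lo by auto
    have flti: "filterlim ti (at t within J) (at (\<tau> t) within \<tau> ` J)"
      unfolding filterlim_at
    proof
      show "\<forall>\<^sub>F y in at (\<tau> t) within \<tau> ` J. ti y \<in> J \<and> ti y \<noteq> t"
        unfolding eventually_at_filter by (rule always_eventually) (use t ti in auto)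
      show "(ti \<longlongrightarrow> t) (at (\<tau> t) within \<tau> ` J)"
        using contti t ti[of t] unfolding continuous_on_def by force
    qed
    have w: "((m \<circ> ti) has_real_derivative 1 / (1 / v t)) (at (\<tau> t) within \<tau> ` J)"
    proof (rule DERIV_reparametrization[where B = I and ?m2.0 = T and ?m1.0 = "\<lambda>x. x"])
      show "\<tau> t \<in> \<tau> ` J" using t by auto
      show "inj_on (m \<circ> ti) (\<tau> ` J)" using ti injm by (auto simp: inj_on_def)
      have "continuous_on (\<tau> ` J) (m \<circ> ti)"
        by (rule continuous_on_compose[OF contti]) (use ti contm in \<open>auto intro: continuous_on_subset\<close>)
      then show "continuous (at (\<tau> t) within \<tau> ` J) (m \<circ> ti)"
        using t unfolding continuous_on_eq_continuous_within by blast
      show "(m \<circ> ti) ` \<tau> ` J \<subseteq> I" using ti by (auto simp: I_def)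
      show "T ((m \<circ> ti) y) = y" if "y \<in> \<tau> ` J" for y using that ti by (auto simp: \<tau>_def)
      show "((\<lambda>x. x) has_real_derivative 1) (at (\<tau> t) within \<tau> ` J)" by (rule DERIV_ident)
      have "m t \<in> I - K'" using t mi by (auto simp: I_def K'_def)
      from TD[OF this] show "(T has_real_derivative 1 / v t) (at ((m \<circ> ti) (\<tau> t)) within I)"
        using t ti mi by auto
      show "1 / v t \<noteq> 0" using vt by simp
    qed
    from curve[OF t] obtain D where D: "\<beta> t = D (m t)" "\<forall>\<^sub>F s in at t within J. \<beta> s = D (m s)"
        "(D has_vector_derivative (1 / v t) *\<^sub>R E t) (at (m t))" by blast
    have "((D \<circ> (m \<circ> ti)) has_vector_derivative v t *\<^sub>R ((1 / v t) *\<^sub>R E t)) (at (\<tau> t) within \<tau> ` J)"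
    proof (rule vector_diff_chain_within)
      show "((m \<circ> ti) has_vector_derivative v t) (at (\<tau> t) within \<tau> ` J)"
        using w by (simp add: has_real_derivative_iff_has_vector_derivative)
      show "(D has_vector_derivative (1 / v t) *\<^sub>R E t) (at ((m \<circ> ti) (\<tau> t)) within (m \<circ> ti) ` \<tau> ` J)"
        using D(3) t ti by (auto intro: has_vector_derivative_at_within)
    qed
    then have 1: "((D \<circ> (m \<circ> ti)) has_vector_derivative E t) (at (\<tau> t) within \<tau> ` J)" using vt by simp
    have "\<forall>\<^sub>F y in at (\<tau> t) within \<tau> ` J. \<beta> (ti y) = D (m (ti y))"
      using D(2) flti by (rule eventually_compose_filterlim)
    then have 2: "\<forall>\<^sub>F y in at (\<tau> t) within \<tau> ` J. (D \<circ> (m \<circ> ti)) y = \<gamma> y"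
      using eventually_in_at_within[of "\<tau> ` J" "\<tau> t"]
      by eventually_elim (use \<gamma> ti in auto)
    show ?thesis
      using 1 2 unfolding has_vector_derivative_def
      by (rule has_derivative_transform_eventually) (use D(1) \<gamma> t ti in auto)
  qed
  moreover have "\<tau> t0 = a" by (simp add: \<tau>_def T_def)
  ultimately show ?thesis using \<tau>c \<tau>m \<tau>i by blast
qed

text \<open>Gronwall's inequality for both directions of time, by way of \<open>w\<^sup>2\<close>, which is differentiable
  where \<open>\<bar>w\<bar>\<close> need not be.\<close>

lemma gronwall_abs:
  fixes w :: "real \<Rightarrow> real"
  assumes J: "is_interval J" and der: "\<And>t. t \<in> J \<Longrightarrow> (w has_real_derivative w' t) (at t within J)"
    and bd: "\<And>t. t \<in> J \<Longrightarrow> \<bar>w' t\<bar> \<le> C * \<bar>w t\<bar>" and s: "s \<in> J" and t: "t \<in> J"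
  shows "\<bar>w t\<bar> \<le> \<bar>w s\<bar> * exp (C * \<bar>t - s\<bar>)"
proof -
  have ww: "2 * w x * w' x \<le> 2 * C * (w x)\<^sup>2" "- (2 * C * (w x)\<^sup>2) \<le> 2 * w x * w' x" if "x \<in> J" for x
  proof -
    have "\<bar>w x * w' x\<bar> \<le> \<bar>w x\<bar> * (C * \<bar>w x\<bar>)" unfolding abs_mult using bd[OF that] by (intro mult_left_mono) auto
    also have "\<dots> = C * (w x)\<^sup>2" by (simp add: power2_eq_square)
    finally show "2 * w x * w' x \<le> 2 * C * (w x)\<^sup>2" "- (2 * C * (w x)\<^sup>2) \<le> 2 * w x * w' x" by auto
  qed
  have sq: "\<bar>w b\<bar> \<le> \<bar>w a\<bar> * exp (C * c)" if "(w b)\<^sup>2 \<le> (w a)\<^sup>2 * exp (2 * C * c)" for a b c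
  proof -
    have "exp (2 * C * c) = (exp (C * c))\<^sup>2" by (simp flip: exp_double)
    then have "(w a)\<^sup>2 * exp (2 * C * c) = (\<bar>w a\<bar> * exp (C * c))\<^sup>2"
      by (simp add: power_mult_distrib)
    then have "\<bar>w b\<bar>\<^sup>2 \<le> (\<bar>w a\<bar> * exp (C * c))\<^sup>2" using that by simp
    then show ?thesis by (rule power2_le_imp_le) simp
  qed
  have fw: "(w b)\<^sup>2 \<le> (w a)\<^sup>2 * exp (2 * C * (b - a)) \<and> (w a)\<^sup>2 \<le> (w b)\<^sup>2 * exp (2 * C * (b - a))"
    if ab: "a \<in> J" "b \<in> J" "a \<le> b" for a b
  proof -
    have sub: "{a..b} \<subseteq> J" using J ab(1,2) by (rule interval_Icc_subset)
    have d: "(w has_real_derivative w' x) (at x)" if "a < x" "x < b" for x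
    proof -
      have "(w has_real_derivative w' x) (at x within {a..b})"
      proof (rule DERIV_subset[OF der sub])
        show "x \<in> J" by (rule subsetD[OF sub]) (use that in simp)
      qed
      then show ?thesis using that by (simp add: at_within_Icc_at)
    qed
    have xJ: "x \<in> J" if "a < x" "x < b" for x by (rule subsetD[OF sub]) (use that in simp)
    have cw: "continuous_on {a..b} w"
    proof (rule continuous_on_subset[OF _ sub])
      show "continuous_on J w" unfolding continuous_on_eq_continuous_within using der DERIV_continuous by blast
    qed
    have e1: "(w a)\<^sup>2 * exp (- (2 * C * a)) \<ge> (w b)\<^sup>2 * exp (- (2 * C * b))"
    proof (rule DERIV_nonpos_imp_decreasing_open[OF ab(3)])
      fix x assume x: "a < x" "x < b"
      have "((\<lambda>x. (w x)\<^sup>2 * exp (- (2 * C * x))) has_real_derivative (2 * w x * w' x - 2 * C * (w x)\<^sup>2) * exp (- (2 * C * x))) (at x)"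
        by (rule derivative_eq_intros d[OF x] refl)+ (simp add: algebra_simps power2_eq_square)
      moreover have "(2 * w x * w' x - 2 * C * (w x)\<^sup>2) * exp (- (2 * C * x)) \<le> 0"
        using ww(1)[OF xJ[OF x]] by (intro mult_nonpos_nonneg) auto
      ultimately show "\<exists>y. ((\<lambda>x. (w x)\<^sup>2 * exp (- (2 * C * x))) has_real_derivative y) (at x) \<and> y \<le> 0" by blast
    qed (intro continuous_intros cw)
    have e2: "(w a)\<^sup>2 * exp (2 * C * a) \<le> (w b)\<^sup>2 * exp (2 * C * b)"
    proof (rule DERIV_nonneg_imp_increasing_open[OF ab(3)])
      fix x assume x: "a < x" "x < b"
      have "((\<lambda>x. (w x)\<^sup>2 * exp (2 * C * x)) has_real_derivative (2 * w x * w' x + 2 * C * (w x)\<^sup>2) * exp (2 * C * x)) (at x)"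
        by (rule derivative_eq_intros d[OF x] refl)+ (simp add: algebra_simps power2_eq_square)
      moreover have "0 \<le> (2 * w x * w' x + 2 * C * (w x)\<^sup>2) * exp (2 * C * x)"
        using ww(2)[OF xJ[OF x]] by (intro mult_nonneg_nonneg) auto
      ultimately show "\<exists>y. ((\<lambda>x. (w x)\<^sup>2 * exp (2 * C * x)) has_real_derivative y) (at x) \<and> 0 \<le> y" by blast
    qed (intro continuous_intros cw)
    have "(w b)\<^sup>2 = (w b)\<^sup>2 * exp (- (2 * C * b)) * exp (2 * C * b)" by (simp add: exp_minus)
    also have "\<dots> \<le> (w a)\<^sup>2 * exp (- (2 * C * a)) * exp (2 * C * b)" using e1 by (rule mult_right_mono) simp
    also have "\<dots> = (w a)\<^sup>2 * exp (2 * C * (b - a))" by (simp add: algebra_simps flip: exp_add)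
    finally have 1: "(w b)\<^sup>2 \<le> (w a)\<^sup>2 * exp (2 * C * (b - a))" .
    have "(w a)\<^sup>2 = (w a)\<^sup>2 * exp (2 * C * a) * exp (- (2 * C * a))" by (simp add: exp_minus)
    also have "\<dots> \<le> (w b)\<^sup>2 * exp (2 * C * b) * exp (- (2 * C * a))" using e2 by (rule mult_right_mono) simp
    also have "\<dots> = (w b)\<^sup>2 * exp (2 * C * (b - a))" by (simp add: algebra_simps flip: exp_add)
    finally show ?thesis using 1 by blast
  qed
  show ?thesis
  proof (cases "s \<le> t")
    case True
    then show ?thesis using sq[of t s "t - s"] fw[OF s t] by simp
  next
    case False
    then show ?thesis using sq[of t s "s - t"] fw[OF t s] by simp
  qed
qed

section \<open>Foliations by solutions of scalar differential equations\<close>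
lemma antiderivative_on_UNIV:
  fixes q :: "real \<Rightarrow> real"
  assumes q: "continuous_on UNIV q"
  shows "\<exists>T. T 0 = 0 \<and> (\<forall>s. (T has_real_derivative q s) (at s))"
proof (intro exI[of _ "\<lambda>s. integral {0..s} q - integral {s..0} q"] conjI allI)
  have qi: "q integrable_on {a..b}" for a b
    by (rule integrable_continuous_real[OF continuous_on_subset[OF q]]) simp
  fix s :: real
  define n where "n = \<bar>s\<bar> + 1"
  have n: "-n < s" "s < n" "0 < n" by (auto simp: n_def)
  have "((\<lambda>x. integral {-n..x} q) has_real_derivative q s) (at s within {-n..n})"
    by (rule integral_has_real_derivative[OF continuous_on_subset[OF q]]) (use n in auto)
  then have "((\<lambda>x. integral {-n..x} q - integral {-n..0} q) has_real_derivative q s) (at s)"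
    using n by (auto intro!: derivative_eq_intros simp: at_within_Icc_at)
  then show "((\<lambda>s. integral {0..s} q - integral {s..0} q) has_real_derivative q s) (at s)"
  proof (rule has_field_derivative_transform_within_open[of _ _ _ "{-n<..<n}"])
    fix x assume x: "x \<in> {-n<..<n}"
    show "integral {-n..x} q - integral {-n..0} q = integral {0..x} q - integral {x..0} q"
      using x n Henstock_Kurzweil_Integration.integral_combine[of "-n" 0 x q]
       Henstock_Kurzweil_Integration.integral_combine[of "-n" x 0 q] qi
      by (cases "x = 0"; cases "0 \<le> x") (auto simp: not_le less_imp_le)
  qed (use n in auto)
qed simp

text \<open>This turns integration into a bounded operation for the weighted sup norm below.\<close>

lemma abs_le_of_exponential_growth_rate:
  fixes W :: "real \<Rightarrow> real"
  assumes W0: "W 0 = 0" and der: "\<And>w. (W has_real_derivative W' w) (at w)"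
    and bd: "\<And>w. \<bar>W' w\<bar> \<le> C * exp (\<mu> * \<bar>w\<bar>)" and l: "0 < \<mu>" and C: "0 \<le> C"
  shows "\<bar>W s\<bar> \<le> C / \<mu> * exp (\<mu> * \<bar>s\<bar>)"
proof -
  have main: "V s \<le> C / \<mu> * exp (\<mu> * s)"
    if V0: "V 0 = 0" and Vd: "\<And>w. (V has_real_derivative V' w) (at w)"
      and Vb: "\<And>w. \<bar>V' w\<bar> \<le> C * exp (\<mu> * \<bar>w\<bar>)" and s: "0 \<le> s" for V V' s
  proof -
    have "C / \<mu> * exp (\<mu> * 0) - V 0 \<le> C / \<mu> * exp (\<mu> * s) - V s"
    proof (rule DERIV_nonneg_imp_nondecreasing[OF s])
      fix x assume x: "0 \<le> x" "x \<le> s"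
      have "((\<lambda>a. C / \<mu> * exp (\<mu> * a) - V a) has_real_derivative C * exp (\<mu> * x) - V' x) (at x)"
        by (rule derivative_eq_intros Vd refl)+ (use l in auto)
      moreover have "0 \<le> C * exp (\<mu> * x) - V' x" using Vb[of x] x by (simp add: abs_le_iff)
      ultimately show "\<exists>y. ((\<lambda>a. C / \<mu> * exp (\<mu> * a) - V a) has_real_derivative y) (at x) \<and> 0 \<le> y" by blast
    qed
    moreover have "0 \<le> C / \<mu>" using C l by simp
    ultimately show ?thesis using V0 by simp
  qed
  have derm: "((\<lambda>w. W (- w)) has_real_derivative - W' (- w)) (at w)" for w
    using DERIV_chain2[OF der[of "-w"] DERIV_minus[OF DERIV_ident]] by simp
  have p: "W s \<le> C / \<mu> * exp (\<mu> * s)" "- W s \<le> C / \<mu> * exp (\<mu> * s)"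
     "W (- s) \<le> C / \<mu> * exp (\<mu> * s)" "- W (- s) \<le> C / \<mu> * exp (\<mu> * s)" if "0 \<le> s" for s
    using main[of W W' s] main[of "\<lambda>w. - W w" "\<lambda>w. - W' w" s]
      main[of "\<lambda>w. W (- w)" "\<lambda>w. - W' (- w)" s]  main[of "\<lambda>w. - W (- w)" "\<lambda>w. W' (- w)" s]
      der derm DERIV_minus[OF der] DERIV_minus[OF derm] bd W0 that
    by (auto simp: bd[of "- w" for w, simplified])
  show ?thesis using p[of s] p[of "- s"] by (cases "0 \<le> s") auto
qed

text \<open>Picard iteration. The sup norm with weight \<open>exp (- \<mu> \<bar>s\<bar>)\<close> makes it a contraction on the
  whole real line at once.\<close>

lemma Picard_global_solution:
  fixes f :: "real \<Rightarrow> real \<Rightarrow> real"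
  assumes contf: "continuous_on UNIV (\<lambda>p. f (fst p) (snd p))"
    and lip: "\<And>x y s. \<bar>f x s - f y s\<bar> \<le> L * \<bar>x - y\<bar>" and L: "0 \<le> L"
    and bd: "\<And>x s. \<bar>f x s\<bar> \<le> M"
  shows "\<exists>x. x 0 = x0 \<and> (\<forall>s. (x has_real_derivative f (x s) s) (at s))"
proof -
  \<comment> \<open>With this weight the contraction factor \<open>L / \<mu>\<close> is at most \<open>1 / 2\<close>.\<close>
  define \<mu> where "\<mu> = 2 * L + 1"
  have l: "0 < \<mu>" "L / \<mu> \<le> 1 / 2" using L by (auto simp: \<mu>_def field_simps)
  have M: "0 \<le> M" using bd[of 0 0] by linarith
  \<comment> \<open>\<open>u\<close> stands for the candidate \<open>x0 + exp (\<mu> * \<bar>w\<bar>) * u w\<close>, which need not be bounded.\<close>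
  define q where "q u w = f (x0 + exp (\<mu> * \<bar>w\<bar>) * apply_bcontfun u w) w" for u :: "real \<Rightarrow>\<^sub>C real" and w
  have qc: "continuous_on UNIV (q u)" for u
  proof -
    have "continuous_on UNIV (\<lambda>w. (\<lambda>p. f (fst p) (snd p)) (x0 + exp (\<mu> * \<bar>w\<bar>) * apply_bcontfun u w, w))"
      by (rule continuous_on_compose2[OF contf]) (auto intro!: continuous_intros)
    then show ?thesis by (simp add: q_def[abs_def])
  qed
  define S where "S u = (SOME T. T 0 = 0 \<and> (\<forall>s. (T has_real_derivative q u s) (at s)))" for u
  have S: "S u 0 = 0" "(S u has_real_derivative q u s) (at s)" for u s
    using someI_ex[OF antiderivative_on_UNIV[OF qc[of u]]] by (auto simp: S_def)
  have Sc: "continuous_on UNIV (S u)" for u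
    using S(2) by (meson DERIV_isCont continuous_at_imp_continuous_on)
  have Sb: "\<bar>S u s\<bar> \<le> M / \<mu> * exp (\<mu> * \<bar>s\<bar>)" for u s
  proof (rule abs_le_of_exponential_growth_rate[OF S(1) S(2) _ l(1) M])
    fix w
    have "\<bar>q u w\<bar> \<le> M * 1" using bd by (simp add: q_def)
    also have "\<dots> \<le> M * exp (\<mu> * \<bar>w\<bar>)" using M l by (intro mult_left_mono) auto
    finally show "\<bar>q u w\<bar> \<le> M * exp (\<mu> * \<bar>w\<bar>)" .
  qed
  have bc: "(\<lambda>s. exp (- \<mu> * \<bar>s\<bar>) * S u s) \<in> bcontfun" for u
  proof (rule bcontfun_normI[of _ "M / \<mu>"])
    show "continuous_on UNIV (\<lambda>s. exp (- \<mu> * \<bar>s\<bar>) * S u s)" by (intro continuous_intros Sc)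
    fix s
    have "norm (exp (- \<mu> * \<bar>s\<bar>) * S u s) = exp (- \<mu> * \<bar>s\<bar>) * \<bar>S u s\<bar>" by (simp add: abs_mult)
    also have "\<dots> \<le> exp (- \<mu> * \<bar>s\<bar>) * (M / \<mu> * exp (\<mu> * \<bar>s\<bar>))" using Sb by (intro mult_left_mono) auto
    also have "\<dots> = M / \<mu>" by (simp add: exp_minus)
    finally show "norm (exp (- \<mu> * \<bar>s\<bar>) * S u s) \<le> M / \<mu>" .
  qed
  define F where "F u = Bcontfun (\<lambda>s. exp (- \<mu> * \<bar>s\<bar>) * S u s)" for u
  have F: "apply_bcontfun (F u) s = exp (- \<mu> * \<bar>s\<bar>) * S u s" for u s
    unfolding F_def by (simp only: Bcontfun_inverse[OF bc])
  have contr: "dist (F u) (F v) \<le> 1 / 2 * dist u v" for u v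
  proof (rule dist_bound)
    fix s
    have "\<bar>S u s - S v s\<bar> \<le> (L * dist u v) / \<mu> * exp (\<mu> * \<bar>s\<bar>)"
    proof (rule abs_le_of_exponential_growth_rate[where W' = "\<lambda>w. q u w - q v w"])
      show "((\<lambda>w. S u w - S v w) has_real_derivative q u w - q v w) (at w)" for w
        by (intro DERIV_diff S)
      fix w
      have "\<bar>q u w - q v w\<bar> \<le> L * (exp (\<mu> * \<bar>w\<bar>) * \<bar>apply_bcontfun u w - apply_bcontfun v w\<bar>)"
        using lip[of "x0 + exp (\<mu> * \<bar>w\<bar>) * apply_bcontfun u w" w "x0 + exp (\<mu> * \<bar>w\<bar>) * apply_bcontfun v w"]
        by (simp add: q_def abs_mult flip: right_diff_distrib)
      also have "\<dots> \<le> L * (exp (\<mu> * \<bar>w\<bar>) * dist u v)"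
        using L dist_bounded[of u w v] by (intro mult_left_mono) (auto simp: dist_real_def)
      finally show "\<bar>q u w - q v w\<bar> \<le> L * dist u v * exp (\<mu> * \<bar>w\<bar>)" by (simp add: mult_ac)
    qed (use S l L in auto)
    then have "exp (- \<mu> * \<bar>s\<bar>) * \<bar>S u s - S v s\<bar> \<le> exp (- \<mu> * \<bar>s\<bar>) * ((L * dist u v) / \<mu> * exp (\<mu> * \<bar>s\<bar>))"
      by (intro mult_left_mono) auto
    also have "\<dots> = (L / \<mu>) * dist u v" by (simp add: exp_minus)
    also have "\<dots> \<le> 1 / 2 * dist u v" using l(2) by (intro mult_right_mono) auto
    finally show "dist (apply_bcontfun (F u) s) (apply_bcontfun (F v) s) \<le> 1 / 2 * dist u v"
      by (simp add: F dist_real_def abs_mult flip: right_diff_distrib)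
  qed
  have "\<exists>!u. F u = u"
    by (rule banach_fix_type[of "1/2"]) (use contr in auto)
  then obtain u where u: "F u = u" by blast
  have ue: "apply_bcontfun u s = exp (- \<mu> * \<bar>s\<bar>) * S u s" for s using F[of u s] u by simp
  show ?thesis
  proof (intro exI[of _ "\<lambda>s. x0 + S u s"] conjI allI)
    show "x0 + S u 0 = x0" using S by simp
    fix s
    have "q u s = f (x0 + S u s) s" by (simp add: q_def ue exp_minus flip: mult.assoc)
    then show "((\<lambda>s. x0 + S u s) has_real_derivative f (x0 + S u s) s) (at s)"
      using S(2)[of u s] by (auto intro!: derivative_eq_intros)
  qed
qed

text \<open>The foliation of the plane by the graphs \<open>s \<mapsto> x s\<close> of the solutions of \<open>x' = f x s\<close>, whose
  slopes all have the sign \<open>\<epsilon>\<close>. \<open>G c\<close> is the leaf with \<open>x 0 = c\<close>, and \<open>H x s\<close> is the label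
  \<open>c\<close> of the leaf through \<open>(x, s)\<close>. Thus \<open>\<kappa> s\<close> is the position at which the leaf through the
  point \<open>(0, s)\<close> of one axis meets the other axis.\<close>

locale leaf_flow =
  fixes f :: "real \<Rightarrow> real \<Rightarrow> real" and L m M \<epsilon> :: real
  assumes contf: "continuous_on UNIV (\<lambda>p. f (fst p) (snd p))"
    and lip: "\<bar>f x s - f y s\<bar> \<le> L * \<bar>x - y\<bar>" and L: "0 \<le> L"
    and m: "0 < m" and eps: "\<epsilon> = 1 \<or> \<epsilon> = -1"
    and flo: "m \<le> \<epsilon> * f x s" and fhi: "\<epsilon> * f x s \<le> M"
begin

definition solves :: "(real \<Rightarrow> real) \<Rightarrow> bool"
  where "solves x \<longleftrightarrow> (\<forall>s. (x has_real_derivative f (x s) s) (at s))"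

definition sol :: "real \<Rightarrow> real \<Rightarrow> real \<Rightarrow> real"
  where "sol s0 x0 = (SOME x. x s0 = x0 \<and> solves x)"

definition H where "H x s = sol s x 0"
definition G where "G c s = sol 0 c s"
definition \<kappa> where "\<kappa> s = H 0 s"

lemma f_abs_le: "\<bar>f x s\<bar> \<le> M"
  using flo[of x s] fhi[of x s] eps m by auto

lemma sol: "sol s0 x0 s0 = x0" "solves (sol s0 x0)"
proof -
  have "\<exists>x. x 0 = x0 \<and> (\<forall>s. (x has_real_derivative f (x s) (s + s0)) (at s))"
  proof (rule Picard_global_solution[where f = "\<lambda>x s. f x (s + s0)" and L = L and M = M])
    have "continuous_on UNIV (\<lambda>p. (\<lambda>p. f (fst p) (snd p)) (fst p, snd p + s0))"
      by (rule continuous_on_compose2[OF contf]) (auto intro!: continuous_intros)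
    then show "continuous_on UNIV (\<lambda>p. f (fst p) (snd p + s0))" by simp
  qed (use lip L f_abs_le in auto)
  then obtain x where x: "x 0 = x0" "\<And>s. (x has_real_derivative f (x s) (s + s0)) (at s)" by blast
  have "((\<lambda>s. x (s - s0)) has_real_derivative f (x (s - s0)) s) (at s)" for s
  proof -
    have "((\<lambda>s. s - s0) has_real_derivative 1) (at s)" by (auto intro!: derivative_eq_intros)
    from DERIV_chain2[where g = "\<lambda>s. s - s0" and f = x, OF x(2) this] show ?thesis by simp
  qed
  then have "\<exists>x. x s0 = x0 \<and> solves x"
    by (intro exI[of _ "\<lambda>s. x (s - s0)"]) (auto simp: solves_def x(1))
  from someI_ex[OF this] show "sol s0 x0 s0 = x0" "solves (sol s0 x0)" by (auto simp: sol_def)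
qed

lemma solves_gronwall:
  assumes "solves x" "solves y"
  shows "\<bar>x t - y t\<bar> \<le> \<bar>x s - y s\<bar> * exp (L * \<bar>t - s\<bar>)"
proof (rule gronwall_abs[where J = UNIV and w' = "\<lambda>t. f (x t) t - f (y t) t"])
  show "((\<lambda>t. x t - y t) has_real_derivative f (x t) t - f (y t) t) (at t)" for t
    using assms by (intro DERIV_diff) (auto simp: solves_def)
qed (use lip in auto)

lemma solves_unique:
  assumes "solves x" "solves y" "x s = y s"
  shows "x = y"
  using solves_gronwall[OF assms(1,2), of _ s] assms(3) by (auto intro!: ext)

lemma sol_eqI: "solves x \<Longrightarrow> x s0 = x0 \<Longrightarrow> sol s0 x0 = x"
  using solves_unique[OF sol(2), of x s0] sol(1) by auto

lemma G_H: "G (H x s) s = x"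
  unfolding G_def H_def using sol_eqI[of "sol s x" 0] sol by simp

lemma H_G: "H (G c s) s = c"
  unfolding G_def H_def using sol_eqI[of "sol 0 c" s] sol by simp

lemma G_0 [simp]: "G c 0 = c" and H_0 [simp]: "H x 0 = x"
  unfolding G_def H_def using sol by simp_all

lemma G_DERIV: "(G c has_real_derivative f (G c s) s) (at s)"
  using sol(2)[of 0 c] unfolding solves_def G_def[abs_def] by blast

lemma G_solves: "solves (G c)"
  unfolding solves_def using G_DERIV by blast

lemma H_eq_iff: "H x s = c \<longleftrightarrow> x = G c s"
  using G_H H_G by metis

lemma increment:
  assumes "solves x" "s \<le> t"
  shows "m * (t - s) \<le> \<epsilon> * (x t - x s)" "\<epsilon> * (x t - x s) \<le> M * (t - s)"
proof -
  have d: "((\<lambda>a. \<epsilon> * x a) has_real_derivative \<epsilon> * f (x a) a) (at a)" for a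
    using assms(1) by (auto intro!: derivative_eq_intros simp: solves_def)
  have "\<epsilon> * x s - m * s \<le> \<epsilon> * x t - m * t"
  proof (rule DERIV_nonneg_imp_nondecreasing[OF assms(2), where f = "\<lambda>a. \<epsilon> * x a - m * a"])
    show "\<exists>y. ((\<lambda>a. \<epsilon> * x a - m * a) has_real_derivative y) (at a) \<and> 0 \<le> y" for a
      by (rule exI[of _ "\<epsilon> * f (x a) a - m"]) (use flo d[of a] in \<open>auto intro!: DERIV_diff DERIV_cmult_Id\<close>)
  qed
  then show "m * (t - s) \<le> \<epsilon> * (x t - x s)" by (simp add: algebra_simps)
  have "M * s - \<epsilon> * x s \<le> M * t - \<epsilon> * x t"
  proof (rule DERIV_nonneg_imp_nondecreasing[OF assms(2), where f = "\<lambda>a. M * a - \<epsilon> * x a"])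
    show "\<exists>y. ((\<lambda>a. M * a - \<epsilon> * x a) has_real_derivative y) (at a) \<and> 0 \<le> y" for a
      by (rule exI[of _ "M - \<epsilon> * f (x a) a"]) (use fhi d[of a] in \<open>auto intro!: DERIV_diff DERIV_cmult_Id\<close>)
  qed
  then show "\<epsilon> * (x t - x s) \<le> M * (t - s)" by (simp add: algebra_simps)
qed

lemma G_strict_mono: assumes "c < c'" shows "G c s < G c' s"
proof (rule ccontr)
  assume neg: "\<not> G c s < G c' s"
  define w where "w t = G c' t - G c t" for t
  have cw: "isCont w t" for t
    unfolding w_def using G_DERIV by (intro continuous_intros DERIV_isCont)
  have w: "0 < w 0" "w s \<le> 0" using assms neg by (auto simp: w_def)
  have "\<exists>t. w t = 0"
    using IVT[of w s 0 0] IVT2[of w s 0 0] w cw by (cases "s \<le> 0") auto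
  then obtain t where "G c' t = G c t" by (auto simp: w_def)
  then have "G c' = G c" using solves_unique[OF G_solves G_solves] by blast
  then show False using assms G_0 by (metis less_irrefl)
qed

lemma G_less_iff: "G c s < G c' s \<longleftrightarrow> c < c'"
  using G_strict_mono[of c c' s] G_strict_mono[of c' c s] by (metis linorder_neqE_linordered_idom order.asym)

lemma H_less_iff: "H x s < H x' s \<longleftrightarrow> x < x'"
  using G_less_iff[of "H x s" s "H x' s"] by (simp add: G_H)

lemma abs_sol_diff_le: "solves x \<Longrightarrow> \<bar>x t - x s\<bar> \<le> M * \<bar>t - s\<bar>"
proof -
  assume x: "solves x"
  have *: "\<bar>x b - x a\<bar> \<le> M * (b - a)" if "a \<le> b" for a b
  proof -
    have "0 \<le> m * (b - a)" using m that by simp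
    then show ?thesis using increment[OF x that] eps by (auto simp: abs_le_iff)
  qed
  show ?thesis using *[of s t] *[of t s] by (cases "s \<le> t") auto
qed

lemma H_dist: "\<bar>H x s - H x' s'\<bar> \<le> (\<bar>x - x'\<bar> + M * \<bar>s - s'\<bar>) * exp (L * \<bar>s'\<bar>)"
proof -
  have "\<bar>sol s x s' - sol s' x' s'\<bar> \<le> \<bar>x - x'\<bar> + M * \<bar>s - s'\<bar>"
    using abs_sol_diff_le[OF sol(2)[of s x], of s' s] sol(1)[of s x] sol(1)[of s' x'] by (simp add: abs_minus_commute)
  then have 1: "\<bar>sol s x s' - sol s' x' s'\<bar> * exp (L * \<bar>s'\<bar>) \<le> (\<bar>x - x'\<bar> + M * \<bar>s - s'\<bar>) * exp (L * \<bar>s'\<bar>)"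
    by (intro mult_right_mono) auto
  have 2: "\<bar>sol s x 0 - sol s' x' 0\<bar> \<le> \<bar>sol s x s' - sol s' x' s'\<bar> * exp (L * \<bar>s'\<bar>)"
    using solves_gronwall[OF sol(2)[of s x] sol(2)[of s' x'], of 0 s'] by simp
  show ?thesis unfolding H_def by (rule order_trans[OF 2 1])
qed

lemma G_dist: "\<bar>G x s - G x' s'\<bar> \<le> \<bar>x - x'\<bar> * exp (L * \<bar>s'\<bar>) + M * \<bar>s - s'\<bar>"
  using abs_sol_diff_le[OF G_solves, of x s s'] solves_gronwall[OF G_solves[of x] G_solves[of x'], of s' 0]
  by simp

lemma H_continuous: "continuous_on UNIV (\<lambda>p. H (fst p) (snd p))"
  unfolding continuous_on_def
proof (intro ballI)
  fix p :: "real \<times> real"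
  show "((\<lambda>p. H (fst p) (snd p)) \<longlongrightarrow> H (fst p) (snd p)) (at p)"
  proof (rule LIM_zero_cancel, rule Lim_null_comparison)
    show "\<forall>\<^sub>F q in at p. norm (H (fst q) (snd q) - H (fst p) (snd p))
        \<le> (\<bar>fst q - fst p\<bar> + M * \<bar>snd q - snd p\<bar>) * exp (L * \<bar>snd p\<bar>)"
      using H_dist by (intro always_eventually) auto
    have "((\<lambda>q. (\<bar>fst q - fst p\<bar> + M * \<bar>snd q - snd p\<bar>) * exp (L * \<bar>snd p\<bar>)) \<longlongrightarrow>
        (\<bar>fst p - fst p\<bar> + M * \<bar>snd p - snd p\<bar>) * exp (L * \<bar>snd p\<bar>)) (at p)"
      by (intro tendsto_intros)
    then show "((\<lambda>q. (\<bar>fst q - fst p\<bar> + M * \<bar>snd q - snd p\<bar>) * exp (L * \<bar>snd p\<bar>)) \<longlongrightarrow> 0) (at p)"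
      by simp
  qed
qed

lemma G_continuous: "continuous_on UNIV (\<lambda>p. G (fst p) (snd p))"
  unfolding continuous_on_def
proof (intro ballI)
  fix p :: "real \<times> real"
  show "((\<lambda>p. G (fst p) (snd p)) \<longlongrightarrow> G (fst p) (snd p)) (at p)"
  proof (rule LIM_zero_cancel, rule Lim_null_comparison)
    show "\<forall>\<^sub>F q in at p. norm (G (fst q) (snd q) - G (fst p) (snd p))
        \<le> \<bar>fst q - fst p\<bar> * exp (L * \<bar>snd p\<bar>) + M * \<bar>snd q - snd p\<bar>"
      using G_dist by (intro always_eventually) auto
    have "((\<lambda>q. \<bar>fst q - fst p\<bar> * exp (L * \<bar>snd p\<bar>) + M * \<bar>snd q - snd p\<bar>) \<longlongrightarrow>
        \<bar>fst p - fst p\<bar> * exp (L * \<bar>snd p\<bar>) + M * \<bar>snd p - snd p\<bar>) (at p)"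
      by (intro tendsto_intros)
    then show "((\<lambda>q. \<bar>fst q - fst p\<bar> * exp (L * \<bar>snd p\<bar>) + M * \<bar>snd q - snd p\<bar>) \<longlongrightarrow> 0) (at p)"
      by simp
  qed
qed

lemma G_0_sign: "s \<noteq> 0 \<Longrightarrow> 0 < \<epsilon> * G 0 s * s"
proof (cases "0 < s")
  case True
  then have "0 < \<epsilon> * G 0 s" using increment(1)[OF G_solves, of 0 s 0] m by (smt (verit) G_0 mult_pos_pos)
  then show ?thesis using True by simp
next
  case False
  moreover assume "s \<noteq> 0"
  ultimately have s: "s < 0" by simp
  have "0 < \<epsilon> * (G 0 0 - G 0 s)" using increment(1)[OF G_solves, of s 0 0] m s by (smt (verit) mult_pos_pos)
  then have "\<epsilon> * G 0 s < 0" by simp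
  then show ?thesis using s by (rule mult_neg_neg)
qed

lemma \<kappa>_0 [simp]: "\<kappa> 0 = 0" by (simp add: \<kappa>_def)

lemma \<kappa>_mono: assumes "s < s'" shows "\<epsilon> * \<kappa> s' < \<epsilon> * \<kappa> s"
proof -
  define x where "x = sol s 0"
  have x: "solves x" "x s = 0" "\<kappa> s = x 0" using sol by (auto simp: x_def \<kappa>_def H_def)
  have inc: "0 < \<epsilon> * x s'" using increment(1)[OF x(1), of s s'] assms m x(2) by (smt (verit) mult_pos_pos)
  have "\<kappa> s = H (x s') s'" unfolding x(3) H_def using sol_eqI[OF x(1), of s' "x s'"] by simp
  moreover have "\<epsilon> = 1 \<and> 0 < x s' \<or> \<epsilon> = -1 \<and> x s' < 0" using inc eps by auto
  ultimately show ?thesis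
    using H_less_iff[of 0 s' "x s'"] H_less_iff[of "x s'" s' 0] by (auto simp: \<kappa>_def[of s'])
qed

lemma \<kappa>_bounds: "m * \<bar>s\<bar> \<le> \<bar>\<kappa> s\<bar>" "\<bar>\<kappa> s\<bar> \<le> M * \<bar>s\<bar>" "s \<noteq> 0 \<Longrightarrow> \<epsilon> * \<kappa> s * s < 0"
proof -
  define x where "x = sol s 0"
  have x: "solves x" "x s = 0" "\<kappa> s = x 0" using sol by (auto simp: x_def \<kappa>_def H_def)
  have e: "\<bar>\<epsilon> * a\<bar> = \<bar>a\<bar>" for a using eps by auto
  have 1: "m * \<bar>s\<bar> \<le> \<bar>\<epsilon> * \<kappa> s\<bar>" "\<bar>\<epsilon> * \<kappa> s\<bar> \<le> M * \<bar>s\<bar>"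
  proof -
    have "m * \<bar>s\<bar> \<le> \<bar>\<epsilon> * \<kappa> s\<bar> \<and> \<bar>\<epsilon> * \<kappa> s\<bar> \<le> M * \<bar>s\<bar>"
    proof (cases "0 \<le> s")
      case True
      have "m * s \<le> - (\<epsilon> * \<kappa> s)" "- (\<epsilon> * \<kappa> s) \<le> M * s"
        using increment[OF x(1) True] x(2,3) by simp_all
      moreover have "0 \<le> m * s" using True m by simp
      ultimately show ?thesis using True by simp
    next
      case False
      then have "m * (- s) \<le> \<epsilon> * \<kappa> s" "\<epsilon> * \<kappa> s \<le> M * (- s)"
        using increment[OF x(1), of s 0] x(2,3) by simp_all
      moreover have "0 \<le> m * (- s)" using False m by (intro mult_nonneg_nonneg) auto
      ultimately show ?thesis using False by simp
    qed
    then show "m * \<bar>s\<bar> \<le> \<bar>\<epsilon> * \<kappa> s\<bar>" "\<bar>\<epsilon> * \<kappa> s\<bar> \<le> M * \<bar>s\<bar>" by blast+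
  qed
  then show "m * \<bar>s\<bar> \<le> \<bar>\<kappa> s\<bar>" "\<bar>\<kappa> s\<bar> \<le> M * \<bar>s\<bar>" by (simp_all add: e)
  show "\<epsilon> * \<kappa> s * s < 0" if "s \<noteq> 0"
    using \<kappa>_mono[of 0 s] \<kappa>_mono[of s 0] that by (cases "0 < s") (auto simp: mult_less_0_iff)
qed

lemma \<kappa>_inj: "inj \<kappa>"
  using \<kappa>_mono by (metis injI linorder_neqE_linordered_idom less_irrefl)

lemma \<kappa>_continuous: "continuous_on UNIV \<kappa>"
proof -
  have "continuous_on UNIV (\<lambda>s. (\<lambda>p. H (fst p) (snd p)) (0, s))"
    by (rule continuous_on_compose2[OF H_continuous]) (auto intro!: continuous_intros)
  then show ?thesis by (simp add: \<kappa>_def[abs_def])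
qed

lemma \<kappa>_surj: "surj \<kappa>"
proof -
  have "\<exists>s. \<kappa> s = c" for c
  proof -
    define a where "a = \<bar>c\<bar> / m + 1"
    have a: "0 < a" "\<bar>c\<bar> \<le> m * a" using m by (auto simp: a_def field_simps add_nonneg_pos)
    have ct: "isCont \<kappa> x" for x using \<kappa>_continuous by (simp add: continuous_on_eq_continuous_at)
    have "\<bar>c\<bar> \<le> \<bar>\<kappa> a\<bar>" "\<bar>c\<bar> \<le> \<bar>\<kappa> (-a)\<bar>" using \<kappa>_bounds(1)[of a] \<kappa>_bounds(1)[of "-a"] a by auto
    moreover have "\<epsilon> * \<kappa> a < 0" "0 < \<epsilon> * \<kappa> (- a)" using \<kappa>_mono[of 0 a] \<kappa>_mono[of "-a" 0] a by auto
    ultimately have "\<epsilon> = 1 \<and> \<kappa> a \<le> c \<and> c \<le> \<kappa> (- a) \<or> \<epsilon> = -1 \<and> \<kappa> (- a) \<le> c \<and> c \<le> \<kappa> a"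
      using eps by (elim disjE) auto
    then show ?thesis
      using IVT[of \<kappa> "-a" c a] IVT2[of \<kappa> a c "-a"] ct a(1) by auto
  qed
  then show ?thesis by (metis surjI)
qed

lemma \<kappa>_bij: "bij \<kappa>" using \<kappa>_inj \<kappa>_surj by (simp add: bij_def)

end

section \<open>Conjugacy of two foliations of the quadrants\<close>
definition int_iterate :: "('a \<Rightarrow> 'a) \<Rightarrow> int \<Rightarrow> 'a \<Rightarrow> 'a"
  where "int_iterate Q n = (if 0 \<le> n then Q ^^ nat n else inv Q ^^ nat (- n))"

lemma int_iterate_0 [simp]: "int_iterate Q 0 = id"
  by (simp add: int_iterate_def)

lemma int_iterate_add_1:
  assumes "bij Q" shows "int_iterate Q (n + 1) x = Q (int_iterate Q n x)"
proof (cases "0 \<le> n")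
  case True
  then show ?thesis by (simp add: int_iterate_def nat_add_distrib)
next
  case False
  define k where "k = nat (- n - 1)"
  have n: "n = - int (Suc k)" using False by (simp add: k_def)
  have "int_iterate Q (n + 1) x = (inv Q ^^ k) x"
    using n by (cases k) (auto simp: int_iterate_def nat_add_distrib)
  moreover have "int_iterate Q n x = inv Q ((inv Q ^^ k) x)" unfolding n by (simp add: int_iterate_def nat_add_distrib)
  ultimately show ?thesis using assms by (simp add: bij_is_surj surj_f_inv_f)
qed

lemma strict_mono_inv_real:
  fixes Q :: "real \<Rightarrow> real"
  assumes "bij Q" "strict_mono Q" shows "strict_mono (inv Q)"
  by (rule strict_monoI) (metis assms bij_is_surj strict_mono_less surj_f_inv_f)

lemma strict_mono_surj_continuous:
  fixes Q :: "real \<Rightarrow> real"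
  assumes "surj Q" "strict_mono Q" shows "continuous_on A Q"
proof (rule continuous_on_subset[OF strict_mono_on_interval_image_continuous])
  show "is_interval (range Q)" using assms(1) by simp
qed (use assms in auto)

lemma int_iterate_strict_mono:
  fixes Q :: "real \<Rightarrow> real"
  assumes "bij Q" "strict_mono Q" shows "strict_mono (int_iterate Q n)"
proof -
  have "strict_mono (R ^^ k)" if "strict_mono R" for R :: "real \<Rightarrow> real" and k
    by (induction k) (use that in \<open>auto simp: strict_mono_def\<close>)
  then show ?thesis using assms strict_mono_inv_real by (auto simp: int_iterate_def)
qed

lemma int_iterate_bij: "bij Q \<Longrightarrow> bij (int_iterate Q n)"
  by (simp add: int_iterate_def bij_imp_bij_inv bij_fn)

text \<open>A parametrization of the positive half line that turns the expansion \<open>Q\<close> into the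
  translation by \<open>1\<close>: it is affine from the unit interval to the fundamental domain between \<open>1\<close>
  and \<open>Q 1\<close> and is continued by the iterates of \<open>Q\<close>.\<close>

lemma expansion_conjugate_to_translation:
  fixes Q :: "real \<Rightarrow> real"
  assumes Q: "bij Q" "strict_mono Q" and Q0: "Q 0 = 0"
    and c: "1 < c" and exp: "\<And>x. 0 < x \<Longrightarrow> c * x \<le> Q x"
  shows "\<exists>B :: real \<Rightarrow> real. strict_mono B \<and> range B = {0<..} \<and> (\<forall>t. B (t + 1) = Q (B t))"
proof -
  define I where "I = int_iterate Q"
  have I1: "I (n + 1) x = Q (I n x)" for n x using Q(1) by (simp add: I_def int_iterate_add_1)
  have Im: "I n x < I n y \<longleftrightarrow> x < y" for n x y using int_iterate_strict_mono[OF Q] by (simp add: I_def strict_mono_less)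
  have Iz: "I n 0 = 0" for n
  proof -
    have f: "(R ^^ k) 0 = 0" if "R 0 = 0" for R :: "real \<Rightarrow> real" and k by (induction k) (use that in auto)
    have "inv Q 0 = 0" using Q(1) Q0 by (metis bij_is_inj inv_f_f)
    then show ?thesis using f Q0 by (simp add: I_def int_iterate_def)
  qed
  have Ipos: "0 < x \<Longrightarrow> 0 < I n x" for n x using Im[of n 0 x] Iz by simp
  have Icomm: "I (n + 1) x = I n (Q x)" for n x
  proof (induction n rule: int_induct[where k = 0])
    case base
    then show ?case using I1[of 0 x] by (simp add: I_def)
  next
    case (step1 i)
    then show ?case by (metis I1)
  next
    case (step2 i)
    have "Q (I (i - 1 + 1) x) = Q (I (i - 1) (Q x))"
      using step2 I1[of "i - 1" "Q x"] I1[of i x] by simp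
    then show ?case using Q(1) by (metis bij_pointE)
  qed
  have Isurj: "\<exists>y. I n y = x" for n x using int_iterate_bij[OF Q(1), of n] unfolding I_def by (metis bij_pointE)
  have up: "c ^ k \<le> I (int k) 1" for k
  proof (induction k)
    case (Suc k)
    have "c ^ Suc k \<le> c * I (int k) 1" using Suc c by simp
    also have "\<dots> \<le> Q (I (int k) 1)" by (rule exp) (simp add: Ipos)
    finally show ?case using I1[of "int k" 1] by (simp add: add.commute)
  qed (simp add: I_def)
  have down: "I (- int k) 1 * c ^ k \<le> 1" for k
  proof (induction k)
    case (Suc k)
    have "c * I (- int (Suc k)) 1 \<le> I (- int k) 1"
      using exp[OF Ipos, of 1 "- int (Suc k)"] I1[of "- int (Suc k)" 1] by simp
    then have "c * I (- int (Suc k)) 1 * c ^ k \<le> I (- int k) 1 * c ^ k" using c by (intro mult_right_mono) auto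
    then show ?case using Suc by (simp add: mult_ac)
  qed (simp add: I_def)
  have Q1: "1 < Q 1" using exp[of 1] c by simp
  have Imono: "I n 1 \<le> I n' 1" if "n \<le> n'" for n n'
    using that
  proof (induction n' rule: int_ge_induct)
    case (step i)
    have "I i 1 < I i (Q 1)" using Im Q1 by simp
    then show ?case using step Icomm[of i 1] by simp
  qed simp
  define B where "B t = I \<lfloor>t\<rfloor> (1 + frac t * (Q 1 - 1))" for t :: real
  have fr: "1 \<le> 1 + frac t * (Q 1 - 1)" "1 + frac t * (Q 1 - 1) < Q 1" for t :: real
  proof -
    show "1 \<le> 1 + frac t * (Q 1 - 1)" using Q1 by (simp add: frac_ge_0)
    have "frac t * (Q 1 - 1) < 1 * (Q 1 - 1)" using Q1 by (intro mult_strict_right_mono frac_lt_1) auto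
    then show "1 + frac t * (Q 1 - 1) < Q 1" by simp
  qed
  have Ile: "I n x \<le> I n y \<longleftrightarrow> x \<le> y" for n x y using Im[of n y x] by (simp add: not_less[symmetric])
  have Blo: "I \<lfloor>t\<rfloor> 1 \<le> B t" and Bhi: "B t < I (\<lfloor>t\<rfloor> + 1) 1" for t
    using fr[of t] by (auto simp: B_def Ile Im Icomm)
  have "B t < B u" if "t < u" for t u
  proof (cases "\<lfloor>t\<rfloor> = \<lfloor>u\<rfloor>")
    case True
    then have "frac t < frac u" using that by (simp add: frac_def)
    then show ?thesis using True Q1 by (simp add: B_def Im)
  next
    case False
    then have "\<lfloor>t\<rfloor> + 1 \<le> \<lfloor>u\<rfloor>" using that floor_mono[of t u] by simp
    then show ?thesis using Bhi[of t] Imono[of "\<lfloor>t\<rfloor> + 1" "\<lfloor>u\<rfloor>"] Blo[of u] by linarith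
  qed
  then have "strict_mono B" by (rule strict_monoI)
  moreover have "B (t + 1) = Q (B t)" for t
    using I1 by (simp add: B_def frac_1_eq)
  moreover have "range B = {0<..}"
  proof (intro equalityI subsetI)
    fix x assume "x \<in> range B"
    then obtain t where "x = B t" by blast
    then show "x \<in> {0<..}" using Blo[of t] Ipos[of 1 "\<lfloor>t\<rfloor>"] by simp
  next
    fix x :: real assume "x \<in> {0<..}"
    then have x: "0 < x" by simp
    obtain k1 where k1: "x < c ^ k1" using real_arch_pow[OF c] by blast
    obtain k2 where k2: "1 / x < c ^ k2" using real_arch_pow[OF c] by blast
    have hi: "x < I (int k1) 1" using k1 up[of k1] by simp
    have lo: "I (- int k2) 1 \<le> x"
    proof -
      have "I (- int k2) 1 * c ^ k2 \<le> x * c ^ k2" using down[of k2] k2 x by (simp add: field_simps)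
      then show ?thesis using c by simp
    qed
    define P where "P k \<longleftrightarrow> x < I (- int k2 + int k) 1" for k
    have "P (k1 + k2)" using hi by (simp add: P_def)
    then have PL: "P (LEAST k. P k)" by (rule LeastI)
    have n0: "\<not> P 0" using lo by (simp add: P_def)
    then obtain k where k: "(LEAST k. P k) = Suc k" using PL by (metis not0_implies_Suc)
    then have "\<not> P k" by (metis lessI not_less_Least)
    define n where "n = - int k2 + int k"
    have n: "I n 1 \<le> x" "x < I (n + 1) 1"
      using \<open>\<not> P k\<close> PL k by (simp_all add: P_def n_def algebra_simps)
    obtain y where y: "I n y = x" using Isurj by blast
    have yb: "1 \<le> y" "y < Q 1" using n y Ile[of n 1 y] Im[of n y "Q 1"] Icomm[of n 1] by auto
    define r where "r = (y - 1) / (Q 1 - 1)"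
    have r: "0 \<le> r" "r < 1" "1 + r * (Q 1 - 1) = y" using yb Q1 by (auto simp: r_def field_simps)
    have "\<lfloor>of_int n + r\<rfloor> = n" "frac (of_int n + r) = r" using r by (auto simp: frac_def floor_unique)
    then have "B (of_int n + r) = x" using y r by (simp add: B_def)
    then show "x \<in> range B" by blast
  qed
  ultimately show ?thesis by - (rule exI[of _ B], simp)
qed

text \<open>The squares preserve the positive half line and contract it. Both inverses are turned into
  the translation by \<open>1\<close>, and \<open>T\<close> compares the two parametrizations.\<close>

lemma contraction_square_conjugacy:
  fixes S S' :: "real \<Rightarrow> real"
  assumes S: "bij S" "\<forall>x y. x < y \<longrightarrow> S y < S x" and S': "bij S'" "\<forall>x y. x < y \<longrightarrow> S' y < S' x"
    and q: "0 < q" "q < 1" "\<And>x. \<bar>S x\<bar> \<le> q * \<bar>x\<bar>" "\<And>x. \<bar>S' x\<bar> \<le> q * \<bar>x\<bar>"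
  shows "\<exists>T. (\<forall>x>0. 0 < T x) \<and> (\<forall>x>0. \<forall>y>x. T x < T y) \<and> (\<forall>y>0. \<exists>x>0. T x = y) \<and>
    (\<forall>x>0. T (S (S x)) = S' (S' (T x)))"
proof -
  have ex: "\<exists>B :: real \<Rightarrow> real. strict_mono B \<and> range B = {0<..} \<and> (\<forall>t. B (t + 1) = inv (R \<circ> R) (B t))"
    if R: "bij R" "\<forall>x y. x < y \<longrightarrow> R y < R x" "\<And>x. \<bar>R x\<bar> \<le> q * \<bar>x\<bar>" for R :: "real \<Rightarrow> real"
  proof (rule expansion_conjugate_to_translation)
    have bj: "bij (R \<circ> R)" using R by (simp add: bij_comp)
    then show "bij (inv (R \<circ> R))" by (rule bij_imp_bij_inv)
    have sm: "strict_mono (R \<circ> R)" using R(2) by (auto intro!: strict_monoI)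
    then show "strict_mono (inv (R \<circ> R))" using bj by (intro strict_mono_inv_real)
    have R0: "R 0 = 0" using R(3)[of 0] by simp
    show "inv (R \<circ> R) 0 = 0" using bj R0 by (metis bij_is_inj comp_apply inv_f_f)
    show "1 < 1 / q\<^sup>2" using q by (simp add: power_less_one_iff)
    fix x :: real assume x: "0 < x"
    define y where "y = inv (R \<circ> R) x"
    have Ry: "R (R y) = x" unfolding y_def using bj by (metis bij_is_surj comp_apply surj_f_inv_f)
    have "0 < y" using strict_mono_less[OF sm, of 0 y] R0 Ry x by simp
    moreover have "\<bar>x\<bar> \<le> q * (q * \<bar>y\<bar>)" 
    proof -
      have "q * \<bar>R y\<bar> \<le> q * (q * \<bar>y\<bar>)" using R(3)[of y] q(1) by (intro mult_left_mono) auto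
      then show ?thesis using R(3)[of "R y"] Ry by simp
    qed
    ultimately show "1 / q\<^sup>2 * x \<le> inv (R \<circ> R) x"
      using x q by (simp add: y_def[symmetric] power2_eq_square field_simps)
  qed
  from ex[OF S q(3)] obtain B :: "real \<Rightarrow> real"
    where "strict_mono B \<and> range B = {0<..} \<and> (\<forall>t. B (t + 1) = inv (S \<circ> S) (B t))" ..
  then have B: "strict_mono B" "range B = {0<..}" "\<And>t. B (t + 1) = inv (S \<circ> S) (B t)" by simp_all
  from ex[OF S' q(4)] obtain B' :: "real \<Rightarrow> real"
    where "strict_mono B' \<and> range B' = {0<..} \<and> (\<forall>t. B' (t + 1) = inv (S' \<circ> S') (B' t))" ..
  then have B': "strict_mono B'" "range B' = {0<..}" "\<And>t. B' (t + 1) = inv (S' \<circ> S') (B' t)" by simp_all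
  have injB: "inj B" using strict_mono_imp_inj_on[OF B(1)] by simp
  define T where "T x = B' (inv B x)" for x
  have TB: "T (B t) = B' t" for t using injB by (simp add: T_def)
  have pos: "\<exists>t. x = B t" if "0 < x" for x using B(2) that by (metis greaterThan_iff imageE)
  have shift: "S (S (B t)) = B (t - 1)" for t
  proof -
    have "bij (S \<circ> S)" using S by (simp add: bij_comp)
    then have "(S \<circ> S) (B t) = B (t - 1)" using B(3)[of "t - 1"] by (metis bij_is_surj diff_add_cancel surj_f_inv_f)
    then show ?thesis by simp
  qed
  have shift': "S' (S' (B' t)) = B' (t - 1)" for t
  proof -
    have "bij (S' \<circ> S')" using S' by (simp add: bij_comp)
    then have "(S' \<circ> S') (B' t) = B' (t - 1)" using B'(3)[of "t - 1"] by (metis bij_is_surj diff_add_cancel surj_f_inv_f)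
    then show ?thesis by simp
  qed
  show ?thesis
  proof (intro exI[of _ T] conjI allI impI)
    show "0 < T x" if x0: "0 < x" for x 
    proof -
      obtain t where "x = B t" using pos[OF x0] by blast
      then show ?thesis using TB[of t] B'(2) rangeI[of B' t] by simp
    qed
    show "T x < T y" if "0 < x" "x < y" for x y
    proof -
      obtain t u where "x = B t" "y = B u" using pos[of x] pos[of y] \<open>0 < x\<close> \<open>x < y\<close> by auto
      then show ?thesis using \<open>x < y\<close> B(1) B'(1) by (simp add: TB strict_mono_less)
    qed
    show "\<exists>x>0. T x = y" if "0 < y" for y
    proof -
      have "y \<in> range B'" using B'(2) that by simp
      then obtain t where "y = B' t" by blast
      moreover have "0 < B t" using B(2) rangeI[of B t] by simp
      ultimately show ?thesis using TB by blast
    qed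
    show "T (S (S x)) = S' (S' (T x))" if "0 < x" for x
      using pos[OF that] by (auto simp: TB shift shift')
  qed
qed

text \<open>Two contractions that reverse the orientation have conjugate squares on the positive half
  line. As they exchange the half lines, the conjugacy \<open>T\<close> of the squares determines the one on the
  negative half line, namely \<open>S' \<circ> T \<circ> S\<^sup>-\<^sup>1\<close>.\<close>

lemma reversing_contractions_conjugate:
  fixes S S' :: "real \<Rightarrow> real"
  assumes S: "bij S" "\<forall>x y. x < y \<longrightarrow> S y < S x" and S': "bij S'" "\<forall>x y. x < y \<longrightarrow> S' y < S' x"
    and q: "0 < q" "q < 1" "\<And>x. \<bar>S x\<bar> \<le> q * \<bar>x\<bar>" "\<And>x. \<bar>S' x\<bar> \<le> q * \<bar>x\<bar>"
  shows "\<exists>\<theta>. bij \<theta> \<and> strict_mono \<theta> \<and> \<theta> 0 = 0 \<and> (\<forall>x. \<theta> (S x) = S' (\<theta> x))"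
proof -
  obtain T where T: "\<And>x. 0 < x \<Longrightarrow> 0 < T x" "\<And>x y. 0 < x \<Longrightarrow> x < y \<Longrightarrow> T x < T y"
      "\<And>y. 0 < y \<Longrightarrow> \<exists>x>0. T x = y" "\<And>x. 0 < x \<Longrightarrow> T (S (S x)) = S' (S' (T x))"
    using contraction_square_conjugacy[OF S S' q] by blast
  have S0: "S 0 = 0" "S' 0 = 0" using q(3)[of 0] q(4)[of 0] by auto
  define iS where "iS = inv S"
  have iS: "S (iS x) = x" "iS (S x) = x" for x
    using S(1) unfolding iS_def by (simp_all add: bij_is_surj surj_f_inv_f bij_is_inj inv_f_f)
  have iSpos: "0 < iS x" if "x < 0" for x
    using S(2)[rule_format, of "iS x" 0] S0 iS(1)[of x] that by (metis linorder_neqE_linordered_idom order.asym)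
  have iSm: "iS y < iS x" if "x < y" for x y using S(2) iS that by (metis linorder_neqE_linordered_idom order.asym less_irrefl)
  define \<theta> where "\<theta> x = (if 0 < x then T x else if x = 0 then 0 else S' (T (iS x)))" for x
  have neg: "\<theta> x < 0" if "x < 0" for x
    using T(1)[OF iSpos[OF that]] S'(2)[rule_format, of 0 "T (iS x)"] S0 that by (simp add: \<theta>_def)
  have mono: "strict_mono \<theta>"
  proof (rule strict_monoI)
    fix x y :: real assume xy: "x < y"
    consider "0 < x" | "x = 0" | "x < 0" "y < 0" | "x < 0" "0 \<le> y" by linarith
    then show "\<theta> x < \<theta> y"
    proof cases
      case 3
      then show ?thesis using S'(2)[rule_format, OF T(2)[OF iSpos iSm]] xy by (simp add: \<theta>_def)
    next
      case 4
      then show ?thesis using neg[of x] T(1)[of y] by (cases "y = 0") (auto simp: \<theta>_def)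
    qed (use T(1)[of y] T(2)[of x y] xy in \<open>auto simp: \<theta>_def\<close>)
  qed
  have conj: "\<theta> (S x) = S' (\<theta> x)" for x
  proof -
    consider "0 < x" | "x = 0" | "x < 0" by linarith
    then show ?thesis
    proof cases
      case 1
      then have "S x < 0" using S(2)[rule_format, of 0 x] S0 by simp
      then show ?thesis using 1 by (simp add: \<theta>_def iS)
    next
      case 2
      then show ?thesis using S0 by (simp add: \<theta>_def)
    next
      case 3
      then have "0 < S x" using S(2)[rule_format, of x 0] S0 by simp
      moreover have "T (S (S (iS x))) = S' (S' (T (iS x)))" by (rule T(4)[OF iSpos[OF 3]])
      ultimately show ?thesis using 3 by (simp add: \<theta>_def iS)
    qed
  qed
  have "surj \<theta>"
  proof -
    have "\<exists>x. \<theta> x = y" for y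
    proof -
      consider "0 < y" | "y = 0" | "y < 0" by linarith
      then show ?thesis
      proof cases
        case 1
        then obtain x where "0 < x" "T x = y" using T(3) by blast
        then have "\<theta> x = y" by (simp add: \<theta>_def)
        then show ?thesis ..
      next
        case 2
        then have "\<theta> 0 = y" by (simp add: \<theta>_def)
        then show ?thesis ..
      next
        case 3
        obtain z where z: "S' z = y" using S'(1) by (metis bij_pointE)
        have "0 < z" using S'(2)[rule_format, of z 0] S0 z 3 by (metis linorder_neqE_linordered_idom order.asym)
        then obtain x where "0 < x" "T x = z" using T(3) by blast
        then have "\<theta> (S x) = y" using conj[of x] z by (simp add: \<theta>_def)
        then show ?thesis ..
      qed
    qed
    then show ?thesis by (metis surjI)
  qed
  then have "bij \<theta>" using mono by (simp add: bij_def strict_mono_imp_inj_on)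
  moreover have "\<theta> 0 = 0" by (simp add: \<theta>_def)
  ultimately show ?thesis using mono conj by - (rule exI[of _ \<theta>], simp)
qed

text \<open>\<open>True\<close> stands for \<open>X\<close> and the quadrants \<open>x\<^sub>1 x\<^sub>2 > 0\<close>, \<open>False\<close> for \<open>Y\<close> and the
  quadrants \<open>x\<^sub>1 x\<^sub>2 < 0\<close>. In particular the leaves of slope sign \<open>\<epsilon> b\<close> connect the two axes inside
  the quadrants of \<open>b\<close> iff \<open>\<epsilon> b = - region_sign b\<close>; otherwise one of them ends at the corner.\<close>

definition region_sign :: "bool \<Rightarrow> real" where "region_sign b = (if b then 1 else -1)"

text \<open>Two pairs of foliations, one for each of two piecewise smooth fields, with equal signs of the
  slopes. \<open>separated\<close>: the same one of the two foliations is steeper in both cases.\<close>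

locale leaf_flow_pair =
  fixes f f' :: "bool \<Rightarrow> real \<Rightarrow> real \<Rightarrow> real" and L m M L' m' M' \<epsilon> :: "bool \<Rightarrow> real"
  assumes flow: "leaf_flow (f b) (L b) (m b) (M b) (\<epsilon> b)"
    and flow': "leaf_flow (f' b) (L' b) (m' b) (M' b) (\<epsilon> b)"
    and separated: "M True < m False \<and> M' True < m' False \<or> M False < m True \<and> M' False < m' True"
begin

interpretation fl: leaf_flow "f b" "L b" "m b" "M b" "\<epsilon> b" for b by (rule flow)
interpretation fl': leaf_flow "f' b" "L' b" "m' b" "M' b" "\<epsilon> b" for b by (rule flow')

abbreviation H where "H b \<equiv> leaf_flow.H (f b)"
abbreviation H' where "H' b \<equiv> leaf_flow.H (f' b)"
abbreviation G' where "G' b \<equiv> leaf_flow.G (f' b)"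
abbreviation \<kappa> where "\<kappa> b \<equiv> leaf_flow.\<kappa> (f b)"
abbreviation \<kappa>' where "\<kappa>' b \<equiv> leaf_flow.\<kappa> (f' b)"

lemma \<kappa>_less: "\<kappa> b s < \<kappa> b t \<longleftrightarrow> (if \<epsilon> b = 1 then t < s else s < t)"
  using fl.\<kappa>_mono[of s t b] fl.\<kappa>_mono[of t s b] fl.eps[of b]
  by (cases s t rule: linorder_cases) auto

lemma \<kappa>'_less: "\<kappa>' b s < \<kappa>' b t \<longleftrightarrow> (if \<epsilon> b = 1 then t < s else s < t)"
  using fl'.\<kappa>_mono[of s t b] fl'.\<kappa>_mono[of t s b] fl.eps[of b]
  by (cases s t rule: linorder_cases) auto

lemma inv_\<kappa> [simp]: "inv (\<kappa> b) (\<kappa> b s) = s" "\<kappa> b (inv (\<kappa> b) x) = x"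
  using fl.\<kappa>_inj fl.\<kappa>_surj by (simp_all add: surj_f_inv_f)

lemma inv_\<kappa>' [simp]: "inv (\<kappa>' b) (\<kappa>' b s) = s" "\<kappa>' b (inv (\<kappa>' b) x) = x"
  using fl'.\<kappa>_inj fl'.\<kappa>_surj by (simp_all add: surj_f_inv_f)

lemma inv_\<kappa>_less: "inv (\<kappa> b) x < inv (\<kappa> b) y \<longleftrightarrow> (if \<epsilon> b = 1 then y < x else x < y)"
  using \<kappa>_less[of b "inv (\<kappa> b) x" "inv (\<kappa> b) y"] \<kappa>_less[of b "inv (\<kappa> b) y" "inv (\<kappa> b) x"] by auto

lemma inv_\<kappa>'_less: "inv (\<kappa>' b) x < inv (\<kappa>' b) y \<longleftrightarrow> (if \<epsilon> b = 1 then y < x else x < y)"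
  using \<kappa>'_less[of b "inv (\<kappa>' b) x" "inv (\<kappa>' b) y"] \<kappa>'_less[of b "inv (\<kappa>' b) y" "inv (\<kappa>' b) x"] by auto

lemma axis_maps_corner:
  shows "\<exists>\<theta> \<rho>. bij \<theta> \<and> strict_mono \<theta> \<and> \<theta> 0 = 0 \<and> bij \<rho> \<and> strict_mono \<rho> \<and> \<rho> 0 = 0 \<and>
    (\<forall>s. \<kappa>' b (\<rho> s) = \<theta> (\<kappa> b s))"
proof (rule exI[of _ "\<lambda>x. \<kappa>' b (inv (\<kappa> b) x)"], rule exI[of _ "\<lambda>s. s"], intro conjI allI)
  show "bij (\<lambda>x. \<kappa>' b (inv (\<kappa> b) x))"
    using bij_comp[OF bij_imp_bij_inv[OF fl.\<kappa>_bij] fl'.\<kappa>_bij] by (simp add: comp_def)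
  show "strict_mono (\<lambda>x. \<kappa>' b (inv (\<kappa> b) x))"
    by (rule strict_monoI) (auto simp: \<kappa>'_less inv_\<kappa>_less)
  show "\<kappa>' b (inv (\<kappa> b) 0) = 0" using inv_\<kappa>(1)[of b 0] by simp
qed (auto intro: strict_monoI bijI' )

text \<open>\<open>S\<close> goes from one axis to the other along the leaves of one region and back along those of the
  other region. It reverses the orientation as the slopes have different signs, and contracts by the
  quotient of the slopes. Any conjugacy \<open>\<theta>\<close> from \<open>S\<close> to \<open>S'\<close> serves; \<open>\<rho>\<close> is transported along the leaves
  of one region, and the conjugacy says that transport along the other ones gives the same.\<close>

lemma axis_maps_cycle:
  assumes e: "\<epsilon> c \<noteq> \<epsilon> (\<not> c)" and sep: "M c < m (\<not> c)" "M' c < m' (\<not> c)"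
  shows "\<exists>\<theta> \<rho>. bij \<theta> \<and> strict_mono \<theta> \<and> \<theta> 0 = 0 \<and> bij \<rho> \<and> strict_mono \<rho> \<and> \<rho> 0 = 0 \<and>
    (\<forall>b s. \<kappa>' b (\<rho> s) = \<theta> (\<kappa> b s))"
proof -
  let ?d = "\<not> c"
  define S where "S x = \<kappa> c (inv (\<kappa> ?d) x)" for x
  define S' where "S' x = \<kappa>' c (inv (\<kappa>' ?d) x)" for x
  have eps: "\<epsilon> b = 1 \<or> \<epsilon> b = -1" for b by (rule fl.eps)
  define q where "q = max (M c / m ?d) (M' c / m' ?d)"
  have mpos: "0 < m b" "0 < m' b" for b using fl.m fl'.m by auto
  have Mpos: "0 < M b" "0 < M' b" for b
    using fl.flo[of b 0 0] fl.fhi[of b 0 0] fl'.flo[of b 0 0] fl'.fhi[of b 0 0] mpos[of b] by linarith+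
  have q: "0 < q" "q < 1" using sep mpos Mpos by (auto simp: q_def less_max_iff_disj)
  have "\<exists>\<theta>. bij \<theta> \<and> strict_mono \<theta> \<and> \<theta> 0 = 0 \<and> (\<forall>x. \<theta> (S x) = S' (\<theta> x))"
  proof (rule reversing_contractions_conjugate[OF _ _ _ _ q])
    show "bij S" "bij S'"
      using bij_comp[OF bij_imp_bij_inv[OF fl.\<kappa>_bij] fl.\<kappa>_bij, of c ?d]
       bij_comp[OF bij_imp_bij_inv[OF fl'.\<kappa>_bij] fl'.\<kappa>_bij, of c ?d]
      by (simp_all add: comp_def S_def[abs_def] S'_def[abs_def])
    show "\<forall>x y. x < y \<longrightarrow> S y < S x" "\<forall>x y. x < y \<longrightarrow> S' y < S' x"
      using e eps[of c] eps[of ?d] by (auto simp: S_def S'_def \<kappa>_less \<kappa>'_less inv_\<kappa>_less inv_\<kappa>'_less)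
    show "\<bar>S x\<bar> \<le> q * \<bar>x\<bar>" for x
    proof -
      have "\<bar>S x\<bar> \<le> M c * \<bar>inv (\<kappa> ?d) x\<bar>" unfolding S_def by (rule fl.\<kappa>_bounds)
      also have "\<dots> \<le> M c * (\<bar>x\<bar> / m ?d)"
        using fl.\<kappa>_bounds(1)[of ?d "inv (\<kappa> ?d) x"] Mpos[of c] mpos[of ?d] by (intro mult_left_mono) (auto simp: field_simps)
      also have "\<dots> = (M c / m ?d) * \<bar>x\<bar>" by simp
      also have "\<dots> \<le> q * \<bar>x\<bar>" by (intro mult_right_mono) (auto simp: q_def)
      finally show ?thesis .
    qed
    show "\<bar>S' x\<bar> \<le> q * \<bar>x\<bar>" for x
    proof -
      have "\<bar>S' x\<bar> \<le> M' c * \<bar>inv (\<kappa>' ?d) x\<bar>" unfolding S'_def by (rule fl'.\<kappa>_bounds)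
      also have "\<dots> \<le> M' c * (\<bar>x\<bar> / m' ?d)"
        using fl'.\<kappa>_bounds(1)[of ?d "inv (\<kappa>' ?d) x"] Mpos[of c] mpos[of ?d] by (intro mult_left_mono) (auto simp: field_simps)
      also have "\<dots> = (M' c / m' ?d) * \<bar>x\<bar>" by simp
      also have "\<dots> \<le> q * \<bar>x\<bar>" by (intro mult_right_mono) (auto simp: q_def)
      finally show ?thesis .
    qed
  qed
  then obtain \<theta> where \<theta>: "bij \<theta>" "strict_mono \<theta>" "\<theta> 0 = 0" "\<And>x. \<theta> (S x) = S' (\<theta> x)" by blast
  define \<rho> where "\<rho> s = inv (\<kappa>' c) (\<theta> (\<kappa> c s))" for s
  have c: "\<kappa>' c (\<rho> s) = \<theta> (\<kappa> c s)" for s by (simp add: \<rho>_def)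
  have d: "\<kappa>' ?d (\<rho> s) = \<theta> (\<kappa> ?d s)" for s
  proof -
    have "\<theta> (\<kappa> c s) = \<kappa>' c (inv (\<kappa>' ?d) (\<theta> (\<kappa> ?d s)))" using \<theta>(4)[of "\<kappa> ?d s"] by (simp add: S_def S'_def)
    then show ?thesis by (simp add: \<rho>_def)
  qed
  have all: "\<kappa>' b (\<rho> s) = \<theta> (\<kappa> b s)" for b s using c d by (cases "b = c") auto
  have "bij \<rho>"
    using bij_comp[OF bij_comp[OF fl.\<kappa>_bij[of c] \<theta>(1)] bij_imp_bij_inv[OF fl'.\<kappa>_bij[of c]]]
    by (simp add: comp_def \<rho>_def[abs_def])
  moreover have "strict_mono \<rho>"
    by (rule strict_monoI) (use \<theta>(2) in \<open>auto simp: \<rho>_def inv_\<kappa>'_less \<kappa>_less strict_mono_less\<close>)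
  moreover have "\<rho> 0 = 0" using inv_\<kappa>'(1)[of c 0] \<theta>(3) by (simp add: \<rho>_def)
  ultimately show ?thesis using \<theta> all by - (rule exI[of _ \<theta>], rule exI[of _ \<rho>], simp)
qed

text \<open>\<open>\<theta>\<close> and \<open>\<rho>\<close> prescribe the homeomorphism on the two axes. In the quadrants whose leaves
  connect the two axes they determine each other. If this concerns the quadrants of one region at
  most, one of the maps may be the identity. If it concerns all four quadrants, the
  constraints close up to a cycle: going around the origin along the leaves gives a return map,
  which has to be conjugated. Here the separation of the slopes enters; it makes the return map
  contract in one of the two directions.\<close>

lemma axis_maps_exist:
  shows "\<exists>\<theta> \<rho>. bij \<theta> \<and> strict_mono \<theta> \<and> \<theta> 0 = 0 \<and> bij \<rho> \<and> strict_mono \<rho> \<and> \<rho> 0 = 0 \<and>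
    (\<forall>b s. \<epsilon> b = - region_sign b \<longrightarrow> \<kappa>' b (\<rho> s) = \<theta> (\<kappa> b s))"
proof (cases "\<epsilon> True = -1 \<and> \<epsilon> False = 1")
  case True
  then obtain c where "M c < m (\<not> c)" "M' c < m' (\<not> c)" "\<epsilon> c \<noteq> \<epsilon> (\<not> c)"
    using separated by (metis (full_types) neg_equal_zero zero_neq_one)
  then show ?thesis using axis_maps_cycle[of c] by blast
next
  case False
  then obtain c where "\<epsilon> (\<not> c) \<noteq> - region_sign (\<not> c)"
    using fl.eps by (metis (full_types) region_sign_def minus_minus)
  moreover obtain \<theta> \<rho> where "bij \<theta>" "strict_mono \<theta>" "\<theta> 0 = 0" "bij \<rho>" "strict_mono \<rho>" "\<rho> 0 = 0"
    "\<forall>s. \<kappa>' c (\<rho> s) = \<theta> (\<kappa> c s)" using axis_maps_corner[of c] by blast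
  ultimately have "\<kappa>' b (\<rho> s) = \<theta> (\<kappa> b s)" if "\<epsilon> b = - region_sign b" for b s
    using that by (cases "b = c") (auto simp: neq_commute[of b c])
  then show ?thesis
    using \<open>bij \<theta>\<close> \<open>strict_mono \<theta>\<close> \<open>\<theta> 0 = 0\<close> \<open>bij \<rho>\<close> \<open>strict_mono \<rho>\<close> \<open>\<rho> 0 = 0\<close>
    by - (rule exI[of _ \<theta>], rule exI[of _ \<rho>], simp)
qed

end

text \<open>Maps of the two axes that respect the leaves joining them are extended to the quadrants.\<close>

locale leaf_conjugacy = leaf_flow_pair +
  fixes \<theta> \<rho> :: "real \<Rightarrow> real"
  assumes bij_\<theta>: "bij \<theta>" and mono_\<theta>: "strict_mono \<theta>" and \<theta>_0 [simp]: "\<theta> 0 = 0"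
    and bij_\<rho>: "bij \<rho>" and mono_\<rho>: "strict_mono \<rho>" and \<rho>_0 [simp]: "\<rho> 0 = 0"
    and transition: "\<epsilon> b = - region_sign b \<Longrightarrow> \<kappa>' b (\<rho> s) = \<theta> (\<kappa> b s)"
begin

interpretation fl: leaf_flow "f b" "L b" "m b" "M b" "\<epsilon> b" for b by (rule flow)
interpretation fl': leaf_flow "f' b" "L' b" "m' b" "M' b" "\<epsilon> b" for b by (rule flow')

text \<open>How labels of leaves are mapped in the quadrant of region \<open>b\<close> on the side \<open>\<sigma>\<close> of the
  axis \<open>x = 0\<close>. A leaf whose label \<open>x\<close> lies on this side ends at the point \<open>(x, 0)\<close> of the
  quadrant's boundary, which is mapped by \<open>\<theta>\<close>; any other leaf ends at a point \<open>(0, s)\<close>, which is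
  mapped by \<open>\<rho>\<close>.\<close>

definition label_map :: "bool \<Rightarrow> real \<Rightarrow> real \<Rightarrow> real"
  where "label_map b \<sigma> x = (if 0 \<le> \<sigma> * x then \<theta> x else \<kappa>' b (\<rho> (inv (\<kappa> b) x)))"

text \<open>The point over \<open>\<rho> s\<close> on the image of the leaf through \<open>(x, s)\<close>. The formula makes sense on the whole
  plane; only its values in one quadrant are used.\<close>

definition quadrant_map :: "bool \<Rightarrow> real \<Rightarrow> real \<Rightarrow> real \<Rightarrow> real"
  where "quadrant_map b \<sigma> x s = G' b (label_map b \<sigma> (H b x s)) (\<rho> s)"

lemma axis_label_map: "\<kappa>' b (\<rho> (inv (\<kappa> b) x)) < \<kappa>' b (\<rho> (inv (\<kappa> b) y)) \<longleftrightarrow> x < y"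
  using mono_\<rho> by (simp add: \<kappa>'_less inv_\<kappa>_less strict_mono_less)

lemma axis_label_map_0: "\<kappa>' b (\<rho> (inv (\<kappa> b) 0)) = 0"
  using inv_\<kappa>(1)[of b 0] by simp

lemma label_map_0 [simp]: "label_map b \<sigma> 0 = 0"
  by (simp add: label_map_def)

lemma label_map_less: assumes "x < y" shows "label_map b \<sigma> x < label_map b \<sigma> y"
proof -
  have 1: "\<theta> x < \<theta> y" using mono_\<theta> assms by (simp add: strict_mono_less)
  have 2: "\<kappa>' b (\<rho> (inv (\<kappa> b) x)) < \<kappa>' b (\<rho> (inv (\<kappa> b) y))" using axis_label_map assms by simp
  have 3: "x \<le> 0 \<Longrightarrow> \<theta> x \<le> 0" "0 \<le> x \<Longrightarrow> 0 \<le> \<theta> x" "x < 0 \<Longrightarrow> \<theta> x < 0" "0 < x \<Longrightarrow> 0 < \<theta> x" for x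
    using strict_mono_less[OF mono_\<theta>, of x 0] strict_mono_less[OF mono_\<theta>, of 0 x] by (auto simp: not_less[symmetric])
  have 4: "x < 0 \<Longrightarrow> \<kappa>' b (\<rho> (inv (\<kappa> b) x)) < 0" "0 < x \<Longrightarrow> 0 < \<kappa>' b (\<rho> (inv (\<kappa> b) x))" for x
    using axis_label_map[of b x 0] axis_label_map[of b 0 x] by (simp_all add: axis_label_map_0)
  show ?thesis
    unfolding label_map_def
    using 1 2 3[of x] 3[of y] 4[of x] 4[of y] assms
    by (auto simp: zero_le_mult_iff split: if_splits)
qed

lemma label_map_eq_iff: "label_map b \<sigma> x = label_map b \<sigma> y \<longleftrightarrow> x = y"
  using label_map_less[of x y] label_map_less[of y x] by (metis linorder_neqE_linordered_idom less_irrefl)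

lemma label_map_continuous: assumes "\<sigma> \<noteq> 0" shows "continuous_on UNIV (label_map b \<sigma>)"
proof -
  have t: "continuous_on A \<theta>" for A using bij_\<theta> mono_\<theta> by (intro strict_mono_surj_continuous) (auto simp: bij_def)
  have "bij (\<lambda>x. \<kappa>' b (\<rho> (inv (\<kappa> b) x)))"
    using bij_comp[OF bij_comp[OF bij_imp_bij_inv[OF fl.\<kappa>_bij[of b]] bij_\<rho>] fl'.\<kappa>_bij[of b]] by (simp add: comp_def)
  then have p: "continuous_on A (\<lambda>x. \<kappa>' b (\<rho> (inv (\<kappa> b) x)))" for A
    by (intro strict_mono_surj_continuous) (auto simp: bij_def axis_label_map intro: strict_monoI)
  have "continuous_on ({x. 0 \<le> \<sigma> * x} \<union> {x. \<sigma> * x \<le> 0}) (\<lambda>x. if 0 \<le> \<sigma> * x then \<theta> x else \<kappa>' b (\<rho> (inv (\<kappa> b) x)))"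
  proof (rule continuous_on_If)
    show "closed {x. 0 \<le> \<sigma> * x}" "closed {x. \<sigma> * x \<le> 0}" by (intro closed_Collect_le continuous_intros)+
    fix x assume "x \<in> {x. \<sigma> * x \<le> 0}" "0 \<le> \<sigma> * x"
    then have "x = 0" using assms by (simp add: antisym)
    then show "\<theta> x = \<kappa>' b (\<rho> (inv (\<kappa> b) x))" by (simp add: axis_label_map_0)
  qed (use t p in auto)
  moreover have "{x. 0 \<le> \<sigma> * x} \<union> {x. \<sigma> * x \<le> 0} = UNIV" by auto
  ultimately show ?thesis by (simp add: label_map_def[abs_def])
qed

lemma quadrant_map_continuous:
  assumes "\<sigma> \<noteq> 0" shows "continuous_on UNIV (\<lambda>p. quadrant_map b \<sigma> (fst p) (snd p))"
proof -
  have r: "continuous_on A \<rho>" for A using bij_\<rho> mono_\<rho> by (intro strict_mono_surj_continuous) (auto simp: bij_def)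
  have "continuous_on UNIV (\<lambda>p. (\<lambda>q. G' b (fst q) (snd q)) (label_map b \<sigma> (H b (fst p) (snd p)), \<rho> (snd p)))"
    by (rule continuous_on_compose2[OF fl'.G_continuous])
     (auto intro!: continuous_intros continuous_on_compose2[OF label_map_continuous[OF assms]]
       continuous_on_compose2[OF fl.H_continuous[of b]] continuous_on_compose2[OF r])
  then show ?thesis by (simp add: quadrant_map_def)
qed

lemma quadrant_map_less: "x < x' \<Longrightarrow> quadrant_map b \<sigma> x s < quadrant_map b \<sigma> x' s"
  by (simp add: quadrant_map_def fl'.G_less_iff label_map_less fl.H_less_iff)

lemma quadrant_map_s0: "0 \<le> \<sigma> * x \<Longrightarrow> quadrant_map b \<sigma> x 0 = \<theta> x"
  by (simp add: quadrant_map_def label_map_def)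

text \<open>On the side of the axis where the quadrant lies: the leaf through \<open>(0, s)\<close> either has its
  other end on this quadrant's part of the second axis, and then the transition condition applies, or
  its label is mapped by \<open>\<rho>\<close> in the first place.\<close>

lemma quadrant_map_x0:
  assumes \<sigma>: "\<sigma> = 1 \<or> \<sigma> = -1" and q: "0 \<le> region_sign b * (\<sigma> * s)"
  shows "quadrant_map b \<sigma> 0 s = 0"
proof -
  have "label_map b \<sigma> (\<kappa> b s) = \<kappa>' b (\<rho> s)"
  proof (cases "s = 0 \<or> \<sigma> * \<kappa> b s < 0")
    case True
    then show ?thesis by (auto simp: label_map_def)
  next
    case False
    then have nz: "s \<noteq> 0" "0 \<le> \<sigma> * \<kappa> b s" by auto
    have "\<epsilon> b * \<kappa> b s * s < 0" using fl.\<kappa>_bounds(3) nz by blast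
    then have "\<epsilon> b = - region_sign b"
      using fl.eps[of b] \<sigma> q nz
      by (auto simp: region_sign_def mult_less_0_iff zero_le_mult_iff zero_less_mult_iff split: if_splits)
    then show ?thesis using transition nz by (simp add: label_map_def)
  qed
  then have "label_map b \<sigma> (H b 0 s) = leaf_flow.H (f' b) 0 (\<rho> s)"
    by (simp add: fl.\<kappa>_def fl'.\<kappa>_def)
  then show ?thesis by (simp add: quadrant_map_def fl'.G_H)
qed

lemma quadrant_map_label: "H' b (quadrant_map b \<sigma> x s) (\<rho> s) = label_map b \<sigma> (H b x s)"
  by (simp add: quadrant_map_def fl'.H_G)

text \<open>On an axis the adjacent quadrants give the same value, so the choice between \<open>\<le>\<close> and \<open><\<close> is immaterial.\<close>

definition glued_map :: "real \<Rightarrow> real \<Rightarrow> real"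
  where "glued_map x s = quadrant_map ((0 \<le> x) = (0 \<le> s)) (if 0 \<le> x then 1 else -1) x s"

lemma glued_map_x0 [simp]: "glued_map 0 s = 0"
  by (simp add: glued_map_def quadrant_map_x0 region_sign_def)

lemma glued_map_less: assumes "x < x'" shows "glued_map x s < glued_map x' s"
proof -
  have neg: "quadrant_map b (-1) x s < 0" if "x < 0" "b \<longleftrightarrow> \<not> 0 \<le> s" for x b
    using quadrant_map_less[OF that(1), of b "-1" s] quadrant_map_x0[of "-1" b s] that(2) by (simp add: region_sign_def)
  have pos: "0 \<le> quadrant_map b 1 x s" if "0 \<le> x" "b \<longleftrightarrow> 0 \<le> s" for x b
    using quadrant_map_less[of 0 x b 1 s] quadrant_map_x0[of 1 b s] that by (cases "x = 0") (auto simp: region_sign_def)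
  show ?thesis
    using assms neg[of x] pos[of x'] quadrant_map_less[OF assms]
    unfolding glued_map_def by (cases "0 \<le> x"; cases "0 \<le> x'") (auto intro: less_le_trans)
qed

lemma glued_map_continuous: "continuous_on UNIV (\<lambda>p. glued_map (fst p) (snd p))"
proof -
  let ?q = "\<lambda>b \<sigma> p. quadrant_map b \<sigma> (fst p) (snd p)"
  let ?Q = "\<lambda>a b. {p :: real \<times> real. 0 \<le> a * fst p \<and> 0 \<le> b * snd p}"
  have q: "continuous_on A (?q b \<sigma>)" if "\<sigma> \<noteq> 0" for A b \<sigma>
    using quadrant_map_continuous[OF that] continuous_on_subset subset_UNIV by blast
  have cl: "closed (?Q a b)" for a b
    by (intro closed_Collect_conj closed_Collect_le continuous_intros)
  have half: "continuous_on (?Q a 1 \<union> ?Q a (-1)) (\<lambda>p. if 0 \<le> snd p then ?q c a p else ?q d a p)"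
    if a: "a = 1 \<or> a = -1" for a c d
  proof (rule continuous_on_If[OF cl cl q q])
    fix p :: "real \<times> real" assume "p \<in> ?Q a (-1)" "0 \<le> snd p"
    then have "snd p = 0" "0 \<le> a * fst p" by auto
    then show "?q c a p = ?q d a p" by (simp add: quadrant_map_s0)
  qed (use a in auto)
  have "continuous_on ((?Q 1 1 \<union> ?Q 1 (-1)) \<union> (?Q (-1) 1 \<union> ?Q (-1) (-1)))
     (\<lambda>p. if 0 \<le> fst p then (if 0 \<le> snd p then ?q True 1 p else ?q False 1 p)
       else (if 0 \<le> snd p then ?q False (-1) p else ?q True (-1) p))"
  proof (rule continuous_on_If[OF closed_Un[OF cl cl] closed_Un[OF cl cl] half half])
    fix p :: "real \<times> real" assume "p \<in> ?Q (-1) 1 \<union> ?Q (-1) (-1)" "0 \<le> fst p"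
    then have "fst p = 0" by auto
    then show "(if 0 \<le> snd p then ?q True 1 p else ?q False 1 p) = (if 0 \<le> snd p then ?q False (-1) p else ?q True (-1) p)"
      by (auto simp: quadrant_map_x0 region_sign_def)
  qed auto
  moreover have "(?Q 1 1 \<union> ?Q 1 (-1)) \<union> (?Q (-1) 1 \<union> ?Q (-1) (-1)) = UNIV" by auto
  moreover have "(\<lambda>p. if 0 \<le> fst p then (if 0 \<le> snd p then ?q True 1 p else ?q False 1 p)
       else (if 0 \<le> snd p then ?q False (-1) p else ?q True (-1) p)) = (\<lambda>p. glued_map (fst p) (snd p))"
    by (rule ext) (auto simp: glued_map_def)
  ultimately show ?thesis by (simp only:)
qed

lemma glued_map_label:
  assumes "0 < region_sign b * (x * s)"
  shows "H' b (glued_map x s) (\<rho> s) = label_map b (sgn x) (H b x s)"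
proof -
  have "((0 \<le> x) = (0 \<le> s)) = b" "(if 0 \<le> x then 1 else -1) = sgn x"
    using assms by (auto simp: region_sign_def zero_less_mult_iff mult_less_0_iff sgn_if split: if_splits)
  then show ?thesis by (simp add: glued_map_def quadrant_map_label)
qed

end

text \<open>A conjugacy of the two pairs of foliations: a homeomorphism of the plane in triangular
  form, increasing in both coordinates, that preserves the axes and maps leaves of \<open>f b\<close> to leaves
  of \<open>f' b\<close> in each quadrant.\<close>

lemma (in leaf_flow_pair) foliations_conjugate:
  obtains \<eta> :: "real \<Rightarrow> real \<Rightarrow> real" and \<rho> :: "real \<Rightarrow> real" where
    "continuous_on UNIV (\<lambda>p. \<eta> (fst p) (snd p))" and "\<And>x x' s. x < x' \<Longrightarrow> \<eta> x s < \<eta> x' s"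
    and "\<And>s. \<eta> 0 s = 0"
    and "continuous_on UNIV \<rho>" and "strict_mono \<rho>" and "\<rho> 0 = 0"
    and "\<And>b x s x' s'. 0 < region_sign b * (x * s) \<Longrightarrow> 0 < region_sign b * (x' * s') \<Longrightarrow> sgn x = sgn x' \<Longrightarrow>
        (H' b (\<eta> x s) (\<rho> s) = H' b (\<eta> x' s') (\<rho> s')) = (H b x s = H b x' s')"
    and "\<And>b x s. 0 < region_sign b * (x * s) \<Longrightarrow> (H' b (\<eta> x s) (\<rho> s) = 0) = (H b x s = 0)"
proof -
  obtain \<theta> \<rho> where *: "bij \<theta>" "strict_mono \<theta>" "\<theta> 0 = 0" "bij \<rho>" "strict_mono \<rho>" "\<rho> 0 = 0"
    "\<And>b s. \<epsilon> b = - region_sign b \<Longrightarrow> \<kappa>' b (\<rho> s) = \<theta> (\<kappa> b s)"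
    using axis_maps_exist by metis
  interpret leaf_conjugacy f f' L m M L' m' M' \<epsilon> \<theta> \<rho> by unfold_locales (use * in auto)
  show thesis
  proof (rule that[of glued_map \<rho>])
    show "continuous_on UNIV \<rho>" using bij_\<rho> mono_\<rho> by (intro strict_mono_surj_continuous) (auto simp: bij_def)
    show "(H' b (glued_map x s) (\<rho> s) = 0) = (H b x s = 0)" if "0 < region_sign b * (x * s)" for b x s
      using label_map_eq_iff[of b "sgn x" _ 0] by (simp add: glued_map_label that)
  qed (use glued_map_continuous glued_map_less mono_\<rho> in \<open>auto simp: glued_map_label label_map_eq_iff\<close>)
qed

section \<open>Fields with components of constant sign\<close>
lemma other_other [simp]: "other (other i) = i"
  using exhaust_2[of i] by (auto simp: other_def)

lemma other_neq [simp]: "other i \<noteq> i" "i \<noteq> other i"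
  using exhaust_2[of i] by (auto simp: other_def)

lemma eq_other_iff: "k \<noteq> j \<longleftrightarrow> k = other j"
  using exhaust_2[of j] exhaust_2[of k] by (auto simp: other_def)

lemma forall_other: "(\<forall>k. P k) \<longleftrightarrow> P j \<and> P (other j)"
  by (metis eq_other_iff)

lemma exists_other: "(\<exists>k. P k) \<longleftrightarrow> P j \<or> P (other j)"
  by (metis eq_other_iff)

lemma plane_eq_iff: "p = q \<longleftrightarrow> p $ j = q $ j \<and> p $ other j = q $ other j" for p q :: plane
  unfolding vec_eq_iff by (rule forall_other)

lemma prod_other: "p $ 1 * p $ 2 = p $ other j * p $ j" for p :: plane
  using exhaust_2[of j] by (auto simp: other_def)

text \<open>The point with \<open>j\<close>-th coordinate \<open>s\<close> and other coordinate \<open>x\<close>: leaves are graphs over the \<open>j\<close>-axis.\<close>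

definition mk :: "2 \<Rightarrow> real \<Rightarrow> real \<Rightarrow> plane"
  where "mk j x s = x *\<^sub>R axis (other j) 1 + s *\<^sub>R axis j 1"

lemma mk_nth [simp]: "mk j x s $ j = s" "mk j x s $ other j = x"
  by (simp_all add: mk_def axis_def)

lemma mk_nth' [simp]: "mk (other j) x s $ j = x"
  using mk_nth(2)[of "other j" x s] by simp

lemma mk_collapse [simp]: "mk j (p $ other j) (p $ j) = p"
  by (simp add: plane_eq_iff[of _ _ j])

definition fld :: "bool \<Rightarrow> pws_field \<Rightarrow> field" where "fld b Z = (if b then fst Z else snd Z)"

definition part :: "bool \<Rightarrow> plane set \<Rightarrow> plane set"
  where "part b V = {p\<in>V. 0 < region_sign b * (p $ 1 * p $ 2)}"

lemma pos_part_eq: "pos_part V = part True V" and neg_part_eq: "neg_part V = part False V"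
  by (auto simp: pos_part_def neg_part_def part_def region_sign_def)

lemma part_iff: "p \<in> part b V \<longleftrightarrow> p \<in> V \<and> 0 < region_sign b * (p $ other j * p $ j)"
  by (simp add: part_def prod_other[of p j])

lemma region_sign_cases: "region_sign b = 1 \<or> region_sign b = -1"
  by (simp add: region_sign_def)

lemma open_part: "open V \<Longrightarrow> open (part b V)"
  unfolding part_def
  by (rule open_Collect_conj[OF _ open_Collect_less, where P = "\<lambda>p. p \<in> V", simplified Collect_mem_eq])
    (auto intro!: continuous_intros)

lemma Sig_iff: "p \<in> Sig V \<longleftrightarrow> p \<in> V \<and> (\<exists>i. p $ i = 0)"
  unfolding exists_other[of _ 1] by (auto simp: Sig_def other_def)

lemma part_or_Sig: "p \<in> V \<Longrightarrow> p \<in> Sig V \<or> (\<exists>b. p \<in> part b V)"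
  using linorder_neqE_linordered_idom[of "p $ 1 * p $ 2" 0]
  by (auto simp: Sig_def part_def region_sign_def intro: exI[of _ True] exI[of _ False])

lemma part_not_Sig: "p \<in> part b V \<Longrightarrow> p \<notin> Sig V"
  by (auto simp: part_def Sig_def)

lemma part_nth_nz: "p \<in> part b V \<Longrightarrow> p $ k \<noteq> 0"
  using part_iff[of p b V k] by auto

lemma part_unique: "p \<in> part b V \<Longrightarrow> p \<in> part b' V' \<Longrightarrow> b = b'"
  by (cases b; cases b') (auto simp: part_def region_sign_def)

text \<open>The topological content of being a trajectory of \<open>Z\<close> in \<open>V\<close>, for a field whose components
  have constant signs: \<open>cr i\<close> says that \<open>\<Sigma>\<^sub>i\<close> is crossed (otherwise it slides or escapes), and
  \<open>lab b\<close> is constant on the integral curves of region \<open>b\<close>.\<close>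

definition follows ::
  "plane set \<Rightarrow> (2 \<Rightarrow> bool) \<Rightarrow> (bool \<Rightarrow> plane \<Rightarrow> real) \<Rightarrow> real set \<Rightarrow> (real \<Rightarrow> plane) \<Rightarrow> real \<Rightarrow> bool"
  where "follows V cr lab J \<beta> t \<longleftrightarrow>
    \<beta> t \<in> V \<and> continuous (at t within J) \<beta> \<and>
    (\<forall>b. \<beta> t \<in> part b V \<longrightarrow>
      (\<forall>\<^sub>F s in at t within J. \<beta> s \<in> part b V \<and> lab b (\<beta> s) = lab b (\<beta> t))) \<and>
    (\<forall>i. \<beta> t \<in> Sig_i V i - {0} \<longrightarrow>
      (if cr i then (\<forall>\<^sub>F s in at t within J. \<beta> s \<notin> Sig V)
       else (\<forall>\<^sub>F s in at t within J. \<beta> s \<in> Sig_i V i))) \<and>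
    (\<beta> t = 0 \<longrightarrow>
      (if \<forall>i. cr i then \<exists>b. \<forall>\<^sub>F s in at t within J. \<beta> s \<in> part b V \<and> lab b (\<beta> s) = 0
       else if \<exists>i. cr i then \<forall>i. \<not> cr i \<longrightarrow> (\<forall>\<^sub>F s in at t within J. \<beta> s \<in> Sig_i V i - {0})
       else \<forall>\<^sub>F s in at t within J. \<beta> s = 0))"

text \<open>The coordinate \<open>k\<close> moves in direction \<open>\<sigma>\<close> along \<open>\<beta>\<close>, as the vector field prescribes. It
  serves as a clock for \<open>\<beta>\<close>. If \<open>\<Sigma>\<^sub>j\<close> is crossed, then \<open>k = j\<close> is a clock for all curves, including those
  that slide along the other axis. If both axes slide, a curve cannot leave the quadrant or
  half axis where it starts, and only a curve along \<open>\<Sigma>\<^sub>j\<close> needs the other coordinate.\<close>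

definition directed ::
  "plane set \<Rightarrow> (2 \<Rightarrow> bool) \<Rightarrow> (bool \<Rightarrow> 2 \<Rightarrow> real) \<Rightarrow> (2 \<Rightarrow> real) \<Rightarrow> 2 \<Rightarrow> real set \<Rightarrow> (real \<Rightarrow> plane) \<Rightarrow> 2 \<Rightarrow> real \<Rightarrow> bool"
  where "directed V cr \<nu> \<omega> j J \<beta> k \<sigma> \<longleftrightarrow>
    strict_mono_on J (\<lambda>t. \<sigma> * \<beta> t $ k) \<and> (\<sigma> = 1 \<or> \<sigma> = -1) \<and>
    (\<forall>t\<in>J. (\<forall>b. \<beta> t \<in> part b V \<longrightarrow> \<sigma> = \<nu> b k) \<and>
      (\<forall>i. \<not> cr i \<longrightarrow> \<beta> t \<in> Sig_i V i \<longrightarrow> k = other i \<and> \<sigma> = \<omega> i)) \<and>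
    ((\<exists>i. cr i) \<or> (\<forall>t\<in>J. \<beta> t \<noteq> 0)) \<and>
    (k = j \<or> (\<forall>t\<in>J. \<beta> t $ j = 0)) \<and> (cr j \<longrightarrow> k = j \<and> (\<forall>b. \<sigma> = \<nu> b j))"

text \<open>\<open>Z\<close> resembles a field with constant components: \<open>\<nu> b k\<close> is the sign of component \<open>k\<close> in
  region \<open>b\<close>, and \<open>\<omega> i\<close> the direction of sliding along \<open>\<Sigma>\<^sub>i\<close>. The coordinate \<open>j\<close> is chosen such that
  \<open>\<Sigma>\<^sub>j\<close> is crossed unless both axes slide. The integral curves in region \<open>b\<close> lie on the leaves
  \<open>x = G b c s\<close> with label \<open>c\<close>.\<close>

locale regular_system =
  fixes Z :: pws_field and V :: "plane set" and j :: 2 and \<nu> :: "bool \<Rightarrow> 2 \<Rightarrow> real" and \<omega> :: "2 \<Rightarrow> real"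
    and cr :: "2 \<Rightarrow> bool" and G :: "bool \<Rightarrow> real \<Rightarrow> real \<Rightarrow> real" and lab :: "bool \<Rightarrow> plane \<Rightarrow> real" and lo hi :: real
  assumes openV: "open V" and zeroV: "0 \<in> V"
    and nu: "\<nu> b k = 1 \<or> \<nu> b k = -1" and om: "\<omega> k = 1 \<or> \<omega> k = -1" and lo: "0 < lo"
    and speed: "p \<in> V \<Longrightarrow> lo \<le> \<nu> b k * fld b Z p $ k \<and> \<nu> b k * fld b Z p $ k \<le> hi"
    and cr_iff: "cr k \<longleftrightarrow> \<nu> True k = \<nu> False k"
    and slide_speed: "\<not> cr i \<Longrightarrow> p \<in> Sig_i V i \<Longrightarrow>
        lo \<le> \<omega> i * sliding_field Z i p $ other i \<and> \<omega> i * sliding_field Z i p $ other i \<le> hi"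
    and cont_fld: "continuous_on V (fld b Z)"
    and types: "cr j \<or> \<not> cr (other j)"
    and om_eq: "cr j \<Longrightarrow> \<not> cr (other j) \<Longrightarrow> \<omega> (other j) = \<nu> b j"
    and leaf: "lab b p = c \<longleftrightarrow> p $ other j = G b c (p $ j)"
    and leaf_DERIV: "p \<in> V \<Longrightarrow> p $ other j = G b c (p $ j) \<Longrightarrow>
        (G b c has_real_derivative fld b Z p $ other j / fld b Z p $ j) (at (p $ j))"
    and lab_const: "is_interval J \<Longrightarrow>
        (\<And>t. t \<in> J \<Longrightarrow> \<gamma> t \<in> V \<and> (\<gamma> has_vector_derivative fld b Z (\<gamma> t)) (at t within J)) \<Longrightarrow>
        s \<in> J \<Longrightarrow> t \<in> J \<Longrightarrow> lab b (\<gamma> s) = lab b (\<gamma> t)"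
    and lab_0: "lab b 0 = 0"
    and G_0: "s \<noteq> 0 \<Longrightarrow> 0 < \<nu> b j * \<nu> b (other j) * G b 0 s * s"
begin

lemma fld_sign: "p \<in> V \<Longrightarrow> 0 < \<nu> b k * fld b Z p $ k"
  using speed[of p b k] lo by linarith

lemma fld_nz: "p \<in> V \<Longrightarrow> fld b Z p $ k \<noteq> 0"
  using fld_sign[of p b k] by auto

lemma XY_sign: "p \<in> V \<Longrightarrow> 0 < \<nu> True k * fst Z p $ k" "p \<in> V \<Longrightarrow> 0 < \<nu> False k * snd Z p $ k"
  using fld_sign[of p True k] fld_sign[of p False k] by (simp_all add: fld_def)

lemma XY_same: "p \<in> V \<Longrightarrow> 0 < fst Z p $ k * snd Z p $ k \<longleftrightarrow> cr k"
proof -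
  assume "p \<in> V"
  then have "0 < \<nu> True k * fst Z p $ k" "0 < \<nu> False k * snd Z p $ k" using XY_sign by blast+
  then show ?thesis
    using nu[of True k] nu[of False k] unfolding cr_iff by (elim disjE) (simp_all add: zero_less_mult_iff)
qed

lemma crossing_eq: "crossing V Z i = (if cr i then Sig_i V i else {})"
  using XY_same[of _ i] by (auto simp: crossing_def Sig_i_def)

lemma crossings_eq: "crossings V Z = (\<Union>i\<in>{i. cr i}. Sig_i V i)"
  by (auto simp: crossings_def crossing_eq split: if_splits)

lemma slidings_eq: "slidings V Z i = (if cr i then {} else Sig_i V i - {0})"
proof -
  have nz: "p $ other i \<noteq> 0 \<longleftrightarrow> p \<noteq> 0" if "p $ i = 0" for p :: plane
    using that by (auto simp: plane_eq_iff[of _ _ i])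
  have op: "fst Z p $ i < 0 \<and> 0 < snd Z p $ i \<or> 0 < fst Z p $ i \<and> snd Z p $ i < 0 \<longleftrightarrow> \<not> cr i" if "p \<in> V" for p
  proof -
    have "0 < \<nu> True i * fst Z p $ i" "0 < \<nu> False i * snd Z p $ i" using XY_sign that by blast+
    then show ?thesis
      using nu[of True i] nu[of False i] unfolding cr_iff by (elim disjE) (auto simp: zero_less_mult_iff)
  qed
  show ?thesis
  proof (rule set_eqI)
    fix p
    show "p \<in> slidings V Z i \<longleftrightarrow> p \<in> (if cr i then {} else Sig_i V i - {0})"
    proof (cases "p \<in> V \<and> p $ i = 0")
      case True
      then show ?thesis
        using op[of p] nz[of p] linorder_neqE_linordered_idom[of "p $ other i" 0]
        by (auto simp: slidings_def sliding_def escaping_def Sig_i_plus_def Sig_i_minus_def Sig_i_def)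
    qed (auto simp: slidings_def sliding_def escaping_def Sig_i_plus_def Sig_i_minus_def Sig_i_def)
  qed
qed

lemma tangencies_empty: "tangencies V Z = {}"
proof -
  have False if "p \<in> tangencies V Z" for p
  proof -
    have p: "p \<in> Sig V" "p \<noteq> 0" "p \<notin> crossings V Z" "\<And>i. p \<notin> slidings V Z i"
      using that by (auto simp: tangencies_def)
    then obtain i where "p \<in> Sig_i V i" by (auto simp: Sig_iff Sig_i_def)
    then show False using p(1-3) slidings_eq[of i] p(4)[of i] by (cases "cr i") (auto simp: crossings_eq)
  qed
  then show ?thesis by blast
qed

lemma germs_eq: "germs V Z = {c. origin_germ V Z c}"
  by (auto simp: germs_def tangencies_empty)

lemma axis_point_near_0:
  assumes "0 < e" shows "\<exists>s>0. s *\<^sub>R axis k 1 \<in> V \<inter> ball 0 e"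
proof -
  have "((\<lambda>s. s *\<^sub>R axis k 1 :: plane) \<longlongrightarrow> 0 *\<^sub>R axis k 1) (at_right 0)"
    by (intro tendsto_intros)
  then have "\<forall>\<^sub>F s in at_right 0. s *\<^sub>R axis k 1 \<in> V \<inter> ball 0 e"
    using openV zeroV assms by (intro topological_tendstoD) auto
  then obtain d where d: "d > 0" "\<And>s. 0 < s \<Longrightarrow> s < d \<Longrightarrow> s *\<^sub>R axis k 1 \<in> V \<inter> ball 0 e"
    unfolding eventually_at_right_field by blast
  then show ?thesis by (intro exI[of _ "d / 2"] conjI d(2)) auto
qed

lemma zero_in_closure_axis: "0 \<in> closure (Sig_i V i - {0})"
  unfolding closure_approachable
proof (intro allI impI)
  fix e :: real assume e: "0 < e"
  then obtain s where s: "0 < s" "s *\<^sub>R axis (other i) 1 \<in> V \<inter> ball 0 e" using axis_point_near_0 by blast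
  moreover have "s *\<^sub>R axis (other i) 1 \<noteq> (0 :: plane)" using s by (simp add: axis_eq_0_iff)
  ultimately show "\<exists>y\<in>Sig_i V i - {0}. dist y 0 < e"
    by (intro bexI[of _ "s *\<^sub>R axis (other i) 1"]) (auto simp: Sig_i_def axis_def dist_commute)
qed

lemma Sig_eq_closure_crossings: "Sig V = closure (crossings V Z) \<inter> V \<longleftrightarrow> (\<forall>i. cr i)"
proof -
  have "closed (\<Union>i\<in>{i. cr i}. {p :: plane. p $ i = 0})"
    by (intro closed_UN ballI closed_Collect_eq continuous_intros) auto
  then have "closure (crossings V Z) \<subseteq> (\<Union>i\<in>{i. cr i}. {p. p $ i = 0})"
    by (intro closure_minimal) (auto simp: crossings_eq Sig_i_def)
  then have eq: "closure (crossings V Z) \<inter> V = (\<Union>i\<in>{i. cr i}. Sig_i V i)"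
    using closure_subset[of "crossings V Z"] by (auto simp: crossings_eq Sig_i_def)
  show ?thesis
  proof
    assume S: "Sig V = closure (crossings V Z) \<inter> V"
    show "\<forall>i. cr i"
    proof
      fix i
      obtain s where s: "s > 0" "s *\<^sub>R axis (other i) 1 \<in> V" using axis_point_near_0[of 1 "other i"] by auto
      then have "s *\<^sub>R axis (other i) 1 \<in> Sig V" by (auto simp: Sig_iff axis_def intro!: exI[of _ i])
      then obtain i' where "cr i'" "s *\<^sub>R axis (other i) 1 \<in> Sig_i V i'" using S eq by blast
      moreover then have "i' = i" using s by (cases "i' = i") (auto simp: Sig_i_def eq_other_iff axis_def)
      ultimately show "cr i" by simp
    qed
  next
    assume "\<forall>i. cr i"
    then show "Sig V = closure (crossings V Z) \<inter> V" by (auto simp: eq Sig_iff Sig_i_def)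
  qed
qed

lemma closure_slidings: "0 \<in> closure (slidings V Z i) \<longleftrightarrow> \<not> cr i"
  using zero_in_closure_axis by (simp add: slidings_eq)

lemma closure_crossing: "0 \<in> closure (crossing V Z i) \<longleftrightarrow> cr i"
  using zero_in_closure_axis[of i] closure_mono[of "Sig_i V i - {0}" "Sig_i V i"]
  by (auto simp: crossing_eq)

text \<open>The three cases of the trajectory of the origin are decided by the number of axes that are
  crossed.\<close>

lemma origin_germ_eq: "origin_germ V Z c \<longleftrightarrow>
   (if \<forall>i. cr i then crosses_origin V Z c
    else if \<exists>i. cr i then slides_through_origin V Z (other j) c else c = (\<lambda>_. 0))"
proof (cases "cr j \<and> \<not> cr (other j)")
  case True
  then have "(\<exists>i. (\<not> cr i \<and> cr (other i)) \<and> slides_through_origin V Z i c) \<longleftrightarrow> slides_through_origin V Z (other j) c"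
    "(\<exists>i. \<not> cr i \<and> cr (other i)) = True" "(\<forall>i. \<not> cr i) = False" "(\<forall>i. cr i) = False" "(\<exists>i. cr i) = True"
    by (auto simp: exists_other[of _ j] forall_other[of _ j])
  then show ?thesis
    unfolding origin_germ_def Sig_eq_closure_crossings closure_slidings closure_crossing Int_iff
    by (simp only: if_True if_False)
next
  case False
  then have "(\<forall>i. cr i) \<or> (\<forall>i. \<not> cr i)" using types by (auto simp: forall_other[of _ j])
  then show ?thesis
    unfolding origin_germ_def Sig_eq_closure_crossings closure_slidings closure_crossing Int_iff by auto
qed

text \<open>There are no tangencies, so that the only germ that matters is the one at the origin.\<close>

lemma obeys_iff: "obeys V Z (germs V Z) J \<gamma> t \<longleftrightarrow>
    \<gamma> t \<in> V \<and>
    (\<forall>b. \<gamma> t \<in> part b V \<longrightarrow> (\<gamma> has_vector_derivative fld b Z (\<gamma> t)) (at t within J)) \<and>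
    (\<forall>i. cr i \<longrightarrow> \<gamma> t \<in> Sig_i V i - {0} \<longrightarrow>
       continuous (at t within J) \<gamma> \<and> (\<forall>\<^sub>F s in at t within J. \<gamma> s \<notin> Sig V)) \<and>
    (\<forall>i. \<not> cr i \<longrightarrow> \<gamma> t \<in> Sig_i V i - {0} \<longrightarrow>
       (\<gamma> has_vector_derivative sliding_field Z i (\<gamma> t)) (at t within J) \<and>
       (\<forall>\<^sub>F s in at t within J. \<gamma> s \<in> Sig_i V i)) \<and>
    (\<gamma> t = 0 \<longrightarrow> (\<exists>c. origin_germ V Z c \<and> c 0 = 0 \<and> (\<forall>\<^sub>F s in at t within J. \<gamma> s = c (s - t))))"
  unfolding obeys_def pos_part_eq neg_part_eq tangencies_empty germs_eq crossings_eq slidings_eq all_bool_eq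
  by (auto simp: fld_def split: if_splits)

end

section \<open>Arcs as directed curves\<close>
lemma filterlim_shift_at_0: "filterlim (\<lambda>s. s - t) (at 0) (at (t::real) within J)"
  unfolding filterlim_at
proof
  have "((\<lambda>s. s - t) \<longlongrightarrow> t - t) (at t within J)" by (intro tendsto_intros)
  then show "((\<lambda>s. s - t) \<longlongrightarrow> 0) (at t within J)" by simp
  show "\<forall>\<^sub>F s in at t within J. s - t \<in> UNIV \<and> s - t \<noteq> 0"
    unfolding eventually_at_filter by (rule always_eventually) auto
qed

lemma has_vector_derivative_germ:
  assumes c: "(c has_vector_derivative D) (at 0)" and t: "t \<in> J" "\<gamma> t = c 0"
    and ev: "\<forall>\<^sub>F s in at t within J. \<gamma> s = c (s - t)"
  shows "(\<gamma> has_vector_derivative D) (at t within J)"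
proof -
  have "((c \<circ> (\<lambda>s. s - t)) has_vector_derivative 1 *\<^sub>R D) (at t within J)"
  proof (rule vector_diff_chain_within)
    show "((\<lambda>s. s - t) has_vector_derivative 1) (at t within J)"
      unfolding has_real_derivative_iff_has_vector_derivative[symmetric] by (auto intro!: derivative_eq_intros)
    show "(c has_vector_derivative D) (at (t - t) within (\<lambda>s. s - t) ` J)"
      using c by (simp add: has_vector_derivative_at_within)
  qed
  then have "((\<lambda>s. c (s - t)) has_vector_derivative D) (at t within J)" by (simp add: comp_def)
  then show ?thesis unfolding has_vector_derivative_def
    by (rule has_derivative_transform_eventually) (use ev t in \<open>auto elim: eventually_mono\<close>)
qed

lemma has_vector_derivative_nth:
  fixes \<gamma> :: "real \<Rightarrow> plane"
  assumes "(\<gamma> has_vector_derivative D) (at t within J)"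
  shows "((\<lambda>t. \<sigma> * \<gamma> t $ k) has_real_derivative \<sigma> * D $ k) (at t within J)"
proof -
  have "((\<lambda>t. \<gamma> t $ k) has_vector_derivative D $ k) (at t within J)"
    using bounded_linear.has_vector_derivative[OF bounded_linear_vec_nth assms] .
  then have "((\<lambda>t. \<gamma> t $ k) has_real_derivative D $ k) (at t within J)"
    by (simp add: has_real_derivative_iff_has_vector_derivative)
  then show ?thesis by (rule DERIV_cmult)
qed

lemma eventually_in_open:
  assumes "continuous (at t within J) \<gamma>" "open S" "\<gamma> t \<in> S"
  shows "\<forall>\<^sub>F s in at t within J. \<gamma> s \<in> S"
  using assms by (simp add: continuous_within topological_tendstoD)

context regular_system begin

lemma open_part': "open (part b V)" using openV by (rule open_part)

text \<open>Labels are constant along curves that solve the differential equation on a whole interval; by continuity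
  the curve stays in the open region for a short time.\<close>

lemma lab_eventually_const:
  assumes J: "is_interval J" and t: "t \<in> J" "\<gamma> t \<in> part b V" and cont: "continuous (at t within J) \<gamma>"
    and der: "\<And>s. s \<in> J \<Longrightarrow> \<gamma> s \<in> part b V \<Longrightarrow> (\<gamma> has_vector_derivative fld b Z (\<gamma> s)) (at s within J)"
  shows "\<forall>\<^sub>F s in at t within J. \<gamma> s \<in> part b V \<and> lab b (\<gamma> s) = lab b (\<gamma> t)"
proof -
  have "\<forall>\<^sub>F s in at t within J. \<gamma> s \<in> part b V" using cont open_part' t(2) by (rule eventually_in_open)
  then obtain d where d: "d > 0" "\<And>s. s \<in> J \<Longrightarrow> s \<noteq> t \<Longrightarrow> dist s t < d \<Longrightarrow> \<gamma> s \<in> part b V"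
    unfolding eventually_at by blast
  define J1 where "J1 = J \<inter> {t - d<..<t + d}"
  have J1: "is_interval J1" unfolding J1_def using J by (intro is_interval_Int) auto
  have in1: "\<gamma> s \<in> part b V" if "s \<in> J1" for s
    using d(2)[of s] t that by (cases "s = t") (auto simp: J1_def dist_real_def abs_less_iff)
  have "lab b (\<gamma> s) = lab b (\<gamma> t)" if s: "s \<in> J1" for s
  proof (rule lab_const[OF J1])
    fix x assume x: "x \<in> J1"
    have "(\<gamma> has_vector_derivative fld b Z (\<gamma> x)) (at x within J)" using der x in1[OF x] by (auto simp: J1_def)
    then show "\<gamma> x \<in> V \<and> (\<gamma> has_vector_derivative fld b Z (\<gamma> x)) (at x within J1)"
      using in1[OF x] by (auto simp: J1_def part_def intro: has_vector_derivative_within_subset)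
  qed (use s t d in \<open>auto simp: J1_def\<close>)
  then show ?thesis using in1 d unfolding eventually_at
    by (intro exI[of _ d]) (auto simp: J1_def dist_real_def abs_less_iff)
qed

lemma origin_germ_cross:
  assumes cr: "\<forall>i. cr i" and c: "origin_germ V Z c"
  shows "c 0 = 0" "\<exists>b. (c has_vector_derivative fld b Z 0) (at 0) \<and> (\<forall>\<^sub>F s in at 0. c s \<in> part b V \<and> lab b (c s) = 0)"
proof -
  have co: "crosses_origin V Z c" using c cr by (simp add: origin_germ_eq)
  then show c0: "c 0 = 0" by (simp add: crosses_origin_def)
  from co obtain \<epsilon> where e: "\<epsilon> > 0" and or:
    "(\<forall>s. \<bar>s\<bar> < \<epsilon> \<longrightarrow> (c has_vector_derivative fst Z (c s)) (at s) \<and> (s \<noteq> 0 \<longrightarrow> c s \<in> pos_part V)) \<or>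
      (\<forall>s. \<bar>s\<bar> < \<epsilon> \<longrightarrow> (c has_vector_derivative snd Z (c s)) (at s) \<and> (s \<noteq> 0 \<longrightarrow> c s \<in> neg_part V))"
    unfolding crosses_origin_def by blast
  from or have "\<exists>b. \<forall>s. \<bar>s\<bar> < \<epsilon> \<longrightarrow> (c has_vector_derivative fld b Z (c s)) (at s) \<and> (s \<noteq> 0 \<longrightarrow> c s \<in> part b V)"
    unfolding ex_bool_eq pos_part_eq neg_part_eq by (simp add: fld_def)
  then obtain b where b: "\<And>s. \<bar>s\<bar> < \<epsilon> \<Longrightarrow> (c has_vector_derivative fld b Z (c s)) (at s)"
    "\<And>s. \<bar>s\<bar> < \<epsilon> \<Longrightarrow> s \<noteq> 0 \<Longrightarrow> c s \<in> part b V" by blast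
  have "lab b (c s) = lab b (c 0)" if "\<bar>s\<bar> < \<epsilon>" for s
  proof (rule lab_const[of "{-\<epsilon><..<\<epsilon>}"])
    fix t assume "t \<in> {-\<epsilon><..<\<epsilon>}"
    then have t: "\<bar>t\<bar> < \<epsilon>" by auto
    show "c t \<in> V \<and> (c has_vector_derivative fld b Z (c t)) (at t within {-\<epsilon><..<\<epsilon>})"
      using b(1)[OF t] b(2)[OF t] c0 zeroV by (cases "t = 0") (auto simp: part_def intro: has_vector_derivative_at_within)
  qed (use that e in auto)
  then have "\<forall>\<^sub>F s in at 0. c s \<in> part b V \<and> lab b (c s) = 0"
    unfolding eventually_at using b(2) e c0 lab_0 by (intro exI[of _ \<epsilon>]) (auto simp: dist_real_def)
  then show "\<exists>b. (c has_vector_derivative fld b Z 0) (at 0) \<and> (\<forall>\<^sub>F s in at 0. c s \<in> part b V \<and> lab b (c s) = 0)"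
    using b(1)[of 0] e c0 by (intro exI[of _ b]) auto
qed

lemma origin_germ_slide:
  assumes cr: "\<not> (\<forall>i. cr i)" "\<exists>i. cr i" and c: "origin_germ V Z c" and i: "\<not> cr i"
  shows "c 0 = 0" "(c has_vector_derivative sliding_field Z i 0) (at 0)" "\<forall>\<^sub>F s in at 0. c s \<in> Sig_i V i - {0}"
proof -
  have ij: "i = other j" using i types cr by (metis eq_other_iff)
  have sl: "slides_through_origin V Z i c" using c cr ij by (simp add: origin_germ_eq)
  then show c0: "c 0 = 0" by (simp add: slides_through_origin_def)
  from sl obtain \<epsilon> where e: "\<epsilon> > 0" "\<And>s. \<bar>s\<bar> < \<epsilon> \<Longrightarrow> c s \<in> Sig_i V i \<and> (c has_vector_derivative sliding_field Z i (c s)) (at s)"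
    unfolding slides_through_origin_def by blast
  show der: "(c has_vector_derivative sliding_field Z i 0) (at 0)" using e(2)[of 0] e(1) c0 by simp
  have "0 \<in> Sig_i V i" using zeroV by (simp add: Sig_i_def)
  from slide_speed[OF i this] have nz: "1 * sliding_field Z i 0 $ other i \<noteq> 0" using lo by auto
  have "((\<lambda>s. 1 * c s $ other i) has_real_derivative 1 * sliding_field Z i 0 $ other i) (at 0)"
    by (rule has_vector_derivative_nth[OF der])
  then have "\<forall>\<^sub>F s in at 0. (1 * c s $ other i - 1 * c 0 $ other i) / (s - 0) \<noteq> 0"
    unfolding has_field_derivative_iff using nz by (rule tendsto_imp_eventually_ne)
  then have "\<forall>\<^sub>F s in at 0. c s \<noteq> 0" by eventually_elim (auto simp: c0)
  moreover have "\<forall>\<^sub>F s in at 0. c s \<in> Sig_i V i" unfolding eventually_at using e by (intro exI[of _ \<epsilon>]) (auto simp: dist_real_def)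
  ultimately show "\<forall>\<^sub>F s in at 0. c s \<in> Sig_i V i - {0}" by eventually_elim auto
qed

text \<open>The conditions on derivatives are replaced by conditions on germs of sets and labels, which survive homeomorphisms.\<close>

lemma arc_follows:
  assumes arc: "arc_of V Z (germs V Z) J \<gamma>" and t: "t \<in> J"
  shows "follows V cr lab J \<gamma> t"
proof -
  have J: "is_interval J" and ob: "\<And>s. s \<in> J \<Longrightarrow> obeys V Z (germs V Z) J \<gamma> s" using arc by (auto simp: arc_of_def)
  note o = ob[OF t, unfolded obeys_iff]
  have V: "\<gamma> t \<in> V" using o by blast
  have zero: "continuous (at t within J) \<gamma> \<and> (if \<forall>i. cr i then \<exists>b. \<forall>\<^sub>F s in at t within J. \<gamma> s \<in> part b V \<and> lab b (\<gamma> s) = 0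
       else if \<exists>i. cr i then \<forall>i. \<not> cr i \<longrightarrow> (\<forall>\<^sub>F s in at t within J. \<gamma> s \<in> Sig_i V i - {0})
       else \<forall>\<^sub>F s in at t within J. \<gamma> s = 0)" if z: "\<gamma> t = 0"
  proof -
    obtain c where c: "origin_germ V Z c" "c 0 = 0" and ev: "\<forall>\<^sub>F s in at t within J. \<gamma> s = c (s - t)" using o z by blast
    have sh: "\<forall>\<^sub>F s in at t within J. P (c (s - t))" if "\<forall>\<^sub>F s in at 0. P (c s)" for P
      using that filterlim_shift_at_0 by (rule eventually_compose_filterlim)
    have tr: "\<forall>\<^sub>F s in at t within J. P (\<gamma> s)" if "\<forall>\<^sub>F s in at 0. P (c s)" for P
      using sh[OF that] ev by eventually_elim simp
    have ct: "continuous (at t within J) \<gamma>" if "(c has_vector_derivative D) (at 0)" for D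
      using has_vector_derivative_germ[OF that t _ ev] z c by (auto intro: has_vector_derivative_continuous)
    consider "\<forall>i. cr i" | "\<not> (\<forall>i. cr i)" "\<exists>i. cr i" | "\<not> (\<exists>i. cr i)" by blast
    then show ?thesis
    proof cases
      case 1
      obtain b where b: "(c has_vector_derivative fld b Z 0) (at 0)" "\<forall>\<^sub>F s in at 0. c s \<in> part b V \<and> lab b (c s) = 0"
        using origin_germ_cross(2)[OF 1 c(1)] by blast
      then show ?thesis using 1 ct[OF b(1)] tr[OF b(2)] by auto
    next
      case 2
      then obtain i where "\<not> cr i" by blast
      then show ?thesis using 2 ct[OF origin_germ_slide(2)[OF 2 c(1)]] tr[OF origin_germ_slide(3)[OF 2 c(1)]] by auto
    next
      case 3
      then have "c = (\<lambda>_. 0)" using c by (auto simp: origin_germ_eq)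
      then show ?thesis using 3 ev ct[of 0] by auto
    qed
  qed
  have cont: "continuous (at t within J) \<gamma>"
  proof -
    consider b where "\<gamma> t \<in> part b V" | i where "cr i" "\<gamma> t \<in> Sig_i V i - {0}"
      | i where "\<not> cr i" "\<gamma> t \<in> Sig_i V i - {0}" | "\<gamma> t = 0"
      using part_or_Sig[OF V] by (auto simp: Sig_iff Sig_i_def)
    then show ?thesis
    proof cases
      case 1
      then show ?thesis using o has_vector_derivative_continuous by blast
    next
      case 3
      then show ?thesis using o has_vector_derivative_continuous by blast
    qed (use o zero in blast)+
  qed
  have "\<forall>\<^sub>F s in at t within J. \<gamma> s \<in> part b V \<and> lab b (\<gamma> s) = lab b (\<gamma> t)" if "\<gamma> t \<in> part b V" for b
    by (rule lab_eventually_const[OF J t that cont]) (use ob obeys_iff in blast)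
  moreover have "if cr i then \<forall>\<^sub>F s in at t within J. \<gamma> s \<notin> Sig V else \<forall>\<^sub>F s in at t within J. \<gamma> s \<in> Sig_i V i"
    if "\<gamma> t \<in> Sig_i V i - {0}" for i
  proof (cases "cr i")
    case True
    then have "\<forall>\<^sub>F s in at t within J. \<gamma> s \<notin> Sig V" using o that by blast
    then show ?thesis using True by simp
  next
    case False
    then have "\<forall>\<^sub>F s in at t within J. \<gamma> s \<in> Sig_i V i" using o that by blast
    then show ?thesis using False by simp
  qed
  ultimately show ?thesis unfolding follows_def using V cont zero by (intro conjI allI impI) blast+
qed

text \<open>The times at which the curve is at the origin or crosses \<open>\<Sigma>\<close>. The vector fields do not
  prescribe its velocity there.\<close>

definition exceptional :: "plane set"
  where "exceptional = insert 0 (\<Union>i\<in>{i. cr i}. Sig_i V i)"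

lemma exceptional_cases:
  assumes "p \<in> V" "p \<notin> exceptional"
  obtains b where "p \<in> part b V" | i where "\<not> cr i" "p \<in> Sig_i V i - {0}"
  using assms part_or_Sig[OF assms(1)] by (auto simp: exceptional_def Sig_iff Sig_i_def)

lemma sliding_not_exceptional:
  assumes i: "\<not> cr i" and p: "p \<in> Sig_i V i - {0}" shows "p \<notin> exceptional"
proof
  assume "p \<in> exceptional"
  then obtain k where "cr k" "p \<in> Sig_i V k" using p by (auto simp: exceptional_def)
  moreover have "k = other i" using calculation(1) i eq_other_iff[of k i] by auto
  ultimately have "p $ i = 0" "p $ other i = 0" using p by (auto simp: Sig_i_def)
  then show False using p by (auto simp: plane_eq_iff[of _ _ i])
qed

text \<open>A curve leaves a crossed axis immediately. At the origin it does so too, unless both axes slide, in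
  which case it rests there.\<close>

lemma exceptional_sparse:
  assumes f: "follows V cr lab J \<beta> t" and z: "(\<exists>i. cr i) \<or> \<beta> t \<noteq> 0"
  shows "\<forall>\<^sub>F s in at t within J. \<beta> s \<notin> exceptional"
proof -
  have nS: "p \<notin> exceptional" if "p \<notin> Sig V" for p
    using that zeroV by (auto simp: exceptional_def Sig_iff Sig_i_def)
  have V: "\<beta> t \<in> V" and cont: "continuous (at t within J) \<beta>" using f by (auto simp: follows_def)
  have pt: "\<forall>\<^sub>F s in at t within J. \<beta> s \<notin> exceptional" if "\<forall>\<^sub>F s in at t within J. \<beta> s \<in> part b V \<and> Q s" for b Q
    using that by eventually_elim (use nS part_not_Sig in blast)
  consider b where "\<beta> t \<in> part b V" | i where "cr i" "\<beta> t \<in> Sig_i V i - {0}"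
    | i where "\<not> cr i" "\<beta> t \<in> Sig_i V i - {0}" | "\<beta> t = 0"
    using part_or_Sig[OF V] by (auto simp: Sig_iff Sig_i_def)
  then show ?thesis
  proof cases
    case 1
    then have "\<forall>\<^sub>F s in at t within J. \<beta> s \<in> part b V \<and> lab b (\<beta> s) = lab b (\<beta> t)" using f by (auto simp: follows_def)
    then show ?thesis by (rule pt)
  next
    case 2
    then have "\<forall>\<^sub>F s in at t within J. \<beta> s \<notin> Sig V" using f unfolding follows_def by auto
    then show ?thesis by eventually_elim (rule nS)
  next
    case 3
    then have "\<forall>\<^sub>F s in at t within J. \<beta> s \<in> Sig_i V i" using f unfolding follows_def by auto
    moreover have "\<forall>\<^sub>F s in at t within J. \<beta> s \<in> - {0}" using cont by (rule eventually_in_open) (use 3 in auto)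
    ultimately show ?thesis by eventually_elim (use sliding_not_exceptional[OF 3(1)] in auto)
  next
    case 4
    show ?thesis
    proof (cases "\<forall>i. cr i")
      case True
      then obtain b where "\<forall>\<^sub>F s in at t within J. \<beta> s \<in> part b V \<and> lab b (\<beta> s) = 0" using f 4 by (auto simp: follows_def)
      then show ?thesis by (rule pt)
    next
      case False
      then obtain i where i: "\<not> cr i" by blast
      then have "\<forall>\<^sub>F s in at t within J. \<beta> s \<in> Sig_i V i - {0}" using f 4 z False by (auto simp: follows_def split: if_splits)
      then show ?thesis by eventually_elim (rule sliding_not_exceptional[OF i])
    qed
  qed
qed

lemma arc_derivative:
  assumes arc: "arc_of V Z (germs V Z) J \<gamma>" and t: "t \<in> J"
  shows "\<gamma> t \<in> part b V \<Longrightarrow> (\<gamma> has_vector_derivative fld b Z (\<gamma> t)) (at t within J)"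
    and "\<not> cr i \<Longrightarrow> \<gamma> t \<in> Sig_i V i - {0} \<Longrightarrow> (\<gamma> has_vector_derivative sliding_field Z i (\<gamma> t)) (at t within J)"
proof -
  have "obeys V Z (germs V Z) J \<gamma> t" using arc t by (auto simp: arc_of_def)
  note o = this[unfolded obeys_iff]
  show "\<gamma> t \<in> part b V \<Longrightarrow> (\<gamma> has_vector_derivative fld b Z (\<gamma> t)) (at t within J)" using o by blast
  show "\<not> cr i \<Longrightarrow> \<gamma> t \<in> Sig_i V i - {0} \<Longrightarrow> (\<gamma> has_vector_derivative sliding_field Z i (\<gamma> t)) (at t within J)"
    using o by blast
qed

text \<open>The vector field that governs a non-exceptional point.\<close>

definition governing_field :: field
  where "governing_field p = (if p \<in> part True V then fld True Z p else if p \<in> part False V then fld False Z p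
     else sliding_field Z (if p \<in> Sig_i V 1 \<and> \<not> cr 1 then 1 else 2) p)"

lemma governing_field_part: "p \<in> part b V \<Longrightarrow> governing_field p = fld b Z p"
  using part_unique[of p b V] by (cases b) (auto simp: governing_field_def)

lemma governing_field_slide:
  assumes "\<not> cr i" "p \<in> Sig_i V i - {0}" shows "governing_field p = sliding_field Z i p"
proof -
  have "p \<notin> part b V" for b using part_nth_nz[of p b V i] assms by (auto simp: Sig_i_def)
  moreover have "p \<notin> Sig_i V k" if "k \<noteq> i" for k
    using assms that by (auto simp: Sig_i_def eq_other_iff plane_eq_iff[of _ _ i])
  then have "(if p \<in> Sig_i V 1 \<and> \<not> cr 1 then 1 else 2) = i" using assms exhaust_2[of i] by (metis DiffD1)
  ultimately show ?thesis by (simp add: governing_field_def)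
qed

lemma governing_speed:
  assumes p: "p \<in> V" "p \<notin> exceptional"
    and dir: "\<And>b. p \<in> part b V \<Longrightarrow> \<sigma> = \<nu> b k"
      "\<And>i. \<not> cr i \<Longrightarrow> p \<in> Sig_i V i - {0} \<Longrightarrow> k = other i \<and> \<sigma> = \<omega> i"
  shows "lo \<le> \<sigma> * governing_field p $ k" "\<sigma> * governing_field p $ k \<le> hi"
proof -
  have "lo \<le> \<sigma> * governing_field p $ k \<and> \<sigma> * governing_field p $ k \<le> hi"
    using p
  proof (cases rule: exceptional_cases)
    case (1 b)
    then show ?thesis using speed[OF p(1), of b k] dir(1)[OF 1] by (simp add: governing_field_part)
  next
    case (2 i)
    then show ?thesis using slide_speed[of i p] dir(2)[OF 2] governing_field_slide[OF 2] by simp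
  qed
  then show "lo \<le> \<sigma> * governing_field p $ k" "\<sigma> * governing_field p $ k \<le> hi" by auto
qed

lemma arc_has_governing_derivative:
  assumes arc: "arc_of V Z (germs V Z) J \<gamma>" and t: "t \<in> J" "\<gamma> t \<notin> exceptional"
  shows "(\<gamma> has_vector_derivative governing_field (\<gamma> t)) (at t within J)"
proof -
  have "\<gamma> t \<in> V" using arc_follows[OF arc t(1)] by (simp add: follows_def)
  then show ?thesis using t(2)
  proof (cases rule: exceptional_cases)
    case (1 b)
    then show ?thesis using arc_derivative(1)[OF arc t(1) 1] by (simp add: governing_field_part)
  next
    case (2 i)
    then show ?thesis using arc_derivative(2)[OF arc t(1) 2] governing_field_slide[OF 2] by simp
  qed
qed

lemma arc_continuous_on: "arc_of V Z (germs V Z) J \<gamma> \<Longrightarrow> continuous_on J \<gamma>"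
  using arc_follows by (auto simp: continuous_on_eq_continuous_within follows_def)

lemma arc_directedI:
  assumes arc: "arc_of V Z (germs V Z) J \<gamma>" and s: "\<sigma> = 1 \<or> \<sigma> = -1"
    and dir: "\<And>t b. t \<in> J \<Longrightarrow> \<gamma> t \<in> part b V \<Longrightarrow> \<sigma> = \<nu> b k"
      "\<And>t i. t \<in> J \<Longrightarrow> \<not> cr i \<Longrightarrow> \<gamma> t \<in> Sig_i V i \<Longrightarrow> k = other i \<and> \<sigma> = \<omega> i"
    and z: "(\<exists>i. cr i) \<or> (\<forall>t\<in>J. \<gamma> t \<noteq> 0)" and kj: "k = j \<or> (\<forall>t\<in>J. \<gamma> t $ j = 0)"
    and cj: "cr j \<longrightarrow> k = j \<and> (\<forall>b. \<sigma> = \<nu> b j)"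
  shows "directed V cr \<nu> \<omega> j J \<gamma> k \<sigma>"
proof -
  have "strict_mono_on J (\<lambda>t. \<sigma> * \<gamma> t $ k)"
  proof (rule strict_mono_on_if_positive_derivative[where K = "{t. \<gamma> t \<in> exceptional}"])
    show "is_interval J" using arc by (simp add: arc_of_def)
    show "continuous_on J (\<lambda>t. \<sigma> * \<gamma> t $ k)" using arc_continuous_on[OF arc] by (intro continuous_intros)
    show "\<forall>\<^sub>F s in at t within J. s \<notin> {t. \<gamma> t \<in> exceptional}" if "t \<in> J" for t
      using exceptional_sparse[OF arc_follows[OF arc that]] z that by auto
    fix t assume t: "t \<in> J - {t. \<gamma> t \<in> exceptional}"
    have "\<gamma> t \<in> V" using arc_follows[OF arc, of t] t by (simp add: follows_def)
    then have "lo \<le> \<sigma> * governing_field (\<gamma> t) $ k" by (rule governing_speed) (use t dir in auto)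
    then show "\<exists>D>0. ((\<lambda>t. \<sigma> * \<gamma> t $ k) has_real_derivative D) (at t within J)"
      using has_vector_derivative_nth[OF arc_has_governing_derivative[OF arc, of t], of \<sigma> k] t lo
      by (intro exI[of _ "\<sigma> * governing_field (\<gamma> t) $ k"]) auto
  qed
  then show ?thesis using s dir z kj cj unfolding directed_def by blast
qed

text \<open>If both axes slide or escape, arcs remain for a while in each quadrant, half axis, or at the origin, so
  that the signs of the coordinates are locally constant.\<close>

lemma arc_sgn_const:
  fixes \<gamma> :: "real \<Rightarrow> plane"
  assumes nc: "\<not> (\<exists>i. cr i)" and arc: "arc_of V Z (germs V Z) J \<gamma>" and st: "s \<in> J" "t \<in> J"
  shows "sgn (\<gamma> s $ k) = sgn (\<gamma> t $ k)"
proof -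
  have "(\<lambda>k. sgn (\<gamma> s $ k)) = (\<lambda>k. sgn (\<gamma> t $ k))"
  proof (rule connected_local_const[where f = "\<lambda>t k. sgn (\<gamma> t $ k)" and A = J])
    show "connected J" using arc by (simp add: arc_of_def is_interval_connected)
    show "\<forall>a\<in>J. \<forall>\<^sub>F b in at a within J. (\<lambda>k. sgn (\<gamma> a $ k)) = (\<lambda>k. sgn (\<gamma> b $ k))"
    proof
      fix a assume a: "a \<in> J"
      have f: "follows V cr lab J \<gamma> a" by (rule arc_follows[OF arc a])
      have cont: "continuous (at a within J) \<gamma>" using f by (simp add: follows_def)
      have ez: "\<forall>\<^sub>F b in at a within J. \<gamma> b $ k = 0" if "\<gamma> a $ k = 0" for k
      proof (cases "\<gamma> a = 0")
        case True
        then have "\<forall>\<^sub>F b in at a within J. \<gamma> b = 0" using f nc by (auto simp: follows_def split: if_splits)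
        then show ?thesis by eventually_elim simp
      next
        case False
        then have "\<gamma> a \<in> Sig_i V k - {0}" using f that by (auto simp: follows_def Sig_i_def)
        then have "\<forall>\<^sub>F b in at a within J. \<gamma> b \<in> Sig_i V k" using f nc unfolding follows_def by metis
        then show ?thesis by eventually_elim (simp add: Sig_i_def)
      qed
      have e1: "\<forall>\<^sub>F b in at a within J. sgn (\<gamma> a $ k) = sgn (\<gamma> b $ k)" for k
      proof -
        have ck: "continuous (at a within J) (\<lambda>b. \<gamma> b $ k)" using cont by (intro continuous_intros)
        consider "\<gamma> a $ k = 0" | "0 < \<gamma> a $ k" | "\<gamma> a $ k < 0" by linarith
        then show ?thesis
        proof cases
          case 1
          show ?thesis using ez[OF 1] by eventually_elim (use 1 in simp)
        next
          case 2
          have "\<forall>\<^sub>F b in at a within J. \<gamma> b $ k \<in> {0<..}" using ck by (rule eventually_in_open) (use 2 in auto)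
          then show ?thesis by eventually_elim (use 2 in simp)
        next
          case 3
          have "\<forall>\<^sub>F b in at a within J. \<gamma> b $ k \<in> {..<0}" using ck by (rule eventually_in_open) (use 3 in auto)
          then show ?thesis by eventually_elim (use 3 in simp)
        qed
      qed
      have "\<forall>\<^sub>F b in at a within J. \<forall>k. sgn (\<gamma> a $ k) = sgn (\<gamma> b $ k)" using e1 by (rule eventually_all_finite)
      then show "\<forall>\<^sub>F b in at a within J. (\<lambda>k. sgn (\<gamma> a $ k)) = (\<lambda>k. sgn (\<gamma> b $ k))" by eventually_elim auto
    qed
  qed (use st in auto)
  then show ?thesis by metis
qed

text \<open>If \<open>\<Sigma>\<^sub>j\<close> is crossed, component \<open>j\<close> has the same sign in all regions and also for the sliding
  motion along the other axis. Otherwise both axes slide and the arc stays where it is.\<close>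

lemma arc_directed:
  assumes arc: "arc_of V Z (germs V Z) J \<gamma>"
  shows "(\<not> (\<exists>i. cr i) \<and> (\<forall>t\<in>J. \<gamma> t = 0)) \<or> (\<exists>k \<sigma>. directed V cr \<nu> \<omega> j J \<gamma> k \<sigma>)"
proof (cases "cr j")
  case True
  have "directed V cr \<nu> \<omega> j J \<gamma> j (\<nu> True j)"
  proof (rule arc_directedI[OF arc nu])
    show nb: "\<nu> True j = \<nu> b j" for b using True cr_iff[of j] by (cases b) auto
    show "cr j \<longrightarrow> j = j \<and> (\<forall>b. \<nu> True j = \<nu> b j)" using nb by blast
    show "j = other i \<and> \<nu> True j = \<omega> i" if "\<not> cr i" for i
    proof -
      have "i = other j" using that True by (metis eq_other_iff)
      then show ?thesis using om_eq[OF True, of True] that by simp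
    qed
  qed (use True in auto)
  then show ?thesis by blast
next
  case False
  then have nc: "\<not> (\<exists>i. cr i)" using types by (auto simp: exists_other[of _ j])
  obtain t0 where t0: "t0 \<in> J" using arc by (auto simp: arc_of_def)
  have sg: "sgn (\<gamma> t $ k) = sgn (\<gamma> t0 $ k)" if "t \<in> J" for t k by (rule arc_sgn_const[OF nc arc that t0])
  have inV: "\<gamma> t \<in> V" if "t \<in> J" for t using arc_follows[OF arc that] by (simp add: follows_def)
  have zi: "\<gamma> t $ k = 0 \<longleftrightarrow> \<gamma> t0 $ k = 0" if "t \<in> J" for t k using sg[OF that, of k] by (metis sgn_0_0)
  have z: "\<gamma> t = 0 \<longleftrightarrow> \<gamma> t0 = 0" if "t \<in> J" for t using zi[OF that] by (simp add: vec_eq_iff)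
  consider b where "\<gamma> t0 \<in> part b V" | i where "\<gamma> t0 \<in> Sig_i V i - {0}" | "\<gamma> t0 = 0"
    using part_or_Sig[OF inV[OF t0]] by (auto simp: Sig_iff Sig_i_def)
  then show ?thesis
  proof cases
    case 1
    have p: "\<gamma> t \<in> part b V" if "t \<in> J" for t
    proof -
      have "sgn (\<gamma> t $ 1 * \<gamma> t $ 2) = sgn (\<gamma> t0 $ 1 * \<gamma> t0 $ 2)" using sg[OF that] by (simp add: sgn_mult)
      then have "sgn (region_sign b * (\<gamma> t $ 1 * \<gamma> t $ 2)) = sgn (region_sign b * (\<gamma> t0 $ 1 * \<gamma> t0 $ 2))"
        by (simp add: sgn_mult)
      then show ?thesis using 1 inV[OF that] by (auto simp: part_def) (metis sgn_1_pos)
    qed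
    have "directed V cr \<nu> \<omega> j J \<gamma> j (\<nu> b j)"
    proof (rule arc_directedI[OF arc nu])
      show "\<nu> b j = \<nu> b' j" if "t \<in> J" "\<gamma> t \<in> part b' V" for t b' using part_unique[OF p[OF that(1)] that(2)] by simp
      show "j = other i \<and> \<nu> b j = \<omega> i" if "t \<in> J" "\<gamma> t \<in> Sig_i V i" for t i
        using part_nth_nz[OF p[OF that(1)], of i] that by (simp add: Sig_i_def)
      show "(\<exists>i. cr i) \<or> (\<forall>t\<in>J. \<gamma> t \<noteq> 0)" using part_nth_nz[OF p, of _ 1] by force
    qed (use False in auto)
    then show ?thesis by blast
  next
    case 2
    have nz: "\<gamma> t $ other i \<noteq> 0" "\<gamma> t $ i = 0" if "t \<in> J" for t
      using zi[OF that] 2 by (auto simp: Sig_i_def plane_eq_iff[of _ _ i])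
    have "directed V cr \<nu> \<omega> j J \<gamma> (other i) (\<omega> i)"
    proof (rule arc_directedI[OF arc om])
      show "\<omega> i = \<nu> b (other i)" if "t \<in> J" "\<gamma> t \<in> part b V" for t b
        using part_nth_nz[OF that(2), of i] nz[OF that(1)] by simp
      show "other i = other i' \<and> \<omega> i = \<omega> i'" if "t \<in> J" "\<gamma> t \<in> Sig_i V i'" for t i'
        using nz[OF that(1)] that(2) by (cases "i' = i") (auto simp: eq_other_iff Sig_i_def)
      show "(\<exists>i. cr i) \<or> (\<forall>t\<in>J. \<gamma> t \<noteq> 0)" using nz by force
      show "other i = j \<or> (\<forall>t\<in>J. \<gamma> t $ j = 0)" using nz by (cases "i = j") (auto simp: eq_other_iff)
    qed (use False in auto)
    then show ?thesis by blast
  next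
    case 3
    then show ?thesis using z nc by blast
  qed
qed

text \<open>The coordinate \<open>k\<close> moves along both arcs with the speed of the governing field, apart from
  isolated times.\<close>

lemma arc_time_unique:
  assumes arc: "arc_of V Z (germs V Z) J \<gamma>" and arc': "arc_of V Z (germs V Z) J' \<gamma>'"
    and dir: "directed V cr \<nu> \<omega> j J \<gamma> k \<sigma>"
    and w: "continuous_on J w" "strict_mono_on J w" "w ` J \<subseteq> J'" "\<And>t. t \<in> J \<Longrightarrow> \<gamma>' (w t) = \<gamma> t"
  shows "\<exists>c. \<forall>t\<in>J. w t = t + c"
proof -
  show ?thesis
  proof (rule equal_speed_imp_time_shift[where K = "{t. \<gamma> t \<in> exceptional}" and ?m1.0 = "\<lambda>t. \<sigma> * \<gamma> t $ k"
        and ?m2.0 = "\<lambda>t. \<sigma> * \<gamma>' t $ k" and v = "\<lambda>t. \<sigma> * governing_field (\<gamma> t) $ k" and B = J'])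
    show "is_interval J" using arc by (simp add: arc_of_def)
    show "\<forall>\<^sub>F s in at t within J. s \<notin> {t. \<gamma> t \<in> exceptional}" if "t \<in> J" for t
      using exceptional_sparse[OF arc_follows[OF arc that]] dir that by (auto simp: directed_def)
    show "inj_on w J" using w(2) by (rule strict_mono_on_imp_inj_on)
    fix t assume "t \<in> J - {t. \<gamma> t \<in> exceptional}"
    then have t: "t \<in> J" "\<gamma> t \<notin> exceptional" by auto
    show "((\<lambda>t. \<sigma> * \<gamma> t $ k) has_real_derivative \<sigma> * governing_field (\<gamma> t) $ k) (at t within J)"
      by (rule has_vector_derivative_nth[OF arc_has_governing_derivative[OF arc t]])
    have wt: "w t \<in> J'" "\<gamma>' (w t) = \<gamma> t" using w t by auto
    have "(\<gamma>' has_vector_derivative governing_field (\<gamma>' (w t))) (at (w t) within J')"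
      by (rule arc_has_governing_derivative[OF arc' wt(1)]) (simp add: wt(2) t)
    then show "((\<lambda>t. \<sigma> * \<gamma>' t $ k) has_real_derivative \<sigma> * governing_field (\<gamma> t) $ k) (at (w t) within J')"
      unfolding wt(2) by (rule has_vector_derivative_nth)
    have "\<gamma> t \<in> V" using arc_follows[OF arc t(1)] by (simp add: follows_def)
    then have "lo \<le> \<sigma> * governing_field (\<gamma> t) $ k" by (rule governing_speed) (use t dir in \<open>auto simp: directed_def\<close>)
    then show "\<sigma> * governing_field (\<gamma> t) $ k \<noteq> 0" using lo by linarith
  qed (use w in auto)
qed

end

section \<open>Trajectories through the origin\<close>
lemma eventually_neq_at_within: "\<forall>\<^sub>F s in at x within J. s \<notin> {t :: real}"
proof (cases "x = t")
  case True
  then show ?thesis unfolding eventually_at_filter by (intro always_eventually) auto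
next
  case False
  show ?thesis using tendsto_imp_eventually_ne[OF tendsto_ident_at False, of J] by simp
qed

text \<open>A curve \<open>\<beta>\<^sub>0\<close> through the origin, transversal to the level sets of the coordinate \<open>k\<close>, is
  the image of an integral curve \<open>c\<close> of \<open>E\<close>, and every solution of \<open>E\<close> that runs along \<open>\<beta>\<^sub>0\<close> on
  one or both sides of the origin is a translate of \<open>c\<close>.\<close>

lemma integral_curve_along:
  fixes \<beta>0 :: "real \<Rightarrow> plane" and E :: field
  assumes \<sigma>: "\<sigma> = 1 \<or> \<sigma> = -1" and \<delta>: "0 < \<delta>" and lo: "0 < lo" and \<beta>00: "\<beta>0 0 = 0"
    and k: "\<And>w. \<bar>w\<bar> < \<delta> \<Longrightarrow> \<sigma> * \<beta>0 w $ k = w"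
    and bd: "\<And>w. \<bar>w\<bar> < \<delta> \<Longrightarrow> lo \<le> \<sigma> * E (\<beta>0 w) $ k \<and> \<sigma> * E (\<beta>0 w) $ k \<le> hi"
    and der: "\<And>w. \<bar>w\<bar> < \<delta> \<Longrightarrow> (\<beta>0 has_vector_derivative (1 / (\<sigma> * E (\<beta>0 w) $ k)) *\<^sub>R E (\<beta>0 w)) (at w)"
    and cont: "\<And>w. \<bar>w\<bar> < \<delta> \<Longrightarrow> isCont (\<lambda>w. \<sigma> * E (\<beta>0 w) $ k) w"
  obtains c \<epsilon> where "0 < \<epsilon>" "c 0 = 0"
    "\<And>s. \<bar>s\<bar> < \<epsilon> \<Longrightarrow> (c has_vector_derivative E (c s)) (at s) \<and> (\<exists>w. \<bar>w\<bar> < \<delta> \<and> c s = \<beta>0 w \<and> (s \<noteq> 0 \<longrightarrow> w \<noteq> 0))"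
    "\<And>J \<gamma> t. is_interval J \<Longrightarrow> t \<in> J \<Longrightarrow> \<gamma> t = 0 \<Longrightarrow> continuous_on J \<gamma> \<Longrightarrow>
       strict_mono_on J (\<lambda>s. \<sigma> * \<gamma> s $ k) \<Longrightarrow>
       \<forall>\<^sub>F s in at t within J. \<gamma> s = \<beta>0 (\<sigma> * \<gamma> s $ k) \<and> (\<gamma> has_vector_derivative E (\<gamma> s)) (at s within J) \<Longrightarrow>
       \<forall>\<^sub>F s in at t within J. \<gamma> s = c (s - t)"
proof -
  define J0 where "J0 = {-\<delta><..<\<delta>}"
  have J0: "w \<in> J0 \<longleftrightarrow> \<bar>w\<bar> < \<delta>" for w by (auto simp: J0_def)
  have "\<exists>\<tau>. \<tau> 0 = 0 \<and> continuous_on J0 \<tau> \<and> strict_mono_on J0 \<tau> \<and> is_interval (\<tau> ` J0) \<and>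
     (\<forall>\<gamma>. (\<forall>t\<in>J0. \<gamma> (\<tau> t) = \<beta>0 t) \<longrightarrow>
        (\<forall>t\<in>J0 - {}. (\<gamma> has_vector_derivative E (\<beta>0 t)) (at (\<tau> t) within \<tau> ` J0)))"
  proof (rule time_change[where m = "\<lambda>w. w" and v = "\<lambda>w. \<sigma> * E (\<beta>0 w) $ k" and lo = lo and hi = hi])
    show "is_interval J0" "continuous_on J0 (\<lambda>w. w)" "strict_mono_on J0 (\<lambda>w. w)"
      by (auto simp: J0_def strict_mono_on_def)
    fix w assume w: "w \<in> J0 - {}"
    then have w': "\<bar>w\<bar> < \<delta>" using J0 by simp
    show "lo \<le> \<sigma> * E (\<beta>0 w) $ k \<and> \<sigma> * E (\<beta>0 w) $ k \<le> hi" by (rule bd[OF w'])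
    show "continuous (at w within J0) (\<lambda>w. \<sigma> * E (\<beta>0 w) $ k)" using cont[OF w'] by (rule continuous_at_imp_continuous_at_within)
    show "\<exists>D. \<beta>0 w = D w \<and> (\<forall>\<^sub>F s in at w within J0. \<beta>0 s = D s) \<and>
         (D has_vector_derivative (1 / (\<sigma> * E (\<beta>0 w) $ k)) *\<^sub>R E (\<beta>0 w)) (at w)"
      using der[OF w'] by (intro exI[of _ \<beta>0]) auto
  qed (use lo in auto)
  then obtain \<tau> where \<tau>0: "\<tau> 0 = 0" and \<tau>: "continuous_on J0 \<tau>" "strict_mono_on J0 \<tau>" "is_interval (\<tau> ` J0)"
    and \<tau>d: "\<And>\<gamma> t. (\<And>t. t \<in> J0 \<Longrightarrow> \<gamma> (\<tau> t) = \<beta>0 t) \<Longrightarrow> t \<in> J0 \<Longrightarrow>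
        (\<gamma> has_vector_derivative E (\<beta>0 t)) (at (\<tau> t) within \<tau> ` J0)" by blast
  have inj: "inj_on \<tau> J0" using \<tau>(2) by (rule strict_mono_on_imp_inj_on)
  define c where "c = \<beta>0 \<circ> inv_into J0 \<tau>"
  have c: "c (\<tau> w) = \<beta>0 w" if "w \<in> J0" for w using inj that by (simp add: c_def)
  have cd: "(c has_vector_derivative E (\<beta>0 w)) (at (\<tau> w) within \<tau> ` J0)" if "w \<in> J0" for w
    by (rule \<tau>d[OF c that])
  have half: "\<delta> / 2 \<in> J0" "- (\<delta> / 2) \<in> J0" "0 \<in> J0" using \<delta> by (auto simp: J0_def)
  define \<epsilon> where "\<epsilon> = min (\<tau> (\<delta> / 2)) (- \<tau> (- (\<delta> / 2)))"
  have e: "0 < \<epsilon>" using strict_mono_onD[OF \<tau>(2) half(3,1)] strict_mono_onD[OF \<tau>(2) half(2,3)] \<delta> \<tau>0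
    by (simp add: \<epsilon>_def)
  have sub: "{-\<epsilon><..<\<epsilon>} \<subseteq> \<tau> ` J0"
  proof
    fix s assume "s \<in> {-\<epsilon><..<\<epsilon>}"
    then have "s \<in> {\<tau> (- (\<delta> / 2))..\<tau> (\<delta> / 2)}" by (auto simp: \<epsilon>_def)
    then show "s \<in> \<tau> ` J0" using interval_Icc_subset[OF \<tau>(3) imageI[OF half(2)] imageI[OF half(1)]] by blast
  qed
  show thesis
  proof (rule that[of \<epsilon> c])
    show "c 0 = 0" using c[OF half(3)] \<tau>0 \<beta>00 by simp
    fix s assume s: "\<bar>s\<bar> < \<epsilon>"
    then obtain w where w: "w \<in> J0" "s = \<tau> w" using sub by (metis abs_less_iff greaterThanLessThan_iff imageE minus_less_iff subsetD)
    have "s \<in> {-\<epsilon><..<\<epsilon>}" using s by auto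
    then have "at s within \<tau> ` J0 = at s" by (intro at_within_interior interiorI[OF open_greaterThanLessThan _ sub])
    then show "(c has_vector_derivative E (c s)) (at s) \<and> (\<exists>w. \<bar>w\<bar> < \<delta> \<and> c s = \<beta>0 w \<and> (s \<noteq> 0 \<longrightarrow> w \<noteq> 0))"
      using cd[OF w(1)] c[OF w(1)] w J0 \<tau>0 by auto
  next
    fix J t and \<gamma> :: "real \<Rightarrow> plane"
    assume J: "is_interval J" and t: "t \<in> J" "\<gamma> t = 0" and cg: "continuous_on J \<gamma>"
      and mono: "strict_mono_on J (\<lambda>s. \<sigma> * \<gamma> s $ k)"
      and ev: "\<forall>\<^sub>F s in at t within J. \<gamma> s = \<beta>0 (\<sigma> * \<gamma> s $ k) \<and> (\<gamma> has_vector_derivative E (\<gamma> s)) (at s within J)"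
    define u where "u s = \<sigma> * \<gamma> s $ k" for s
    have cu: "continuous_on J u" unfolding u_def by (intro continuous_intros cg)
    have "continuous (at t within J) u" using cu t(1) by (auto simp: continuous_on_eq_continuous_within)
    then have "\<forall>\<^sub>F s in at t within J. u s \<in> J0"
      by (rule eventually_in_open) (use t half in \<open>auto simp: u_def J0_def\<close>)
    with ev have "\<forall>\<^sub>F s in at t within J. (\<gamma> s = \<beta>0 (u s) \<and> (\<gamma> has_vector_derivative E (\<gamma> s)) (at s within J)) \<and> u s \<in> J0"
      unfolding u_def by (rule eventually_conj)
    then obtain d where d: "d > 0" "\<And>s. s \<in> J \<Longrightarrow> s \<noteq> t \<Longrightarrow> dist s t < d \<Longrightarrow>
        (\<gamma> s = \<beta>0 (u s) \<and> (\<gamma> has_vector_derivative E (\<gamma> s)) (at s within J)) \<and> u s \<in> J0"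
      unfolding eventually_at by blast
    define J1 where "J1 = J \<inter> {t - d<..<t + d}"
    have J1: "is_interval J1" unfolding J1_def using J by (intro is_interval_Int) auto
    have u0: "u t = 0" using t by (simp add: u_def)
    have P: "(\<gamma> has_vector_derivative E (\<gamma> s)) (at s within J)" if "s \<in> J1" "s \<noteq> t" for s
      using d(2)[of s] that by (auto simp: J1_def dist_real_def abs_less_iff)
    have Q: "\<gamma> s = \<beta>0 (u s)" "u s \<in> J0" if "s \<in> J1" for s
      using d(2)[of s] that u0 t \<beta>00 half(3) by (cases "s = t"; auto simp: J1_def dist_real_def abs_less_iff)+
    have "\<exists>C. \<forall>s\<in>J1. \<tau> (u s) = s + C"
    proof (rule equal_speed_imp_time_shift[where K = "{t}" and ?m1.0 = u and ?m2.0 = "\<lambda>s. \<sigma> * c s $ k"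
          and v = "\<lambda>s. \<sigma> * E (\<gamma> s) $ k" and B = "\<tau> ` J0", OF J1 eventually_neq_at_within])
      have "continuous_on J1 u" using cu by (rule continuous_on_subset) (auto simp: J1_def)
      then show "continuous_on J1 (\<lambda>s. \<tau> (u s))"
        using continuous_on_compose2[OF \<tau>(1), of J1 u] Q(2) by auto
      have "inj_on u J1" using strict_mono_on_imp_inj_on[OF mono] unfolding u_def[symmetric]
        by (rule inj_on_subset) (auto simp: J1_def)
      then show "inj_on (\<lambda>s. \<tau> (u s)) J1" using inj Q(2) by (auto simp: inj_on_def)
      show "(\<lambda>s. \<tau> (u s)) ` J1 \<subseteq> \<tau> ` J0" using Q(2) by auto
      show "\<sigma> * c (\<tau> (u s)) $ k = u s" if "s \<in> J1" for s
        using c[OF Q(2)[OF that]] Q(1)[OF that] k[of "u s"] Q(2)[OF that] J0 by auto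
      fix s assume s: "s \<in> J1 - {t}"
      then have "(\<gamma> has_vector_derivative E (\<gamma> s)) (at s within J1)"
        using P[of s] by (auto simp: J1_def intro: has_vector_derivative_within_subset)
      then show "(u has_real_derivative \<sigma> * E (\<gamma> s) $ k) (at s within J1)"
        unfolding u_def by (rule has_vector_derivative_nth)
      have "(c has_vector_derivative E (\<gamma> s)) (at (\<tau> (u s)) within \<tau> ` J0)"
        using cd[OF Q(2)] Q(1) s by auto
      then show "((\<lambda>s. \<sigma> * c s $ k) has_real_derivative \<sigma> * E (\<gamma> s) $ k) (at (\<tau> (u s)) within \<tau> ` J0)"
        by (rule has_vector_derivative_nth)
      show "\<sigma> * E (\<gamma> s) $ k \<noteq> 0" using bd[of "u s"] Q s lo J0 by fastforce
    qed
    then obtain C where C: "\<And>s. s \<in> J1 \<Longrightarrow> \<tau> (u s) = s + C" by blast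
    have tJ1: "t \<in> J1" using t d by (auto simp: J1_def)
    have "C = - t" using C[OF tJ1] u0 \<tau>0 by simp
    then have "\<gamma> s = c (s - t)" if "s \<in> J1" for s
      using C[OF that] c[OF Q(2)[OF that]] Q(1)[OF that] by simp
    then show "\<forall>\<^sub>F s in at t within J. \<gamma> s = c (s - t)"
      unfolding eventually_at using d(1) by (intro exI[of _ d]) (auto simp: J1_def dist_real_def abs_less_iff)
  qed (use e in auto)
qed

lemma mk_has_vector_derivative:
  assumes "(x has_real_derivative x') (at w)" "(s has_real_derivative s') (at w)"
  shows "((\<lambda>w. mk j (x w) (s w)) has_vector_derivative mk j x' s') (at w)"
proof -
  have "((\<lambda>w. x w *\<^sub>R (axis (other j) 1 :: plane) + s w *\<^sub>R axis j 1) has_vector_derivative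
     (x w *\<^sub>R 0 + x' *\<^sub>R axis (other j) 1) + (s w *\<^sub>R 0 + s' *\<^sub>R axis j 1)) (at w)"
    by (intro has_vector_derivative_add has_vector_derivative_scaleR assms has_vector_derivative_const)
  then show ?thesis by (simp add: mk_def)
qed

context regular_system begin

lemma sliding_speed_continuous:
  assumes i: "\<not> cr i" shows "continuous_on V (\<lambda>p. sliding_field Z i p $ other i)"
proof -
  have nz: "snd Z p $ i - fst Z p $ i \<noteq> 0" if "p \<in> V" for p
    using XY_sign[OF that, of i] nu[of True i] nu[of False i] i unfolding cr_iff
    by (elim disjE) auto
  have "continuous_on V (fst Z)" "continuous_on V (snd Z)" using cont_fld[of True] cont_fld[of False] by (simp_all add: fld_def)
  then show ?thesis using nz by (auto simp: sliding_field_def axis_def intro!: continuous_intros)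
qed

text \<open>Leaves parametrized by the \<open>j\<close>-th coordinate up to the sign \<open>\<sigma>\<close>, i.e. by the clock of a directed curve.\<close>

lemma leaf_curve:
  assumes p: "p \<in> V" "lab b p = c" and \<sigma>: "\<sigma> = 1 \<or> \<sigma> = -1"
  shows "p = mk j (G b c (\<sigma> * (\<sigma> * p $ j))) (\<sigma> * (\<sigma> * p $ j))"
    "((\<lambda>w. mk j (G b c (\<sigma> * w)) (\<sigma> * w)) has_vector_derivative (1 / (\<sigma> * fld b Z p $ j)) *\<^sub>R fld b Z p) (at (\<sigma> * p $ j))"
proof -
  have ss: "\<sigma> * (\<sigma> * x) = x" for x using \<sigma> by auto
  have l: "p $ other j = G b c (p $ j)" using p leaf by blast
  then show "p = mk j (G b c (\<sigma> * (\<sigma> * p $ j))) (\<sigma> * (\<sigma> * p $ j))" by (simp add: ss plane_eq_iff[of _ _ j])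
  have "((\<lambda>w. G b c (\<sigma> * w)) has_real_derivative fld b Z p $ other j / fld b Z p $ j * \<sigma>) (at (\<sigma> * p $ j))"
  proof (rule DERIV_chain2[where g = "\<lambda>w. \<sigma> * w" and f = "G b c"])
    show "(G b c has_real_derivative fld b Z p $ other j / fld b Z p $ j) (at (\<sigma> * (\<sigma> * p $ j)))"
      using leaf_DERIV[OF p(1) l] by (simp add: ss)
  qed (auto intro!: derivative_eq_intros)
  moreover have "((\<lambda>w. \<sigma> * w) has_real_derivative \<sigma>) (at (\<sigma> * p $ j))" by (auto intro!: derivative_eq_intros)
  ultimately have "((\<lambda>w. mk j (G b c (\<sigma> * w)) (\<sigma> * w)) has_vector_derivative
     mk j (fld b Z p $ other j / fld b Z p $ j * \<sigma>) \<sigma>) (at (\<sigma> * p $ j))" by (rule mk_has_vector_derivative)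
  moreover have "mk j (fld b Z p $ other j / fld b Z p $ j * \<sigma>) \<sigma> = (1 / (\<sigma> * fld b Z p $ j)) *\<^sub>R fld b Z p"
    using \<sigma> fld_nz[OF p(1), of b j] by (auto simp: plane_eq_iff[of _ _ j])
  ultimately show "((\<lambda>w. mk j (G b c (\<sigma> * w)) (\<sigma> * w)) has_vector_derivative (1 / (\<sigma> * fld b Z p $ j)) *\<^sub>R fld b Z p) (at (\<sigma> * p $ j))"
    by simp
qed

lemma slide_curve:
  assumes p: "p \<in> Sig_i V i" and i: "\<not> cr i" and \<sigma>: "\<sigma> = 1 \<or> \<sigma> = -1"
  shows "p = mk (other i) 0 (\<sigma> * (\<sigma> * p $ other i))"
    "((\<lambda>w. mk (other i) 0 (\<sigma> * w)) has_vector_derivative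
       (1 / (\<sigma> * sliding_field Z i p $ other i)) *\<^sub>R sliding_field Z i p) (at w)"
proof -
  show "p = mk (other i) 0 (\<sigma> * (\<sigma> * p $ other i))" using p \<sigma> by (auto simp: plane_eq_iff[of _ _ "other i"] Sig_i_def)
  have "((\<lambda>w. mk (other i) 0 (\<sigma> * w)) has_vector_derivative mk (other i) 0 \<sigma>) (at w)"
    by (rule mk_has_vector_derivative) (auto intro!: derivative_eq_intros)
  moreover have "sliding_field Z i p $ other i \<noteq> 0" using slide_speed[OF i p] lo by auto
  then have "mk (other i) 0 \<sigma> = (1 / (\<sigma> * sliding_field Z i p $ other i)) *\<^sub>R sliding_field Z i p"
    using \<sigma> by (auto simp: plane_eq_iff[of _ _ "other i"] sliding_field_def axis_def)
  ultimately show "((\<lambda>w. mk (other i) 0 (\<sigma> * w)) has_vector_derivative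
       (1 / (\<sigma> * sliding_field Z i p $ other i)) *\<^sub>R sliding_field Z i p) (at w)" by simp
qed

text \<open>If both axes are crossed, exactly one of the fields runs, at the origin, from one of its quadrants to
  the opposite one, namely the field whose slope has the sign of its quadrants.\<close>

lemma leaf_through_origin:
  assumes fa: "\<forall>i. cr i"
  obtains b where "\<nu> b j * \<nu> b (other j) = region_sign b" "\<And>s. s \<noteq> 0 \<Longrightarrow> mk j (G b 0 s) s \<in> V \<Longrightarrow> mk j (G b 0 s) s \<in> part b V"
    "\<And>b'. b' \<noteq> b \<Longrightarrow> \<nu> b' j * \<nu> b' (other j) \<noteq> region_sign b'"
proof -
  have eq: "\<nu> True k = \<nu> False k" for k using fa cr_iff by blast
  define b where "b \<longleftrightarrow> \<nu> True j * \<nu> True (other j) = 1"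
  have e: "\<nu> b j * \<nu> b (other j) = region_sign b"
    using nu[of True j] nu[of True "other j"] eq[of j] eq[of "other j"] by (cases b) (auto simp: b_def region_sign_def)
  show thesis
  proof (rule that[of b, OF e])
    show "mk j (G b 0 s) s \<in> part b V" if "s \<noteq> 0" "mk j (G b 0 s) s \<in> V" for s
      using G_0[OF that(1), of b] that(2) unfolding e by (simp add: part_iff[of _ _ _ j] mult.assoc)
    fix b' assume "b' \<noteq> b"
    then have "region_sign b' = - region_sign b" "\<nu> b' k = \<nu> b k" for k
      using eq[of k] by (cases b; cases b'; simp add: region_sign_def)+
    then show "\<nu> b' j * \<nu> b' (other j) \<noteq> region_sign b'" using e region_sign_cases[of b] by auto
  qed
qed

lemma origin_curve_in_V:
  fixes \<beta>0 :: "real \<Rightarrow> plane"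
  assumes "continuous (at 0) \<beta>0" "\<beta>0 0 = 0"
  obtains \<delta> where "0 < \<delta>" "\<And>w. \<bar>w\<bar> < \<delta> \<Longrightarrow> \<beta>0 w \<in> V"
proof -
  have "\<forall>\<^sub>F w in at 0. \<beta>0 w \<in> V" by (rule eventually_in_open[OF assms(1) openV]) (use assms zeroV in auto)
  then obtain \<delta> where "0 < \<delta>" "\<And>w. w \<noteq> 0 \<Longrightarrow> dist w 0 < \<delta> \<Longrightarrow> \<beta>0 w \<in> V" unfolding eventually_at by blast
  then show thesis using that[of \<delta>] assms(2) zeroV by (metis dist_real_def diff_zero)
qed

text \<open>A curve that runs along the leaf through the origin is the germ prescribed there, including
  the time parametrization.\<close>

lemma origin_germ_along_leaf:
  assumes fa: "\<forall>i. cr i" and \<sigma>: "\<And>b. \<sigma> = \<nu> b j"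
    and J: "is_interval J" "t \<in> J" "\<gamma> t = 0" "continuous_on J \<gamma>" "strict_mono_on J (\<lambda>s. \<sigma> * \<gamma> s $ j)"
    and ev: "\<forall>\<^sub>F s in at t within J. \<gamma> s \<in> part b V \<and> lab b (\<gamma> s) = 0 \<and> (\<gamma> has_vector_derivative fld b Z (\<gamma> s)) (at s within J)"
  shows "\<exists>c. origin_germ V Z c \<and> c 0 = 0 \<and> (\<forall>\<^sub>F s in at t within J. \<gamma> s = c (s - t))"
proof -
  obtain b0 where b0: "\<nu> b0 j * \<nu> b0 (other j) = region_sign b0" "\<And>s. s \<noteq> 0 \<Longrightarrow> mk j (G b0 0 s) s \<in> V \<Longrightarrow> mk j (G b0 0 s) s \<in> part b0 V"
    "\<And>b'. b' \<noteq> b0 \<Longrightarrow> \<nu> b' j * \<nu> b' (other j) \<noteq> region_sign b'" using leaf_through_origin[OF fa] by metis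
  have ev0: "\<forall>\<^sub>F s in at t within J. \<gamma> s \<in> part b0 V \<and> lab b0 (\<gamma> s) = 0 \<and> (\<gamma> has_vector_derivative fld b0 Z (\<gamma> s)) (at s within J)"
    using ev
  proof eventually_elim
    case (elim s)
    then have p: "\<gamma> s \<in> part b V" "\<gamma> s $ other j = G b 0 (\<gamma> s $ j)" using leaf by blast+
    then have "0 < \<nu> b j * \<nu> b (other j) * (\<gamma> s $ other j * \<gamma> s $ j)"
      using G_0[of "\<gamma> s $ j" b] part_nth_nz[OF p(1), of j] by (simp add: mult.assoc)
    moreover have "0 < region_sign b * (\<gamma> s $ other j * \<gamma> s $ j)" using p(1) by (simp add: part_iff[of _ _ _ j])
    ultimately have "\<nu> b j * \<nu> b (other j) = region_sign b"
      using nu[of b j] nu[of b "other j"] region_sign_cases[of b] by (elim disjE) auto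
    then have "b = b0" using b0(3) by blast
    then show ?case using elim by simp
  qed
  have s1: "\<sigma> = 1 \<or> \<sigma> = -1" using \<sigma>[of True] nu[of True j] by simp
  have ss: "\<sigma> * (\<sigma> * x) = x" for x using s1 by auto
  define \<beta>0 where "\<beta>0 w = mk j (G b0 0 (\<sigma> * w)) (\<sigma> * w)" for w
  have G00: "G b0 0 0 = 0" using leaf[of b0 0 0] lab_0 by simp
  have z: "\<beta>0 0 = 0" by (simp add: \<beta>0_def G00 plane_eq_iff[of _ _ j])
  have labz: "lab b0 (\<beta>0 w) = 0" for w using leaf[of b0 "\<beta>0 w" 0] by (simp add: \<beta>0_def)
  have k: "\<sigma> * \<beta>0 w $ j = w" for w by (simp add: \<beta>0_def ss)
  have der: "(\<beta>0 has_vector_derivative (1 / (\<sigma> * fld b0 Z (\<beta>0 w) $ j)) *\<^sub>R fld b0 Z (\<beta>0 w)) (at w)" if "\<beta>0 w \<in> V" for w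
    using leaf_curve(2)[OF that labz s1] unfolding k \<beta>0_def[symmetric] .
  have "continuous (at 0) \<beta>0" using der[of 0] z zeroV has_vector_derivative_continuous by auto
  then obtain \<delta> where \<delta>: "0 < \<delta>" "\<And>w. \<bar>w\<bar> < \<delta> \<Longrightarrow> \<beta>0 w \<in> V" using origin_curve_in_V z by blast
  have bd: "lo \<le> \<sigma> * fld b0 Z (\<beta>0 w) $ j \<and> \<sigma> * fld b0 Z (\<beta>0 w) $ j \<le> hi" if "\<bar>w\<bar> < \<delta>" for w
    using speed[OF \<delta>(2)[OF that], of b0 j] \<sigma>[of b0] by simp
  have ct: "isCont (\<lambda>w. \<sigma> * fld b0 Z (\<beta>0 w) $ j) w" if "\<bar>w\<bar> < \<delta>" for w
  proof -
    have "isCont \<beta>0 w" using der[OF \<delta>(2)[OF that]] by (rule has_vector_derivative_continuous)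
    moreover have "isCont (fld b0 Z) (\<beta>0 w)" using cont_fld openV \<delta>(2)[OF that] continuous_on_eq_continuous_at by blast
    ultimately have "isCont (\<lambda>w. fld b0 Z (\<beta>0 w)) w" by (rule isCont_o2)
    then show ?thesis by (intro continuous_intros)
  qed
  obtain c \<epsilon> where ce: "0 < \<epsilon>" "c 0 = 0"
    "\<And>s. \<bar>s\<bar> < \<epsilon> \<Longrightarrow> (c has_vector_derivative fld b0 Z (c s)) (at s) \<and> (\<exists>w. \<bar>w\<bar> < \<delta> \<and> c s = \<beta>0 w \<and> (s \<noteq> 0 \<longrightarrow> w \<noteq> 0))"
    and uniq: "\<And>J \<gamma> t. is_interval J \<Longrightarrow> t \<in> J \<Longrightarrow> \<gamma> t = 0 \<Longrightarrow> continuous_on J \<gamma> \<Longrightarrow>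
       strict_mono_on J (\<lambda>s. \<sigma> * \<gamma> s $ j) \<Longrightarrow>
       \<forall>\<^sub>F s in at t within J. \<gamma> s = \<beta>0 (\<sigma> * \<gamma> s $ j) \<and> (\<gamma> has_vector_derivative fld b0 Z (\<gamma> s)) (at s within J) \<Longrightarrow>
       \<forall>\<^sub>F s in at t within J. \<gamma> s = c (s - t)"
    by (rule integral_curve_along[where ?\<beta>0.0 = \<beta>0 and E = "fld b0 Z" and k = j, OF s1 \<delta>(1) lo z k bd der[OF \<delta>(2)] ct]) (assumption | (rule that, assumption+))+
  have "\<gamma> s = \<beta>0 (\<sigma> * \<gamma> s $ j)" if "\<gamma> s \<in> part b0 V" "lab b0 (\<gamma> s) = 0" for s
    using leaf_curve(1)[of "\<gamma> s" b0 0 \<sigma>] that s1 by (simp add: part_def \<beta>0_def)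
  then have "\<forall>\<^sub>F s in at t within J. \<gamma> s = c (s - t)"
    by (intro uniq[OF J]) (use ev0 in \<open>auto elim: eventually_mono\<close>)
  moreover have "origin_germ V Z c"
  proof -
    have p: "(c has_vector_derivative fld b0 Z (c s)) (at s) \<and> (s \<noteq> 0 \<longrightarrow> c s \<in> part b0 V)" if se: "\<bar>s\<bar> < \<epsilon>" for s
    proof -
      obtain w where w: "\<bar>w\<bar> < \<delta>" "c s = \<beta>0 w" "s \<noteq> 0 \<longrightarrow> w \<noteq> 0" using ce(3)[OF se] by blast
      have "\<beta>0 w \<in> part b0 V" if "w \<noteq> 0" using b0(2)[of "\<sigma> * w"] \<delta>(2)[OF w(1)] that s1 by (auto simp: \<beta>0_def)
      then show ?thesis using w ce(3)[OF se] by auto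
    qed
    have "crosses_origin V Z c"
      unfolding crosses_origin_def pos_part_eq neg_part_eq
      using p ce(1,2) by (cases b0) (auto simp: fld_def intro!: exI[of _ \<epsilon>])
    then show ?thesis using fa by (simp add: origin_germ_eq)
  qed
  ultimately show ?thesis using ce(2) by blast
qed

lemma origin_germ_along_axis:
  assumes mixed: "cr j" "\<not> cr (other j)" and \<sigma>: "\<sigma> = \<omega> (other j)"
    and J: "is_interval J" "t \<in> J" "\<gamma> t = 0" "continuous_on J \<gamma>" "strict_mono_on J (\<lambda>s. \<sigma> * \<gamma> s $ j)"
    and ev: "\<forall>\<^sub>F s in at t within J. \<gamma> s \<in> Sig_i V (other j) \<and>
      (\<gamma> has_vector_derivative sliding_field Z (other j) (\<gamma> s)) (at s within J)"
  shows "\<exists>c. origin_germ V Z c \<and> c 0 = 0 \<and> (\<forall>\<^sub>F s in at t within J. \<gamma> s = c (s - t))"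
proof -
  let ?S = "sliding_field Z (other j)"
  have s1: "\<sigma> = 1 \<or> \<sigma> = -1" using \<sigma> om by simp
  have ss: "\<sigma> * (\<sigma> * x) = x" for x using s1 by auto
  define \<beta>0 where "\<beta>0 w = mk j 0 (\<sigma> * w)" for w
  have z: "\<beta>0 0 = 0" by (simp add: \<beta>0_def plane_eq_iff[of _ _ j])
  have k: "\<sigma> * \<beta>0 w $ j = w" for w by (simp add: \<beta>0_def ss)
  have "continuous (at 0) \<beta>0" unfolding \<beta>0_def mk_def by (intro continuous_intros)
  then obtain \<delta> where \<delta>: "0 < \<delta>" "\<And>w. \<bar>w\<bar> < \<delta> \<Longrightarrow> \<beta>0 w \<in> V" using origin_curve_in_V z by blast
  have S: "\<beta>0 w \<in> Sig_i V (other j)" if "\<bar>w\<bar> < \<delta>" for w using \<delta>(2)[OF that] by (simp add: Sig_i_def \<beta>0_def)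
  have der: "(\<beta>0 has_vector_derivative (1 / (\<sigma> * ?S (\<beta>0 w) $ j)) *\<^sub>R ?S (\<beta>0 w)) (at w)" if "\<bar>w\<bar> < \<delta>" for w
    using slide_curve(2)[OF S[OF that] mixed(2) s1, of w] unfolding other_other \<beta>0_def[symmetric] .
  have bd: "lo \<le> \<sigma> * ?S (\<beta>0 w) $ j \<and> \<sigma> * ?S (\<beta>0 w) $ j \<le> hi" if "\<bar>w\<bar> < \<delta>" for w
    using slide_speed[OF mixed(2) S[OF that]] \<sigma> by simp
  have ct: "isCont (\<lambda>w. \<sigma> * ?S (\<beta>0 w) $ j) w" if "\<bar>w\<bar> < \<delta>" for w
  proof -
    have "isCont \<beta>0 w" unfolding \<beta>0_def mk_def by (intro continuous_intros)
    moreover have "isCont (\<lambda>p. ?S p $ j) (\<beta>0 w)"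
      using sliding_speed_continuous[OF mixed(2)] openV \<delta>(2)[OF that] by (simp add: continuous_on_eq_continuous_at)
    ultimately have "isCont (\<lambda>w. ?S (\<beta>0 w) $ j) w" by (rule isCont_o2)
    then show ?thesis by (rule continuous_mult[OF continuous_const])
  qed
  obtain c \<epsilon> where ce: "0 < \<epsilon>" "c 0 = 0"
    "\<And>s. \<bar>s\<bar> < \<epsilon> \<Longrightarrow> (c has_vector_derivative ?S (c s)) (at s) \<and> (\<exists>w. \<bar>w\<bar> < \<delta> \<and> c s = \<beta>0 w \<and> (s \<noteq> 0 \<longrightarrow> w \<noteq> 0))"
    and uniq: "\<And>J \<gamma> t. is_interval J \<Longrightarrow> t \<in> J \<Longrightarrow> \<gamma> t = 0 \<Longrightarrow> continuous_on J \<gamma> \<Longrightarrow>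
       strict_mono_on J (\<lambda>s. \<sigma> * \<gamma> s $ j) \<Longrightarrow>
       \<forall>\<^sub>F s in at t within J. \<gamma> s = \<beta>0 (\<sigma> * \<gamma> s $ j) \<and> (\<gamma> has_vector_derivative ?S (\<gamma> s)) (at s within J) \<Longrightarrow>
       \<forall>\<^sub>F s in at t within J. \<gamma> s = c (s - t)"
    by (rule integral_curve_along[where ?\<beta>0.0 = \<beta>0 and E = ?S and k = j, OF s1 \<delta>(1) lo z k bd der ct]) (assumption | (rule that, assumption+))+
  have "\<gamma> s = \<beta>0 (\<sigma> * \<gamma> s $ j)" if "\<gamma> s \<in> Sig_i V (other j)" for s
    using slide_curve(1)[OF that mixed(2) s1] by (simp add: \<beta>0_def)
  then have "\<forall>\<^sub>F s in at t within J. \<gamma> s = c (s - t)"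
    by (intro uniq[OF J]) (use ev in \<open>auto elim: eventually_mono\<close>)
  moreover have "slides_through_origin V Z (other j) c"
    unfolding slides_through_origin_def using ce S by (intro conjI exI[of _ \<epsilon>]) (auto, metis)
  then have "origin_germ V Z c" using mixed by (auto simp: origin_germ_eq)
  ultimately show ?thesis using ce(2) by blast
qed

end

section \<open>Directed curves as arcs\<close>
context regular_system begin

lemma follows_eventually_part:
  assumes "follows V cr lab J \<beta> t" "\<beta> t \<in> part b V"
  shows "\<forall>\<^sub>F s in at t within J. \<beta> s \<in> part b V \<and> lab b (\<beta> s) = lab b (\<beta> t)"
  using assms by (simp add: follows_def)

lemma follows_eventually_slide:
  assumes f: "follows V cr lab J \<beta> t" and i: "\<not> cr i" "\<beta> t \<in> Sig_i V i - {0}"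
  shows "\<forall>\<^sub>F s in at t within J. \<beta> s \<in> Sig_i V i - {0}"
proof -
  have "\<forall>\<^sub>F s in at t within J. \<beta> s \<in> Sig_i V i" using assms unfolding follows_def by auto
  moreover have "continuous (at t within J) \<beta>" using f by (simp add: follows_def)
  then have "\<forall>\<^sub>F s in at t within J. \<beta> s \<in> - {0}" by (rule eventually_in_open) (use i in auto)
  ultimately show ?thesis by eventually_elim auto
qed

lemma governing_speed_continuous:
  assumes f: "follows V cr lab J \<beta> t" and t: "\<beta> t \<notin> exceptional"
    and dir: "\<And>i. \<not> cr i \<Longrightarrow> \<beta> t \<in> Sig_i V i - {0} \<Longrightarrow> k = other i"
  shows "continuous (at t within J) (\<lambda>s. \<sigma> * governing_field (\<beta> s) $ k)"
proof -
  have V: "\<beta> t \<in> V" and cont: "continuous (at t within J) \<beta>" using f by (auto simp: follows_def)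
  have tend: "((\<lambda>s. F (\<beta> s)) \<longlongrightarrow> F (\<beta> t)) (at t within J)" if "continuous_on V F" for F :: "plane \<Rightarrow> real"
  proof -
    have "isCont F (\<beta> t)" using that openV V by (simp add: continuous_on_eq_continuous_at)
    moreover have "(\<beta> \<longlongrightarrow> \<beta> t) (at t within J)" using cont by (simp add: continuous_within)
    ultimately show ?thesis by (rule isCont_tendsto_compose)
  qed
  have "((\<lambda>s. governing_field (\<beta> s) $ k) \<longlongrightarrow> governing_field (\<beta> t) $ k) (at t within J)"
    using V t
  proof (cases rule: exceptional_cases)
    case (1 b)
    have "((\<lambda>s. fld b Z (\<beta> s) $ k) \<longlongrightarrow> fld b Z (\<beta> t) $ k) (at t within J)"
      by (rule tend) (intro continuous_intros cont_fld)
    moreover have "\<forall>\<^sub>F s in at t within J. fld b Z (\<beta> s) $ k = governing_field (\<beta> s) $ k"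
      using follows_eventually_part[OF f 1] by eventually_elim (simp add: governing_field_part[of _ b])
    ultimately show ?thesis unfolding governing_field_part[OF 1] by (rule Lim_transform_eventually)
  next
    case (2 i)
    have "((\<lambda>s. sliding_field Z i (\<beta> s) $ k) \<longlongrightarrow> sliding_field Z i (\<beta> t) $ k) (at t within J)"
      unfolding dir[OF 2] by (rule tend[OF sliding_speed_continuous[OF 2(1)]])
    moreover have "\<forall>\<^sub>F s in at t within J. sliding_field Z i (\<beta> s) $ k = governing_field (\<beta> s) $ k"
      using follows_eventually_slide[OF f 2] by eventually_elim (simp add: governing_field_slide[OF 2(1)])
    ultimately show ?thesis unfolding governing_field_slide[OF 2] by (rule Lim_transform_eventually)
  qed
  then show ?thesis unfolding continuous_within by (rule tendsto_mult_left)
qed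

text \<open>A curve with the topology and the direction of a trajectory becomes an arc of \<open>Z\<close> after a
  change of time.\<close>

lemma realization:
  assumes J: "is_interval J" "J \<noteq> {}" and f: "\<And>t. t \<in> J \<Longrightarrow> follows V cr lab J \<beta> t"
    and dir: "directed V cr \<nu> \<omega> j J \<beta> k \<sigma>"
  shows "\<exists>\<tau> \<gamma>. \<tau> t0 = a \<and> continuous_on J \<tau> \<and> strict_mono_on J \<tau> \<and> (\<forall>t\<in>J. \<gamma> (\<tau> t) = \<beta> t) \<and>
    arc_of V Z (germs V Z) (\<tau> ` J) \<gamma>"
proof -
  have mono: "strict_mono_on J (\<lambda>t. \<sigma> * \<beta> t $ k)" and s1: "\<sigma> = 1 \<or> \<sigma> = -1"
    and dp: "\<And>t b. t \<in> J \<Longrightarrow> \<beta> t \<in> part b V \<Longrightarrow> \<sigma> = \<nu> b k"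
    and ds: "\<And>t i. t \<in> J \<Longrightarrow> \<not> cr i \<Longrightarrow> \<beta> t \<in> Sig_i V i \<Longrightarrow> k = other i \<and> \<sigma> = \<omega> i"
    and dz: "\<And>t. t \<in> J \<Longrightarrow> (\<exists>i. cr i) \<or> \<beta> t \<noteq> 0"
    and dj: "k = j \<or> (\<forall>t\<in>J. \<beta> t $ j = 0)" using dir by (auto simp: directed_def)
  have V: "\<And>t. t \<in> J \<Longrightarrow> \<beta> t \<in> V" using f by (simp add: follows_def)
  have cb: "continuous_on J \<beta>" using f by (simp add: continuous_on_eq_continuous_within follows_def)
  have ss: "\<sigma> * (\<sigma> * x) = x" for x using s1 by auto
  let ?K = "{t. \<beta> t \<in> exceptional}"
  \<comment> \<open>The clock is the coordinate \<open>k\<close>, and its speed is bounded away from \<open>0\<close>.\<close>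
  have "\<exists>\<tau>. \<tau> t0 = a \<and> continuous_on J \<tau> \<and> strict_mono_on J \<tau> \<and> is_interval (\<tau> ` J) \<and>
     (\<forall>\<gamma>. (\<forall>t\<in>J. \<gamma> (\<tau> t) = \<beta> t) \<longrightarrow>
        (\<forall>t\<in>J - ?K. (\<gamma> has_vector_derivative governing_field (\<beta> t)) (at (\<tau> t) within \<tau> ` J)))"
  proof (rule time_change[OF J(1) _ mono])
    show "continuous_on J (\<lambda>t. \<sigma> * \<beta> t $ k)" by (intro continuous_intros cb)
    show "\<forall>\<^sub>F s in at t within J. s \<notin> ?K" if "t \<in> J" for t
      using exceptional_sparse[OF f[OF that] dz[OF that]] by simp
    show "0 < lo" by (rule lo)
    fix t assume "t \<in> J - ?K"
    then have t: "t \<in> J" "\<beta> t \<notin> exceptional" by auto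
    show "lo \<le> \<sigma> * governing_field (\<beta> t) $ k \<and> \<sigma> * governing_field (\<beta> t) $ k \<le> hi"
      using governing_speed[OF V[OF t(1)] t(2), of \<sigma> k] dp[OF t(1)] ds[OF t(1)] by blast
    show "continuous (at t within J) (\<lambda>s. \<sigma> * governing_field (\<beta> s) $ k)"
      by (rule governing_speed_continuous[OF f[OF t(1)] t(2)]) (use ds[OF t(1)] in blast)
    show "\<exists>D. \<beta> t = D (\<sigma> * \<beta> t $ k) \<and> (\<forall>\<^sub>F s in at t within J. \<beta> s = D (\<sigma> * \<beta> s $ k)) \<and>
        (D has_vector_derivative (1 / (\<sigma> * governing_field (\<beta> t) $ k)) *\<^sub>R governing_field (\<beta> t)) (at (\<sigma> * \<beta> t $ k))"
      using V[OF t(1)] t(2)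
    proof (cases rule: exceptional_cases)
      case (1 b)
      have kj: "k = j" using dj part_nth_nz[OF 1, of j] t(1) by auto
      let ?D = "\<lambda>w. mk j (G b (lab b (\<beta> t)) (\<sigma> * w)) (\<sigma> * w)"
      have ev: "\<forall>\<^sub>F s in at t within J. \<beta> s = ?D (\<sigma> * \<beta> s $ k)"
        using follows_eventually_part[OF f[OF t(1)] 1] unfolding kj
        by eventually_elim (rule leaf_curve(1)[OF _ _ s1], auto simp: part_def)
      show ?thesis
        by (rule exI[of _ ?D], intro conjI ev)
          (use leaf_curve[OF V[OF t(1)] refl s1, of b] governing_field_part[OF 1] in \<open>simp_all only: kj\<close>)
    next
      case (2 i)
      have ki: "k = other i" using ds[OF t(1) 2(1)] 2 by blast
      let ?D = "\<lambda>w. mk (other i) 0 (\<sigma> * w)"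
      have ev: "\<forall>\<^sub>F s in at t within J. \<beta> s = ?D (\<sigma> * \<beta> s $ k)"
        using follows_eventually_slide[OF f[OF t(1)] 2] unfolding ki
        by eventually_elim (rule slide_curve(1)[OF _ 2(1) s1], auto)
      have S: "\<beta> t \<in> Sig_i V i" using 2 by blast
      show ?thesis
        by (rule exI[of _ ?D], intro conjI ev)
          (use slide_curve[OF S 2(1) s1] governing_field_slide[OF 2] in \<open>simp_all only: ki\<close>)
    qed
  qed
  then obtain \<tau> where \<tau>0: "\<tau> t0 = a" and \<tau>: "continuous_on J \<tau>" "strict_mono_on J \<tau>" "is_interval (\<tau> ` J)"
    and \<tau>d: "\<And>\<gamma> t. (\<And>t. t \<in> J \<Longrightarrow> \<gamma> (\<tau> t) = \<beta> t) \<Longrightarrow> t \<in> J - ?K \<Longrightarrow>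
        (\<gamma> has_vector_derivative governing_field (\<beta> t)) (at (\<tau> t) within \<tau> ` J)" by blast
  have inj: "inj_on \<tau> J" using \<tau>(2) by (rule strict_mono_on_imp_inj_on)
  define ti where "ti = inv_into J \<tau>"
  have ti: "ti (\<tau> t) = t" if "t \<in> J" for t using inj that by (simp add: ti_def)
  define \<gamma> where "\<gamma> = \<beta> \<circ> ti"
  have \<gamma>: "\<gamma> (\<tau> t) = \<beta> t" if "t \<in> J" for t using ti that by (simp add: \<gamma>_def)
  have cti: "continuous_on (\<tau> ` J) ti" unfolding ti_def using \<tau>(2) J(1) by (rule continuous_on_inv_into_strict_mono)
  have tr: "\<forall>\<^sub>F y in at (\<tau> t) within \<tau> ` J. P (\<gamma> y)" if t: "t \<in> J" and ev: "\<forall>\<^sub>F s in at t within J. P (\<beta> s)" for P t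
  proof -
    have "filterlim ti (at t within J) (at (\<tau> t) within \<tau> ` J)"
      unfolding filterlim_at
    proof
      show "\<forall>\<^sub>F y in at (\<tau> t) within \<tau> ` J. ti y \<in> J \<and> ti y \<noteq> t"
        unfolding eventually_at_filter by (rule always_eventually) (use t ti in auto)
      show "(ti \<longlongrightarrow> t) (at (\<tau> t) within \<tau> ` J)" using cti t ti[of t] unfolding continuous_on_def by force
    qed
    from eventually_compose_filterlim[OF ev this] show ?thesis by (simp add: \<gamma>_def)
  qed
  have cg: "continuous_on (\<tau> ` J) \<gamma>"
    unfolding \<gamma>_def by (rule continuous_on_compose[OF cti]) (use ti cb in \<open>auto intro: continuous_on_subset\<close>)
  have mg: "strict_mono_on (\<tau> ` J) (\<lambda>s. \<sigma> * \<gamma> s $ k)"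
  proof (rule strict_mono_onI)
    fix r s assume rs: "r \<in> \<tau> ` J" "s \<in> \<tau> ` J" "r < s"
    then obtain x y where xy: "x \<in> J" "y \<in> J" "r = \<tau> x" "s = \<tau> y" by blast
    then have "x < y" using rs strict_mono_onD[OF \<tau>(2), of y x] by (metis linorder_neqE_linordered_idom order.asym)
    then show "\<sigma> * \<gamma> r $ k < \<sigma> * \<gamma> s $ k" using strict_mono_onD[OF mono xy(1,2)] xy by (simp add: \<gamma>)
  qed
  have "obeys V Z (germs V Z) (\<tau> ` J) \<gamma> (\<tau> t)" if t: "t \<in> J" for t
  proof -
    note ft = f[OF t]
    have der: "(\<gamma> has_vector_derivative governing_field (\<beta> s)) (at (\<tau> s) within \<tau> ` J)" if "s \<in> J" "\<beta> s \<notin> exceptional" for s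
      by (rule \<tau>d[OF \<gamma>]) (use that in auto)
    have ct: "continuous (at (\<tau> t) within \<tau> ` J) \<gamma>" using cg t by (auto simp: continuous_on_eq_continuous_within)
    have derp: "(\<gamma> has_vector_derivative fld b Z (\<beta> s)) (at (\<tau> s) within \<tau> ` J)" if "s \<in> J" "\<beta> s \<in> part b V" for s b
    proof -
      have "\<beta> s \<notin> exceptional" using part_not_Sig[OF that(2)] zeroV by (auto simp: exceptional_def Sig_iff Sig_i_def)
      from der[OF that(1) this] show ?thesis using governing_field_part[OF that(2)] by simp
    qed
    have ders: "(\<gamma> has_vector_derivative sliding_field Z i (\<beta> s)) (at (\<tau> s) within \<tau> ` J)"
      if "s \<in> J" "\<not> cr i" "\<beta> s \<in> Sig_i V i - {0}" for s i
      using der[OF that(1) sliding_not_exceptional[OF that(2,3)]] governing_field_slide[OF that(2,3)] by simp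
    have orig: "\<exists>c. origin_germ V Z c \<and> c 0 = 0 \<and> (\<forall>\<^sub>F s in at (\<tau> t) within \<tau> ` J. \<gamma> s = c (s - \<tau> t))" if z: "\<beta> t = 0"
    proof -
      have tJ: "\<tau> t \<in> \<tau> ` J" "\<gamma> (\<tau> t) = 0" using t z \<gamma> by auto
      have crj: "cr j" using dz[OF t] z types by (metis eq_other_iff)
      have at_img: "\<forall>\<^sub>F s in at (\<tau> t) within \<tau> ` J. s \<in> \<tau> ` J" by (rule eventually_in_at_within)
      show ?thesis
      proof (cases "cr (other j)")
        case True
        then have fa: "\<forall>i. cr i" using crj by (metis eq_other_iff)
        then obtain b where b: "\<forall>\<^sub>F s in at t within J. \<beta> s \<in> part b V \<and> lab b (\<beta> s) = 0"
          using ft z by (auto simp: follows_def)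
        have ev: "\<forall>\<^sub>F s in at (\<tau> t) within \<tau> ` J. \<gamma> s \<in> part b V \<and> lab b (\<gamma> s) = 0 \<and>
            (\<gamma> has_vector_derivative fld b Z (\<gamma> s)) (at s within \<tau> ` J)"
          using tr[OF t b] at_img by eventually_elim (use derp \<gamma> in auto)
        have k: "k = j" "\<And>b. \<sigma> = \<nu> b j" using dir crj by (auto simp: directed_def)
        show ?thesis by (rule origin_germ_along_leaf[OF fa k(2) \<tau>(3) tJ cg _ ev]) (use mg k(1) in auto)
      next
        case False
        have S: "\<beta> t \<in> Sig_i V (other j)" using z zeroV by (simp add: Sig_i_def)
        have k: "k = j" "\<sigma> = \<omega> (other j)" using ds[OF t False S] by auto
        have b: "\<forall>\<^sub>F s in at t within J. \<beta> s \<in> Sig_i V (other j) - {0}"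
        proof -
          have eqs: "(\<forall>i. cr i) = False" "(\<exists>i. cr i) = True" using False crj by auto
          have "\<forall>i. \<not> cr i \<longrightarrow> (\<forall>\<^sub>F s in at t within J. \<beta> s \<in> Sig_i V i - {0})"
            using ft z unfolding follows_def by (simp only: eqs if_True if_False simp_thms) blast
          then show ?thesis using False by blast
        qed
        have ev: "\<forall>\<^sub>F s in at (\<tau> t) within \<tau> ` J. \<gamma> s \<in> Sig_i V (other j) \<and>
           (\<gamma> has_vector_derivative sliding_field Z (other j) (\<gamma> s)) (at s within \<tau> ` J)"
          using tr[OF t b] at_img by eventually_elim (use ders False \<gamma> in auto)
        show ?thesis by (rule origin_germ_along_axis[OF crj False k(2) \<tau>(3) tJ cg _ ev]) (use mg k(1) in auto)
      qed
    qed
    show ?thesis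
      unfolding obeys_iff \<gamma>[OF t]
    proof (intro conjI allI impI V[OF t] derp[OF t] ders[OF t] orig)
      show "\<forall>\<^sub>F s in at (\<tau> t) within \<tau> ` J. \<gamma> s \<notin> Sig V" if "cr i" "\<beta> t \<in> Sig_i V i - {0}" for i
        by (rule tr[OF t]) (use ft that in \<open>auto simp: follows_def\<close>)
      show "\<forall>\<^sub>F s in at (\<tau> t) within \<tau> ` J. \<gamma> s \<in> Sig_i V i" if "\<not> cr i" "\<beta> t \<in> Sig_i V i - {0}" for i
        by (rule tr[OF t]) (use follows_eventually_slide[OF ft that] in \<open>auto elim: eventually_mono\<close>)
    qed (use ct in auto)
  qed
  then have "arc_of V Z (germs V Z) (\<tau> ` J) \<gamma>" unfolding arc_of_def using \<tau>(3) J(2) by auto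
  then show ?thesis using \<tau>0 \<tau> \<gamma> by (intro exI[of _ \<tau>] exI[of _ \<gamma>]) simp
qed

end

section \<open>Homeomorphisms that preserve trajectories\<close>
lemma part_sgn: "p \<in> part b V \<longleftrightarrow> p \<in> V \<and> sgn (p $ other j) * sgn (p $ j) = region_sign b"
  unfolding part_iff[of p b V j]
  by (cases b) (auto simp: region_sign_def sgn_if zero_less_mult_iff mult_less_0_iff)

text \<open>The order conditions preserve \<open>directed\<close> and the conditions on signs and labels preserve
  \<open>follows\<close>. Labels need only be compared within one quadrant.\<close>

locale trajectory_conjugacy =
  S: regular_system Z V j \<nu> \<omega> cr G lab lo hi + S': regular_system Z' V' j \<nu> \<omega> cr G' lab' lo' hi'
  for Z V j \<nu> \<omega> cr G lab lo hi Z' V' G' lab' lo' hi' +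
  fixes h g :: "plane \<Rightarrow> plane"
  assumes homeo: "homeomorphism V V' h g"
    and sgn_h: "p \<in> V \<Longrightarrow> sgn (h p $ k) = sgn (p $ k)"
    and less_h: "p \<in> V \<Longrightarrow> q \<in> V \<Longrightarrow> h p $ j < h q $ j \<longleftrightarrow> p $ j < q $ j"
    and less_axis: "p \<in> V \<Longrightarrow> q \<in> V \<Longrightarrow> p $ j = 0 \<Longrightarrow> q $ j = 0 \<Longrightarrow>
        h p $ other j < h q $ other j \<longleftrightarrow> p $ other j < q $ other j"
    and lab_h: "p \<in> part b V \<Longrightarrow> q \<in> part b V \<Longrightarrow> sgn (p $ other j) = sgn (q $ other j) \<Longrightarrow>
        lab' b (h p) = lab' b (h q) \<longleftrightarrow> lab b p = lab b q"
    and lab_h_0: "p \<in> part b V \<Longrightarrow> lab' b (h p) = 0 \<longleftrightarrow> lab b p = 0"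
begin

lemma h_in: "p \<in> V \<Longrightarrow> h p \<in> V'" and g_in: "q \<in> V' \<Longrightarrow> g q \<in> V"
  and g_h: "p \<in> V \<Longrightarrow> g (h p) = p" and h_g: "q \<in> V' \<Longrightarrow> h (g q) = q"
  using homeo by (auto simp: homeomorphism_def)

lemma h_nth_0: "p \<in> V \<Longrightarrow> h p $ k = 0 \<longleftrightarrow> p $ k = 0"
  using sgn_h[of p k] by (metis sgn_0_0)

lemma h_eq_0: "p \<in> V \<Longrightarrow> h p = 0 \<longleftrightarrow> p = 0"
  using h_nth_0[of p] by (simp add: vec_eq_iff)

lemma h_part: "p \<in> V \<Longrightarrow> h p \<in> part b V' \<longleftrightarrow> p \<in> part b V"
  using h_in sgn_h by (simp add: part_sgn[of _ _ _ j])

lemma h_Sig_i: "p \<in> V \<Longrightarrow> h p \<in> Sig_i V' i \<longleftrightarrow> p \<in> Sig_i V i"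
  using h_in h_nth_0 by (simp add: Sig_i_def)

lemma h_Sig: "p \<in> V \<Longrightarrow> h p \<in> Sig V' \<longleftrightarrow> p \<in> Sig V"
  using h_in h_nth_0 by (simp add: Sig_iff)

lemma image_Sig: "h ` Sig V = Sig V'"
proof
  show "h ` Sig V \<subseteq> Sig V'" using h_Sig by (auto simp: Sig_iff)
  show "Sig V' \<subseteq> h ` Sig V"
  proof
    fix q assume q: "q \<in> Sig V'"
    then have "q \<in> V'" by (simp add: Sig_iff)
    then have "h (g q) = q" "g q \<in> V" using h_g g_in by auto
    then show "q \<in> h ` Sig V" using q h_Sig[of "g q"] by (metis imageI)
  qed
qed

lemma swap: "trajectory_conjugacy Z' V' j \<nu> \<omega> cr G' lab' lo' hi' Z V G lab lo hi g h"
proof unfold_locales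
  show "homeomorphism V' V g h" using homeo by (rule homeomorphism_symD)
  note gi = g_in h_g
  show "sgn (g p $ k) = sgn (p $ k)" if "p \<in> V'" for p k using sgn_h[OF g_in[OF that], of k] h_g[OF that] by simp
  show "(g p $ j < g q $ j) = (p $ j < q $ j)" if "p \<in> V'" "q \<in> V'" for p q
    using less_h[OF g_in[OF that(1)] g_in[OF that(2)]] h_g that by simp
  show "(g p $ other j < g q $ other j) = (p $ other j < q $ other j)"
    if "p \<in> V'" "q \<in> V'" "p $ j = 0" "q $ j = 0" for p q
    using less_axis[OF g_in[OF that(1)] g_in[OF that(2)]] h_nth_0[OF g_in[OF that(1)], of j] h_nth_0[OF g_in[OF that(2)], of j] h_g that by simp
  have pg: "g p \<in> part b V" if "p \<in> part b V'" for p b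
    using h_part[of "g p" b] gi[of p] that by (simp add: part_def)
  show "(lab b (g p) = lab b (g q)) = (lab' b p = lab' b q)"
    if "p \<in> part b V'" "q \<in> part b V'" "sgn (p $ other j) = sgn (q $ other j)" for p q b
  proof -
    have "p \<in> V'" "q \<in> V'" using that by (auto simp: part_def)
    then show ?thesis using lab_h[OF pg[OF that(1)] pg[OF that(2)]] that(3) sgn_h[OF g_in, of p "other j"]
        sgn_h[OF g_in, of q "other j"] h_g by simp
  qed
  show "(lab b (g p) = 0) = (lab' b p = 0)" if "p \<in> part b V'" for p b
    using lab_h_0[OF pg[OF that]] h_g[of p] that by (simp add: part_def)
qed

lemma h_isCont: "p \<in> V \<Longrightarrow> isCont h p"
  using homeo S.openV by (auto simp: homeomorphism_def continuous_on_eq_continuous_at)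

lemma follows_image:
  assumes f: "follows V cr lab J \<beta> t" and V: "\<And>s. s \<in> J \<Longrightarrow> \<beta> s \<in> V"
  shows "follows V' cr lab' J (\<lambda>s. h (\<beta> s)) t"
proof -
  have Vt: "\<beta> t \<in> V" and ct: "continuous (at t within J) \<beta>" using f by (auto simp: follows_def)
  have "(\<beta> \<longlongrightarrow> \<beta> t) (at t within J)" using ct by (simp add: continuous_within)
  from isCont_tendsto_compose[OF h_isCont[OF Vt] this] have cont: "continuous (at t within J) (\<lambda>s. h (\<beta> s))"
    by (simp add: continuous_within)
  have inV: "\<forall>\<^sub>F s in at t within J. \<beta> s \<in> V" using ct S.openV Vt by (rule eventually_in_open)
  have sg: "\<forall>\<^sub>F s in at t within J. sgn (\<beta> s $ k) = sgn (\<beta> t $ k)" if nz: "\<beta> t $ k \<noteq> 0" for k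
  proof -
    have "open {p :: plane. 0 < \<beta> t $ k * p $ k}" by (intro open_Collect_less continuous_intros)
    then have "\<forall>\<^sub>F s in at t within J. \<beta> s \<in> {p. 0 < \<beta> t $ k * p $ k}"
      by (rule eventually_in_open[OF ct]) (use nz in \<open>auto simp: zero_less_mult_iff linorder_neq_iff\<close>)
    then show ?thesis by eventually_elim (auto simp: zero_less_mult_iff)
  qed
  have labp: "\<forall>\<^sub>F s in at t within J. h (\<beta> s) \<in> part b V' \<and> lab' b (h (\<beta> s)) = lab' b (h (\<beta> t))"
    if b: "\<beta> t \<in> part b V" for b
    using S.follows_eventually_part[OF f b] sg[OF part_nth_nz[OF b], of "other j"] inV
  proof eventually_elim
    case (elim s)
    then show ?case using h_part[of "\<beta> s" b] lab_h[of "\<beta> s" b "\<beta> t"] b by auto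
  qed
  have sig: "if cr i then \<forall>\<^sub>F s in at t within J. h (\<beta> s) \<notin> Sig V' else \<forall>\<^sub>F s in at t within J. h (\<beta> s) \<in> Sig_i V' i"
    if i: "\<beta> t \<in> Sig_i V i - {0}" for i
  proof (cases "cr i")
    case True
    then have "\<forall>\<^sub>F s in at t within J. \<beta> s \<notin> Sig V" using f i unfolding follows_def by auto
    with inV have "\<forall>\<^sub>F s in at t within J. h (\<beta> s) \<notin> Sig V'" by eventually_elim (simp add: h_Sig)
    then show ?thesis using True by simp
  next
    case False
    have "\<forall>\<^sub>F s in at t within J. h (\<beta> s) \<in> Sig_i V' i"
      using S.follows_eventually_slide[OF f False i] inV by eventually_elim (simp add: h_Sig_i)
    then show ?thesis using False by simp
  qed
  have zero: "if \<forall>i. cr i then \<exists>b. \<forall>\<^sub>F s in at t within J. h (\<beta> s) \<in> part b V' \<and> lab' b (h (\<beta> s)) = 0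
       else if \<exists>i. cr i then \<forall>i. \<not> cr i \<longrightarrow> (\<forall>\<^sub>F s in at t within J. h (\<beta> s) \<in> Sig_i V' i - {0})
       else \<forall>\<^sub>F s in at t within J. h (\<beta> s) = 0" if z: "\<beta> t = 0"
  proof -
    have fz: "if \<forall>i. cr i then \<exists>b. \<forall>\<^sub>F s in at t within J. \<beta> s \<in> part b V \<and> lab b (\<beta> s) = 0
       else if \<exists>i. cr i then \<forall>i. \<not> cr i \<longrightarrow> (\<forall>\<^sub>F s in at t within J. \<beta> s \<in> Sig_i V i - {0})
       else \<forall>\<^sub>F s in at t within J. \<beta> s = 0" using f z unfolding follows_def by blast
    consider "\<forall>i. cr i" | "\<not> (\<forall>i. cr i)" "\<exists>i. cr i" | "\<not> (\<exists>i. cr i)" by blast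
    then show ?thesis
    proof cases
      case 1
      then obtain b where "\<forall>\<^sub>F s in at t within J. \<beta> s \<in> part b V \<and> lab b (\<beta> s) = 0" using fz by auto
      with inV have "\<forall>\<^sub>F s in at t within J. h (\<beta> s) \<in> part b V' \<and> lab' b (h (\<beta> s)) = 0"
        by eventually_elim (simp add: h_part lab_h_0)
      then show ?thesis using 1 by auto
    next
      case 2
      have "\<forall>\<^sub>F s in at t within J. h (\<beta> s) \<in> Sig_i V' i - {0}" if "\<not> cr i" for i
      proof -
        have "\<forall>\<^sub>F s in at t within J. \<beta> s \<in> Sig_i V i - {0}" using fz 2 that by simp
        with inV show ?thesis by eventually_elim (simp add: h_Sig_i h_eq_0)
      qed
      then show ?thesis using 2 by auto
    next
      case 3
      then have "\<forall>\<^sub>F s in at t within J. \<beta> s = 0" using fz by auto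
      then have "\<forall>\<^sub>F s in at t within J. h (\<beta> s) = 0" by eventually_elim (simp add: h_eq_0 S.zeroV)
      then show ?thesis using 3 by auto
    qed
  qed
  show ?thesis
    unfolding follows_def
    using Vt h_in[OF Vt] cont labp sig zero h_part[OF Vt] h_Sig_i[OF Vt] h_eq_0[OF Vt]
    by (intro conjI allI impI) auto
qed

lemma directed_image:
  assumes d: "directed V cr \<nu> \<omega> j J \<beta> k \<sigma>" and V: "\<And>s. s \<in> J \<Longrightarrow> \<beta> s \<in> V"
  shows "directed V' cr \<nu> \<omega> j J (\<lambda>s. h (\<beta> s)) k \<sigma>"
proof -
  have s1: "\<sigma> = 1 \<or> \<sigma> = -1" and mono: "strict_mono_on J (\<lambda>t. \<sigma> * \<beta> t $ k)"
    and kj: "k = j \<or> k = other j \<and> (\<forall>t\<in>J. \<beta> t $ j = 0)"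
    using d eq_other_iff[of k j] by (auto simp: directed_def)
  have eq: "h (\<beta> s) $ k < h (\<beta> t) $ k \<longleftrightarrow> \<beta> s $ k < \<beta> t $ k" if "s \<in> J" "t \<in> J" for s t
    using kj less_h[OF V[OF that(1)] V[OF that(2)]] less_axis[OF V[OF that(1)] V[OF that(2)]] that by auto
  have "strict_mono_on J (\<lambda>t. \<sigma> * h (\<beta> t) $ k)"
  proof (rule strict_mono_onI)
    fix r s assume rs: "r \<in> J" "s \<in> J" "r < s"
    have "\<sigma> * \<beta> r $ k < \<sigma> * \<beta> s $ k" using strict_mono_onD[OF mono rs] .
    then show "\<sigma> * h (\<beta> r) $ k < \<sigma> * h (\<beta> s) $ k" using s1 eq rs by auto
  qed
  then show ?thesis
    using d V h_part h_Sig_i h_eq_0 h_nth_0 unfolding directed_def by simp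
qed

text \<open>The image of an arc is a directed curve and becomes an arc in its own time.\<close>

lemma transfer_arc:
  assumes arc: "arc_of V Z (germs V Z) J \<gamma>" and d: "directed V cr \<nu> \<omega> j J \<gamma> k \<sigma>"
  shows "\<exists>\<tau> \<gamma>'. \<tau> t0 = a \<and> continuous_on J \<tau> \<and> strict_mono_on J \<tau> \<and> (\<forall>t\<in>J. \<gamma>' (\<tau> t) = h (\<gamma> t)) \<and>
    arc_of V' Z' (germs V' Z') (\<tau> ` J) \<gamma>'"
proof (rule S'.realization)
  have V: "\<gamma> s \<in> V" if "s \<in> J" for s using S.arc_follows[OF arc that] by (simp add: follows_def)
  show "is_interval J" "J \<noteq> {}" using arc by (auto simp: arc_of_def)
  show "follows V' cr lab' J (\<lambda>t. h (\<gamma> t)) t" if "t \<in> J" for t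
    by (rule follows_image[OF S.arc_follows[OF arc that] V])
  show "directed V' cr \<nu> \<omega> j J (\<lambda>t. h (\<gamma> t)) k \<sigma>" by (rule directed_image[OF d V])
qed

text \<open>If both axes slide, the arc resting at the origin is directed in no coordinate; it is a trajectory of both fields.\<close>

lemma zero_trajectory:
  assumes "\<not> (\<exists>i. cr i)" shows "trajectory V' Z' UNIV (\<lambda>_. 0)"
  unfolding trajectory_def
proof (intro conjI allI impI)
  have "obeys V' Z' (germs V' Z') UNIV (\<lambda>_. 0) t" for t
    unfolding S'.obeys_iff using assms S'.zeroV by (auto simp: part_def S'.origin_germ_eq)
  then show "arc_of V' Z' (germs V' Z') UNIV (\<lambda>_. 0)" by (auto simp: arc_of_def)
qed auto

text \<open>Arcs correspond to arcs in both directions. A proper extension of the image of a maximal arc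
  would therefore give one of the maximal arc itself.\<close>

lemma maps_trajectories_h: "maps_trajectories V Z V' Z' h"
  unfolding maps_trajectories_def
proof (intro allI impI)
  fix J \<gamma> assume tr: "trajectory V Z J \<gamma>"
  then have arc: "arc_of V Z (germs V Z) J \<gamma>"
    and maxi: "\<And>J' \<gamma>'. arc_of V Z (germs V Z) J' \<gamma>' \<Longrightarrow> J \<subseteq> J' \<Longrightarrow> (\<forall>t\<in>J. \<gamma>' t = \<gamma> t) \<Longrightarrow> J' = J"
    unfolding trajectory_def by blast+
  interpret sw: trajectory_conjugacy Z' V' j \<nu> \<omega> cr G' lab' lo' hi' Z V G lab lo hi g h by (rule swap)
  obtain t0 where t0: "t0 \<in> J" using arc by (auto simp: arc_of_def)
  from S.arc_directed[OF arc] show "\<exists>J' \<gamma>' \<tau>. trajectory V' Z' J' \<gamma>' \<and> strict_mono_on J \<tau> \<and> \<tau> ` J = J' \<and>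
          (\<forall>t\<in>J. h (\<gamma> t) = \<gamma>' (\<tau> t))"
  proof (elim disjE exE)
    assume z: "\<not> (\<exists>i. cr i) \<and> (\<forall>t\<in>J. \<gamma> t = 0)"
    have "arc_of V Z (germs V Z) UNIV (\<lambda>_. 0)" using sw.zero_trajectory z by (auto simp: trajectory_def)
    then have "UNIV = J" using maxi z by auto
    then show ?thesis
      using zero_trajectory z h_eq_0[OF S.zeroV]
      by (intro exI[of _ UNIV] exI[of _ "\<lambda>_. 0"] exI[of _ "\<lambda>t. t"]) (auto simp: strict_mono_on_def)
  next
    fix k \<sigma> assume d: "directed V cr \<nu> \<omega> j J \<gamma> k \<sigma>"
    obtain \<tau> \<gamma>' where \<tau>: "continuous_on J \<tau>" "strict_mono_on J \<tau>" "\<And>t. t \<in> J \<Longrightarrow> \<gamma>' (\<tau> t) = h (\<gamma> t)"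
      and arc': "arc_of V' Z' (germs V' Z') (\<tau> ` J) \<gamma>'"
      using transfer_arc[OF arc d, of t0 0] by blast
    have "J'' = \<tau> ` J" if arc'': "arc_of V' Z' (germs V' Z') J'' \<gamma>''" and ext: "\<tau> ` J \<subseteq> J''" "\<forall>t\<in>\<tau> ` J. \<gamma>'' t = \<gamma>' t" for J'' \<gamma>''
    proof -
      have "\<exists>k \<sigma>. directed V' cr \<nu> \<omega> j J'' \<gamma>'' k \<sigma>"
      proof (rule ccontr)
        assume "\<not> ?thesis"
        then have z: "\<not> (\<exists>i. cr i)" "\<forall>t\<in>J''. \<gamma>'' t = 0" using S'.arc_directed[OF arc''] by blast+
        have Vt: "\<gamma> t0 \<in> V" using S.arc_follows[OF arc t0] by (simp add: follows_def)
        have "\<gamma>'' (\<tau> t0) = 0" using z ext t0 by blast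
        then have "h (\<gamma> t0) = 0" using ext t0 \<tau>(3) by auto
        then have "\<gamma> t0 = 0" using h_eq_0[OF Vt] by simp
        then show False using d z t0 by (auto simp: directed_def)
      qed
      then obtain k' \<sigma>' where d': "directed V' cr \<nu> \<omega> j J'' \<gamma>'' k' \<sigma>'" by blast
      obtain \<tau>2 \<gamma>3 where \<tau>2: "\<tau>2 (\<tau> t0) = t0" "continuous_on J'' \<tau>2" "strict_mono_on J'' \<tau>2"
          "\<And>t. t \<in> J'' \<Longrightarrow> \<gamma>3 (\<tau>2 t) = g (\<gamma>'' t)" and arc3: "arc_of V Z (germs V Z) (\<tau>2 ` J'') \<gamma>3"
        using sw.transfer_arc[OF arc'' d', of "\<tau> t0" t0] by blast
      have comp: "\<gamma>3 (\<tau>2 (\<tau> t)) = \<gamma> t" if "t \<in> J" for t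
      proof -
        have "\<gamma> t \<in> V" using S.arc_follows[OF arc that] by (simp add: follows_def)
        then show ?thesis using \<tau>2(4)[of "\<tau> t"] ext \<tau>(3)[OF that] that g_h by auto
      qed
      have "\<exists>c. \<forall>t\<in>J. \<tau>2 (\<tau> t) = t + c"
      proof (rule S.arc_time_unique[OF arc arc3 d])
        show "continuous_on J (\<lambda>t. \<tau>2 (\<tau> t))" by (rule continuous_on_compose2[OF \<tau>2(2) \<tau>(1) ext(1)])
        show "strict_mono_on J (\<lambda>t. \<tau>2 (\<tau> t))"
          using \<tau>(2) \<tau>2(3) ext(1) unfolding strict_mono_on_def by blast
      qed (use ext(1) comp in auto)
      then have id: "\<tau>2 (\<tau> t) = t" if "t \<in> J" for t using \<tau>2(1) t0 that by force
      have "\<tau>2 ` J'' = J"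
      proof (rule maxi[OF arc3])
        show "J \<subseteq> \<tau>2 ` J''" using id ext(1) by (metis image_subset_iff subsetI image_eqI)
        show "\<forall>t\<in>J. \<gamma>3 t = \<gamma> t" using comp id by simp
      qed
      moreover have "inj_on \<tau>2 J''" using \<tau>2(3) by (rule strict_mono_on_imp_inj_on)
      moreover have "\<tau>2 ` \<tau> ` J = J" using id by (auto simp: image_image)
      ultimately show ?thesis using ext(1) by (metis inj_on_image_eq_iff order_refl)
    qed
    then have "trajectory V' Z' (\<tau> ` J) \<gamma>'" using arc' unfolding trajectory_def by blast
    then show ?thesis using \<tau> by (intro exI[of _ "\<tau> ` J"] exI[of _ \<gamma>'] exI[of _ \<tau>]) auto
  qed
qed

end

section \<open>Fields on small squares\<close>
lemma Cr_fields_differentiable: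
  assumes "f \<in> Cr_fields r U" "1 \<le> r" "x \<in> U" shows "f differentiable (at x)"
proof -
  have "\<forall>js. length js < r \<longrightarrow> (\<forall>x\<in>U. iter_partial js f differentiable (at x))"
    using assms(1) by (simp add: Cr_fields_def)
  from this[rule_format, of "[]" x] show ?thesis using assms by simp
qed

lemma frechet_derivative_eq_partials:
  assumes "f differentiable (at x)"
  shows "frechet_derivative f (at x) h = (\<Sum>k\<in>UNIV. h $ k *\<^sub>R partial k f x)"
proof -
  have lin: "linear (frechet_derivative f (at x))" using assms by (rule linear_frechet_derivative)
  have "h = (\<Sum>k\<in>UNIV. h $ k *\<^sub>R axis k 1)" by (simp add: vec_eq_iff axis_def sum.delta' if_distrib cong: if_cong)
  then have "frechet_derivative f (at x) h = frechet_derivative f (at x) (\<Sum>k\<in>UNIV. h $ k *\<^sub>R axis k 1)" by simp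
  also have "\<dots> = (\<Sum>k\<in>UNIV. h $ k *\<^sub>R partial k f x)"
    by (simp add: linear_sum[OF lin] linear_scale[OF lin] partial_def)
  finally show ?thesis .
qed

lemma Cr_fields_iter_partial_bounded:
  assumes "f \<in> Cr_fields r U" "bounded U" "length js \<le> r"
  shows "\<exists>C\<ge>0. \<forall>x\<in>U. norm (iter_partial js f x) \<le> C"
proof -
  obtain g where g: "continuous_on (closure U) g" "\<And>x. x \<in> U \<Longrightarrow> g x = iter_partial js f x"
    using assms(1,3) unfolding Cr_fields_def by blast
  have "compact (closure U)" using assms(2) by (simp add: compact_closure)
  then have "bounded (g ` closure U)" using compact_continuous_image[OF g(1)] compact_imp_bounded by blast
  then obtain C where C: "\<And>x. x \<in> closure U \<Longrightarrow> norm (g x) \<le> C" unfolding bounded_iff by blast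
  have "norm (iter_partial js f x) \<le> max 0 C" if "x \<in> U" for x
    using C[of x] g(2)[OF that] that closure_subset[of U] by auto
  then show ?thesis by (intro exI[of _ "max 0 C"]) auto
qed

lemma Cr_fields_lipschitz:
  assumes f: "f \<in> Cr_fields r U" "1 \<le> r" "bounded U"
  obtains L where "0 \<le> L" "\<And>S x y. convex S \<Longrightarrow> S \<subseteq> U \<Longrightarrow> x \<in> S \<Longrightarrow> y \<in> S \<Longrightarrow> norm (f x - f y) \<le> L * norm (x - y)"
proof -
  have "\<exists>C\<ge>0. \<forall>x\<in>U. norm (partial k f x) \<le> C" for k
    using Cr_fields_iter_partial_bounded[OF f(1,3), of "[k]"] f(2) by simp
  then obtain C where C: "\<And>k. 0 \<le> C k" "\<And>k x. x \<in> U \<Longrightarrow> norm (partial k f x) \<le> C k" by metis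
  have "0 \<le> (\<Sum>k\<in>UNIV. C k)" using C(1) by (intro sum_nonneg) auto
  moreover have "norm (f x - f y) \<le> (\<Sum>k\<in>UNIV. C k) * norm (x - y)" if S: "convex S" "S \<subseteq> U" "x \<in> S" "y \<in> S" for S x y
  proof (rule differentiable_bound[OF S(1) _ _ S(3,4)])
    fix z assume z: "z \<in> S"
    then have d: "f differentiable (at z)" using Cr_fields_differentiable f S(2) by blast
    show "(f has_derivative frechet_derivative f (at z)) (at z within S)"
      using d frechet_derivative_works has_derivative_at_withinI by blast
    show "onorm (frechet_derivative f (at z)) \<le> (\<Sum>k\<in>UNIV. C k)"
    proof (rule onorm_le)
      fix h
      have "norm (frechet_derivative f (at z) h) \<le> (\<Sum>k\<in>UNIV. norm (h $ k *\<^sub>R partial k f z))"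
        unfolding frechet_derivative_eq_partials[OF d] by (rule norm_sum)
      also have "\<dots> \<le> (\<Sum>k\<in>UNIV. norm h * C k)"
      proof (rule sum_mono)
        fix k
        show "norm (h $ k *\<^sub>R partial k f z) \<le> norm h * C k"
          using C(2)[of z k] z S(2) component_le_norm_cart[of h k] by (auto intro!: mult_mono)
      qed
      also have "\<dots> = (\<Sum>k\<in>UNIV. C k) * norm h" by (simp add: sum_distrib_left mult.commute)
      finally show "norm (frechet_derivative f (at z) h) \<le> (\<Sum>k\<in>UNIV. C k) * norm h" .
    qed
  qed
  ultimately show thesis by (rule that)
qed

definition square :: "real \<Rightarrow> plane set" where "square d = {p. \<forall>k. \<bar>p $ k\<bar> \<le> d}"

lemma convex_square: "convex (square d)"
proof -
  have "square d = (\<Inter>k. {p. p $ k \<le> d} \<inter> {p. - d \<le> p $ k})" by (auto simp: square_def abs_le_iff minus_le_iff)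
  moreover have "convex {p :: plane. p $ k \<le> d}" "convex {p :: plane. - d \<le> p $ k}" for k
    using convex_halfspace_le[where a = "axis k 1 :: plane" and b = d]
      convex_halfspace_ge[where a = "axis k 1 :: plane" and b = "- d"]
    by (simp_all add: inner_axis' inner_axis inner_commute)
  ultimately show ?thesis by (auto intro!: convex_Inter convex_Int)
qed

lemma norm_le_in_square: "p \<in> square d \<Longrightarrow> norm p \<le> 2 * d"
  using norm_le_l1_cart[of p] by (auto simp: square_def sum_2 dest: spec[of _ 1] intro: order_trans) 
   (smt (verit) forall_2)

lemma eventually_square:
  assumes "eventually P (nhds (0 :: plane))"
  obtains d where "0 < d" "\<And>p. p \<in> square d \<Longrightarrow> P p"
proof -
  obtain e where e: "0 < e" "\<And>p. dist p 0 < e \<Longrightarrow> P p" using assms unfolding eventually_nhds_metric by blast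
  have "P p" if "p \<in> square (e / 3)" for p
    using e norm_le_in_square[OF that] by (intro e(2)) (auto simp: dist_norm)
  then show thesis using e(1) that[of "e / 3"] by auto
qed

text \<open>Clamping the coordinates extends the slope field from the square to the plane with the same bounds and
  Lipschitz constant, so that its leaves are global.\<close>

definition clamp1 :: "real \<Rightarrow> real \<Rightarrow> real" where "clamp1 d x = max (- d) (min d x)"

lemma clamp1_id: "\<bar>x\<bar> \<le> d \<Longrightarrow> clamp1 d x = x" and clamp1_abs: "0 \<le> d \<Longrightarrow> \<bar>clamp1 d x\<bar> \<le> d"
  and clamp1_lip: "\<bar>clamp1 d x - clamp1 d y\<bar> \<le> \<bar>x - y\<bar>"
  by (auto simp: clamp1_def)

lemma quotient_lipschitz:
  fixes a b c e :: real
  assumes lo: "0 < lo" "lo \<le> \<bar>b\<bar>" "lo \<le> \<bar>e\<bar>" and hi: "\<bar>c\<bar> \<le> hi" "\<bar>e\<bar> \<le> hi"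
    and d: "\<bar>a - c\<bar> \<le> D" "\<bar>b - e\<bar> \<le> D"
  shows "\<bar>a / b - c / e\<bar> \<le> 2 * hi / lo\<^sup>2 * D"
proof -
  have nz: "b \<noteq> 0" "e \<noteq> 0" using lo by auto
  have "a / b - c / e = ((a - c) * e - c * (b - e)) / (b * e)" using nz by (simp add: field_simps)
  then have "\<bar>a / b - c / e\<bar> = \<bar>(a - c) * e - c * (b - e)\<bar> / (\<bar>b\<bar> * \<bar>e\<bar>)" by (simp add: abs_mult)
  also have "\<dots> \<le> (D * hi + hi * D) / (lo * lo)"
  proof (rule frac_le)
    have "\<bar>(a - c) * e - c * (b - e)\<bar> \<le> \<bar>a - c\<bar> * \<bar>e\<bar> + \<bar>c\<bar> * \<bar>b - e\<bar>"
      using abs_triangle_ineq4[of "(a - c) * e" "c * (b - e)"] by (simp add: abs_mult)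
    also have "\<dots> \<le> D * hi + hi * D" using hi d by (intro add_mono mult_mono) auto
    finally show "\<bar>(a - c) * e - c * (b - e)\<bar> \<le> D * hi + hi * D" .
    show "lo * lo \<le> \<bar>b\<bar> * \<bar>e\<bar>" using lo by (intro mult_mono) auto
    show "0 \<le> D * hi + hi * D" using hi d by auto
  qed (use lo in auto)
  finally show ?thesis by (simp add: power2_eq_square mult_ac)
qed

text \<open>A square around the origin on which \<open>Z\<close> looks like a field with constant components, as far
  as signs, speeds and slopes are concerned.\<close>

locale regular_square =
  fixes Z :: pws_field and j :: 2 and d :: real and \<nu> :: "bool \<Rightarrow> 2 \<Rightarrow> real" and \<omega> :: "2 \<Rightarrow> real"
    and cr :: "2 \<Rightarrow> bool" and L lo hi :: real and m M :: "bool \<Rightarrow> real"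
  assumes d: "0 < d"
    and nu: "\<nu> b k = 1 \<or> \<nu> b k = -1" and om: "\<omega> k = 1 \<or> \<omega> k = -1" and lo: "0 < lo"
    and speed: "p \<in> square d \<Longrightarrow> lo \<le> \<nu> b k * fld b Z p $ k \<and> \<nu> b k * fld b Z p $ k \<le> hi"
    and cr_iff: "cr k \<longleftrightarrow> \<nu> True k = \<nu> False k"
    and slide_speed: "\<not> cr i \<Longrightarrow> p \<in> square d \<Longrightarrow>
        lo \<le> \<omega> i * sliding_field Z i p $ other i \<and> \<omega> i * sliding_field Z i p $ other i \<le> hi"
    and types: "cr j \<or> \<not> cr (other j)"
    and om_eq: "cr j \<Longrightarrow> \<not> cr (other j) \<Longrightarrow> \<omega> (other j) = \<nu> b j"
    and lip: "p \<in> square d \<Longrightarrow> q \<in> square d \<Longrightarrow> norm (fld b Z p - fld b Z q) \<le> L * norm (p - q)"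
    and L: "0 \<le> L" and m: "0 < m b"
    and slope: "p \<in> square d \<Longrightarrow> m b \<le> \<bar>fld b Z p $ other j / fld b Z p $ j\<bar> \<and>
        \<bar>fld b Z p $ other j / fld b Z p $ j\<bar> \<le> M b"
begin

definition slope_fun :: "bool \<Rightarrow> real \<Rightarrow> real \<Rightarrow> real"
  where "slope_fun b x s = (let p = mk j (clamp1 d x) (clamp1 d s) in fld b Z p $ other j / fld b Z p $ j)"

lemma mk_clamp_in: "mk j (clamp1 d x) (clamp1 d s) \<in> square d"
  using d by (auto simp: square_def forall_other[of _ j] clamp1_abs)

lemma slope_fun_eq: "p \<in> square d \<Longrightarrow> slope_fun b (p $ other j) (p $ j) = fld b Z p $ other j / fld b Z p $ j"
  by (simp add: slope_fun_def square_def clamp1_id)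

lemma fld_abs: "p \<in> square d \<Longrightarrow> lo \<le> \<bar>fld b Z p $ k\<bar> \<and> \<bar>fld b Z p $ k\<bar> \<le> hi"
  using speed[of p b k] nu[of b k] lo by auto

lemma fld_nth_lip: "p \<in> square d \<Longrightarrow> q \<in> square d \<Longrightarrow> \<bar>fld b Z p $ k - fld b Z q $ k\<bar> \<le> L * norm (p - q)"
  using component_le_norm_cart[of "fld b Z p - fld b Z q" k] lip[of p q b] by simp

lemma fld_continuous: "continuous_on (square d) (fld b Z)"
  by (rule lipschitz_on_continuous_on[of L], rule lipschitz_onI) (use lip L in \<open>auto simp: dist_norm\<close>)

lemma slope_flow: "leaf_flow (slope_fun b) (2 * hi / lo\<^sup>2 * L) (m b) (M b) (\<nu> b j * \<nu> b (other j))"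
proof
  let ?P = "\<lambda>p. mk j (clamp1 d (fst p)) (clamp1 d (snd p))"
  have fa: "lo \<le> \<bar>fld b Z (mk j (clamp1 d x) (clamp1 d s)) $ k\<bar>" "\<bar>fld b Z (mk j (clamp1 d x) (clamp1 d s)) $ k\<bar> \<le> hi" for b k x s
    using fld_abs[OF mk_clamp_in] by blast+
  have hi: "0 \<le> hi" using fa(2)[of True 0 0 j] by linarith
  have cP: "continuous_on UNIV ?P" unfolding mk_def clamp1_def by (intro continuous_intros)
  have "continuous_on UNIV (\<lambda>p. fld b Z (?P p))"
    by (rule continuous_on_compose2[OF fld_continuous cP]) (use mk_clamp_in in auto)
  moreover have "fld b Z (?P p) $ j \<noteq> 0" for p using fa(1)[of b "fst p" "snd p" j] lo by auto
  ultimately show "continuous_on UNIV (\<lambda>p. slope_fun b (fst p) (snd p))"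
    unfolding slope_fun_def Let_def by (intro continuous_intros) auto
  show "\<bar>slope_fun b x s - slope_fun b y s\<bar> \<le> 2 * hi / lo\<^sup>2 * L * \<bar>x - y\<bar>" for x y s
  proof -
    let ?p = "mk j (clamp1 d x) (clamp1 d s)" and ?q = "mk j (clamp1 d y) (clamp1 d s)"
    have "?p - ?q = (clamp1 d x - clamp1 d y) *\<^sub>R axis (other j) 1" by (simp add: mk_def scaleR_diff_left)
    then have n: "norm (?p - ?q) \<le> \<bar>x - y\<bar>" using clamp1_lip[of d x y] by (simp add: norm_axis_1)
    have D: "\<bar>fld b Z ?p $ k - fld b Z ?q $ k\<bar> \<le> L * \<bar>x - y\<bar>" for k
      by (rule order_trans[OF fld_nth_lip[OF mk_clamp_in mk_clamp_in] mult_left_mono[OF n L]])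
    have "\<bar>slope_fun b x s - slope_fun b y s\<bar> \<le> 2 * hi / lo\<^sup>2 * (L * \<bar>x - y\<bar>)"
      unfolding slope_fun_def Let_def
      by (rule quotient_lipschitz[OF lo]) (use fa D in auto)
    then show ?thesis by (simp add: mult.assoc)
  qed
  show "0 \<le> 2 * hi / lo\<^sup>2 * L" using hi L by simp
  show "\<nu> b j * \<nu> b (other j) = 1 \<or> \<nu> b j * \<nu> b (other j) = - 1"
    using nu[of b j] nu[of b "other j"] by auto
  show "0 < m b" by (rule m)
  have "\<nu> b j * \<nu> b (other j) * slope_fun b x s = \<bar>slope_fun b x s\<bar>" for x s
  proof -
    let ?p = "mk j (clamp1 d x) (clamp1 d s)"
    have "0 < \<nu> b k * fld b Z ?p $ k" for k
      by (rule less_le_trans[OF lo]) (use speed[OF mk_clamp_in] in blast)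
    then have "0 < \<nu> b j * fld b Z ?p $ j" "0 < \<nu> b (other j) * fld b Z ?p $ other j" by blast+
    then show ?thesis
      using nu[of b j] nu[of b "other j"] unfolding slope_fun_def Let_def
      by (elim disjE) (simp_all add: abs_if divide_less_0_iff)
  qed
  then show "m b \<le> \<nu> b j * \<nu> b (other j) * slope_fun b x s" "\<nu> b j * \<nu> b (other j) * slope_fun b x s \<le> M b" for x s
    using slope[OF mk_clamp_in] by (simp_all add: slope_fun_def Let_def)
qed

text \<open>Along an integral curve, the distance from the leaf of its starting point satisfies a linear
  differential inequality and vanishes by Gronwall's inequality. So labels are constant along integral curves.\<close>

lemma regular_system_in_square:
  assumes V: "open V" "0 \<in> V" "V \<subseteq> square d"
  shows "regular_system Z V j \<nu> \<omega> cr (\<lambda>b. leaf_flow.G (slope_fun b))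
     (\<lambda>b p. leaf_flow.H (slope_fun b) (p $ other j) (p $ j)) lo hi"
proof -
  interpret fl: leaf_flow "slope_fun b" "2 * hi / lo\<^sup>2 * L" "m b" "M b" "\<nu> b j * \<nu> b (other j)" for b by (rule slope_flow)
  show ?thesis
  proof
    show "open V" "0 \<in> V" by (fact V)+
    show "\<nu> b k = 1 \<or> \<nu> b k = -1" "\<omega> k = 1 \<or> \<omega> k = -1" "0 < lo" for b k by (fact nu om lo)+
    show "lo \<le> \<nu> b k * fld b Z p $ k \<and> \<nu> b k * fld b Z p $ k \<le> hi" if "p \<in> V" for p b k
      using speed that V(3) by blast
    show "lo \<le> \<omega> i * sliding_field Z i p $ other i \<and> \<omega> i * sliding_field Z i p $ other i \<le> hi"
      if "\<not> cr i" "p \<in> Sig_i V i" for i p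
      using slide_speed[OF that(1)] that(2) V(3) unfolding Sig_i_def by blast
    show "continuous_on V (fld b Z)" for b using fld_continuous V(3) by (rule continuous_on_subset)
    show "(leaf_flow.H (slope_fun b) (p $ other j) (p $ j) = c) = (p $ other j = leaf_flow.G (slope_fun b) c (p $ j))" for b p c
      by (rule fl.H_eq_iff)
    show "(leaf_flow.G (slope_fun b) c has_real_derivative fld b Z p $ other j / fld b Z p $ j) (at (p $ j))"
      if "p \<in> V" "p $ other j = leaf_flow.G (slope_fun b) c (p $ j)" for p b c
      using fl.G_DERIV[of b c "p $ j"] slope_fun_eq[of p b] that V(3) by auto
    show "leaf_flow.H (slope_fun b) (0 $ other j) (0 $ j) = 0" for b by simp
    show "0 < \<nu> b j * \<nu> b (other j) * leaf_flow.G (slope_fun b) 0 s * s" if "s \<noteq> 0" for s b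
      using fl.G_0_sign[OF that] .
    fix J and \<gamma> :: "real \<Rightarrow> plane" and b s t
    assume J: "is_interval J" and \<gamma>: "\<And>t. t \<in> J \<Longrightarrow> \<gamma> t \<in> V \<and> (\<gamma> has_vector_derivative fld b Z (\<gamma> t)) (at t within J)"
      and st: "s \<in> J" "t \<in> J"
    define c where "c = fl.H b (\<gamma> s $ other j) (\<gamma> s $ j)"
    define w where "w t = \<gamma> t $ other j - fl.G b c (\<gamma> t $ j)" for t
    define w' where "w' t = fld b Z (\<gamma> t) $ other j - slope_fun b (fl.G b c (\<gamma> t $ j)) (\<gamma> t $ j) * fld b Z (\<gamma> t) $ j" for t
    have ws: "w s = 0" by (simp add: w_def c_def fl.G_H)
    have "\<bar>w t\<bar> \<le> \<bar>w s\<bar> * exp ((hi * (2 * hi / lo\<^sup>2 * L)) * \<bar>t - s\<bar>)"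
    proof (rule gronwall_abs[OF J _ _ st])
      fix t assume t: "t \<in> J"
      have c1: "((\<lambda>t. \<gamma> t $ k) has_real_derivative fld b Z (\<gamma> t) $ k) (at t within J)" for k
        using has_vector_derivative_nth[of \<gamma> "fld b Z (\<gamma> t)" t J 1 k] \<gamma>[OF t] by simp
      have "((\<lambda>t. fl.G b c (\<gamma> t $ j)) has_real_derivative slope_fun b (fl.G b c (\<gamma> t $ j)) (\<gamma> t $ j) * fld b Z (\<gamma> t) $ j) (at t within J)"
        by (rule DERIV_chain2[OF fl.G_DERIV c1])
      then show "(w has_real_derivative w' t) (at t within J)"
        unfolding w_def w'_def by (intro DERIV_diff c1)
      have sq: "\<gamma> t \<in> square d" using \<gamma>[OF t] V(3) by blast
      have "fld b Z (\<gamma> t) $ j \<noteq> 0" using fld_abs[OF sq, of b j] lo by auto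
      then have "w' t = fld b Z (\<gamma> t) $ j * (slope_fun b (\<gamma> t $ other j) (\<gamma> t $ j) - slope_fun b (fl.G b c (\<gamma> t $ j)) (\<gamma> t $ j))"
        by (simp add: w'_def slope_fun_eq[OF sq] field_simps)
      then have "\<bar>w' t\<bar> = \<bar>fld b Z (\<gamma> t) $ j\<bar> * \<bar>slope_fun b (\<gamma> t $ other j) (\<gamma> t $ j) - slope_fun b (fl.G b c (\<gamma> t $ j)) (\<gamma> t $ j)\<bar>"
        by (simp add: abs_mult)
      also have "\<dots> \<le> hi * (2 * hi / lo\<^sup>2 * L * \<bar>w t\<bar>)"
        using fld_abs[OF sq, of b j] fl.lip[of b "\<gamma> t $ other j" "\<gamma> t $ j" "fl.G b c (\<gamma> t $ j)"]
        unfolding w_def by (intro mult_mono) auto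
      finally show "\<bar>w' t\<bar> \<le> hi * (2 * hi / lo\<^sup>2 * L) * \<bar>w t\<bar>" by (simp add: mult.assoc)
    qed
    then have "w t = 0" using ws by simp
    then have "fl.H b (\<gamma> t $ other j) (\<gamma> t $ j) = c" by (simp add: fl.H_eq_iff w_def)
    then show "fl.H b (\<gamma> s $ other j) (\<gamma> s $ j) = fl.H b (\<gamma> t $ other j) (\<gamma> t $ j)" by (simp add: c_def)
  qed (fact cr_iff types om_eq)+
qed

end

section \<open>Stability of nondegenerate fields\<close>
lemma to_complex_simps [simp]: "Re (to_complex p) = p $ 1" "Im (to_complex p) = p $ 2"
  "to_complex (of_complex z) = z" "of_complex (to_complex p) = p"
  by (simp_all add: to_complex_def of_complex_def complex_eq_iff vec_eq_iff forall_2)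

lemma of_complex_eq: "of_complex z = Re z *\<^sub>R axis 1 1 + Im z *\<^sub>R axis 2 1"
  by (simp add: of_complex_def vec_eq_iff forall_2 axis_def)

lemma to_complex_eq: "to_complex p = complex_of_real (p $ 1) + \<i> * complex_of_real (p $ 2)"
  by (simp add: complex_eq_iff)

lemma continuous_on_to_complex: "continuous_on A to_complex"
  unfolding to_complex_eq[abs_def] by (intro continuous_intros)

lemma continuous_on_of_complex: "continuous_on A of_complex"
  unfolding of_complex_eq[abs_def] by (intro continuous_intros)

lemma dist_of_complex: "dist (of_complex z) p = dist z (to_complex p)"
  by (simp add: dist_norm norm_vec_def L2_set_def sum_2 cmod_def of_complex_def)

text \<open>Around \<open>p\<close>, the loop \<open>h q - h p\<close> is homotopic to \<open>q - p\<close> along segments. These avoid \<open>0\<close>, because some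
  coordinate of the two vectors has the same strict sign.\<close>

lemma triangular_preserves_orientation:
  fixes h :: "plane \<Rightarrow> plane"
  assumes V: "open V" and cont: "continuous_on V h"
    and less: "\<And>p q. p \<in> V \<Longrightarrow> q \<in> V \<Longrightarrow> p $ j < q $ j \<Longrightarrow> h p $ j < h q $ j"
    and less_o: "\<And>p q. p \<in> V \<Longrightarrow> q \<in> V \<Longrightarrow> p $ j = q $ j \<Longrightarrow> p $ other j < q $ other j \<Longrightarrow> h p $ other j < h q $ other j"
  shows "preserves_orientation V h"
  unfolding preserves_orientation_def
proof
  fix p assume p: "p \<in> V"
  then obtain e where e: "0 < e" "cball p e \<subseteq> V" using V open_contains_cball by blast
  have "winding_number (to_complex \<circ> h \<circ> of_complex \<circ> circlepath (to_complex p) s) (to_complex (h p)) = 1"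
    if s: "0 < s" "s \<le> e" for s
  proof -
    let ?c = "circlepath (to_complex p) s" and ?c' = "circlepath (to_complex (h p)) s"
    let ?g = "to_complex \<circ> h \<circ> of_complex \<circ> ?c"
    have on: "of_complex (?c t) \<in> V" "of_complex (?c t) \<noteq> p" if "t \<in> {0..1}" for t
    proof -
      have "?c t \<in> path_image ?c" using that by (auto simp: path_image_def)
      then have "dist (?c t) (to_complex p) = s" using s by (simp add: dist_commute)
      then have d: "dist (of_complex (?c t)) p = s" by (simp add: dist_of_complex)
      then show "of_complex (?c t) \<in> V" using e(2) s by (auto simp: dist_commute)
      show "of_complex (?c t) \<noteq> p" using d s by auto
    qed
    have "continuous_on {0..1} ?c" using path_circlepath[of "to_complex p" s] by (simp add: path_def)
    then have "continuous_on {0..1} (of_complex \<circ> ?c)" by (rule continuous_on_compose[OF _ continuous_on_of_complex])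
    then have "continuous_on {0..1} (h \<circ> (of_complex \<circ> ?c))"
      by (rule continuous_on_compose) (use on in \<open>auto intro: continuous_on_subset[OF cont]\<close>)
    then have "continuous_on {0..1} (to_complex \<circ> (h \<circ> (of_complex \<circ> ?c)))"
      by (rule continuous_on_compose[OF _ continuous_on_to_complex])
    then have pg: "path ?g" by (simp add: path_def comp_assoc)
    have "winding_number ?g (to_complex (h p)) = winding_number ?c' (to_complex (h p))"
    proof (rule winding_number_loops_linear_eq)
      show "pathfinish ?g = pathstart ?g"
        using pathfinish_circlepath[of "to_complex p" s] pathstart_circlepath[of "to_complex p" s]
        by (simp add: pathfinish_def pathstart_def)
      fix t :: real assume t: "t \<in> {0..1}"
      define q where "q = of_complex (?c t)"
      have q: "q \<in> V" "q \<noteq> p" using on[OF t] by (simp_all add: q_def)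
      have ct: "?c t = to_complex q" by (simp add: q_def)
      have c't: "?c' t = to_complex q - to_complex p + to_complex (h p)"
        unfolding ct[symmetric] by (simp add: circlepath)
      show "to_complex (h p) \<notin> closed_segment (?c' t) (?g t)"
      proof
        assume "to_complex (h p) \<in> closed_segment (?c' t) (?g t)"
        then obtain u where u: "0 \<le> u" "u \<le> 1"
          "to_complex (h p) = (1 - u) *\<^sub>R (to_complex q - to_complex p + to_complex (h p)) + u *\<^sub>R to_complex (h q)"
          unfolding in_segment c't by (auto simp: q_def)
        then have "\<forall>k. (1 - u) * (q $ k - p $ k) + u * (h q $ k - h p $ k) = 0"
          unfolding forall_2 complex_eq_iff by (simp add: algebra_simps)
        then have E: "(1 - u) * (q $ k - p $ k) + u * (h q $ k - h p $ k) = 0" for k by blast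
        have pos: "0 < (1 - u) * a + u * b" if "0 < a" "0 < b" for a b :: real
          using u that by (cases "u = 0") (auto intro: add_nonneg_pos)
        have imp: False if "q $ k < p $ k \<and> h q $ k < h p $ k \<or> p $ k < q $ k \<and> h p $ k < h q $ k" for k
        proof -
          have "0 < (1 - u) * (p $ k - q $ k) + u * (h p $ k - h q $ k) \<or> 0 < (1 - u) * (q $ k - p $ k) + u * (h q $ k - h p $ k)"
            using that pos by auto
          then show False using E[of k] by (simp add: algebra_simps)
        qed
        show False
        proof (cases "q $ j" "p $ j" rule: linorder_cases)
          case equal
          then have "q $ other j \<noteq> p $ other j" using q by (auto simp: plane_eq_iff[of _ _ j])
          then show False using imp[of "other j"] less_o[OF p q(1)] less_o[OF q(1) p] equal
            by (metis linorder_neqE_linordered_idom)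
        qed (use imp[of j] less[OF p q(1)] less[OF q(1) p] in auto)
      qed
    qed (use pg in auto)
    then show ?thesis using s by (simp add: winding_number_circlepath_centre)
  qed
  then show "\<exists>\<rho>>0. cball p \<rho> \<subseteq> V \<and> (\<forall>s. 0 < s \<and> s \<le> \<rho> \<longrightarrow>
          winding_number (to_complex \<circ> h \<circ> of_complex \<circ> circlepath (to_complex p) s) (to_complex (h p)) = 1)"
    using e by blast
qed

text \<open>The conjugacy of the leaves is a homeomorphism onto an open set by invariance of domain. Its
  domain is cut down such that neither it nor its image exceeds the squares.\<close>

lemma squares_locally_equivalent:
  assumes S: "regular_square Z j d \<nu> \<omega> cr L lo hi m M" and S': "regular_square Z' j d' \<nu> \<omega> cr L' lo' hi' m' M'"
    and sep: "M True < m False \<and> M' True < m' False \<or> M False < m True \<and> M' False < m' True"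
    and sub: "square d \<subseteq> U" "square d' \<subseteq> U"
  shows "locally_equivalent U Z Z'"
proof -
  interpret S: regular_square Z j d \<nu> \<omega> cr L lo hi m M by (rule S)
  interpret S': regular_square Z' j d' \<nu> \<omega> cr L' lo' hi' m' M' by (rule S')
  interpret lp: leaf_flow_pair S.slope_fun S'.slope_fun "\<lambda>b. 2 * hi / lo\<^sup>2 * L" m M "\<lambda>b. 2 * hi' / lo'\<^sup>2 * L'" m' M'
    "\<lambda>b. \<nu> b j * \<nu> b (other j)"
    by (rule leaf_flow_pair.intro) (fact S.slope_flow S'.slope_flow sep)+
  obtain \<eta> \<rho> where \<eta>c: "continuous_on UNIV (\<lambda>p. \<eta> (fst p) (snd p))" and \<eta>m: "\<And>x x' s. x < x' \<Longrightarrow> \<eta> x s < \<eta> x' s"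
    and \<eta>0: "\<And>s. \<eta> 0 s = 0" and \<rho>c: "continuous_on UNIV \<rho>" and \<rho>m: "strict_mono \<rho>" and \<rho>0: "\<rho> 0 = 0"
    and lab: "\<And>b x s x' s'. 0 < region_sign b * (x * s) \<Longrightarrow> 0 < region_sign b * (x' * s') \<Longrightarrow> sgn x = sgn x' \<Longrightarrow>
        (lp.H' b (\<eta> x s) (\<rho> s) = lp.H' b (\<eta> x' s') (\<rho> s')) = (lp.H b x s = lp.H b x' s')"
    and lab0: "\<And>b x s. 0 < region_sign b * (x * s) \<Longrightarrow> (lp.H' b (\<eta> x s) (\<rho> s) = 0) = (lp.H b x s = 0)"
    by (rule lp.foliations_conjugate) (rule that, assumption+)
  have \<eta>l: "\<eta> x s < \<eta> x' s \<longleftrightarrow> x < x'" for x x' s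
    using \<eta>m[of x x' s] \<eta>m[of x' x s] by (metis linorder_neqE_linordered_idom order.asym)
  have \<rho>l: "\<rho> s < \<rho> s' \<longleftrightarrow> s < s'" for s s' using \<rho>m by (simp add: strict_mono_less)
  define h where "h p = mk j (\<eta> (p $ other j) (p $ j)) (\<rho> (p $ j))" for p
  have hj: "h p $ j = \<rho> (p $ j)" "h p $ other j = \<eta> (p $ other j) (p $ j)" for p by (simp_all add: h_def)
  have hc: "continuous_on UNIV h"
  proof -
    have "continuous_on UNIV (\<lambda>p :: plane. (\<lambda>q. \<eta> (fst q) (snd q)) (p $ other j, p $ j))"
      by (rule continuous_on_compose2[OF \<eta>c]) (auto intro!: continuous_intros)
    then have "continuous_on UNIV (\<lambda>p :: plane. \<eta> (p $ other j) (p $ j))" by simp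
    moreover have "continuous_on UNIV (\<lambda>p :: plane. \<rho> (p $ j))"
      by (rule continuous_on_compose2[OF \<rho>c]) (auto intro!: continuous_intros)
    ultimately show ?thesis unfolding h_def mk_def by (intro continuous_intros)
  qed
  have hinj: "inj h"
  proof (rule injI)
    fix p q assume "h p = h q"
    then have e: "\<rho> (p $ j) = \<rho> (q $ j)" "\<eta> (p $ other j) (p $ j) = \<eta> (q $ other j) (q $ j)" using hj by metis+
    have 1: "p $ j = q $ j" using e(1) \<rho>l by (metis linorder_neqE_linordered_idom less_irrefl)
    then have "p $ other j = q $ other j" using e(2) \<eta>l by (metis linorder_neqE_linordered_idom less_irrefl)
    with 1 show "p = q" by (simp add: plane_eq_iff[of _ _ j])
  qed
  have h0: "h 0 = 0" by (simp add: plane_eq_iff[of _ _ j] hj \<eta>0 \<rho>0)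
  define V where "V = {p. \<forall>k. \<bar>p $ k\<bar> < d \<and> \<bar>h p $ k\<bar> < d'}"
  have hck: "continuous_on UNIV (\<lambda>p. h p $ k)" for k by (intro continuous_intros hc)
  have Veq: "V = {p. (\<bar>p $ j\<bar> < d \<and> \<bar>h p $ j\<bar> < d') \<and> (\<bar>p $ other j\<bar> < d \<and> \<bar>h p $ other j\<bar> < d')}"
    by (auto simp: V_def forall_other[of _ j])
  have V: "open V" unfolding Veq by (intro open_Collect_conj open_Collect_less continuous_intros hck)
  have V0: "0 \<in> V" using S.d S'.d h0 by (simp add: V_def)
  have Vsq: "V \<subseteq> square d" by (auto simp: V_def square_def less_imp_le)
  define V' where "V' = h ` V"
  have cV: "continuous_on V h" using hc by (rule continuous_on_subset) simp
  have iV: "inj_on h V" using hinj by (rule inj_on_subset) simp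
  have V': "open V'" unfolding V'_def by (rule invariance_of_domain[OF cV V iV])
  have V'0: "0 \<in> V'" using V0 h0 unfolding V'_def by (metis imageI)
  have V'sq: "V' \<subseteq> square d'" by (auto simp: V'_def V_def square_def less_imp_le)
  obtain g where g: "homeomorphism V V' h g"
    using invariance_of_domain_homeomorphism[OF V cV _ iV] unfolding V'_def by auto
  interpret T: regular_system Z V j \<nu> \<omega> cr "\<lambda>b. leaf_flow.G (S.slope_fun b)"
    "\<lambda>b p. leaf_flow.H (S.slope_fun b) (p $ other j) (p $ j)" lo hi by (rule S.regular_system_in_square[OF V V0 Vsq])
  interpret T': regular_system Z' V' j \<nu> \<omega> cr "\<lambda>b. leaf_flow.G (S'.slope_fun b)"
    "\<lambda>b p. leaf_flow.H (S'.slope_fun b) (p $ other j) (p $ j)" lo' hi' by (rule S'.regular_system_in_square[OF V' V'0 V'sq])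
  have sgr: "sgn (\<rho> s) = sgn s" for s using \<rho>l[of s 0] \<rho>l[of 0 s] \<rho>0 by (auto simp: sgn_if) 
  have sge: "sgn (\<eta> x s) = sgn x" for x s using \<eta>l[of x s 0] \<eta>l[of 0 s x] \<eta>0[of s] by (auto simp: sgn_if)
  interpret C: trajectory_conjugacy Z V j \<nu> \<omega> cr "\<lambda>b. leaf_flow.G (S.slope_fun b)"
    "\<lambda>b p. leaf_flow.H (S.slope_fun b) (p $ other j) (p $ j)" lo hi Z' V' "\<lambda>b. leaf_flow.G (S'.slope_fun b)"
    "\<lambda>b p. leaf_flow.H (S'.slope_fun b) (p $ other j) (p $ j)" lo' hi' h g
  proof unfold_locales
    show "homeomorphism V V' h g" by (rule g)
    show "sgn (h p $ k) = sgn (p $ k)" for p k using sgr sge hj by (cases "k = j") (auto simp: eq_other_iff)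
    show "(h p $ j < h q $ j) = (p $ j < q $ j)" for p q by (simp add: hj \<rho>l)
    show "(h p $ other j < h q $ other j) = (p $ other j < q $ other j)" if "p $ j = 0" "q $ j = 0" for p q
      using that by (simp add: hj \<eta>l)
    show "(lp.H' b (h p $ other j) (h p $ j) = lp.H' b (h q $ other j) (h q $ j)) =
        (lp.H b (p $ other j) (p $ j) = lp.H b (q $ other j) (q $ j))"
      if "p \<in> part b V" "q \<in> part b V" "sgn (p $ other j) = sgn (q $ other j)" for p q b
      using lab[of b "p $ other j" "p $ j" "q $ other j" "q $ j"] that by (simp add: hj part_iff[of _ _ _ j])
    show "(lp.H' b (h p $ other j) (h p $ j) = 0) = (lp.H b (p $ other j) (p $ j) = 0)" if "p \<in> part b V" for p b
      using lab0[of b "p $ other j" "p $ j"] that by (simp add: hj part_iff[of _ _ _ j])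
  qed
  interpret D: trajectory_conjugacy Z' V' j \<nu> \<omega> cr "\<lambda>b. leaf_flow.G (S'.slope_fun b)"
    "\<lambda>b p. leaf_flow.H (S'.slope_fun b) (p $ other j) (p $ j)" lo' hi' Z V "\<lambda>b. leaf_flow.G (S.slope_fun b)"
    "\<lambda>b p. leaf_flow.H (S.slope_fun b) (p $ other j) (p $ j)" lo hi g h by (rule C.swap)
  have "preserves_orientation V h"
    by (rule triangular_preserves_orientation[OF V cV, of j]) (simp_all add: hj \<rho>l \<eta>l)
  then show ?thesis
    unfolding locally_equivalent_def
    using V V0 V' V'0 Vsq V'sq sub g C.image_Sig C.maps_trajectories_h D.maps_trajectories_h
    by (intro exI[of _ V] exI[of _ V'] exI[of _ h] exI[of _ g]) auto
qed

lemma eventually_in_open_at_0: "open U \<Longrightarrow> 0 \<in> U \<Longrightarrow> \<forall>\<^sub>F p in nhds (0 :: plane). p \<in> U"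
  by (rule eventually_nhds_in_open)

lemma eventually_between:
  fixes \<phi> :: "plane \<Rightarrow> real"
  assumes "isCont \<phi> 0" "lo < \<phi> 0" "\<phi> 0 < hi"
  shows "\<forall>\<^sub>F p in nhds 0. lo \<le> \<phi> p \<and> \<phi> p \<le> hi"
proof -
  have t: "(\<phi> \<longlongrightarrow> \<phi> 0) (nhds 0)" using assms(1) by (simp add: isCont_def tendsto_at_iff_tendsto_nhds)
  have "\<forall>\<^sub>F p in nhds 0. lo < \<phi> p" "\<forall>\<^sub>F p in nhds 0. \<phi> p < hi"
    using order_tendstoD[OF t] assms(2,3) by blast+
  then show ?thesis by eventually_elim auto
qed

text \<open>For nonzero components, the sign tells which of \<open>X\<close> and \<open>Y\<close> has the larger slope
  \<open>\<bar>X\<^sub>j / X\<^sub>i\<bar>\<close>, \<open>\<bar>Y\<^sub>j / Y\<^sub>i\<bar>\<close> at the origin, where \<open>j = other i\<close>. It matters twice: if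
  both axes slide, the two terms of the numerator of the sliding field compete, and the larger one
  decides on the direction; and if exactly one axis slides, the leaves may run around the origin, and
  the gap decides in which sense their return map contracts.\<close>

definition slope_gap :: "pws_field \<Rightarrow> 2 \<Rightarrow> real"
  where "slope_gap Z i = \<bar>snd Z 0 $ i * fst Z 0 $ other i\<bar> - \<bar>fst Z 0 $ i * snd Z 0 $ other i\<bar>"

lemma slope_gap_other: "slope_gap Z (other i) = - slope_gap Z i"
  by (simp add: slope_gap_def mult.commute)

text \<open>The direction of sliding along \<open>\<Sigma>\<^sub>i\<close>: the sliding vector is a convex combination of \<open>X\<close> and \<open>Y\<close>, so
  it has their common direction if there is one.\<close>

definition axis_direction :: "pws_field \<Rightarrow> (bool \<Rightarrow> 2 \<Rightarrow> real) \<Rightarrow> 2 \<Rightarrow> real"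
  where "axis_direction Z \<nu> i = (if \<nu> True (other i) = \<nu> False (other i) then \<nu> True (other i)
    else \<nu> True (other i) * sgn (slope_gap Z i))"

lemma sliding_direction_at_0:
  assumes nu: "\<And>b k. \<nu> b k = 1 \<or> \<nu> b k = -1" and pos: "\<And>b k. 0 < \<nu> b k * fld b Z 0 $ k"
    and sl: "\<nu> True i \<noteq> \<nu> False i" and gap: "slope_gap Z i \<noteq> 0"
  shows "0 < axis_direction Z \<nu> i * sliding_field Z i 0 $ other i"
proof -
  define x y a c where "x = \<bar>fst Z 0 $ i\<bar>" "y = \<bar>snd Z 0 $ i\<bar>" "a = \<bar>fst Z 0 $ other i\<bar>" "c = \<bar>snd Z 0 $ other i\<bar>"
  have eq: "fld b Z 0 $ k = \<nu> b k * \<bar>fld b Z 0 $ k\<bar>" "fld b Z 0 $ k \<noteq> 0" for b k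
    using nu[of b k] pos[of b k] by auto
  have nF: "\<nu> False i = - \<nu> True i" using nu[of True i] nu[of False i] sl by auto
  define n where "n = \<nu> True i"
  have n: "n = 1 \<or> n = -1" using nu by (simp add: n_def)
  have X: "fst Z 0 $ i = n * x" "snd Z 0 $ i = - n * y" "fst Z 0 $ other i = \<nu> True (other i) * a" "snd Z 0 $ other i = \<nu> False (other i) * c"
    using eq(1)[of True i] eq(1)[of False i] eq(1)[of True "other i"] eq(1)[of False "other i"] nF
    by (simp_all add: fld_def x_y_a_c_def n_def)
  have p: "0 < x" "0 < y" "0 < a" "0 < c"
    using eq(2)[of True i] eq(2)[of False i] eq(2)[of True "other i"] eq(2)[of False "other i"] by (simp_all add: fld_def x_y_a_c_def)
  have "sliding_field Z i 0 $ other i = (snd Z 0 $ i * fst Z 0 $ other i - fst Z 0 $ i * snd Z 0 $ other i) / (snd Z 0 $ i - fst Z 0 $ i)"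
    by (simp add: sliding_field_def axis_def)
  also have "\<dots> = (\<nu> True (other i) * y * a + \<nu> False (other i) * x * c) / (x + y)"
    unfolding X using n p by (elim disjE) (auto simp: field_simps)
  finally have s: "sliding_field Z i 0 $ other i = (\<nu> True (other i) * y * a + \<nu> False (other i) * x * c) / (x + y)" .
  have g: "slope_gap Z i = y * a - x * c" by (simp add: slope_gap_def abs_mult x_y_a_c_def)
  have xy: "0 < x + y" "0 < y * a" "0 < x * c" using p by simp_all
  show ?thesis
  proof (cases "\<nu> True (other i) = \<nu> False (other i)")
    case True
    show ?thesis unfolding s axis_direction_def True
      using nu[of False "other i"] xy by (elim disjE) (simp_all add: add_pos_pos flip: minus_add_distrib)
  next
    case False
    then have "\<nu> False (other i) = - \<nu> True (other i)" using nu[of True "other i"] nu[of False "other i"] by auto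
    then have "axis_direction Z \<nu> i * sliding_field Z i 0 $ other i = sgn (slope_gap Z i) * slope_gap Z i / (x + y)"
      unfolding s axis_direction_def g using False nu[of True "other i"] by (elim disjE) (auto simp: algebra_simps)
    then show ?thesis using gap xy by (simp add: sgn_mult_self_eq[symmetric] abs_sgn[symmetric] mult.commute)
  qed
qed

text \<open>All conditions are strict inequalities at the origin between continuous functions, and hence
  hold in a small square with a margin.\<close>

lemma regular_square_exists:
  assumes U: "1 \<le> r" "open U" "bounded U" "0 \<in> U" and Z: "Z \<in> Omega r U"
    and nu: "\<And>b k. \<nu> b k = 1 \<or> \<nu> b k = -1" and pos: "\<And>b k. 0 < \<nu> b k * fld b Z 0 $ k"
    and gap: "\<And>i. slope_gap Z i \<noteq> 0"
    and types: "\<nu> True j = \<nu> False j \<or> \<nu> True (other j) \<noteq> \<nu> False (other j)"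
  obtains d L lo hi m M where
    "regular_square Z j d \<nu> (axis_direction Z \<nu>) (\<lambda>k. \<nu> True k = \<nu> False k) L lo hi m M" "square d \<subseteq> U"
    "0 < slope_gap Z (other j) \<Longrightarrow> M True < m False" "slope_gap Z (other j) < 0 \<Longrightarrow> M False < m True"
proof -
  let ?cr = "\<lambda>k. \<nu> True k = \<nu> False k" and ?\<omega> = "axis_direction Z \<nu>"
  have f: "fld b Z \<in> Cr_fields r U" for b using Z by (cases b) (auto simp: Omega_def fld_def)
  have "\<exists>L\<ge>0. \<forall>S x y. convex S \<longrightarrow> S \<subseteq> U \<longrightarrow> x \<in> S \<longrightarrow> y \<in> S \<longrightarrow> norm (fld b Z x - fld b Z y) \<le> L * norm (x - y)" for b
    by (rule Cr_fields_lipschitz[OF f[of b] U(1,3)]) blast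
  then obtain Lb where Lb: "\<And>b. 0 \<le> Lb b" "\<And>b S x y. convex S \<Longrightarrow> S \<subseteq> U \<Longrightarrow> x \<in> S \<Longrightarrow> y \<in> S \<Longrightarrow>
      norm (fld b Z x - fld b Z y) \<le> Lb b * norm (x - y)" by metis
  have ic: "isCont (fld b Z) 0" for b
    using Cr_fields_differentiable[OF f U(1,4)] by (rule differentiable_imp_continuous_within)
  have ick: "isCont (\<lambda>p. fld b Z p $ k) 0" for b k using ic by (intro continuous_intros)
  have nz: "fld b Z 0 $ k \<noteq> 0" for b k using pos[of b k] by auto
  have o1: "?\<omega> i = 1 \<or> ?\<omega> i = -1" for i
    using nu[of True "other i"] gap[of i] by (auto simp: axis_direction_def sgn_if)
  have sl: "0 < ?\<omega> i * sliding_field Z i 0 $ other i" if "\<not> ?cr i" for i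
    by (rule sliding_direction_at_0[OF nu pos that gap])
  have isl: "isCont (\<lambda>p. ?\<omega> i * sliding_field Z i p $ other i) 0" if "\<not> ?cr i" for i
  proof -
    have ne: "snd Z 0 $ i - fst Z 0 $ i \<noteq> 0"
      using pos[of True i] pos[of False i] nu[of True i] nu[of False i] that by (elim disjE) (auto simp: fld_def)
    have "isCont (\<lambda>p. fst Z p $ k) 0" "isCont (\<lambda>p. snd Z p $ k) 0" for k
      using ick[of True k] ick[of False k] by (simp_all add: fld_def)
    then show ?thesis using ne unfolding sliding_field_def by (simp add: axis_def)
  qed
  define A where "A = (\<lambda>(b, k). \<nu> b k * fld b Z 0 $ k) ` UNIV \<union> (\<lambda>i. ?\<omega> i * sliding_field Z i 0 $ other i) ` {i. \<not> ?cr i}"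
  have A: "finite A" "A \<noteq> {}" by (auto simp: A_def)
  have Apos: "0 < x" if "x \<in> A" for x using that pos sl by (auto simp: A_def)
  define lo hi where "lo = Min A / 2" "hi = 2 * Max A"
  have lo: "0 < lo" using Apos A by (simp add: lo_hi_def)
  have lh: "lo < x \<and> x < hi" if "x \<in> A" for x
  proof -
    have "Min A \<le> x" "x \<le> Max A" "0 < Min A" "0 < x" using that A Apos by auto
    then show ?thesis by (simp add: lo_hi_def)
  qed
  have e1: "\<forall>\<^sub>F p in nhds 0. \<forall>b k. lo \<le> \<nu> b k * fld b Z p $ k \<and> \<nu> b k * fld b Z p $ k \<le> hi"
  proof (intro eventually_all_finite)
    fix b k
    have "\<nu> b k * fld b Z 0 $ k \<in> A" by (auto simp: A_def)
    then show "\<forall>\<^sub>F p in nhds 0. lo \<le> \<nu> b k * fld b Z p $ k \<and> \<nu> b k * fld b Z p $ k \<le> hi"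
      using lh pos ic by (intro eventually_between continuous_intros) auto
  qed
  have e2: "\<forall>\<^sub>F p in nhds 0. \<forall>i. \<not> ?cr i \<longrightarrow> lo \<le> ?\<omega> i * sliding_field Z i p $ other i \<and> ?\<omega> i * sliding_field Z i p $ other i \<le> hi"
  proof (intro eventually_all_finite)
    fix i
    show "\<forall>\<^sub>F p in nhds 0. \<not> ?cr i \<longrightarrow> lo \<le> ?\<omega> i * sliding_field Z i p $ other i \<and> ?\<omega> i * sliding_field Z i p $ other i \<le> hi"
    proof (cases "?cr i")
      case False
      then have "?\<omega> i * sliding_field Z i 0 $ other i \<in> A" by (auto simp: A_def)
      then have "\<forall>\<^sub>F p in nhds 0. lo \<le> ?\<omega> i * sliding_field Z i p $ other i \<and> ?\<omega> i * sliding_field Z i p $ other i \<le> hi"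
        using lh sl[OF False] isl[OF False] by (intro eventually_between) auto
      then show ?thesis by eventually_elim simp
    qed simp
  qed
  define v where "v b = \<bar>fld b Z 0 $ other j / fld b Z 0 $ j\<bar>" for b
  have v: "0 < v b" for b using nz by (simp add: v_def)
  have vgap: "0 < slope_gap Z (other j) \<Longrightarrow> v True < v False" "slope_gap Z (other j) < 0 \<Longrightarrow> v False < v True"
    using nz[of True j] nz[of False j] nz[of True "other j"] nz[of False "other j"]
    by (auto simp: v_def slope_gap_def fld_def abs_mult divide_less_eq less_divide_eq field_simps)
  have vne: "v True \<noteq> v False" using vgap gap[of "other j"] by (metis less_irrefl linorder_neqE_linordered_idom)
  define e where "e = min (\<bar>v True - v False\<bar> / 3) (min (v True) (v False) / 2)"
  have e: "0 < e" "e < v b" "e \<le> \<bar>v True - v False\<bar> / 3" for b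
    using vne v[of True] v[of False] by (cases b; auto simp: e_def min_def)+
  have e3: "\<forall>\<^sub>F p in nhds 0. \<forall>b. v b - e \<le> \<bar>fld b Z p $ other j / fld b Z p $ j\<bar> \<and> \<bar>fld b Z p $ other j / fld b Z p $ j\<bar> \<le> v b + e"
  proof (intro eventually_all_finite)
    fix b
    show "\<forall>\<^sub>F p in nhds 0. v b - e \<le> \<bar>fld b Z p $ other j / fld b Z p $ j\<bar> \<and> \<bar>fld b Z p $ other j / fld b Z p $ j\<bar> \<le> v b + e"
      using nz[of b j] ic e(1) v[of b] by (intro eventually_between continuous_intros) (auto simp: v_def)
  qed
  obtain d where d: "0 < d" and P: "\<And>p. p \<in> square d \<Longrightarrow> p \<in> U \<and> (\<forall>b k. lo \<le> \<nu> b k * fld b Z p $ k \<and> \<nu> b k * fld b Z p $ k \<le> hi) \<and>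
     (\<forall>i. \<not> ?cr i \<longrightarrow> lo \<le> ?\<omega> i * sliding_field Z i p $ other i \<and> ?\<omega> i * sliding_field Z i p $ other i \<le> hi) \<and>
     (\<forall>b. v b - e \<le> \<bar>fld b Z p $ other j / fld b Z p $ j\<bar> \<and> \<bar>fld b Z p $ other j / fld b Z p $ j\<bar> \<le> v b + e)"
    using eventually_square[OF eventually_conj[OF eventually_in_open_at_0[OF U(2,4)] eventually_conj[OF e1 eventually_conj[OF e2 e3]]]]
    by metis
  have sub: "square d \<subseteq> U" using P by blast
  have "regular_square Z j d \<nu> ?\<omega> ?cr (Lb True + Lb False) lo hi (\<lambda>b. v b - e) (\<lambda>b. v b + e)"
  proof
    show "norm (fld b Z p - fld b Z q) \<le> (Lb True + Lb False) * norm (p - q)" if "p \<in> square d" "q \<in> square d" for p q b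
    proof -
      have "norm (fld b Z p - fld b Z q) \<le> Lb b * norm (p - q)" by (rule Lb(2)[OF convex_square sub that])
      also have "\<dots> \<le> (Lb True + Lb False) * norm (p - q)" using Lb(1) by (intro mult_right_mono) (cases b; simp)+
      finally show ?thesis .
    qed
    show "?\<omega> (other j) = \<nu> b j" if "?cr j" for b using that by (cases b) (auto simp: axis_direction_def)
    show "0 \<le> Lb True + Lb False" using Lb(1) by simp
    show "0 < v b - e" for b using e(2) by simp
  qed (use d nu o1 lo P types in auto)
  then show thesis
  proof (rule that[OF _ sub])
    show "v True + e < v False - e" if "0 < slope_gap Z (other j)" using vgap(1)[OF that] e(3) e(1) by (simp add: abs_if split: if_splits)
    show "v False + e < v True - e" if "slope_gap Z (other j) < 0" using vgap(2)[OF that] e(3) e(1) by (simp add: abs_if split: if_splits)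
  qed
qed

text \<open>Both fields have the same types of axes and the same directions, and their leaves are
  separated in the same sense. The coordinate \<open>j\<close> is one for which \<open>\<Sigma>\<^sub>j\<close> is crossed, if there is any.\<close>

theorem nondegenerate_locally_equivalent:
  assumes U: "1 \<le> r" "open U" "bounded U" "0 \<in> U" and Z: "Z \<in> Omega r U" "Z' \<in> Omega r U"
    and nz: "\<And>b k. fld b Z 0 $ k \<noteq> 0" and gap: "slope_gap Z 1 \<noteq> 0"
    and sg: "\<And>b k. sgn (fld b Z' 0 $ k) = sgn (fld b Z 0 $ k)" and sg_gap: "sgn (slope_gap Z' 1) = sgn (slope_gap Z 1)"
  shows "locally_equivalent U Z Z'"
proof -
  define \<nu> where "\<nu> b k = sgn (fld b Z 0 $ k)" for b k
  have nu: "\<nu> b k = 1 \<or> \<nu> b k = -1" for b k using nz by (simp add: \<nu>_def sgn_if)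
  have nz': "fld b Z' 0 $ k \<noteq> 0" for b k using nz[of b k] sg[of b k] by (metis sgn_0_0)
  have pos: "0 < \<nu> b k * fld b Z 0 $ k" "0 < \<nu> b k * fld b Z' 0 $ k" for b k
    using nz[of b k] nz'[of b k] sg[of b k] by (auto simp: \<nu>_def sgn_mult_self_eq abs_sgn[symmetric] mult.commute)
      (metis abs_sgn mult.commute zero_less_abs_iff)+
  have sgi: "sgn (slope_gap Z' i) = sgn (slope_gap Z i)" "slope_gap Z i \<noteq> 0" "slope_gap Z' i \<noteq> 0" for i
  proof -
    have g': "slope_gap Z' 1 \<noteq> 0" using gap sg_gap by (metis sgn_0_0)
    have "i = 1 \<or> i = other 1" using eq_other_iff[of i 1] by blast
    then show "sgn (slope_gap Z' i) = sgn (slope_gap Z i)" "slope_gap Z i \<noteq> 0" "slope_gap Z' i \<noteq> 0"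
      using gap g' sg_gap by (auto simp: slope_gap_other sgn_minus)
  qed
  have dir: "axis_direction Z' \<nu> = axis_direction Z \<nu>" by (rule ext) (simp add: axis_direction_def sgi)
  define j :: 2 where "j = (if \<nu> True 1 = \<nu> False 1 then 1 else 2)"
  have types: "\<nu> True j = \<nu> False j \<or> \<nu> True (other j) \<noteq> \<nu> False (other j)"
    by (auto simp: j_def other_def)
  obtain d L lo hi m M where S: "regular_square Z j d \<nu> (axis_direction Z \<nu>) (\<lambda>k. \<nu> True k = \<nu> False k) L lo hi m M" "square d \<subseteq> U"
    "0 < slope_gap Z (other j) \<Longrightarrow> M True < m False" "slope_gap Z (other j) < 0 \<Longrightarrow> M False < m True"
    by (rule regular_square_exists[OF U Z(1) nu pos(1) sgi(2) types]) (rule that, assumption+)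
  obtain d' L' lo' hi' m' M' where S': "regular_square Z' j d' \<nu> (axis_direction Z' \<nu>) (\<lambda>k. \<nu> True k = \<nu> False k) L' lo' hi' m' M'" "square d' \<subseteq> U"
    "0 < slope_gap Z' (other j) \<Longrightarrow> M' True < m' False" "slope_gap Z' (other j) < 0 \<Longrightarrow> M' False < m' True"
    by (rule regular_square_exists[OF U Z(2) nu pos(2) sgi(3) types]) (rule that, assumption+)
  have "M True < m False \<and> M' True < m' False \<or> M False < m True \<and> M' False < m' True"
    using S(3,4) S'(3,4) sgi[of "other j"] by (metis linorder_neqE_linordered_idom sgn_greater sgn_less)
  then show ?thesis by (rule squares_locally_equivalent[OF S(1) S'(1)[unfolded dir] _ S(2) S'(2)])
qed

section \<open>Topological invariants of the switching set\<close>
text \<open>The condition is local in time; this allows arcs to be glued along chains.\<close>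

lemma obeys_local:
  assumes o: "obeys V Z A J \<gamma> t" and t: "t \<in> J" and d: "0 < d"
    and eq: "\<And>s. \<bar>s - t\<bar> < d \<Longrightarrow> (s \<in> J' \<longleftrightarrow> s \<in> J) \<and> (s \<in> J \<longrightarrow> \<gamma>' s = \<gamma> s)"
  shows "obeys V Z A J' \<gamma>' t"
proof -
  have F: "at t within J' = at t within J"
  proof (rule at_within_nhd[of t "ball t d"])
    show "J' \<inter> ball t d - {t} = J \<inter> ball t d - {t}" using eq by (auto simp: dist_real_def abs_minus_commute)
  qed (use d in auto)
  have gt: "\<gamma>' t = \<gamma> t" using eq[of t] t d by simp
  have ev: "\<forall>\<^sub>F s in at t within J. \<gamma> s = \<gamma>' s"
    unfolding eventually_at using d eq by (intro exI[of _ d]) (auto simp: dist_real_def)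
  have der: "(\<gamma>' has_vector_derivative D) (at t within J)" if "(\<gamma> has_vector_derivative D) (at t within J)" for D
    using that unfolding has_vector_derivative_def
    by (rule has_derivative_transform_eventually) (use ev gt t in simp_all)
  have cont: "continuous (at t within J) \<gamma>'" if "continuous (at t within J) \<gamma>"
    using that Lim_transform_eventually[OF _ ev] by (simp add: continuous_within gt)
  have evP: "\<forall>\<^sub>F s in at t within J. P s (\<gamma>' s)" if "\<forall>\<^sub>F s in at t within J. P s (\<gamma> s)" for P
    using that ev by eventually_elim simp
  have orig: "\<exists>c\<in>A. c 0 = \<gamma> t \<and> (\<forall>\<^sub>F s in at t within J. \<gamma>' s = c (s - t))"
    if c0: "\<exists>c\<in>A. c 0 = \<gamma> t \<and> (\<forall>\<^sub>F s in at t within J. \<gamma> s = c (s - t))"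
  proof -
    obtain c where c: "c \<in> A" "c 0 = \<gamma> t" "\<forall>\<^sub>F s in at t within J. \<gamma> s = c (s - t)" using c0 by blast
    have "\<forall>\<^sub>F s in at t within J. \<gamma>' s = c (s - t)" using c(3) ev by eventually_elim simp
    then show ?thesis using c by blast
  qed
  note ev1 = evP[where P = "\<lambda>_ x. x \<notin> Sig V"] and ev2 = evP[where P = "\<lambda>_ x. x \<in> Sig_i V i" for i]
  show ?thesis
    using o unfolding obeys_def F gt
    by (elim conjE, intro conjI allI impI) (simp_all add: der cont ev1 ev2 del: insert_iff, rule orig, blast)
qed

text \<open>Every arc is contained in a trajectory, by Zorn's lemma for the graphs of its extensions.\<close>

lemma arc_extends_to_trajectory:
  assumes arc: "arc_of V Z (germs V Z) J \<gamma>"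
  shows "\<exists>J' \<gamma>'. trajectory V Z J' \<gamma>' \<and> J \<subseteq> J' \<and> (\<forall>t\<in>J. \<gamma>' t = \<gamma> t)"
proof -
  define gr where "gr J \<gamma> = (\<lambda>t. (t, \<gamma> t)) ` J" for J :: "real set" and \<gamma> :: "real \<Rightarrow> plane"
  have gr: "(t, x) \<in> gr J \<gamma> \<longleftrightarrow> t \<in> J \<and> x = \<gamma> t" for t x J \<gamma> by (auto simp: gr_def)
  have gr_le: "gr J1 \<gamma>1 \<subseteq> gr J2 \<gamma>2 \<longleftrightarrow> J1 \<subseteq> J2 \<and> (\<forall>t\<in>J1. \<gamma>2 t = \<gamma>1 t)" for J1 J2 \<gamma>1 \<gamma>2
    by (auto simp: gr_def)
  let ?arc = "arc_of V Z (germs V Z)"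
  define \<A> where "\<A> = {gr J' \<gamma>' | J' \<gamma>'. ?arc J' \<gamma>' \<and> gr J \<gamma> \<subseteq> gr J' \<gamma>'}"
  have "\<exists>M\<in>\<A>. \<forall>X\<in>\<A>. M \<subseteq> X \<longrightarrow> X = M"
  proof (rule subset_Zorn_nonempty)
    show "\<A> \<noteq> {}" using arc by (auto simp: \<A>_def)
    fix \<C> assume ne: "\<C> \<noteq> {}" and ch: "subset.chain \<A> \<C>"
    have sub: "\<C> \<subseteq> \<A>" and tot: "\<And>X Y. X \<in> \<C> \<Longrightarrow> Y \<in> \<C> \<Longrightarrow> X \<subseteq> Y \<or> Y \<subseteq> X"
      using ch by (auto simp: subset.chain_def)
    have rep: "\<exists>J1 \<gamma>1. X = gr J1 \<gamma>1 \<and> ?arc J1 \<gamma>1 \<and> gr J \<gamma> \<subseteq> X" if "X \<in> \<C>" for X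
      using subsetD[OF sub that] unfolding \<A>_def by blast
    define J' where "J' = fst ` \<Union>\<C>"
    define \<gamma>' where "\<gamma>' t = (THE x. (t, x) \<in> \<Union>\<C>)" for t
    have common: "\<exists>X\<in>\<C>. S \<subseteq> fst ` X" if "finite S" "S \<subseteq> J'" for S
      using that
    proof (induction S)
      case empty
      then show ?case using ne by blast
    next
      case (insert t S)
      then obtain X Y where "X \<in> \<C>" "S \<subseteq> fst ` X" "Y \<in> \<C>" "t \<in> fst ` Y" by (auto simp: J'_def)
      then show ?case using tot[of X Y] by (meson image_mono insert_subset order_trans subsetD)
    qed
    have g': "\<gamma>' t = \<gamma>1 t" if "gr J1 \<gamma>1 \<in> \<C>" "t \<in> J1" for t J1 \<gamma>1
      unfolding \<gamma>'_def
    proof (rule the_equality)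
      show "(t, \<gamma>1 t) \<in> \<Union>\<C>" using that gr by blast
      fix x assume "(t, x) \<in> \<Union>\<C>"
      then obtain Y where Y: "Y \<in> \<C>" "(t, x) \<in> Y" by blast
      obtain J2 \<gamma>2 where "Y = gr J2 \<gamma>2" using rep[OF Y(1)] by blast
      then show "x = \<gamma>1 t" using tot[OF Y(1) that(1)] Y that(2) gr by (metis subsetD)
    qed
    have J1sub: "J1 \<subseteq> J'" if "gr J1 \<gamma>1 \<in> \<C>" for J1 \<gamma>1 
    proof
      fix t assume "t \<in> J1"
      then have "(t, \<gamma>1 t) \<in> \<Union>\<C>" using that gr by blast
      then have "fst (t, \<gamma>1 t) \<in> J'" unfolding J'_def by (rule imageI)
      then show "t \<in> J'" by simp
    qed
    have member: "\<exists>J1 \<gamma>1. gr J1 \<gamma>1 \<in> \<C> \<and> ?arc J1 \<gamma>1 \<and> S \<subseteq> J1" if fs: "finite S" "S \<subseteq> J'" for S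
    proof -
      obtain X where X: "X \<in> \<C>" "S \<subseteq> fst ` X" using common[OF fs] by blast
      obtain J1 \<gamma>1 where "X = gr J1 \<gamma>1" "?arc J1 \<gamma>1" using rep[OF X(1)] by blast
      moreover have "fst ` gr J1 \<gamma>1 = J1" by (force simp: gr_def)
      ultimately show ?thesis using X by blast
    qed
    have U: "\<Union>\<C> = gr J' \<gamma>'"
    proof -
      have "(t, x) \<in> \<Union>\<C> \<longleftrightarrow> (t, x) \<in> gr J' \<gamma>'" for t x
      proof
        assume "(t, x) \<in> \<Union>\<C>"
        then obtain X where X: "X \<in> \<C>" "(t, x) \<in> X" by blast
        obtain J1 \<gamma>1 where "X = gr J1 \<gamma>1" using rep[OF X(1)] by blast
        then have "gr J1 \<gamma>1 \<in> \<C>" "t \<in> J1" "x = \<gamma>1 t" using X gr by auto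
        then show "(t, x) \<in> gr J' \<gamma>'" using g'[of J1 \<gamma>1 t] J1sub[of J1 \<gamma>1] by (auto simp: gr)
      next
        assume "(t, x) \<in> gr J' \<gamma>'"
        then have t: "t \<in> J'" "x = \<gamma>' t" using gr by auto
        obtain J1 \<gamma>1 where m: "gr J1 \<gamma>1 \<in> \<C>" "t \<in> J1" using member[of "{t}"] t by auto
        then have "(t, x) \<in> gr J1 \<gamma>1" using g'[OF m] t(2) by (simp add: gr)
        then show "(t, x) \<in> \<Union>\<C>" using m(1) by blast
      qed
      then show ?thesis by auto
    qed
    have int: "is_interval J'" unfolding is_interval_1
    proof (intro ballI allI impI)
      fix a b x assume ab: "a \<in> J'" "b \<in> J'" "a \<le> x \<and> x \<le> b"
      obtain J1 \<gamma>1 where m: "gr J1 \<gamma>1 \<in> \<C>" "?arc J1 \<gamma>1" "{a, b} \<subseteq> J1" using member[of "{a, b}"] ab by auto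
      then have "{a..b} \<subseteq> J1" by (intro interval_Icc_subset) (auto simp: arc_of_def)
      then show "x \<in> J'" using J1sub[OF m(1)] ab by auto
    qed
    have ob: "obeys V Z (germs V Z) J' \<gamma>' t" if t: "t \<in> J'" for t
    proof -
      define l where "l = (if \<exists>s\<in>J'. s < t then SOME s. s \<in> J' \<and> s < t else t)"
      define u where "u = (if \<exists>s\<in>J'. t < s then SOME s. s \<in> J' \<and> t < s else t)"
      have l: "l \<in> J'" "l < t \<or> (\<forall>s\<in>J'. t \<le> s)" using someI_ex[of "\<lambda>s. s \<in> J' \<and> s < t"] t by (auto simp: l_def not_less)
      have u: "u \<in> J'" "t < u \<or> (\<forall>s\<in>J'. s \<le> t)" using someI_ex[of "\<lambda>s. s \<in> J' \<and> t < s"] t by (auto simp: u_def not_less)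
      obtain J1 \<gamma>1 where m: "gr J1 \<gamma>1 \<in> \<C>" "?arc J1 \<gamma>1" "{t, l, u} \<subseteq> J1" using member[of "{t, l, u}"] t l u by auto
      define d where "d = min (if l < t then t - l else 1) (if t < u then u - t else 1)"
      have i1: "{l..t} \<subseteq> J1" "{t..u} \<subseteq> J1" 
      proof -
        have "is_interval J1" "t \<in> J1" "l \<in> J1" "u \<in> J1" using m by (simp_all add: arc_of_def)
        then show "{l..t} \<subseteq> J1" "{t..u} \<subseteq> J1" by (simp_all add: interval_Icc_subset)
      qed
      show ?thesis
      proof (rule obeys_local[where J = J1 and \<gamma> = \<gamma>1 and d = d])
        show "obeys V Z (germs V Z) J1 \<gamma>1 t" "t \<in> J1" using m by (auto simp: arc_of_def)
        show "0 < d" by (simp add: d_def)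
        fix s assume s: "\<bar>s - t\<bar> < d"
        have "s \<in> J1" if sJ: "s \<in> J'"
        proof (cases "s \<le> t")
          case True
          show ?thesis
          proof (cases "s = t")
            case False
            then have "l < t" using l(2) sJ True by force
            then have "l \<le> s" using s True by (auto simp: d_def abs_if split: if_splits)
            then show ?thesis using i1(1) True by auto
          qed (use m in auto)
        next
          case False
          then have "t < u" using u(2) sJ by force
          then have "s \<le> u" using s False by (auto simp: d_def abs_if split: if_splits)
          then show ?thesis using i1(2) False by auto
        qed
        then show "(s \<in> J' \<longleftrightarrow> s \<in> J1) \<and> (s \<in> J1 \<longrightarrow> \<gamma>' s = \<gamma>1 s)" using J1sub[OF m(1)] g'[OF m(1)] by blast
      qed
    qed
    obtain X where X: "X \<in> \<C>" using ne by blast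
    have le: "gr J \<gamma> \<subseteq> gr J' \<gamma>'" using rep[OF X] X U by blast
    then have "J' \<noteq> {}" using arc by (auto simp: arc_of_def gr_def)
    then have "?arc J' \<gamma>'" using int ob by (simp add: arc_of_def)
    then show "\<Union>\<C> \<in> \<A>" using le U by (auto simp: \<A>_def)
  qed
  then obtain J' \<gamma>' where M: "?arc J' \<gamma>'" "gr J \<gamma> \<subseteq> gr J' \<gamma>'" and max: "\<And>X. X \<in> \<A> \<Longrightarrow> gr J' \<gamma>' \<subseteq> X \<Longrightarrow> X = gr J' \<gamma>'"
    by (auto simp: \<A>_def)
  have "J2 = J'" if "?arc J2 \<gamma>2" "J' \<subseteq> J2" "\<forall>t\<in>J'. \<gamma>2 t = \<gamma>' t" for J2 \<gamma>2
  proof -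
    have le: "gr J' \<gamma>' \<subseteq> gr J2 \<gamma>2" using that by (simp add: gr_le)
    have "gr J2 \<gamma>2 \<in> \<A>" using order_trans[OF M(2) le] that(1) unfolding \<A>_def by blast
    from max[OF this le] have "gr J2 \<gamma>2 \<subseteq> gr J' \<gamma>'" by simp
    then show ?thesis using that(2) by (simp add: gr_le)
  qed
  then have "trajectory V Z J' \<gamma>'" using M(1) unfolding trajectory_def by blast
  then show ?thesis using M(2) by (auto simp: gr_le)
qed

lemma slidings_iff: "p \<in> slidings V Z i \<longleftrightarrow> p \<in> Sig_i V i \<and> p $ other i \<noteq> 0 \<and> fst Z p $ i * snd Z p $ i < 0"
  by (auto simp: slidings_def sliding_def escaping_def Sig_i_plus_def Sig_i_minus_def Sig_i_def mult_less_0_iff)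

lemma crossings_iff: "p \<in> crossings V Z \<longleftrightarrow> (\<exists>i. p \<in> Sig_i V i \<and> 0 < fst Z p $ i * snd Z p $ i)"
  by (auto simp: crossings_def crossing_def)

lemma obeys_sliding:
  assumes p: "\<gamma> t \<in> slidings V Z i"
    and der: "(\<gamma> has_vector_derivative sliding_field Z i (\<gamma> t)) (at t within J)"
    and ev: "\<forall>\<^sub>F s in at t within J. \<gamma> s \<in> Sig_i V i"
  shows "obeys V Z A J \<gamma> t"
proof -
  have s: "\<gamma> t \<in> V" "\<gamma> t $ i = 0" "\<gamma> t $ other i \<noteq> 0" "fst Z (\<gamma> t) $ i * snd Z (\<gamma> t) $ i < 0"
    using p by (auto simp: slidings_iff Sig_i_def)
  have i': "i' = i" if "\<gamma> t $ i' = 0" for i' using that s eq_other_iff[of i' i] by auto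
  have z: "\<gamma> t $ 1 * \<gamma> t $ 2 = 0" using s prod_other[of "\<gamma> t" i] by simp
  have "\<gamma> t \<notin> crossings V Z"
  proof
    assume "\<gamma> t \<in> crossings V Z"
    then obtain k where k: "\<gamma> t $ k = 0" "0 < fst Z (\<gamma> t) $ k * snd Z (\<gamma> t) $ k" by (auto simp: crossings_iff Sig_i_def)
    then show False using s(4) i'[OF k(1)] by simp
  qed
  moreover have "\<gamma> t \<notin> tangencies V Z" using p by (auto simp: tangencies_def)
  moreover have "\<gamma> t \<noteq> 0" using s by auto
  moreover have "i' = i" if "\<gamma> t \<in> slidings V Z i'" for i' using that i' by (auto simp: slidings_iff Sig_i_def)
  ultimately show ?thesis
    unfolding obeys_def pos_part_def neg_part_def using s(1) z der ev by auto
qed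

text \<open>The scalar equation on \<open>\<Sigma>\<^sub>i\<close> has a continuous right hand side. At its zeros the arc rests;
  elsewhere it is solved by separation of variables.\<close>

lemma sliding_arc_exists:
  assumes V: "open V" and cont: "continuous_on V (fst Z)" "continuous_on V (snd Z)" and q: "q \<in> slidings V Z i"
  obtains J \<gamma> t s where "arc_of V Z A J \<gamma>" "t \<in> J" "s \<in> J" "s \<noteq> t" "\<gamma> t = q" "\<And>s. s \<in> J \<Longrightarrow> \<gamma> s \<in> Sig_i V i"
proof -
  let ?k = "other i" and ?S = "sliding_field Z i"
  have qs: "q \<in> V" "q $ i = 0" "q $ ?k \<noteq> 0" "fst Z q $ i * snd Z q $ i < 0" using q by (auto simp: slidings_iff Sig_i_def)
  show thesis
  proof (cases "?S q $ ?k = 0")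
    case True
    have S0: "?S q = 0" using True by (simp add: sliding_field_def plane_eq_iff[of _ _ i] axis_def)
    show thesis
    proof (rule that[of UNIV "\<lambda>_. q" 0 1])
      have "obeys V Z A UNIV (\<lambda>_. q) t" for t
        by (rule obeys_sliding[of _ _ _ _ i]) (use q S0 in \<open>auto simp: slidings_iff\<close>)
      then show "arc_of V Z A UNIV (\<lambda>_. q)" by (simp add: arc_of_def)
    qed (use q in \<open>auto simp: slidings_iff\<close>)
  next
    case False
    define \<sigma> where "\<sigma> = sgn (?S q $ ?k)"
    have \<sigma>: "\<sigma> = 1 \<or> \<sigma> = -1" using False by (simp add: \<sigma>_def sgn_if)
    define \<beta> where "\<beta> w = mk ?k 0 (q $ ?k + \<sigma> * w)" for w
    have \<beta>i: "\<beta> w $ i = 0" for w by (simp add: \<beta>_def)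
    have \<beta>0: "\<beta> 0 = q" using qs by (simp add: \<beta>_def plane_eq_iff[of _ _ i] mk_nth(1))
    have \<beta>c: "isCont \<beta> w" for w unfolding \<beta>_def mk_def by (intro continuous_intros)
    have \<beta>d: "(\<beta> has_vector_derivative \<sigma> *\<^sub>R axis ?k 1) (at w)" for w
    proof -
      have "(\<beta> has_vector_derivative mk ?k 0 \<sigma>) (at w)"
        unfolding \<beta>_def by (rule mk_has_vector_derivative) (auto intro!: derivative_eq_intros)
      then show ?thesis by (simp add: mk_def)
    qed
    have icF: "isCont (fst Z) q" "isCont (snd Z) q" using cont V qs(1) by (auto simp: continuous_on_eq_continuous_at)
    have den: "snd Z p $ i - fst Z p $ i \<noteq> 0" if "fst Z p $ i * snd Z p $ i < 0" for p using that by (auto simp: mult_less_0_iff)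
    have icS: "isCont (\<lambda>p. ?S p $ ?k) p" if "p \<in> V" "fst Z p $ i * snd Z p $ i < 0" for p
    proof -
      have "isCont (fst Z) p" "isCont (snd Z) p" using cont V that(1) by (auto simp: continuous_on_eq_continuous_at)
      then show ?thesis using den[OF that(2)] by (simp add: sliding_field_def axis_def)
    qed
    define P where "P p \<longleftrightarrow> p \<in> V \<and> p $ ?k \<noteq> 0 \<and> fst Z p $ i * snd Z p $ i < 0 \<and>
       \<bar>?S q $ ?k\<bar> / 2 \<le> \<sigma> * ?S p $ ?k \<and> \<sigma> * ?S p $ ?k \<le> 2 * \<bar>?S q $ ?k\<bar>" for p
    have "\<forall>\<^sub>F p in nhds q. P p"
    proof -
      have t1: "((\<lambda>p. \<sigma> * ?S p $ ?k) \<longlongrightarrow> \<sigma> * ?S q $ ?k) (nhds q)"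
        using icS[OF qs(1,4)] unfolding isCont_def
        by (intro tendsto_mult_left) (rule tendsto_at_iff_tendsto_nhds[THEN iffD1])
      have v: "\<sigma> * ?S q $ ?k = \<bar>?S q $ ?k\<bar>" by (simp add: \<sigma>_def abs_sgn mult.commute)
      have p: "0 < \<bar>?S q $ ?k\<bar>" using False by simp
      have a1: "\<forall>\<^sub>F p in nhds q. \<bar>?S q $ ?k\<bar> / 2 < \<sigma> * ?S p $ ?k" by (rule order_tendstoD(1)[OF t1]) (use v p in linarith)
      have a2: "\<forall>\<^sub>F p in nhds q. \<sigma> * ?S p $ ?k < 2 * \<bar>?S q $ ?k\<bar>" by (rule order_tendstoD(2)[OF t1]) (use v p in linarith)
      have a3: "\<forall>\<^sub>F p in nhds q. p \<in> V" by (rule eventually_nhds_in_open[OF V qs(1)])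
      have "isCont (\<lambda>p. fst Z p $ i * snd Z p $ i) q" using icF by (intro continuous_intros)
      then have "((\<lambda>p. fst Z p $ i * snd Z p $ i) \<longlongrightarrow> fst Z q $ i * snd Z q $ i) (nhds q)"
        unfolding isCont_def by (rule tendsto_at_iff_tendsto_nhds[THEN iffD1])
      then have a4: "\<forall>\<^sub>F p in nhds q. fst Z p $ i * snd Z p $ i < 0" using qs(4) by (rule order_tendstoD)
      have "open {p :: plane. p $ ?k \<noteq> 0}" by (intro open_Collect_neq continuous_intros)
      then have a5: "\<forall>\<^sub>F p in nhds q. p \<in> {p. p $ ?k \<noteq> 0}" by (rule eventually_nhds_in_open) (use qs in auto)
      show ?thesis using a1 a2 a3 a4 a5 by eventually_elim (auto simp: P_def)
    qed
    moreover have "(\<beta> \<longlongrightarrow> q) (nhds 0)" 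
    proof -
      have "(\<beta> \<longlongrightarrow> \<beta> 0) (nhds 0)" using \<beta>c[of 0] unfolding isCont_def by (rule tendsto_at_iff_tendsto_nhds[THEN iffD1])
      then show ?thesis by (simp add: \<beta>0)
    qed
    ultimately have "\<forall>\<^sub>F w in nhds 0. P (\<beta> w)" by (rule eventually_compose_filterlim)
    then obtain \<delta> where \<delta>: "0 < \<delta>" "\<And>w. \<bar>w\<bar> < \<delta> \<Longrightarrow> P (\<beta> w)" unfolding eventually_nhds_metric by (auto simp: dist_real_def)
    define J0 where "J0 = {-\<delta><..<\<delta>}"
    have PJ: "P (\<beta> w)" if "w \<in> J0" for w using that \<delta>(2)[of w] by (auto simp: J0_def abs_less_iff)
    have "\<exists>\<tau>. \<tau> 0 = 0 \<and> continuous_on J0 \<tau> \<and> strict_mono_on J0 \<tau> \<and> is_interval (\<tau> ` J0) \<and>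
     (\<forall>\<gamma>. (\<forall>t\<in>J0. \<gamma> (\<tau> t) = \<beta> t) \<longrightarrow>
        (\<forall>t\<in>J0 - {}. (\<gamma> has_vector_derivative ?S (\<beta> t)) (at (\<tau> t) within \<tau> ` J0)))"
    proof (rule time_change[where m = "\<lambda>w. w" and v = "\<lambda>w. \<sigma> * ?S (\<beta> w) $ ?k"])
      show "is_interval J0" "continuous_on J0 (\<lambda>w. w)" "strict_mono_on J0 (\<lambda>w. w)" by (auto simp: J0_def strict_mono_on_def)
      show "0 < \<bar>?S q $ ?k\<bar> / 2" using False by simp
      fix w assume w: "w \<in> J0 - {}"
      then have p: "P (\<beta> w)" using PJ by simp
      then show "\<bar>?S q $ ?k\<bar> / 2 \<le> \<sigma> * ?S (\<beta> w) $ ?k \<and> \<sigma> * ?S (\<beta> w) $ ?k \<le> 2 * \<bar>?S q $ ?k\<bar>" by (simp add: P_def)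
      have "isCont (\<lambda>p. ?S p $ ?k) (\<beta> w)" using icS p by (simp add: P_def)
      with \<beta>c[of w] have "isCont (\<lambda>w. ?S (\<beta> w) $ ?k) w" by (rule isCont_o2)
      then show "continuous (at w within J0) (\<lambda>w. \<sigma> * ?S (\<beta> w) $ ?k)"
        by (rule continuous_at_imp_continuous_at_within[OF continuous_mult[OF continuous_const]])
      have nz: "?S (\<beta> w) $ ?k \<noteq> 0" using p False by (auto simp: P_def)
      have "\<sigma> *\<^sub>R axis ?k 1 = (1 / (\<sigma> * ?S (\<beta> w) $ ?k)) *\<^sub>R ?S (\<beta> w)"
        using nz \<sigma> by (auto simp: plane_eq_iff[of _ _ ?k] sliding_field_def axis_def)
      then show "\<exists>D. \<beta> w = D w \<and> (\<forall>\<^sub>F s in at w within J0. \<beta> s = D s) \<and>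
         (D has_vector_derivative (1 / (\<sigma> * ?S (\<beta> w) $ ?k)) *\<^sub>R ?S (\<beta> w)) (at w)"
        using \<beta>d[of w] by (intro exI[of _ \<beta>]) auto
    qed auto
    then obtain \<tau> where \<tau>0: "\<tau> 0 = 0" and \<tau>: "strict_mono_on J0 \<tau>" "is_interval (\<tau> ` J0)"
      and \<tau>d: "\<And>\<gamma> t. (\<And>t. t \<in> J0 \<Longrightarrow> \<gamma> (\<tau> t) = \<beta> t) \<Longrightarrow> t \<in> J0 \<Longrightarrow>
        (\<gamma> has_vector_derivative ?S (\<beta> t)) (at (\<tau> t) within \<tau> ` J0)" by blast
    have inj: "inj_on \<tau> J0" using \<tau>(1) by (rule strict_mono_on_imp_inj_on)
    define \<gamma> where "\<gamma> = \<beta> \<circ> inv_into J0 \<tau>"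
    have \<gamma>: "\<gamma> (\<tau> w) = \<beta> w" if "w \<in> J0" for w using inj that by (simp add: \<gamma>_def)
    have Sg: "\<gamma> s \<in> Sig_i V i" if "s \<in> \<tau> ` J0" for s using that PJ \<gamma> \<beta>i by (auto simp: P_def Sig_i_def)
    have in0: "0 \<in> J0" "\<delta> / 2 \<in> J0" using \<delta> by (auto simp: J0_def)
    show thesis
    proof (rule that[of "\<tau> ` J0" \<gamma> "\<tau> 0" "\<tau> (\<delta> / 2)"])
      have "obeys V Z A (\<tau> ` J0) \<gamma> (\<tau> w)" if w: "w \<in> J0" for w
      proof (rule obeys_sliding[of _ _ _ _ i])
        show "\<gamma> (\<tau> w) \<in> slidings V Z i" using PJ[OF w] \<beta>i by (simp add: \<gamma>[OF w] slidings_iff P_def Sig_i_def)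
        show "(\<gamma> has_vector_derivative ?S (\<gamma> (\<tau> w))) (at (\<tau> w) within \<tau> ` J0)" unfolding \<gamma>[OF w] by (rule \<tau>d[OF \<gamma> w])
        show "\<forall>\<^sub>F s in at (\<tau> w) within \<tau> ` J0. \<gamma> s \<in> Sig_i V i" using eventually_in_at_within by eventually_elim (rule Sg)
      qed
      then show "arc_of V Z A (\<tau> ` J0) \<gamma>" using \<tau>(2) in0 by (auto simp: arc_of_def)
      show "\<tau> (\<delta> / 2) \<noteq> \<tau> 0" using inj in0 \<delta> by (auto dest: inj_onD)
    qed (use in0 \<gamma> \<beta>0 Sg in auto)
  qed
qed

text \<open>Sliding and crossing points are distinguished by the trajectories through them: the ones
  remain in \<open>\<Sigma>\<close> for some time, the others do not.\<close>

lemma sliding_not_mapped_to_crossing: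
  assumes V: "open V" and cont: "continuous_on V (fst Z)" "continuous_on V (snd Z)"
    and maps: "maps_trajectories V Z V' Z' h" and Sg: "h ` Sig V \<subseteq> Sig V'"
    and q: "q \<in> slidings V Z i" and hq: "h q \<in> crossings V' Z' - {0}"
  shows False
proof -
  obtain J \<gamma> t s where arc: "arc_of V Z (germs V Z) J \<gamma>" and ts: "t \<in> J" "s \<in> J" "s \<noteq> t"
    and gt: "\<gamma> t = q" and gS: "\<And>s. s \<in> J \<Longrightarrow> \<gamma> s \<in> Sig_i V i"
    by (rule sliding_arc_exists[OF V cont q, of "germs V Z"]) (rule that, assumption+)
  obtain J1 \<gamma>1 where tr: "trajectory V Z J1 \<gamma>1" and ext: "J \<subseteq> J1" "\<And>t. t \<in> J \<Longrightarrow> \<gamma>1 t = \<gamma> t"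
    using arc_extends_to_trajectory[OF arc] by blast
  obtain J2 \<gamma>2 \<tau> where tr2: "trajectory V' Z' J2 \<gamma>2" and \<tau>: "strict_mono_on J1 \<tau>" "\<tau> ` J1 = J2"
    and eq: "\<And>t. t \<in> J1 \<Longrightarrow> h (\<gamma>1 t) = \<gamma>2 (\<tau> t)"
    using maps tr unfolding maps_trajectories_def by blast
  have tJ1: "t \<in> J1" using ts ext by blast
  have "is_interval (\<tau> ` J1)" using tr2 \<tau> by (auto simp: trajectory_def arc_of_def)
  from strict_mono_on_interval_image_continuous[OF \<tau>(1) this] have c\<tau>: "continuous_on J1 \<tau>" .
  have "obeys V' Z' (germs V' Z') J2 \<gamma>2 (\<tau> t)" using tr2 \<tau>(2) tJ1 by (auto simp: trajectory_def arc_of_def)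
  moreover have "\<gamma>2 (\<tau> t) = h q" using eq[OF tJ1] ext(2)[OF ts(1)] gt by simp
  ultimately have ev: "\<forall>\<^sub>F s in at (\<tau> t) within J2. \<gamma>2 s \<notin> Sig V'" using hq by (simp add: obeys_def)
  have "filterlim \<tau> (at (\<tau> t) within J2) (at t within J)"
    unfolding filterlim_at
  proof
    have "inj_on \<tau> J1" using \<tau>(1) by (rule strict_mono_on_imp_inj_on)
    then show "\<forall>\<^sub>F s in at t within J. \<tau> s \<in> J2 \<and> \<tau> s \<noteq> \<tau> t"
      unfolding eventually_at_filter by (intro always_eventually) (use ext(1) \<tau>(2) tJ1 in \<open>auto dest: inj_onD\<close>)
    have "continuous_on J \<tau>" using c\<tau> ext(1) by (rule continuous_on_subset)
    then show "(\<tau> \<longlongrightarrow> \<tau> t) (at t within J)" using ts(1) by (simp add: continuous_on_def)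
  qed
  from eventually_compose_filterlim[OF ev this] have "\<forall>\<^sub>F s in at t within J. \<gamma>2 (\<tau> s) \<notin> Sig V'" .
  moreover have "\<forall>\<^sub>F s in at t within J. s \<in> J" by (rule eventually_in_at_within)
  ultimately have "\<forall>\<^sub>F s in at t within J. False"
  proof eventually_elim
    case (elim s)
    have "\<gamma> s \<in> Sig V" using gS[OF elim(2)] by (auto simp: Sig_iff Sig_i_def)
    then have "h (\<gamma> s) \<in> Sig V'" using Sg by blast
    moreover have "h (\<gamma> s) = \<gamma>2 (\<tau> s)" using eq[of s] ext elim by auto
    ultimately show ?case using elim by simp
  qed
  moreover have "t islimpt J"
  proof (rule connected_imp_perfect)
    show "connected J" using arc by (simp add: arc_of_def is_interval_connected)
  qed (use ts in auto)
  ultimately show False by (simp add: eventually_False trivial_limit_within)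
qed

text \<open>Two paths in the line that start at the same point towards the same side run into each other.\<close>

lemma injective_images_overlap:
  fixes f g :: "real \<Rightarrow> real"
  assumes c: "0 < c" and f: "continuous_on {0..c} f" and g: "continuous_on {0..c} g" and 0: "f 0 = g 0"
    and side: "0 < (f c - f 0) * (g c - g 0)"
  shows "\<exists>s\<in>{0<..c}. \<exists>t\<in>{0<..c}. f s = g t"
proof -
  have up: "\<exists>s\<in>{0<..c}. \<exists>t\<in>{0<..c}. f s = g t"
    if f: "continuous_on {0..c} f" and g: "continuous_on {0..c} g" and 0: "f 0 = g 0" and s: "f 0 < f c" "f 0 < g c" for f g :: "real \<Rightarrow> real"
  proof (cases "f c \<le> g c")
    case True
    then obtain t where "0 \<le> t" "t \<le> c" "g t = f c" using IVT'[of g 0 "f c" c] g s 0 c by auto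
    then show ?thesis using s 0 c by (intro bexI[of _ c] bexI[of _ t]) (auto simp: less_le)
  next
    case False
    then obtain t where "0 \<le> t" "t \<le> c" "f t = g c" using IVT'[of f 0 "g c" c] f s 0 c by auto
    then show ?thesis using s 0 c by (intro bexI[of _ t] bexI[of _ c]) (auto simp: less_le)
  qed
  show ?thesis
  proof (cases "f 0 < f c")
    case True
    then show ?thesis using up[OF f g 0] side 0 by (auto simp: zero_less_mult_iff)
  next
    case False
    then have "f c < f 0" "g c < f 0" using side 0 by (auto simp: zero_less_mult_iff)
    then show ?thesis using up[of "\<lambda>s. - f s" "\<lambda>s. - g s"] f g 0 by (auto intro: continuous_on_minus)
  qed
qed

text \<open>The origin is the only point of \<open>\<Sigma>\<close> at which three disjoint arcs of \<open>\<Sigma>\<close> meet; two of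
  three such arcs in a line would overlap.\<close>

lemma origin_fixed:
  assumes V: "open V" "0 \<in> V" and hom: "homeomorphism V V' h g" and Sg: "h ` Sig V = Sig V'"
  shows "h 0 = 0"
proof (rule ccontr)
  assume nz: "h 0 \<noteq> 0"
  have S0: "0 \<in> Sig V" using V by (auto simp: Sig_iff)
  have hV: "\<And>p. p \<in> V \<Longrightarrow> h p \<in> V'" and inj: "inj_on h V" and ch: "continuous_on V h"
    using hom by (auto simp: homeomorphism_def inj_on_def) metis
  have "h 0 \<in> Sig V'" using Sg S0 by blast
  then obtain i where i: "h 0 $ i = 0" by (auto simp: Sig_iff)
  then have o: "h 0 $ other i \<noteq> 0" using nz by (auto simp: plane_eq_iff[of _ _ i])
  have ic: "isCont h 0" using ch V by (simp add: continuous_on_eq_continuous_at)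
  have "open {p :: plane. p $ other i \<noteq> 0}" by (intro open_Collect_neq continuous_intros)
  from eventually_nhds_in_open[OF this, of "h 0"] have "\<forall>\<^sub>F q in nhds (h 0). q $ other i \<noteq> 0" using o by simp
  moreover have "(h \<longlongrightarrow> h 0) (nhds 0)" using ic unfolding isCont_def by (rule tendsto_at_iff_tendsto_nhds[THEN iffD1])
  ultimately have "\<forall>\<^sub>F p in nhds 0. h p $ other i \<noteq> 0" by (rule eventually_compose_filterlim)
  moreover have "\<forall>\<^sub>F p in nhds 0. p \<in> V" by (rule eventually_nhds_in_open[OF V])
  ultimately have "\<forall>\<^sub>F p in nhds 0. p \<in> V \<and> h p $ other i \<noteq> 0" by eventually_elim simp
  then obtain d where d: "0 < d" "\<And>p. p \<in> square d \<Longrightarrow> p \<in> V \<and> h p $ other i \<noteq> 0" by (rule eventually_square) (rule that)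
  define \<phi> where "\<phi> p = h p $ other i" for p
  have h_eq: "h p $ i = 0" if "p \<in> square d" "p \<in> Sig V" for p
  proof -
    have "h p \<in> Sig V'" using that Sg by blast
    then obtain k where "h p $ k = 0" by (auto simp: Sig_iff)
    then show ?thesis using d(2)[OF that(1)] by (cases "k = i") (auto simp: eq_other_iff)
  qed
  have \<phi>inj: "p = q" if "p \<in> square d" "p \<in> Sig V" "q \<in> square d" "q \<in> Sig V" "\<phi> p = \<phi> q" for p q
  proof -
    have "h p = h q" using that h_eq by (simp add: plane_eq_iff[of _ _ i] \<phi>_def)
    then show ?thesis using inj d(2) that by (auto dest: inj_onD)
  qed
  \<comment> \<open>Three of the four half axes, parametrized by the distance from the origin.\<close>
  define arm :: "nat \<Rightarrow> real \<Rightarrow> plane" where "arm n s = (if n = 0 then s *\<^sub>R axis 1 1 else if n = 1 then (- s) *\<^sub>R axis 1 1 else s *\<^sub>R axis 2 1)" for n :: nat and s :: real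
  have arm_in: "arm n s \<in> square d" "arm n s \<in> Sig V" if "s \<in> {0..d}" for n s
  proof -
    show sq: "arm n s \<in> square d" using that by (auto simp: arm_def square_def axis_def)
    show "arm n s \<in> Sig V" using d(2)[OF sq] by (auto simp: Sig_def arm_def axis_def)
  qed
  have arm_c: "continuous_on {0..d} (\<lambda>s. \<phi> (arm n s))" for n
  proof -
    have "continuous_on {0..d} (arm n)" unfolding arm_def by (cases "n = 0"; cases "n = 1") (auto intro!: continuous_intros)
    then have "continuous_on {0..d} (\<lambda>s. h (arm n s))"
      by (rule continuous_on_compose2[OF ch]) (use arm_in d(2) in auto)
    then show ?thesis unfolding \<phi>_def by (intro continuous_intros)
  qed
  have arm_disj: "arm n s \<noteq> arm n' t" if "n < n'" "n' < 3" "0 < s" "0 < t" for n n' s t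
    using that by (auto simp: arm_def vec_eq_iff axis_def forall_2)
  have no: "\<not> 0 < (\<phi> (arm n d) - \<phi> 0) * (\<phi> (arm n' d) - \<phi> 0)" if n: "n < n'" "n' < 3" for n n'
  proof
    assume pos: "0 < (\<phi> (arm n d) - \<phi> 0) * (\<phi> (arm n' d) - \<phi> 0)"
    have a0: "arm n 0 = 0" for n by (simp add: arm_def)
    obtain s t where st: "s \<in> {0<..d}" "t \<in> {0<..d}" "\<phi> (arm n s) = \<phi> (arm n' t)"
      using injective_images_overlap[OF d(1) arm_c[of n] arm_c[of n']] pos by (auto simp: a0)
    then have "arm n s = arm n' t" by (intro \<phi>inj arm_in) auto
    then show False using arm_disj[OF n] st by auto
  qed
  have ne: "\<phi> (arm n d) \<noteq> \<phi> 0" if "n < 3" for n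
  proof
    assume e: "\<phi> (arm n d) = \<phi> 0"
    have "arm n d = 0" by (rule \<phi>inj[OF arm_in _ S0 e]) (use d V in \<open>auto simp: square_def\<close>)
    then show False using d(1) by (auto simp: arm_def axis_eq_0_iff split: if_splits)
  qed
  have nes: "\<phi> (arm 0 d) - \<phi> 0 \<noteq> 0" "\<phi> (arm 1 d) - \<phi> 0 \<noteq> 0" "\<phi> (arm 2 d) - \<phi> 0 \<noteq> 0" using ne[of 0] ne[of 1] ne[of 2] by simp_all
  show False
    using no[of 0 1] no[of 0 2] no[of 1 2] nes
    by (simp add: zero_less_mult_iff not_less) linarith
qed

text \<open>\<open>F\<^sub>i\<close> has a simple zero along \<open>\<Sigma>\<^sub>i\<close> at the origin and \<open>O'\<^sub>i\<close> does not vanish there, so their product takes both signs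
  arbitrarily near the origin.\<close>

lemma fold_points_near_origin:
  fixes F O' :: field
  assumes diff: "F differentiable (at 0)" and F0: "F 0 $ i = 0" and kn: "partial (other i) F 0 $ i \<noteq> 0"
    and O: "isCont O' 0" "O' 0 $ i \<noteq> 0" and V: "open V" "0 \<in> V" and \<tau>: "\<tau> = 1 \<or> \<tau> = -1" and N: "\<forall>\<^sub>F p in nhds 0. N p"
  obtains q where "q \<in> Sig_i V i" "q $ other i \<noteq> 0" "0 < \<tau> * (F q $ i * O' q $ i)" "N q"
proof -
  let ?\<kappa> = "partial (other i) F 0 $ i" and ?a = "\<lambda>s. s *\<^sub>R (axis (other i) 1 :: plane)"
  have a_lim: "(?a \<longlongrightarrow> 0) (at 0 within A)" for A
    using tendsto_scaleR[OF tendsto_ident_at tendsto_const, of "axis (other i) 1 :: plane" 0 A] by simp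
  have "(F has_derivative frechet_derivative F (at 0)) (at (?a 0))" using diff by (simp add: frechet_derivative_works)
  moreover have "(?a has_vector_derivative axis (other i) 1) (at 0)"
    by (auto intro!: derivative_eq_intros simp: has_vector_derivative_def)
  ultimately have "((F \<circ> ?a) has_vector_derivative frechet_derivative F (at 0) (axis (other i) 1)) (at 0)"
    using vector_derivative_diff_chain_within[of ?a "axis (other i) 1" 0 UNIV F "frechet_derivative F (at 0)"]
    by (simp add: has_derivative_at_withinI)
  from has_vector_derivative_nth[OF this, of 1 i] have "((\<lambda>s. F (?a s) $ i) has_real_derivative ?\<kappa>) (at 0)"
    by (simp add: partial_def)
  then have l1: "((\<lambda>s. F (?a s) $ i / s) \<longlongrightarrow> ?\<kappa>) (at 0)" by (simp add: has_field_derivative_iff F0)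
  have l2: "((\<lambda>s. O' (?a s) $ i) \<longlongrightarrow> O' 0 $ i) (at 0)"
    by (intro tendsto_intros isCont_tendsto_compose[OF O(1)] a_lim)
  have l3: "((\<lambda>s. (F (?a s) $ i / s * ?\<kappa>) * (O' (?a s) $ i * O' 0 $ i)) \<longlongrightarrow> (?\<kappa> * ?\<kappa>) * (O' 0 $ i * O' 0 $ i)) (at 0)"
    by (intro tendsto_intros l1 l2)
  have "0 < (?\<kappa> * ?\<kappa>) * (O' 0 $ i * O' 0 $ i)" using kn O(2) by (auto simp: zero_less_mult_iff linorder_neq_iff)
  from order_tendstoD(1)[OF l3 this] have e1: "\<forall>\<^sub>F s in at 0. 0 < (F (?a s) $ i / s * ?\<kappa>) * (O' (?a s) $ i * O' 0 $ i)" .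
  have "\<forall>\<^sub>F p in nhds 0. p \<in> V \<and> N p" using eventually_nhds_in_open[OF V] N by eventually_elim simp
  from eventually_compose_filterlim[OF this a_lim] have e2: "\<forall>\<^sub>F s in at 0. ?a s \<in> V \<and> N (?a s)" .
  obtain d where d: "0 < d" "\<And>s. s \<noteq> 0 \<Longrightarrow> dist s 0 < d \<Longrightarrow>
      0 < (F (?a s) $ i / s * ?\<kappa>) * (O' (?a s) $ i * O' 0 $ i) \<and> ?a s \<in> V \<and> N (?a s)"
    using eventually_conj[OF e1 e2] unfolding eventually_at by blast
  \<comment> \<open>The product is close to \<open>s * ?\<kappa> * O' 0 $ i\<close>, to which this \<open>s\<close> gives the sign \<open>\<tau>\<close>.\<close>
  define s where "s = \<tau> * sgn (?\<kappa> * O' 0 $ i) * (d / 2)"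
  have s: "s \<noteq> 0" "dist s 0 < d" using \<tau> kn O(2) d(1) by (auto simp: s_def sgn_if)
  have p: "0 < (F (?a s) $ i / s * ?\<kappa>) * (O' (?a s) $ i * O' 0 $ i)" "?a s \<in> V" "N (?a s)" using d(2)[OF s] by auto
  show thesis
  proof (rule that[of "?a s"])
    let ?P = "F (?a s) $ i * O' (?a s) $ i" and ?R = "\<bar>?\<kappa> * O' 0 $ i\<bar> / (d / 2)"
    have e1: "(F (?a s) $ i / s * ?\<kappa>) * (O' (?a s) $ i * O' 0 $ i) = ?P * (?\<kappa> * O' 0 $ i / s)" by simp
    have e2: "?\<kappa> * O' 0 $ i / s = \<tau> * ?R"
      using \<tau> kn O(2) d(1) by (auto simp: s_def sgn_if field_simps)
    have "0 < ?P * (\<tau> * ?R)" using p(1) unfolding e1 e2 .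
    then have "0 < (\<tau> * ?P) * ?R" by (simp only: mult_ac)
    moreover have "0 < ?R" using kn O(2) d(1) by simp
    ultimately show "0 < \<tau> * ?P" by (rule zero_less_mult_pos2)
  qed (use p s in \<open>auto simp: Sig_i_def axis_def\<close>)
qed

section \<open>Instability of folds\<close>
lemma Cr_fields_continuous_on:
  assumes "f \<in> Cr_fields r U" "1 \<le> r" "V \<subseteq> U" shows "continuous_on V f"
proof (rule continuous_at_imp_continuous_on, rule ballI)
  fix x assume "x \<in> V"
  then have "f differentiable (at x)" using assms Cr_fields_differentiable by blast
  then show "isCont f x" by (rule differentiable_imp_continuous_within)
qed

lemma fld_prod: "fld b Z p $ k * fld (\<not> b) Z p $ k = fst Z p $ k * snd Z p $ k"
  by (cases b) (simp_all add: fld_def)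

lemma fld_Omega: "Z \<in> Omega r U \<Longrightarrow> fld b Z \<in> Cr_fields r U"
  by (auto simp: Omega_def fld_def)

text \<open>All points of \<open>\<Sigma>\<close> near the origin, except the origin, are crossed by \<open>Z'\<close> (if \<open>\<tau> = 1\<close>) or all slide or
  escape (if \<open>\<tau> = -1\<close>). The fold provides points of the opposite type for \<open>Z\<close> arbitrarily near the origin, which
  an equivalence would have to map there.\<close>

lemma fold_not_locally_equivalent:
  fixes Z Z' :: pws_field
  assumes U: "1 \<le> r" and Z: "Z \<in> Omega r U" "Z' \<in> Omega r U"
    and fold: "fld b Z 0 $ i = 0" "partial (other i) (fld b Z) 0 $ i \<noteq> 0" "fld (\<not> b) Z 0 $ i \<noteq> 0"
    and \<tau>: "\<tau> = 1 \<or> \<tau> = -1" and same: "\<And>k. 0 < \<tau> * (fst Z' 0 $ k * snd Z' 0 $ k)"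
  shows "\<not> locally_equivalent U Z Z'"
proof
  assume "locally_equivalent U Z Z'"
  then obtain V V' and h g :: "plane \<Rightarrow> plane"
    where V: "open V" "0 \<in> V" "V \<subseteq> U" and V': "open V'" "0 \<in> V'" "V' \<subseteq> U"
      and hom: "homeomorphism V V' h g" and Sg: "h ` Sig V = Sig V'"
      and maps: "maps_trajectories V Z V' Z' h" "maps_trajectories V' Z' V Z g"
    unfolding locally_equivalent_def by blast
  have gh: "\<And>p. p \<in> V \<Longrightarrow> g (h p) = p" and ch: "continuous_on V h" using hom by (auto simp: homeomorphism_def)
  have SV: "Sig V \<subseteq> V" by (auto simp: Sig_def)
  have gS: "g ` Sig V' \<subseteq> Sig V" unfolding Sg[symmetric] using gh SV by auto
  have cont: "continuous_on V (fst Z)" "continuous_on V (snd Z)" "continuous_on V' (fst Z')" "continuous_on V' (snd Z')"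
    using Z U V(3) V'(3) by (auto simp: Omega_def intro: Cr_fields_continuous_on)
  have h0: "h 0 = 0" by (rule origin_fixed[OF V(1,2) hom Sg])
  have ic: "isCont (fst Z') 0" "isCont (snd Z') 0" using cont V' by (auto simp: continuous_on_eq_continuous_at)
  have "\<forall>\<^sub>F p in nhds 0. 0 < \<tau> * (fst Z' p $ k * snd Z' p $ k)" for k
  proof -
    have "isCont (\<lambda>p. \<tau> * (fst Z' p $ k * snd Z' p $ k)) 0" by (intro continuous_intros ic)
    then have "((\<lambda>p. \<tau> * (fst Z' p $ k * snd Z' p $ k)) \<longlongrightarrow> \<tau> * (fst Z' 0 $ k * snd Z' 0 $ k)) (nhds 0)"
      unfolding isCont_def by (rule tendsto_at_iff_tendsto_nhds[THEN iffD1])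
    from order_tendstoD(1)[OF this same] show ?thesis .
  qed
  then have "\<forall>\<^sub>F p in nhds 0. \<forall>k. 0 < \<tau> * (fst Z' p $ k * snd Z' p $ k)" by (rule eventually_all_finite)
  moreover have "(h \<longlongrightarrow> 0) (nhds 0)"
  proof -
    have "isCont h 0" using ch V by (simp add: continuous_on_eq_continuous_at)
    then have "(h \<longlongrightarrow> h 0) (nhds 0)" unfolding isCont_def by (rule tendsto_at_iff_tendsto_nhds[THEN iffD1])
    then show ?thesis by (simp add: h0)
  qed
  ultimately have ev: "\<forall>\<^sub>F p in nhds 0. \<forall>k. 0 < \<tau> * (fst Z' (h p) $ k * snd Z' (h p) $ k)"
    by (rule eventually_compose_filterlim)
  have "0 \<in> U" using V by blast
  then have d: "fld b Z differentiable (at 0)" by (rule Cr_fields_differentiable[OF fld_Omega[OF Z(1)] U])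
  have cO: "isCont (fld (\<not> b) Z) 0" using cont V by (auto simp: fld_def continuous_on_eq_continuous_at)
  have "- \<tau> = 1 \<or> - \<tau> = - 1" using \<tau> by auto
  from fold_points_near_origin[OF d fold(1,2) cO fold(3) V(1,2) this ev]
  obtain q where q: "q \<in> Sig_i V i" "q $ other i \<noteq> 0" "0 < - \<tau> * (fld b Z q $ i * fld (\<not> b) Z q $ i)"
      and hq: "\<And>k. 0 < \<tau> * (fst Z' (h q) $ k * snd Z' (h q) $ k)" by blast
  have qV: "q \<in> V" "q \<in> Sig V" "q \<noteq> 0" using q by (auto simp: Sig_i_def Sig_iff)
  have hqn: "h q \<noteq> 0" using gh[OF qV(1)] gh[OF V(2)] h0 qV(3) by metis
  have "h q \<in> Sig V'" using Sg qV(2) by blast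
  then obtain k where k: "h q \<in> V'" "h q $ k = 0" by (auto simp: Sig_iff)
  then have ko: "h q $ other k \<noteq> 0" using hqn by (auto simp: plane_eq_iff[of _ _ k])
  from \<tau> show False
  proof
    assume "\<tau> = 1"
    then have "q \<in> slidings V Z i" "h q \<in> crossings V' Z' - {0}"
      using q hq[of k] hqn k by (auto simp: slidings_iff crossings_iff fld_prod Sig_i_def)
    then show False by (rule sliding_not_mapped_to_crossing[OF V(1) cont(1,2) maps(1) equalityD1[OF Sg]])
  next
    assume "\<tau> = -1"
    then have "h q \<in> slidings V' Z' k" "g (h q) \<in> crossings V Z - {0}"
      using q hq[of k] k ko qV by (auto simp: slidings_iff crossings_iff fld_prod Sig_i_def gh)
    then show False by (rule sliding_not_mapped_to_crossing[OF V'(1) cont(3,4) maps(2) gS])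
  qed
qed

section \<open>The topology of the space of fields\<close>

text \<open>A norm on a subspace, in the sense of \<open>norm_topology\<close>. Subadditivity and homogeneity are
  combined in one inequality.\<close>

locale normed_subspace =
  fixes E :: "'v::real_vector set" and N :: "'v \<Rightarrow> real"
  assumes subspace: "subspace E" and N_0: "N 0 = 0" and N_nonneg: "x \<in> E \<Longrightarrow> 0 \<le> N x"
    and N_eq_0: "x \<in> E \<Longrightarrow> N x = 0 \<Longrightarrow> x = 0"
    and N_comb: "x \<in> E \<Longrightarrow> y \<in> E \<Longrightarrow> N (c *\<^sub>R x + y) \<le> \<bar>c\<bar> * N x + N y"
begin

lemma mem [intro]: "0 \<in> E" "x \<in> E \<Longrightarrow> y \<in> E \<Longrightarrow> x + y \<in> E" "x \<in> E \<Longrightarrow> y \<in> E \<Longrightarrow> x - y \<in> E" "x \<in> E \<Longrightarrow> c *\<^sub>R x \<in> E"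
  using subspace by (auto simp: subspace_0 subspace_add subspace_diff subspace_scale)

lemma N_scale: "x \<in> E \<Longrightarrow> N (c *\<^sub>R x) \<le> \<bar>c\<bar> * N x"
  using N_comb[of x 0 c] mem(1) by (simp add: N_0)

lemma N_triangle: "x \<in> E \<Longrightarrow> y \<in> E \<Longrightarrow> N (x + y) \<le> N x + N y"
  using N_comb[of x y 1] by simp

lemma N_minus_commute: "x \<in> E \<Longrightarrow> y \<in> E \<Longrightarrow> N (x - y) = N (y - x)"
  using N_scale[OF mem(3), of x y "-1"] N_scale[OF mem(3), of y x "-1"] by simp

sublocale metric: Metric_space E "norm_dist E N"
proof
  show "0 \<le> norm_dist E N x y" for x y by (auto simp: norm_dist_def intro: N_nonneg)
  show "norm_dist E N x y = norm_dist E N y x" for x y by (auto simp: norm_dist_def N_minus_commute)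
  show "norm_dist E N x y = 0 \<longleftrightarrow> x = y" if "x \<in> E" "y \<in> E" for x y
    using that N_eq_0[of "x - y"] by (auto simp: norm_dist_def N_0)
  show "norm_dist E N x z \<le> norm_dist E N x y + norm_dist E N y z" if "x \<in> E" "y \<in> E" "z \<in> E" for x y z
    using that N_triangle[of "x - y" "y - z"] by (auto simp: norm_dist_def)
qed

lemma topspace_norm_topology [simp]: "topspace (norm_topology E N) = E"
  by (simp add: norm_topology_def)

lemma openin_norm_topology:
  "openin (norm_topology E N) W \<longleftrightarrow> W \<subseteq> E \<and> (\<forall>x\<in>W. \<exists>e>0. \<forall>y\<in>E. N (y - x) < e \<longrightarrow> y \<in> W)"
proof -
  have "metric.mball x e \<subseteq> W \<longleftrightarrow> (\<forall>y\<in>E. N (y - x) < e \<longrightarrow> y \<in> W)" if "x \<in> E" for x e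
    using that by (auto simp: metric.mball_def norm_dist_def N_minus_commute)
  then show ?thesis unfolding norm_topology_def metric.openin_mtopology by (metis subsetD)
qed

lemma continuous_map_if_contracting:
  assumes "\<And>x y. x \<in> E \<Longrightarrow> y \<in> E \<Longrightarrow> \<bar>\<phi> y - \<phi> x\<bar> \<le> N (y - x)"
  shows "continuous_map (norm_topology E N) euclideanreal \<phi>"
  unfolding continuous_map_def
proof (intro conjI allI impI)
  fix S :: "real set" assume "openin euclidean S"
  then have S: "open S" by simp
  show "openin (norm_topology E N) {x \<in> topspace (norm_topology E N). \<phi> x \<in> S}"
    unfolding openin_norm_topology topspace_norm_topology
  proof (intro conjI ballI)
    fix x assume "x \<in> {x \<in> E. \<phi> x \<in> S}"
    then obtain e where "0 < e" "\<And>a. dist a (\<phi> x) < e \<Longrightarrow> a \<in> S" and "x \<in> E"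
      using S unfolding open_dist by blast
    then show "\<exists>e>0. \<forall>y\<in>E. N (y - x) < e \<longrightarrow> y \<in> {x \<in> E. \<phi> x \<in> S}"
      using assms by (intro exI[of _ e]) (force simp: dist_real_def)
  qed auto
qed simp

lemma smooth_map_on_id: "W \<subseteq> E \<Longrightarrow> smooth_map_on E N W (\<lambda>x. x)"
proof -
  assume W: "W \<subseteq> E"
  \<comment> \<open>The first derivative is the identity; all higher ones vanish.\<close>
  define D where "D k x vs = (if k = 0 then x else if k = 1 then hd vs else 0)" for k :: nat and x :: 'v and vs
  have "bounded_multilinear_on E N k (D k x)" if "x \<in> W" for k x
  proof -
    consider "k = 0" | "k = 1" | "2 \<le> k" by linarith
    then show ?thesis
    proof cases
      case 1
      then show ?thesis using that W by (auto simp: bounded_multilinear_on_def D_def)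
    next
      case 2
      have "hd vs \<in> E" if "length vs = 1" "set vs \<subseteq> E" for vs using that by (cases vs) auto
      moreover have "N (hd vs) \<le> 1 * prod_list (map N vs)" if "length vs = 1" for vs using that by (cases vs) auto
      moreover have "hd (vs[i := w]) = w" if "length vs = 1" "i < 1" for vs :: "'v list" and i w using that by (cases vs) auto
      ultimately show ?thesis unfolding bounded_multilinear_on_def D_def 2 by (auto intro!: exI[of _ 1])
    next
      case 3
      then show ?thesis by (auto simp: bounded_multilinear_on_def D_def N_0 intro!: exI[of _ 0])
    qed
  qed
  moreover have "D k (x + h) vs - D k x vs - D (Suc k) x (h # vs) = 0" for k x h vs
    by (auto simp: D_def)
  ultimately show ?thesis
    unfolding smooth_map_on_def
    by (intro exI[of _ D]) (auto simp: D_def[of 0] N_0 intro!: exI[of _ 1] mult_nonneg_nonneg N_nonneg)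
qed

lemma smooth_diffeo_id: "W \<subseteq> E \<Longrightarrow> smooth_diffeo E N W W (\<lambda>x. x)"
  unfolding smooth_diffeo_def using smooth_map_on_id by auto

end

lemma openin_Collect_sgn:
  assumes "continuous_map T euclideanreal \<phi>" "s \<noteq> 0"
  shows "openin T {x \<in> topspace T. sgn (\<phi> x) = s}"
proof -
  have "open {a :: real. sgn a = s}"
  proof -
    have "{a :: real. sgn a = s} = (if s = 1 then {0<..} else if s = -1 then {..<0} else {})"
      using assms(2) by (auto simp: sgn_if)
    then show ?thesis by simp
  qed
  then show ?thesis using openin_continuous_map_preimage[OF assms(1), of "{a. sgn a = s}"] by simp
qed

lemma openin_Collect_nonzero:
  assumes "continuous_map T euclideanreal \<phi>" shows "openin T {x \<in> topspace T. \<phi> x \<noteq> 0}"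
  using openin_continuous_map_preimage[OF assms, of "- {0}"] by (simp add: open_Compl)

lemma openin_Collect_conj:
  assumes "openin T {x \<in> topspace T. P x}" "openin T {x \<in> topspace T. Q x}"
  shows "openin T {x \<in> topspace T. P x \<and> Q x}"
  using openin_Int[OF assms] by (simp add: Int_def conj_ac cong: conj_cong)

lemma openin_Collect_all:
  assumes "\<And>i :: 'i :: finite. openin T {x \<in> topspace T. P i x}"
  shows "openin T {x \<in> topspace T. \<forall>i. P i x}"
proof -
  have "openin T (\<Inter>i. {x \<in> topspace T. P i x})" by (rule openin_Inter) (use assms in auto)
  moreover have "(\<Inter>i. {x \<in> topspace T. P i x}) = {x \<in> topspace T. \<forall>i. P i x}" by auto
  ultimately show ?thesis by simp
qed

text \<open>Linearity needs differentiability, so it holds on \<open>U\<close> and up to order \<open>r\<close> only.\<close>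

lemma iter_partial_comb:
  assumes "f \<in> Cr_fields r U" "g \<in> Cr_fields r U" "open U" "length js \<le> r" "x \<in> U"
  shows "iter_partial js (c *\<^sub>R f + g) x = c *\<^sub>R iter_partial js f x + iter_partial js g x"
  using assms(4,5)
proof (induction js arbitrary: x)
  case Nil
  then show ?case by (simp add: scaleR_fun_def)
next
  case (Cons j js)
  let ?a = "iter_partial js f" and ?b = "iter_partial js g"
  have d: "?a differentiable (at x)" "?b differentiable (at x)"
    using assms(1,2) Cons.prems by (auto simp: Cr_fields_def)
  have "((\<lambda>x. c *\<^sub>R ?a x + ?b x) has_derivative (\<lambda>h. c *\<^sub>R frechet_derivative ?a (at x) h + frechet_derivative ?b (at x) h)) (at x)"
    using d by (intro derivative_intros) (simp_all add: frechet_derivative_works)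
  then have "(iter_partial js (c *\<^sub>R f + g) has_derivative (\<lambda>h. c *\<^sub>R frechet_derivative ?a (at x) h + frechet_derivative ?b (at x) h)) (at x)"
    by (rule has_derivative_transform_within_open[OF _ assms(3) Cons.prems(2)])
      (rule Cons.IH[symmetric], use Cons.prems in auto)
  from frechet_derivative_at[OF this, symmetric] show ?case
    unfolding iter_partial.simps partial_def by (simp only:)
qed

lemma Cr_fields_comb:
  assumes f: "f \<in> Cr_fields r U" "g \<in> Cr_fields r U" and U: "open U"
  shows "c *\<^sub>R f + g \<in> Cr_fields r U"
proof -
  note eq = iter_partial_comb[OF f U]
  have "iter_partial js (c *\<^sub>R f + g) differentiable (at x)" if "length js < r" "x \<in> U" for js x
  proof -
    have d: "iter_partial js f differentiable (at x)" "iter_partial js g differentiable (at x)"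
      using f that by (auto simp: Cr_fields_def)
    then have "((\<lambda>x. c *\<^sub>R iter_partial js f x + iter_partial js g x) has_derivative
        (\<lambda>h. c *\<^sub>R frechet_derivative (iter_partial js f) (at x) h + frechet_derivative (iter_partial js g) (at x) h)) (at x)"
      by (intro derivative_intros) (simp_all add: frechet_derivative_works)
    then have "(iter_partial js (c *\<^sub>R f + g) has_derivative
        (\<lambda>h. c *\<^sub>R frechet_derivative (iter_partial js f) (at x) h + frechet_derivative (iter_partial js g) (at x) h)) (at x)"
      by (rule has_derivative_transform_within_open[OF _ U that(2)]) (use eq that in auto)
    then show ?thesis by (auto simp: differentiable_def)
  qed
  moreover have "\<exists>u. continuous_on (closure U) u \<and> (\<forall>x\<in>U. u x = iter_partial js (c *\<^sub>R f + g) x)" if "length js \<le> r" for js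
  proof -
    obtain u where u: "continuous_on (closure U) u" "\<forall>x\<in>U. u x = iter_partial js f x"
      using f(1) \<open>length js \<le> r\<close> unfolding Cr_fields_def by blast
    obtain v where v: "continuous_on (closure U) v" "\<forall>x\<in>U. v x = iter_partial js g x"
      using f(2) \<open>length js \<le> r\<close> unfolding Cr_fields_def by blast
    show ?thesis
      by (rule exI[of _ "\<lambda>x. c *\<^sub>R u x + v x"]) (use u v that eq in \<open>auto intro!: continuous_intros\<close>)
  qed
  moreover have "continuous_on (closure U) (c *\<^sub>R f + g)" "\<forall>x. x \<notin> closure U \<longrightarrow> (c *\<^sub>R f + g) x = 0"
    using f by (auto simp: Cr_fields_def plus_fun_def scaleR_fun_def intro!: continuous_intros)
  ultimately show ?thesis by (simp add: Cr_fields_def)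
qed

text \<open>A constant field in the representation where fields vanish outside of \<open>closure U\<close>.\<close>

definition const_field :: "plane set \<Rightarrow> plane \<Rightarrow> field"
  where "const_field U v x = (if x \<in> closure U then v else 0)"

lemma iter_partial_const_field:
  assumes "open U" "x \<in> U" shows "iter_partial js (const_field U v) x = (if js = [] then v else 0)"
  using assms(2)
proof (induction js arbitrary: x)
  case Nil
  then show ?case using closure_subset by (auto simp: const_field_def)
next
  case (Cons j js)
  have "((\<lambda>x. if js = [] then v else 0) has_derivative (\<lambda>h. 0)) (at x)" by (cases "js = []") auto
  then have "(iter_partial js (const_field U v) has_derivative (\<lambda>h. 0)) (at x)"
    by (rule has_derivative_transform_within_open[OF _ assms(1) Cons.prems]) (use Cons in auto)
  from frechet_derivative_at[OF this, symmetric] show ?case by (simp add: partial_def)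
qed

lemma const_field_in_Cr_fields:
  assumes U: "open U" shows "const_field U v \<in> Cr_fields r U"
proof -
  have "iter_partial js (const_field U v) differentiable (at x)" if "x \<in> U" for js x
  proof -
    have "((\<lambda>x. if js = [] then v else 0) has_derivative (\<lambda>h. 0)) (at x)" by (cases "js = []") auto
    then have "(iter_partial js (const_field U v) has_derivative (\<lambda>h. 0)) (at x)"
      by (rule has_derivative_transform_within_open[OF _ U that]) (use iter_partial_const_field[OF U] in auto)
    then show ?thesis by (auto simp: differentiable_def)
  qed
  moreover have "\<exists>u. continuous_on (closure U) u \<and> (\<forall>x\<in>U. u x = iter_partial js (const_field U v) x)" for js
    by (rule exI[of _ "\<lambda>x. if js = [] then v else 0"]) (simp add: iter_partial_const_field[OF U])
  moreover have "continuous_on (closure U) (const_field U v)"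
    using continuous_on_const by (rule continuous_on_eq) (simp add: const_field_def)
  ultimately show ?thesis by (simp add: Cr_fields_def const_field_def)
qed

lemma zero_eq_const_field: "0 = const_field U 0"
  by (simp add: fun_eq_iff const_field_def)

text \<open>The supremum in \<open>Cr_norm\<close> is finite: there are finitely many derivatives, each bounded by
  continuity on the compact set \<open>closure U\<close>.\<close>

lemma Cr_norm_upper:
  assumes "f \<in> Cr_fields r U" "bounded U" "length js \<le> r" "x \<in> U"
  shows "norm (iter_partial js f x) \<le> Cr_norm r U f"
proof -
  let ?J = "{js :: 2 list. length js \<le> r}"
  have "\<exists>C. \<forall>js\<in>?J. 0 \<le> C js \<and> (\<forall>x\<in>U. norm (iter_partial js f x) \<le> C js)"
    by (rule bchoice) (use Cr_fields_iter_partial_bounded[OF assms(1,2)] in blast)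
  then obtain C where C: "\<And>js. js \<in> ?J \<Longrightarrow> 0 \<le> C js \<and> (\<forall>x\<in>U. norm (iter_partial js f x) \<le> C js)" by blast
  have fin: "finite ?J" using finite_lists_length_le[of "UNIV :: 2 set" r] by simp
  have "norm (iter_partial js f x) \<le> sum C ?J" if "js \<in> ?J" "x \<in> U" for js x
    using C[OF that(1)] that(2) member_le_sum[OF that(1), of C] C fin by fastforce
  then have "bdd_above ((\<lambda>(js, x). norm (iter_partial js f x)) ` (?J \<times> U))" by (intro bdd_aboveI2[of _ _ "sum C ?J"]) auto
  from cSUP_upper[OF _ this, of "(js, x)"] show ?thesis using assms(3,4) by (simp add: Cr_norm_def)
qed

lemma Cr_norm_least:
  assumes "U \<noteq> {}" "\<And>js x. length js \<le> r \<Longrightarrow> x \<in> U \<Longrightarrow> norm (iter_partial js f x) \<le> C"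
  shows "Cr_norm r U f \<le> C"
proof -
  have "([], SOME x. x \<in> U) \<in> {js :: 2 list. length js \<le> r} \<times> U" using assms(1) by (simp add: some_in_eq)
  then have "{js :: 2 list. length js \<le> r} \<times> U \<noteq> {}" by blast
  then show ?thesis unfolding Cr_norm_def by (rule cSUP_least) (use assms(2) in auto)
qed

lemma Cr_fields_normed_subspace:
  assumes U: "open U" "bounded U" "U \<noteq> {}"
  shows "normed_subspace (Cr_fields r U) (Cr_norm r U)"
proof
  have 0: "0 \<in> Cr_fields r U" using const_field_in_Cr_fields[OF U(1), of 0] by (simp add: zero_eq_const_field[of U])
  show "subspace (Cr_fields r U)"
    using 0 Cr_fields_comb[OF _ _ U(1), of _ r _ 1] Cr_fields_comb[OF _ 0 U(1)] by (intro subspaceI) auto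
  have nn: "0 \<le> Cr_norm r U f" if "f \<in> Cr_fields r U" for f
    using U(3) Cr_norm_upper[OF that U(2), of "[]"] by (auto intro: order_trans[OF norm_ge_zero])
  show "0 \<le> Cr_norm r U f" if "f \<in> Cr_fields r U" for f by (rule nn[OF that])
  have "Cr_norm r U 0 \<le> 0"
    by (rule Cr_norm_least[OF U(3)]) (simp add: zero_eq_const_field[of U] iter_partial_const_field[OF U(1)])
  then show "Cr_norm r U 0 = 0" using nn[OF 0] by simp
  show "f = 0" if f: "f \<in> Cr_fields r U" "Cr_norm r U f = 0" for f
  proof
    fix x
    have z: "f x = 0" if "x \<in> U" for x using Cr_norm_upper[OF f(1) U(2) _ that, of "[]"] f(2) by simp
    have "continuous_on (closure U) f" using f(1) by (simp add: Cr_fields_def)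
    then have "f x = 0" if "x \<in> closure U" using z that by (rule continuous_constant_on_closure)
    moreover have "f x = 0" if "x \<notin> closure U" using f(1) that by (simp add: Cr_fields_def)
    ultimately show "f x = 0 x" by (cases "x \<in> closure U") simp_all
  qed
  show "Cr_norm r U (c *\<^sub>R f + g) \<le> \<bar>c\<bar> * Cr_norm r U f + Cr_norm r U g"
    if f: "f \<in> Cr_fields r U" and g: "g \<in> Cr_fields r U" for f g c
  proof (rule Cr_norm_least[OF U(3)])
    fix js :: "2 list" and x assume js: "length js \<le> r" and x: "x \<in> U"
    have "norm (iter_partial js (c *\<^sub>R f + g) x) \<le> \<bar>c\<bar> * norm (iter_partial js f x) + norm (iter_partial js g x)"
      unfolding iter_partial_comb[OF f g U(1) js x] by (rule order_trans[OF norm_triangle_ineq]) simp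
    also have "\<dots> \<le> \<bar>c\<bar> * Cr_norm r U f + Cr_norm r U g"
      by (intro add_mono mult_left_mono Cr_norm_upper f g js x U) simp
    finally show "norm (iter_partial js (c *\<^sub>R f + g) x) \<le> \<bar>c\<bar> * Cr_norm r U f + Cr_norm r U g" .
  qed
qed

lemma normed_subspace_Times:
  assumes "normed_subspace E N"
  shows "normed_subspace (E \<times> E) (\<lambda>z. max (N (fst z)) (N (snd z)))"
proof -
  interpret normed_subspace E N by fact
  show ?thesis
  proof
    show "subspace (E \<times> E)" by (rule subspace_Times[OF subspace subspace])
    show "z = 0" if z: "z \<in> E \<times> E" "max (N (fst z)) (N (snd z)) = 0" for z
    proof -
      have "N (fst z) = 0" "N (snd z) = 0"
        using N_nonneg[of "fst z"] N_nonneg[of "snd z"] z by (auto simp: max_def split: if_splits)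
      then show ?thesis using N_eq_0 z(1) by (auto simp: prod_eq_iff)
    qed
    show "max (N (fst (c *\<^sub>R x + y))) (N (snd (c *\<^sub>R x + y))) \<le> \<bar>c\<bar> * max (N (fst x)) (N (snd x)) + max (N (fst y)) (N (snd y))"
      if "x \<in> E \<times> E" "y \<in> E \<times> E" for x y c
    proof -
      have "N (c *\<^sub>R u + v) \<le> \<bar>c\<bar> * M + M'" if "u \<in> E" "v \<in> E" "N u \<le> M" "N v \<le> M'" for u v M M'
        using N_comb[OF that(1,2), of c] mult_left_mono[OF that(3), of "\<bar>c\<bar>"] that(4) by simp
      then show ?thesis using that by (auto simp: mem_Times_iff)
    qed
  qed (auto simp: N_0 le_max_iff_disj intro: N_nonneg)
qed

lemma Omega_normed_subspace:
  assumes "open U" "bounded U" "U \<noteq> {}" shows "normed_subspace (Omega r U) (Omega_norm r U)"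
  using normed_subspace_Times[OF Cr_fields_normed_subspace[OF assms, of r]]
  unfolding Omega_def Omega_norm_def[abs_def] .

section \<open>The set of regular-folds\<close>
definition fold_at :: "bool \<Rightarrow> 2 \<Rightarrow> pws_field \<Rightarrow> bool"
  where "fold_at b i Z \<longleftrightarrow> fld b Z 0 $ i = 0 \<and> fld b Z 0 $ other i \<noteq> 0 \<and>
    partial (other i) (fld b Z) 0 $ i \<noteq> 0 \<and> (\<forall>l. fld (\<not> b) Z 0 $ l \<noteq> 0)"

lemma has_regular_fold_iff: "has_regular_fold Z \<longleftrightarrow> (\<exists>b i. fold_at b i Z)"
proof -
  have b: "(\<exists>b. Q b) \<longleftrightarrow> Q True \<or> Q False" for Q by (metis (full_types))
  show ?thesis
    unfolding has_regular_fold_def b fold_at_def regular_fold_of_def fold_point_def fld_def by auto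
qed

context
  fixes r :: nat and U :: "plane set"
  assumes U: "1 \<le> r" "open U" "bounded U" "0 \<in> U"
begin

interpretation Om: normed_subspace "Omega r U" "Omega_norm r U"
  using U by (intro Omega_normed_subspace) auto

text \<open>Evaluations of derivatives at the origin are functionals of norm at most \<open>1\<close>.\<close>

lemma iter_partial_contracting:
  assumes "Z \<in> Omega r U" "Z' \<in> Omega r U" "length js \<le> r"
  shows "\<bar>iter_partial js (fld b Z') 0 $ k - iter_partial js (fld b Z) 0 $ k\<bar> \<le> Omega_norm r U (Z' - Z)"
proof -
  interpret C: normed_subspace "Cr_fields r U" "Cr_norm r U"
    using U by (intro Cr_fields_normed_subspace) auto
  have f: "fld b Z \<in> Cr_fields r U" "fld b Z' \<in> Cr_fields r U" using assms by (auto intro: fld_Omega)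
  have "fld b Z' = 1 *\<^sub>R (fld b Z' - fld b Z) + fld b Z" by simp
  then have "iter_partial js (fld b Z') 0 = 1 *\<^sub>R iter_partial js (fld b Z' - fld b Z) 0 + iter_partial js (fld b Z) 0"
    using iter_partial_comb[OF C.mem(3)[OF f(2,1)] f(1) U(2) assms(3) U(4), of 1] by simp
  then have "iter_partial js (fld b Z') 0 - iter_partial js (fld b Z) 0 = iter_partial js (fld b Z' - fld b Z) 0"
    by (simp only: scaleR_one add_diff_cancel_right')
  then have "\<bar>iter_partial js (fld b Z') 0 $ k - iter_partial js (fld b Z) 0 $ k\<bar> \<le> norm (iter_partial js (fld b Z' - fld b Z) 0)"
    using component_le_norm_cart by (metis vector_minus_component)
  also have "\<dots> \<le> Cr_norm r U (fld b Z' - fld b Z)"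
    by (rule Cr_norm_upper[OF C.mem(3)[OF f(2,1)] U(3) assms(3) U(4)])
  also have "\<dots> \<le> Omega_norm r U (Z' - Z)" by (simp add: Omega_norm_def fld_def)
  finally show ?thesis .
qed

lemma continuous_map_value: "continuous_map (Omega_topology r U) euclideanreal (\<lambda>Z. fld b Z 0 $ k)"
  using iter_partial_contracting[of _ _ "[]"] by (intro Om.continuous_map_if_contracting) simp

lemma continuous_map_partial: "continuous_map (Omega_topology r U) euclideanreal (\<lambda>Z. partial j (fld b Z) 0 $ k)"
  using iter_partial_contracting[of _ _ "[j]"] U(1) by (intro Om.continuous_map_if_contracting) simp

lemma continuous_map_slope_gap: "continuous_map (Omega_topology r U) euclideanreal (\<lambda>Z. slope_gap Z i)"
proof -
  have "slope_gap Z i = \<bar>fld False Z 0 $ i * fld True Z 0 $ other i\<bar> - \<bar>fld True Z 0 $ i * fld False Z 0 $ other i\<bar>" for Z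
    by (simp add: slope_gap_def fld_def)
  then show ?thesis
    by (simp only:) (intro continuous_map_diff continuous_map_real_abs continuous_map_real_mult continuous_map_value)
qed

text \<open>The signs that determine the local phase portrait are constant near \<open>Z\<close>.\<close>

lemma nondegenerate_in_Omega_0:
  assumes Z: "Z \<in> Omega r U" and nz: "\<And>b k. fld b Z 0 $ k \<noteq> 0" and gap: "slope_gap Z 1 \<noteq> 0"
  shows "Z \<in> Omega_0 r U"
proof -
  define W where "W = {Z' \<in> Omega r U.
    (\<forall>b k. sgn (fld b Z' 0 $ k) = sgn (fld b Z 0 $ k)) \<and> sgn (slope_gap Z' 1) = sgn (slope_gap Z 1)}"
  have "openin (Omega_topology r U) {Z' \<in> topspace (Omega_topology r U).
      (\<forall>b k. sgn (fld b Z' 0 $ k) = sgn (fld b Z 0 $ k)) \<and> sgn (slope_gap Z' 1) = sgn (slope_gap Z 1)}"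
    by (intro openin_Collect_conj openin_Collect_all openin_Collect_sgn continuous_map_value continuous_map_slope_gap)
      (simp_all add: nz gap sgn_zero_iff)
  then have "openin (Omega_topology r U) W" by (simp add: W_def)
  moreover have "Z \<in> W" using Z by (simp add: W_def)
  moreover have "locally_equivalent U Z Z'" if "Z' \<in> W" for Z'
    using that by (intro nondegenerate_locally_equivalent[OF U Z _ nz gap]) (auto simp: W_def)
  ultimately show ?thesis using Z by (auto simp: Omega_0_def)
qed

text \<open>The direction in \<open>\<Omega>\<close> that changes component \<open>i\<close> of region \<open>b\<close> only, by a constant.\<close>

definition bump :: "bool \<Rightarrow> 2 \<Rightarrow> pws_field"
  where "bump b i = (if b then (const_field U (axis i 1), 0) else (0, const_field U (axis i 1)))"

lemma bump_in_Omega: "bump b i \<in> Omega r U"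
proof -
  have "0 \<in> Cr_fields r U" using const_field_in_Cr_fields[OF U(2), of 0] by (simp add: zero_eq_const_field[of U])
  then show ?thesis using const_field_in_Cr_fields[OF U(2)] by (auto simp: bump_def Omega_def)
qed

lemma fld_bump:
  "fld b (Z + t *\<^sub>R bump b' i) 0 = (if b = b' then fld b Z 0 + t *\<^sub>R axis i 1 else fld b Z 0)"
  using U(4) closure_subset[of U] by (auto simp: fld_def bump_def const_field_def scaleR_fun_def)

text \<open>A small constant, added to the component that vanishes, gives both axes the same type. The neighborhood of
  \<open>Z\<close> witnessing stability would contain such a perturbation.\<close>

lemma fold_in_Omega_1:
  assumes Z: "Z \<in> Omega r U" and fold: "fold_at b i Z" shows "Z \<in> Omega_1 r U"
proof -
  have "Z \<notin> Omega_0 r U"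
  proof
    assume "Z \<in> Omega_0 r U"
    then obtain W where W: "openin (Omega_topology r U) W" "Z \<in> W" "\<And>Z'. Z' \<in> W \<Longrightarrow> locally_equivalent U Z Z'"
      by (auto simp: Omega_0_def)
    obtain e where e: "0 < e" "\<And>Z'. Z' \<in> Omega r U \<Longrightarrow> Omega_norm r U (Z' - Z) < e \<Longrightarrow> Z' \<in> W"
      using W(1,2) unfolding Om.openin_norm_topology by blast
    let ?o = "fld (\<not> b) Z 0 $ i" and ?p = "fld b Z 0 $ other i * fld (\<not> b) Z 0 $ other i"
    have o: "?o \<noteq> 0" "?p \<noteq> 0" using fold by (auto simp: fold_at_def)
    have sgn_pos: "0 < sgn x * x" and sgn_sq: "sgn x * sgn x = 1" if "x \<noteq> 0" for x :: real
      using that by (auto simp: sgn_if)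
    define N where "N = Omega_norm r U (bump b i)"
    have N: "0 \<le> N" unfolding N_def by (rule Om.N_nonneg[OF bump_in_Omega])
    \<comment> \<open>The sign makes \<open>\<Sigma>\<^sub>i\<close> of the same type as the other axis, whose type is the sign of \<open>?p\<close>.\<close>
    define t where "t = sgn ?p * sgn ?o * (e / (N + 1) / 2)"
    define Z' where "Z' = Z + t *\<^sub>R bump b i"
    have at: "\<bar>t\<bar> = e / (N + 1) / 2" using o e N by (simp add: t_def abs_mult abs_sgn_eq)
    have "Omega_norm r U (Z' - Z) \<le> \<bar>t\<bar> * N"
      unfolding Z'_def N_def using Om.N_scale[OF bump_in_Omega] by simp
    also have "\<bar>t\<bar> * N < e"
    proof -
      have "0 < N * e + e * 2" using N e(1) by (intro add_nonneg_pos) auto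
      then show ?thesis using N unfolding at by (simp add: field_simps)
    qed
    finally have small: "Omega_norm r U (Z' - Z) < e" .
    have Z': "Z' \<in> Omega r U" unfolding Z'_def by (intro Om.mem Z bump_in_Omega)
    have "\<not> locally_equivalent U Z Z'"
    proof (rule fold_not_locally_equivalent[OF U(1) Z Z', of b i])
      show "sgn ?p = 1 \<or> sgn ?p = -1" using o by (simp add: sgn_if)
      have "fld b Z' 0 $ i * fld (\<not> b) Z' 0 $ i = t * ?o"
        using fold by (simp add: Z'_def fld_bump fold_at_def axis_def)
      then have "sgn ?p * (fld b Z' 0 $ i * fld (\<not> b) Z' 0 $ i) = (sgn ?p * sgn ?p) * (sgn ?o * ?o) * (e / (N + 1) / 2)"
        by (simp only: t_def mult_ac)
      moreover have "0 < (sgn ?p * sgn ?p) * (sgn ?o * ?o) * (e / (N + 1) / 2)"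
        using sgn_pos[OF o(1)] sgn_sq[OF o(2)] e(1) N by simp
      ultimately have "0 < sgn ?p * (fst Z' 0 $ i * snd Z' 0 $ i)" unfolding fld_prod by simp
      moreover have "fst Z' 0 $ other i * snd Z' 0 $ other i = ?p"
        unfolding fld_prod[of b, symmetric] by (simp add: Z'_def fld_bump axis_def)
      then have "0 < sgn ?p * (fst Z' 0 $ other i * snd Z' 0 $ other i)" using sgn_pos[OF o(2)] by (simp only:)
      ultimately show "0 < sgn ?p * (fst Z' 0 $ k * snd Z' 0 $ k)" for k
        by (cases "k = i") (simp_all add: eq_other_iff)
    qed (use fold in \<open>simp_all add: fold_at_def\<close>)
    then show False using W(3) e(2)[OF Z' small] by blast
  qed
  then show ?thesis using Z by (simp add: Omega_1_def)
qed

text \<open>Every regular-fold is unstable, so membership in \<open>\<Omega>\<^sub>1\<close> is automatic.\<close>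

lemma Xi_1_3_iff: "Z \<in> Xi_1_3 r U \<longleftrightarrow> Z \<in> Omega r U \<and> (\<exists>b i. fold_at b i Z)"
proof
  assume "Z \<in> Xi_1_3 r U"
  then show "Z \<in> Omega r U \<and> (\<exists>b i. fold_at b i Z)" by (simp add: Xi_1_3_def has_regular_fold_iff Omega_1_def)
next
  assume "Z \<in> Omega r U \<and> (\<exists>b i. fold_at b i Z)"
  then obtain b i where Z: "Z \<in> Omega r U" "fold_at b i Z" by blast
  show "Z \<in> Xi_1_3 r U" using fold_in_Omega_1[OF Z] Z(2) by (auto simp: Xi_1_3_def has_regular_fold_iff)
qed

text \<open>\<open>W\<close> retains all nondegeneracy conditions of the fold. In \<open>W\<close> a field has a regular-fold iff
  the component in question vanishes; otherwise it is nondegenerate, hence stable.\<close>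

lemma fold_neighbourhood:
  assumes "Z \<in> Xi_1_3 r U"
  obtains W b i where "openin (Omega_topology r U) W" "Z \<in> W" "W \<subseteq> Omega r U"
    "W \<inter> Xi_1_3 r U = W \<inter> {Z \<in> Omega r U. fld b Z 0 $ i = 0}" "W \<inter> Omega_1 r U \<subseteq> Xi_1_3 r U"
proof -
  obtain b i where Z: "Z \<in> Omega r U" and fold: "fold_at b i Z" using assms by (auto simp: Xi_1_3_iff)
  define W where "W = {Z \<in> Omega r U. fld b Z 0 $ other i \<noteq> 0 \<and> partial (other i) (fld b Z) 0 $ i \<noteq> 0 \<and>
    (\<forall>l. fld (\<not> b) Z 0 $ l \<noteq> 0) \<and> slope_gap Z 1 \<noteq> 0}"
  have W_fold: "fold_at b i Z' \<longleftrightarrow> fld b Z' 0 $ i = 0" if "Z' \<in> W" for Z'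
    using that by (auto simp: W_def fold_at_def)
  have nz: "fld b' Z' 0 $ k \<noteq> 0" if "Z' \<in> W" "\<not> (b' = b \<and> k = i)" for Z' b' k
    using that by (cases "b' = b") (auto simp: W_def eq_other_iff)
  show thesis
  proof (rule that[of W b i])
    have "openin (Omega_topology r U) {Z \<in> topspace (Omega_topology r U). fld b Z 0 $ other i \<noteq> 0 \<and>
        partial (other i) (fld b Z) 0 $ i \<noteq> 0 \<and> (\<forall>l. fld (\<not> b) Z 0 $ l \<noteq> 0) \<and> slope_gap Z 1 \<noteq> 0}"
      by (intro openin_Collect_conj openin_Collect_all openin_Collect_nonzero continuous_map_value
          continuous_map_partial continuous_map_slope_gap)
    then show "openin (Omega_topology r U) W" by (simp add: W_def)
    have "slope_gap Z i \<noteq> 0"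
      using fold by (cases b) (auto simp: fold_at_def slope_gap_def fld_def)
    then have "slope_gap Z 1 \<noteq> 0"
      using slope_gap_other[of Z 1] by (cases "i = 1") (auto simp: eq_other_iff)
    then show "Z \<in> W" using Z fold by (simp add: W_def fold_at_def)
    show "W \<subseteq> Omega r U" by (auto simp: W_def)
    show "W \<inter> Xi_1_3 r U = W \<inter> {Z \<in> Omega r U. fld b Z 0 $ i = 0}"
    proof (intro set_eqI iffI)
      fix Z' assume "Z' \<in> W \<inter> Xi_1_3 r U"
      then obtain b' i' where Z': "Z' \<in> W" "Z' \<in> Omega r U" "fold_at b' i' Z'" by (auto simp: Xi_1_3_iff)
      then have "fld b' Z' 0 $ i' = 0" by (simp add: fold_at_def)
      then have "b' = b \<and> i' = i" using nz[OF Z'(1)] by blast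
      then show "Z' \<in> W \<inter> {Z \<in> Omega r U. fld b Z 0 $ i = 0}" using Z' by (auto simp: fold_at_def)
    next
      fix Z' assume "Z' \<in> W \<inter> {Z \<in> Omega r U. fld b Z 0 $ i = 0}"
      then have "Z' \<in> W" "Z' \<in> Omega r U" "fold_at b i Z'" using W_fold[of Z'] by blast+
      then show "Z' \<in> W \<inter> Xi_1_3 r U" using Xi_1_3_iff by blast
    qed
    show "W \<inter> Omega_1 r U \<subseteq> Xi_1_3 r U"
    proof
      fix Z' assume Z': "Z' \<in> W \<inter> Omega_1 r U"
      then have m: "Z' \<in> Omega r U" "slope_gap Z' 1 \<noteq> 0" by (auto simp: W_def)
      have "fld b Z' 0 $ i = 0"
      proof (rule ccontr)
        assume "fld b Z' 0 $ i \<noteq> 0"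
        then have "fld b' Z' 0 $ k \<noteq> 0" for b' k using nz[of Z' b' k] Z' by blast
        from nondegenerate_in_Omega_0[OF m(1) this m(2)] show False using Z' by (simp add: Omega_1_def)
      qed
      then have "fold_at b i Z'" using W_fold[of Z'] Z' by blast
      then show "Z' \<in> Xi_1_3 r U" using m(1) unfolding Xi_1_3_iff by blast
    qed
  qed
qed

text \<open>A complement is spanned by the constant field in the direction of the component.\<close>

lemma value_hyperplane: "closed_hyperplane_in (Omega r U) (Omega_norm r U) {Z \<in> Omega r U. fld b Z 0 $ i = 0}"
    (is "closed_hyperplane_in _ _ ?F")
  unfolding closed_hyperplane_in_def
proof (intro conjI)
  show "subspace ?F"
    using Om.mem by (intro subspaceI) (auto simp: fld_def scaleR_fun_def)
  have "closedin (Omega_topology r U) {Z \<in> topspace (Omega_topology r U). fld b Z 0 $ i \<in> {0}}"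
    by (rule closedin_continuous_map_preimage[OF continuous_map_value]) simp
  then show "closedin (Omega_topology r U) ?F" by simp
  show "\<exists>e\<in>Omega r U. e \<notin> ?F \<and> (\<forall>Z\<in>Omega r U. \<exists>c. Z - c *\<^sub>R e \<in> ?F)"
  proof (intro bexI[of _ "bump b i"] conjI ballI)
    have "fld b (0 + 1 *\<^sub>R bump b i) 0 = fld b 0 0 + 1 *\<^sub>R axis i 1" by (simp only: fld_bump simp_thms if_True)
    then show "bump b i \<notin> ?F" by (simp add: fld_def axis_def split: if_splits)
    fix Z assume Z: "Z \<in> Omega r U"
    have "Z - (fld b Z 0 $ i) *\<^sub>R bump b i = Z + (- (fld b Z 0 $ i)) *\<^sub>R bump b i" by simp
    moreover have "fld b (Z + (- (fld b Z 0 $ i)) *\<^sub>R bump b i) 0 $ i = 0" unfolding fld_bump by (simp add: axis_def)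
    moreover have "Z - (fld b Z 0 $ i) *\<^sub>R bump b i \<in> Omega r U" by (intro Om.mem Z bump_in_Omega)
    ultimately show "\<exists>c. Z - c *\<^sub>R bump b i \<in> ?F" by (intro exI[of _ "fld b Z 0 $ i"]) simp
  qed (rule bump_in_Omega)
qed auto

lemma Xi_1_3_submanifold: "embedded_submanifold_codim_1 (Omega r U) (Omega_norm r U) (Xi_1_3 r U)"
  unfolding embedded_submanifold_codim_1_def
proof (intro conjI ballI)
  fix Z assume "Z \<in> Xi_1_3 r U"
  then obtain W b i where W: "openin (Omega_topology r U) W" "Z \<in> W" "W \<subseteq> Omega r U"
      and eq: "W \<inter> Xi_1_3 r U = W \<inter> {Z \<in> Omega r U. fld b Z 0 $ i = 0}"
    by (rule fold_neighbourhood)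
  have "(\<lambda>Z. Z) ` (W \<inter> Xi_1_3 r U) = W \<inter> {Z \<in> Omega r U. fld b Z 0 $ i = 0}" using eq by simp
  then show "\<exists>W W' f F. Z \<in> W \<and> openin (Omega_topology r U) W \<and> openin (Omega_topology r U) W' \<and>
      smooth_diffeo (Omega r U) (Omega_norm r U) W W' f \<and>
      closed_hyperplane_in (Omega r U) (Omega_norm r U) F \<and> f ` (W \<inter> Xi_1_3 r U) = W' \<inter> F"
    by (intro exI conjI) (rule W Om.smooth_diffeo_id[OF W(3)] value_hyperplane | assumption)+
qed (auto simp: Xi_1_3_iff)

lemma Xi_1_3_open: "openin (subtopology (Omega_topology r U) (Omega_1 r U)) (Xi_1_3 r U)"
  unfolding openin_subopen[of _ "Xi_1_3 r U"]
proof
  fix Z assume Z: "Z \<in> Xi_1_3 r U"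
  then obtain W where W: "openin (Omega_topology r U) W" "Z \<in> W" "W \<inter> Omega_1 r U \<subseteq> Xi_1_3 r U"
    by (rule fold_neighbourhood)
  then show "\<exists>T. openin (subtopology (Omega_topology r U) (Omega_1 r U)) T \<and> Z \<in> T \<and> T \<subseteq> Xi_1_3 r U"
    using Z by (intro exI[of _ "W \<inter> Omega_1 r U"]) (auto simp: openin_subtopology Xi_1_3_def)
qed

end

theorem proposition4p10:
  fixes r :: nat and U :: "(real ^ 2) set"
  assumes "r \<ge> 1" and "open U" and "bounded U" and "0 \<in> U"
  shows "embedded_submanifold_codim_1 (Omega r U) (Omega_norm r U) (Xi_1_3 r U) \<and>
         openin (subtopology (Omega_topology r U) (Omega_1 r U)) (Xi_1_3 r U)"
  using Xi_1_3_submanifold[OF assms] Xi_1_3_open[OF assms] by (rule conjI)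

end
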